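(* Let $d\ge 2$, let $\alpha_1,\dots,\alpha_d\in[1/2,2]$, and let $\mathbb{T}^d=\mathbb{R}^d/\prod_{j=1}^d\alpha_j\mathbb{Z}$ be the corresponding flat torus. Then the Cauchy problem for the cubic Schrödinger equation $$i\partial_t u+\Delta u=|u|^2u,\qquad u(0,x)=u_0(x),\qquad x\in\mathbb{T}^d,$$ is locally well posed in $H^s(\mathbb{T}^d)$ for every $s$ satisfying $$s>\tfrac13 \ \text{ if } d=2;\qquad s>\tfrac d2-\tfrac{d}{d+1}\ \text{ if } d\ge 3 \text{ is odd};\qquad s>\tfrac d2-1\ \text{ if } d\ge 4 \text{ is even}.$$
   Context: The unknown $u$ is complex valued; no arithmetic assumption is made on the ratios of the $\alpha_j$. $H^s=H^s(\mathbb{T}^d)$ is the Sobolev space. Local well-posedness in $H^s$ means: for any $R>0$ there exist $T>0$ and a Banach space $X_T$ continuously embedded in $C^0([0,T],H^s)$ such that (i) for any $u_0\in H^s$ with $\|u_0\|_{H^s}\le R$, the Cauchy problem has a unique solution $u\in X_T$; (ii) if moreover $u_0\in H^{s'}$ with $s'>s$, then $u\in C^0([0,T],H^{s'})$; (iii) the map $u_0\mapsto u$, from the ball $\{\|u_0\|_{H^s}\le R\}$ of $H^s$ to $X_T$, is uniformly continuous. (Solutions are understood in the sense of the Duhamel formula $u(t)=e^{it\Delta}u_0-i\int_0^te^{i(t-\tau)\Delta}(|u(\tau)|^2u(\tau))\,d\tau$.) *)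

theory Defs
  imports "HOL-Analysis.Analysis" "HOL-Library.Function_Algebras"
begin

text \<open>
  Measurable complex-valued functions on the Euclidean space, modulo equality almost everywhere.
  A function on the flat torus with periods \<open>\<alpha>\<close> is an element of this type that is
  \<open>\<alpha>\<close>-periodic; integrals over the torus are integrals over the box \<open>cbox 0 \<alpha>\<close>.
\<close>

definition ae_eq :: "(real^'d \<Rightarrow> complex) \<Rightarrow> (real^'d \<Rightarrow> complex) \<Rightarrow> bool" where
  "ae_eq f g \<longleftrightarrow> f \<in> borel_measurable lborel \<and> g \<in> borel_measurable lborel \<and>
     (AE x in lborel. f x = g x)"

lemma part_equivp_ae_eq: "part_equivp ae_eq"
proof (rule part_equivpI)
  show "\<exists>f. ae_eq f f" by (rule exI[of _ "\<lambda>_. 0"]) (simp add: ae_eq_def)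
  show "symp ae_eq" unfolding symp_def ae_eq_def by (auto elim: eventually_mono)
  show "transp ae_eq" unfolding transp_def ae_eq_def
    by (auto elim: eventually_elim2)
qed

quotient_type (overloaded) 'd L0 = "real^'d::finite \<Rightarrow> complex" / partial: ae_eq
  by (rule part_equivp_ae_eq)

instantiation L0 :: (finite) ab_group_add
begin

lift_definition zero_L0 :: "'a L0" is "\<lambda>_. 0"
  by (simp add: ae_eq_def)

lift_definition plus_L0 :: "'a L0 \<Rightarrow> 'a L0 \<Rightarrow> 'a L0" is "\<lambda>f g x. f x + g x"
  unfolding ae_eq_def by (auto elim: eventually_elim2)

lift_definition uminus_L0 :: "'a L0 \<Rightarrow> 'a L0" is "\<lambda>f x. - f x"
  unfolding ae_eq_def by (auto elim: eventually_mono)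

lift_definition minus_L0 :: "'a L0 \<Rightarrow> 'a L0 \<Rightarrow> 'a L0" is "\<lambda>f g x. f x - g x"
  unfolding ae_eq_def by (auto elim: eventually_elim2)

instance
  by standard (transfer; auto simp: ae_eq_def algebra_simps)+

end

lift_definition scaleC :: "complex \<Rightarrow> 'd::finite L0 \<Rightarrow> 'd L0" is "\<lambda>c f x. c * f x"
  unfolding ae_eq_def by (auto elim: eventually_mono)

lift_definition cubic :: "'d::finite L0 \<Rightarrow> 'd L0" is "\<lambda>f x. of_real ((cmod (f x))\<^sup>2) * f x"
  unfolding ae_eq_def by (auto elim: eventually_mono)

lemma AE_lborel_shift:
  fixes a :: "'a::euclidean_space"
  assumes "AE x in lborel. P x"
  shows "AE x in lborel. P (x + a)"
proof -
  have "AE x in distr lborel borel ((+) a). P x"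
    using assms by (simp only: lborel_distr_plus)
  from AE_distrD[OF _ this] show ?thesis
    by (simp add: add.commute)
qed

lift_definition periodic :: "real^'d::finite \<Rightarrow> 'd L0 \<Rightarrow> bool" is
  "\<lambda>\<alpha> f. \<forall>j. AE x in lborel. f (x + axis j (\<alpha> $ j)) = f x"
proof -
  have *: "\<forall>j. AE x in lborel. g (x + axis j (\<alpha> $ j)) = g x"
    if "ae_eq f g" "\<forall>j. AE x in lborel. f (x + axis j (\<alpha> $ j)) = f x"
    for \<alpha> :: "real^'d" and f g
  proof
    fix j
    have e: "AE x in lborel. f x = g x" using that(1) by (simp add: ae_eq_def)
    show "AE x in lborel. g (x + axis j (\<alpha> $ j)) = g x"
      using e AE_lborel_shift[OF e, of "axis j (\<alpha> $ j)"] that(2)[rule_format, of j]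
      by eventually_elim simp
  qed
  have sym: "ae_eq g f" if "ae_eq f g" for f g :: "real^'d \<Rightarrow> complex"
    using that part_equivp_symp[OF part_equivp_ae_eq] by blast
  show "\<And>\<alpha> f g. ae_eq f g \<Longrightarrow>
      (\<forall>j. AE x in lborel. f (x + axis j ((\<alpha>::real^'d) $ j)) = f x) =
      (\<forall>j. AE x in lborel. g (x + axis j (\<alpha> $ j)) = g x)"
    using * sym by blast
qed

lemma set_integrable_cong_ae_eq:
  fixes F :: "complex \<Rightarrow> 'b::{banach, second_countable_topology}"
  assumes "ae_eq f g" and [measurable]: "F \<in> borel_measurable borel"
  shows "set_integrable lborel (cbox 0 \<alpha>) (\<lambda>x. F (f x)) \<longleftrightarrow>
         set_integrable lborel (cbox 0 \<alpha>) (\<lambda>x. F (g x))"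
proof -
  have [measurable]: "f \<in> borel_measurable lborel" "g \<in> borel_measurable lborel"
    and ae: "AE x in lborel. f x = g x"
    using assms(1) by (simp_all add: ae_eq_def)
  show ?thesis unfolding set_integrable_def
    by (rule integrable_cong_AE) (use ae in \<open>auto elim: eventually_mono\<close>)
qed

lift_definition torus_L1 :: "real^'d::finite \<Rightarrow> 'd L0 \<Rightarrow> bool" is
  "\<lambda>\<alpha> f. set_integrable lborel (cbox 0 \<alpha>) f"
  using set_integrable_cong_ae_eq[where F = "\<lambda>z. z"] by auto

lift_definition torus_L2 :: "real^'d::finite \<Rightarrow> 'd L0 \<Rightarrow> bool" is
  "\<lambda>\<alpha> f. set_integrable lborel (cbox 0 \<alpha>) (\<lambda>x. (cmod (f x))\<^sup>2)"
  using set_integrable_cong_ae_eq[where F = "\<lambda>z. (cmod z)\<^sup>2"] by auto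

definition freq :: "real^'d::finite \<Rightarrow> int^'d \<Rightarrow> real^'d" where
  "freq \<alpha> n = (\<chi> j. 2 * pi * of_int (n $ j) / \<alpha> $ j)"

lift_definition fourier :: "real^'d::finite \<Rightarrow> 'd L0 \<Rightarrow> int^'d \<Rightarrow> complex" is
  "\<lambda>\<alpha> f n. (LINT x:cbox 0 \<alpha>|lborel. f x * cis (- (freq \<alpha> n \<bullet> x))) / of_real (\<Prod>j\<in>UNIV. \<alpha> $ j)"
proof -
  fix \<alpha> :: "real^'d" and f g :: "real^'d \<Rightarrow> complex"
  assume "ae_eq f g"
  then have [measurable]: "f \<in> borel_measurable lborel" "g \<in> borel_measurable lborel"
    and ae: "AE x in lborel. f x = g x"
    by (simp_all add: ae_eq_def)
  have [measurable]: "(\<lambda>x. cis (- (freq \<alpha> n \<bullet> x))) \<in> borel_measurable lborel" for n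
    unfolding cis_conv_exp by measurable
  have "(LINT x:cbox 0 \<alpha>|lborel. f x * cis (- (freq \<alpha> n \<bullet> x))) =
        (LINT x:cbox 0 \<alpha>|lborel. g x * cis (- (freq \<alpha> n \<bullet> x)))" for n
    unfolding set_lebesgue_integral_def
  proof (rule integral_cong_AE)
    show "AE x in lborel. indicator (cbox 0 \<alpha>) x *\<^sub>R (f x * cis (- (freq \<alpha> n \<bullet> x))) =
        indicator (cbox 0 \<alpha>) x *\<^sub>R (g x * cis (- (freq \<alpha> n \<bullet> x)))"
      using ae by eventually_elim simp
  qed measurable
  then show "(\<lambda>n. (LINT x:cbox 0 \<alpha>|lborel. f x * cis (- (freq \<alpha> n \<bullet> x))) / of_real (\<Prod>j\<in>UNIV. \<alpha> $ j)) =
        (\<lambda>n. (LINT x:cbox 0 \<alpha>|lborel. g x * cis (- (freq \<alpha> n \<bullet> x))) / of_real (\<Prod>j\<in>UNIV. \<alpha> $ j))"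
    by simp
qed

text \<open>Sobolev spaces as subspaces of \<open>L\<^sup>2\<close>, which is the usual definition for \<open>s \<ge> 0\<close> only.\<close>

definition sobolev :: "real^'d::finite \<Rightarrow> real \<Rightarrow> 'd L0 set" where
  "sobolev \<alpha> s = {f. periodic \<alpha> f \<and> torus_L2 \<alpha> f \<and>
     (\<lambda>n. (1 + (norm (freq \<alpha> n))\<^sup>2) powr s * (cmod (fourier \<alpha> f n))\<^sup>2) summable_on UNIV}"

definition sobolev_norm :: "real^'d::finite \<Rightarrow> real \<Rightarrow> 'd L0 \<Rightarrow> real" where
  "sobolev_norm \<alpha> s f =
     sqrt (\<Sum>\<^sub>\<infinity>n. (1 + (norm (freq \<alpha> n))\<^sup>2) powr s * (cmod (fourier \<alpha> f n))\<^sup>2)"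

text \<open>
  The space \<open>C\<^sup>0([0,T], H\<^sup>s)\<close>. Functions of time are extended by 0 outside \<open>[0,T]\<close>, so that
  equality of the HOL functions is equality on \<open>[0,T]\<close>.
\<close>

definition C0_sobolev :: "real^'d::finite \<Rightarrow> real \<Rightarrow> real \<Rightarrow> (real \<Rightarrow> 'd L0) set" where
  "C0_sobolev \<alpha> s T = {u. (\<forall>t\<in>{0..T}. u t \<in> sobolev \<alpha> s) \<and> (\<forall>t. t \<notin> {0..T} \<longrightarrow> u t = 0) \<and>
     (\<forall>t\<in>{0..T}. ((\<lambda>r. sobolev_norm \<alpha> s (u r - u t)) \<longlongrightarrow> 0) (at t within {0..T}))}"

definition complex_banach_on ::
    "(complex \<Rightarrow> 'v \<Rightarrow> 'v) \<Rightarrow> 'v::ab_group_add set \<Rightarrow> ('v \<Rightarrow> real) \<Rightarrow> bool" where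
  "complex_banach_on smul X N \<longleftrightarrow>
     0 \<in> X \<and> (\<forall>u\<in>X. \<forall>v\<in>X. u + v \<in> X) \<and> (\<forall>c. \<forall>u\<in>X. smul c u \<in> X) \<and>
     (\<forall>u\<in>X. 0 \<le> N u) \<and> (\<forall>u\<in>X. N u = 0 \<longleftrightarrow> u = 0) \<and>
     (\<forall>c. \<forall>u\<in>X. N (smul c u) = cmod c * N u) \<and>
     (\<forall>u\<in>X. \<forall>v\<in>X. N (u + v) \<le> N u + N v) \<and>
     (\<forall>f. (\<forall>k. f k \<in> X) \<and> (\<forall>e>0. \<exists>M. \<forall>k\<ge>M. \<forall>l\<ge>M. N (f k - f l) < e) \<longrightarrow>
        (\<exists>u\<in>X. (\<lambda>k::nat. N (f k - u)) \<longlonglongrightarrow> 0))"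

text \<open>
  The group \<open>e\<^bsup>it\<Delta>\<^esup>\<close>, acting on the Fourier coefficients of a periodic distribution.
\<close>

definition schrodinger_group ::
    "real^'d::finite \<Rightarrow> real \<Rightarrow> (int^'d \<Rightarrow> complex) \<Rightarrow> int^'d \<Rightarrow> complex" where
  "schrodinger_group \<alpha> t a n = cis (- t * (norm (freq \<alpha> n))\<^sup>2) * a n"

text \<open>
  The Duhamel formula on \<open>[0,T]\<close>, as an identity between periodic distributions, that is, between
  Fourier coefficients. The first two clauses say that the nonlinear term makes sense.
\<close>

definition duhamel_solution ::
    "real^'d::finite \<Rightarrow> real \<Rightarrow> 'd L0 \<Rightarrow> (real \<Rightarrow> 'd L0) \<Rightarrow> bool" where
  "duhamel_solution \<alpha> T u0 u \<longleftrightarrow>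
     (\<forall>\<tau>\<in>{0..T}. torus_L1 \<alpha> (cubic (u \<tau>))) \<and>
     (\<forall>t\<in>{0..T}. \<forall>n.
        set_integrable lborel {0..t}
          (\<lambda>\<tau>. schrodinger_group \<alpha> (t - \<tau>) (fourier \<alpha> (cubic (u \<tau>))) n) \<and>
        fourier \<alpha> (u t) n = schrodinger_group \<alpha> t (fourier \<alpha> u0) n -
          \<i> * (LINT \<tau>:{0..t}|lborel.
                 schrodinger_group \<alpha> (t - \<tau>) (fourier \<alpha> (cubic (u \<tau>))) n))"

definition locally_well_posed :: "real^'d::finite \<Rightarrow> real \<Rightarrow> bool" where
  "locally_well_posed \<alpha> s \<longleftrightarrow>
     (\<forall>R>0. \<exists>T>0. \<exists>X N.
        let B = {u0 \<in> sobolev \<alpha> s. sobolev_norm \<alpha> s u0 \<le> R} in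
        complex_banach_on (\<lambda>c u t. scaleC c (u t)) X N \<and>
        X \<subseteq> C0_sobolev \<alpha> s T \<and>
        (\<exists>C. \<forall>u\<in>X. \<forall>t\<in>{0..T}. sobolev_norm \<alpha> s (u t) \<le> C * N u) \<and>
        (\<forall>u0\<in>B. \<exists>!u. u \<in> X \<and> duhamel_solution \<alpha> T u0 u) \<and>
        (\<forall>u0\<in>B. \<forall>s'>s. u0 \<in> sobolev \<alpha> s' \<longrightarrow>
           (\<forall>u\<in>X. duhamel_solution \<alpha> T u0 u \<longrightarrow> u \<in> C0_sobolev \<alpha> s' T)) \<and>
        (\<forall>e>0. \<exists>\<delta>>0. \<forall>u0\<in>B. \<forall>v0\<in>B. \<forall>u\<in>X. \<forall>v\<in>X.
           duhamel_solution \<alpha> T u0 u \<longrightarrow> duhamel_solution \<alpha> T v0 v \<longrightarrow>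
           sobolev_norm \<alpha> s (u0 - v0) < \<delta> \<longrightarrow> N (u - v) < e))"

end

theory Submission
 imports Defs "HOL-Analysis.Analysis"
begin

text \<open>
  Write the Fourier coefficients of \<open>e\<^bsup>-it\<Delta>\<^esup>u(t)\<close> on \<open>[0,T]\<close> as cosine series in time with coefficients
  \<open>c\<^sub>k(n)\<close>; the space \<open>X\<^sub>T\<close> carries the norm \<open>\<Sum>\<^sub>k \<parallel>c\<^sub>k\<parallel>\<close> in \<open>H\<^sup>s\<close>. The Duhamel term becomes a trilinear
  operator whose kernel consists of the cosine coefficients of \<open>\<integral>\<^sub>0\<^sup>t e\<^bsup>i\<mu>r\<^esup> dr\<close>, where \<open>\<mu>\<close> is the resonance
  function up to a shift; they sum to at most \<open>T\<^bsup>2\<delta>\<^esup> (1 + |\<mu>|)\<^bsup>2\<delta>-1\<^esup>\<close>. After sorting the frequency triples by the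
  integer part of \<open>\<mu>\<close> and by dyadic size, the Cauchy-Schwarz inequality leaves the problem of counting
  the lattice points of a box of size \<open>N\<close> in a thin ellipsoidal shell. In dimension 2 this number is
  \<open>O(N\<^bsup>2/3\<^esup>)\<close>, since a lattice triangle of positive area has area at least \<open>1/2\<close> and so does not fit in a short arc;
  in higher dimensions it is controlled by the number of solutions of \<open>x\<^sup>2 - x'\<^sup>2 = y\<^sup>2 - y'\<^sup>2\<close>.
  The power of \<open>T\<close> makes Duhamel's formula a contraction. Uniqueness in all of \<open>X\<^sub>T\<close> follows by damping the
  difference of two solutions with \<open>e\<^bsup>-Mt\<^esup>\<close>, \<open>M\<close> large, and regularity by running the contraction in a
  weighted space whose weight is close to that of \<open>H\<^sup>s\<close>. Dyadic sums converge in \<open>L\<^sup>3\<close> because \<open>s > d/6\<close>, which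
  identifies the Fourier coefficients of \<open>|u|\<^sup>2u\<close> with the cubic convolution.
\<close>

section \<open>Trilinear estimates\<close>

text \<open>The summable cosine index is what lets multilinearity work: a cosine mode in time only
  shifts the phase of a free solution, so a bound for free solutions that is uniform in a shift of
  the resonance function passes to the whole space. Cosines are used because the even reflection of
  a function on [0,T] is continuous and periodic; no end values have to match. The obstacle is that
  the summed Duhamel kernel decays slightly slower than the reciprocal of the resonance, so a sum
  over unit bins diverges. A sharp bound for one bin is interpolated with a crude square-summable
  bound over all bins; the loss is a small power of the frequency, paid by the strict inequality for
  s. Only two of the three frequencies are localized. The third may be arbitrarily high and carries
  the derivatives of the output, so all counts must be uniform in the position of the box. For d at
  least 3 exact coincidences are needed only between squares of one coordinate, hence no relation
  between the periods enters. Small T gives a contraction in a ball only. At fixed T the damping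
  makes the difference equation small for solutions of any size, which is why uniqueness needs
  it.\<close>

definition energy :: "'i set => ('i => 'k) => ('i => real) => ('i => real) => real" where
 "energy I a x F = (\<Sum>i\<in>I. \<Sum>j\<in>I. if a i = a j \<and> \<bar>x i - x j\<bar> < 1 then F i * F j else 0)"

lemma sum_matching_keys:
 fixes F :: "'i => real" and G :: "'j => real"
 assumes "finite K" "\<And>i. i \<in> I ==> \<kappa> i \<in> K"
 shows "(\<Sum>i\<in>I. \<Sum>j\<in>J. if \<kappa> i = \<kappa>' j then F i * G j else 0) =
  (\<Sum>k\<in>K. (\<Sum>i\<in>I. if \<kappa> i = k then F i else 0) * (\<Sum>j\<in>J. if \<kappa>' j = k then G j else 0))"
proof -
 have "(\<Sum>k\<in>K. (\<Sum>i\<in>I. if \<kappa> i = k then F i else 0) * (\<Sum>j\<in>J. if \<kappa>' j = k then G j else 0)) =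
  (\<Sum>k\<in>K. \<Sum>i\<in>I. \<Sum>j\<in>J. (if \<kappa> i = k then F i else 0) * (if \<kappa>' j = k then G j else 0))"
  by (simp add: sum_product)
 also have "... = (\<Sum>i\<in>I. \<Sum>j\<in>J. \<Sum>k\<in>K. (if \<kappa> i = k then F i else 0) * (if \<kappa>' j = k then G j else 0))"
  by (subst sum.swap, rule sum.cong[OF refl], subst sum.swap, simp)
 also have "... = (\<Sum>i\<in>I. \<Sum>j\<in>J. if \<kappa> i = \<kappa>' j then F i * G j else 0)"
 proof (intro sum.cong refl)
  fix i j assume i: "i \<in> I"
  have "(\<Sum>k\<in>K. (if \<kappa> i = k then F i else 0) * (if \<kappa>' j = k then G j else 0)) =
   (\<Sum>k\<in>K. if \<kappa> i = k then F i * (if \<kappa>' j = \<kappa> i then G j else 0) else 0)"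
   by (intro sum.cong) auto
  also have "... = F i * (if \<kappa>' j = \<kappa> i then G j else 0)"
   using assms i by (subst sum.delta') auto
  finally show "(\<Sum>k\<in>K. (if \<kappa> i = k then F i else 0) * (if \<kappa>' j = k then G j else 0)) =
   (if \<kappa> i = \<kappa>' j then F i * G j else 0)" by auto
 qed
 finally show ?thesis by simp
qed

text \<open>Cauchy-Schwarz over the common keys. By \<open>sum_matching_keys\<close> with both
  families equal, the sums of squares are again weighted counts of coinciding pairs; a fourfold sum
  thus splits into two \<open>energy\<close> terms, which play the part of bilinear space-time L2
  norms.\<close>

lemma sum_matching_keys_le:
 fixes F :: "'i => real" and G :: "'j => real"
 assumes "finite I" "finite J"
 shows "(\<Sum>i\<in>I. \<Sum>j\<in>J. if \<kappa> i = \<kappa>' j then F i * G j else 0) <=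
  sqrt (\<Sum>i\<in>I. \<Sum>j\<in>I. if \<kappa> i = \<kappa> j then F i * F j else 0) *
  sqrt (\<Sum>i\<in>J. \<Sum>j\<in>J. if \<kappa>' i = \<kappa>' j then G i * G j else 0)"
proof -
 define K where "K = \<kappa> ` I \<union> \<kappa>' ` J"
 have K: "finite K" using assms by (simp add: K_def)
 let ?f = "\<lambda>k. \<Sum>i\<in>I. if \<kappa> i = k then F i else 0"
 let ?g = "\<lambda>k. \<Sum>j\<in>J. if \<kappa>' j = k then G j else 0"
 have "(\<Sum>k\<in>K. ?f k * ?g k) <= (\<Sum>k\<in>K. \<bar>?f k\<bar> * \<bar>?g k\<bar>)"
  by (intro sum_mono) (simp add: abs_mult[symmetric])
 also have "... <= L2_set ?f K * L2_set ?g K" by (rule L2_set_mult_ineq)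
 finally have *: "(\<Sum>k\<in>K. ?f k * ?g k) <= L2_set ?f K * L2_set ?g K" .
 have 1: "(\<Sum>i\<in>I. \<Sum>j\<in>J. if \<kappa> i = \<kappa>' j then F i * G j else 0) = (\<Sum>k\<in>K. ?f k * ?g k)"
  by (rule sum_matching_keys[OF K]) (simp add: K_def)
 have 2: "(\<Sum>i\<in>I. \<Sum>j\<in>I. if \<kappa> i = \<kappa> j then F i * F j else 0) = (\<Sum>k\<in>K. ?f k * ?f k)"
  by (rule sum_matching_keys[OF K]) (simp add: K_def)
 have 3: "(\<Sum>i\<in>J. \<Sum>j\<in>J. if \<kappa>' i = \<kappa>' j then G i * G j else 0) = (\<Sum>k\<in>K. ?g k * ?g k)"
  by (rule sum_matching_keys[OF K]) (simp add: K_def)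
 show ?thesis unfolding 1 2 3 using * by (simp add: L2_set_def power2_eq_square)
qed

text \<open>The integer part of \<open>y j - x i\<close> leaves just two possible offsets,
  \<open>m\<close> and \<open>m + 1\<close>, between the integer parts of \<open>y j\<close> and
  \<open>x i\<close>. Each offset is an exact key match, and reals with equal integer parts are
  closer than 1, as \<open>energy\<close> asks. Hence the factor 2.\<close>

lemma sum_matching_bins_le:
 fixes F :: "'i => real" and G :: "'j => real"
 assumes fin: "finite I" "finite J" and F: "\<And>i. i \<in> I ==> F i >= 0" and G: "\<And>j. j \<in> J ==> G j >= 0"
 shows "(\<Sum>i\<in>I. \<Sum>j\<in>J. if a i = b j \<and> \<lfloor>y j - x i\<rfloor> = m then F i * G j else 0) <=
  2 * (sqrt (energy I a x F) * sqrt (energy J b y G))"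
proof -
 define \<kappa> where "\<kappa> i = (a i, \<lfloor>x i\<rfloor>)" for i
 define \<kappa>' where "\<kappa>' e j = (b j, \<lfloor>y j\<rfloor> - m - e)" for e j
 let ?S = "\<lambda>e. \<Sum>i\<in>I. \<Sum>j\<in>J. if \<kappa> i = \<kappa>' e j then F i * G j else 0"
 have close: "\<bar>u - v\<bar> < 1" if "\<lfloor>u\<rfloor> = \<lfloor>v\<rfloor>" for u v :: real
  using that by linarith
 have e: "?S e <= sqrt (energy I a x F) * sqrt (energy J b y G)" for e
 proof -
  have "?S e <= sqrt (\<Sum>i\<in>I. \<Sum>j\<in>I. if \<kappa> i = \<kappa> j then F i * F j else 0) *
   sqrt (\<Sum>i\<in>J. \<Sum>j\<in>J. if \<kappa>' e i = \<kappa>' e j then G i * G j else 0)"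
   by (rule sum_matching_keys_le) fact+
  also have "... <= sqrt (energy I a x F) * sqrt (energy J b y G)"
   unfolding energy_def
   by (intro mult_mono real_sqrt_le_mono sum_mono real_sqrt_ge_zero sum_nonneg)
    (auto simp: \<kappa>_def \<kappa>'_def F G dest: close)
  finally show ?thesis .
 qed
 have "(\<Sum>i\<in>I. \<Sum>j\<in>J. if a i = b j \<and> \<lfloor>y j - x i\<rfloor> = m then F i * G j else 0) <=
  (\<Sum>i\<in>I. \<Sum>j\<in>J. (if \<kappa> i = \<kappa>' 0 j then F i * G j else 0) + (if \<kappa> i = \<kappa>' 1 j then F i * G j else 0))"
 proof (intro sum_mono)
  fix i j assume ij: "i \<in> I" "j \<in> J"
  have "\<lfloor>x i\<rfloor> = \<lfloor>y j\<rfloor> - m \<or> \<lfloor>x i\<rfloor> = \<lfloor>y j\<rfloor> - m - 1" if "\<lfloor>y j - x i\<rfloor> = m"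
   using that by linarith
  then show "(if a i = b j \<and> \<lfloor>y j - x i\<rfloor> = m then F i * G j else 0) <=
   (if \<kappa> i = \<kappa>' 0 j then F i * G j else 0) + (if \<kappa> i = \<kappa>' 1 j then F i * G j else 0)"
   using F[OF ij(1)] G[OF ij(2)] by (auto simp: \<kappa>_def \<kappa>'_def)
 qed
 also have "... = ?S 0 + ?S 1" by (simp add: sum.distrib)
 also have "... <= 2 * (sqrt (energy I a x F) * sqrt (energy J b y G))"
  using e[of 0] e[of 1] by simp
 finally show ?thesis .
qed

text \<open>The bound by arithmetic-geometric means keeps one free and one localized variable in each
 product, so that only the representations by the localized factor have to be counted.\<close>

lemma energy_differences_le:
 fixes f g :: "'a::ab_group_add => real" and K :: real
 assumes fin: "finite S" "finite R"
  and f: "\<And>n. f n >= 0" and g: "\<And>n. g n >= 0"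
  and count: "\<And>a b. card {n \<in> R. \<bar>Q n + Q (a - n) - b\<bar> < 1} <= K"
 shows "energy (S \<times> R) (\<lambda>(n, m). n - m) (\<lambda>(n, m). Q n - Q m + c) (\<lambda>(n, m). f n * g m) <=
  K * (\<Sum>n\<in>S. (f n)\<^sup>2) * (\<Sum>n\<in>R. (g n)\<^sup>2)"
proof -
 define P where "P n m n' m' \<longleftrightarrow> n - m = n' - m' \<and> \<bar>Q n - Q m + c - (Q n' - Q m' + c)\<bar> < 1" for n m n' m'
 have P_sym: "P n m n' m' = P n' m' n m" for n m n' m'
  unfolding P_def by (auto simp: abs_minus_commute)
 let ?E = "energy (S \<times> R) (\<lambda>(n, m). n - m) (\<lambda>(n, m). Q n - Q m + c) (\<lambda>(n, m). f n * g m)"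
 let ?H = "\<Sum>n\<in>S. \<Sum>m\<in>R. \<Sum>n'\<in>S. \<Sum>m'\<in>R. if P n m n' m' then (f n)\<^sup>2 * (g m')\<^sup>2 else 0"
 let ?H' = "\<Sum>n\<in>S. \<Sum>m\<in>R. \<Sum>n'\<in>S. \<Sum>m'\<in>R. if P n m n' m' then (f n')\<^sup>2 * (g m)\<^sup>2 else 0"
 have sw: "(\<Sum>m\<in>R. \<Sum>n'\<in>S. \<Sum>m'\<in>R. h m n' m') = (\<Sum>m'\<in>R. \<Sum>m\<in>R. \<Sum>n'\<in>S. h m n' m')"
  for h :: "'a => 'a => 'a => real"
 proof -
  have "(\<Sum>n'\<in>S. \<Sum>m'\<in>R. h m n' m') = (\<Sum>m'\<in>R. \<Sum>n'\<in>S. h m n' m')" for m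
   by (rule sum.swap)
  then show ?thesis by (simp only:) (rule sum.swap)
 qed
 have HH: "?H' = ?H"
 proof -
  have "?H' = (\<Sum>p\<in>S\<times>R. \<Sum>q\<in>S\<times>R. if P (fst p) (snd p) (fst q) (snd q) then (f (fst q))\<^sup>2 * (g (snd p))\<^sup>2 else 0)"
   by (simp add: sum.cartesian_product' cong: if_cong)
  also have "... = (\<Sum>q\<in>S\<times>R. \<Sum>p\<in>S\<times>R. if P (fst p) (snd p) (fst q) (snd q) then (f (fst q))\<^sup>2 * (g (snd p))\<^sup>2 else 0)"
   by (rule sum.swap)
  also have "... = ?H"
   by (subst P_sym) (simp add: sum.cartesian_product' cong: if_cong)
  finally show ?thesis .
 qed
 have "?E = (\<Sum>n\<in>S. \<Sum>m\<in>R. \<Sum>n'\<in>S. \<Sum>m'\<in>R. if P n m n' m' then f n * g m * (f n' * g m') else 0)"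
  unfolding energy_def P_def by (simp add: sum.cartesian_product' cong: if_cong)
 also have "... <= (\<Sum>n\<in>S. \<Sum>m\<in>R. \<Sum>n'\<in>S. \<Sum>m'\<in>R.
   (if P n m n' m' then (f n)\<^sup>2 * (g m')\<^sup>2 else 0) / 2 + (if P n m n' m' then (f n')\<^sup>2 * (g m)\<^sup>2 else 0) / 2)"
 proof (intro sum_mono)
  fix n m n' m'
  have "0 <= (f n * g m' - f n' * g m)\<^sup>2" by simp
  then have "f n * g m * (f n' * g m') <= (f n)\<^sup>2 * (g m')\<^sup>2 / 2 + (f n')\<^sup>2 * (g m)\<^sup>2 / 2"
   by (simp add: power2_eq_square algebra_simps)
  then show "(if P n m n' m' then f n * g m * (f n' * g m') else 0) <=
   (if P n m n' m' then (f n)\<^sup>2 * (g m')\<^sup>2 else 0) / 2 + (if P n m n' m' then (f n')\<^sup>2 * (g m)\<^sup>2 else 0) / 2"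
   by auto
 qed
 also have "... = ?H / 2 + ?H' / 2"
  by (simp add: sum.distrib sum_divide_distrib)
 also have "... = ?H" using HH by simp
 also have "... = (\<Sum>n\<in>S. \<Sum>m'\<in>R. \<Sum>m\<in>R. \<Sum>n'\<in>S. if P n m n' m' then (f n)\<^sup>2 * (g m')\<^sup>2 else 0)"
  by (rule sum.cong[OF refl]) (rule sw)
 also have "... <= (\<Sum>n\<in>S. \<Sum>m'\<in>R. K * ((f n)\<^sup>2 * (g m')\<^sup>2))"
 proof (intro sum_mono)
  fix n m'
  \<comment> \<open>With \<open>n\<close> and \<open>m'\<close> fixed,
    \<open>n' = n + m' - m\<close> is forced, so \<open>m\<close> alone is free, and it is a point
    that \<open>count\<close> counts with \<open>a = n + m'\<close> and
    \<open>b = Q n + Q m'\<close>.\<close>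
  let ?B = "{m \<in> R. \<bar>Q m + Q (n + m' - m) - (Q n + Q m')\<bar> < 1}"
  let ?c = "(f n)\<^sup>2 * (g m')\<^sup>2"
  have "(\<Sum>m\<in>R. \<Sum>n'\<in>S. if P n m n' m' then ?c else 0) <= (\<Sum>m\<in>R. if m \<in> ?B then ?c else 0)"
  proof (intro sum_mono)
   fix m assume m: "m \<in> R"
   have "(\<Sum>n'\<in>S. if P n m n' m' then ?c else 0) <= (\<Sum>n'\<in>S. if n' = n + m' - m then (if m \<in> ?B then ?c else 0) else 0)"
   proof (intro sum_mono)
    fix n'
    have "n' = n + m' - m \<and> m \<in> ?B" if P: "P n m n' m'"
    proof -
     have n': "n' = n + m' - m" using P unfolding P_def by (simp add: algebra_simps)
     show ?thesis using P m unfolding P_def n' by (simp add: algebra_simps abs_minus_commute)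
    qed
    then show "(if P n m n' m' then ?c else 0) <= (if n' = n + m' - m then (if m \<in> ?B then ?c else 0) else 0)"
     by auto
   qed
   also have "... <= (if m \<in> ?B then ?c else 0)"
    using fin by (subst sum.delta) auto
   finally show "(\<Sum>n'\<in>S. if P n m n' m' then ?c else 0) <= (if m \<in> ?B then ?c else 0)" .
  qed
  also have "... = card ?B * ?c"
  proof -
   have "R \<inter> ?B = ?B" by auto
   then show ?thesis using fin by (subst sum.inter_restrict[symmetric]) auto
  qed
  also have "... <= K * ?c"
   using count[of "n + m'" "Q n + Q m'"] by (intro mult_right_mono) auto
  finally show "(\<Sum>m\<in>R. \<Sum>n'\<in>S. if P n m n' m' then ?c else 0) <= K * ?c" .
 qed
 also have "... = K * (\<Sum>n\<in>S. (f n)\<^sup>2) * (\<Sum>n\<in>R. (g n)\<^sup>2)"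
  unfolding mult.assoc sum_product by (simp add: sum_distrib_left)
 finally show ?thesis .
qed

text \<open>Negating both key and phase preserves coincidences. This form serves the pairing in
  which the conjugated frequency is the unlocalized one.\<close>

lemma energy_differences_le':
 fixes f g :: "'a::ab_group_add => real" and K :: real
 assumes fin: "finite S" "finite R"
  and f: "\<And>n. f n >= 0" and g: "\<And>n. g n >= 0"
  and count: "\<And>a b. card {n \<in> R. \<bar>Q n + Q (a - n) - b\<bar> < 1} <= K"
 shows "energy (S \<times> R) (\<lambda>(n, m). m - n) (\<lambda>(n, m). Q m - Q n) (\<lambda>(n, m). f n * g m) <=
  K * (\<Sum>n\<in>S. (f n)\<^sup>2) * (\<Sum>n\<in>R. (g n)\<^sup>2)"
proof -
 have *: "m - n = m' - n' \<longleftrightarrow> n - m = n' - m'" for n m n' m' :: 'a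
  by (metis minus_diff_eq)
 have **: "\<bar>Q m - Q n - (Q m' - Q n')\<bar> = \<bar>Q n - Q m + 0 - (Q n' - Q m' + 0)\<bar>" for n m n' m' :: 'a
  by linarith
 have "energy (S \<times> R) (\<lambda>(n, m). m - n) (\<lambda>(n, m). Q m - Q n) (\<lambda>(n, m). f n * g m) =
  energy (S \<times> R) (\<lambda>(n, m). n - m) (\<lambda>(n, m). Q n - Q m + 0) (\<lambda>(n, m). f n * g m)"
  unfolding energy_def split_beta * ** ..
 then show ?thesis using energy_differences_le[OF assms, of 0] by simp
qed

definition out :: "'a::ab_group_add \<times> 'a \<times> 'a => 'a" where
 "out = (\<lambda>(n1, n2, n3). n1 - n2 + n3)"

text \<open>The phase that remains in the coefficient of \<open>u * cnj u * u\<close> at the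
  frequency \<open>out\<close>, once the free phases have been removed.\<close>

definition res :: "('a::ab_group_add => real) => 'a \<times> 'a \<times> 'a => real" where
 "res Q = (\<lambda>(n1, n2, n3). Q (n1 - n2 + n3) - Q n1 + Q n2 - Q n3)"

text \<open>The bins have unit width. The shift \<open>\<nu>\<close> will be the time frequency
  contributed by three cosine modes (\<open>shift3\<close>); every bound below is uniform in
  it.\<close>

definition binned :: "('a::ab_group_add => real) => ('a \<times> 'a \<times> 'a) set => ('a \<times> 'a \<times> 'a => real) =>
  real => int => 'a => real" where
 "binned Q \<Theta> F \<nu> j n = (\<Sum>\<tau>\<in>\<Theta>. if out \<tau> = n \<and> \<lfloor>res Q \<tau> + \<nu>\<rfloor> = j then F \<tau> else 0)"

lemma binned_nonneg: "(\<And>\<tau>. F \<tau> >= 0) ==> binned Q \<Theta> F \<nu> j n >= 0"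
 unfolding binned_def by (intro sum_nonneg) auto

lemma energy_nonneg: "(\<And>i. i \<in> I ==> F i >= 0) ==> energy I a x F >= 0"
 unfolding energy_def by (intro sum_nonneg) auto

lemma binned_dual_eq:
 fixes Q :: "'a::ab_group_add => real"
 shows "(\<Sum>n\<in>R. binned Q (S1 \<times> S2 \<times> S3) F \<nu> j n * w n) =
  (\<Sum>n\<in>R. \<Sum>n1\<in>S1. \<Sum>n2\<in>S2. \<Sum>n3\<in>S3.
   if n1 - n2 + n3 = n \<and> \<lfloor>Q n - Q n1 + Q n2 - Q n3 + \<nu>\<rfloor> = j then F (n1, n2, n3) * w n else 0)"
 unfolding binned_def sum.cartesian_product' sum_distrib_right
 by (intro sum.cong refl) (auto simp: out_def res_def)

lemma sum_rearrange4:
 fixes X :: "'a => 'b => 'c => 'd => 'e::comm_monoid_add"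
 shows "(\<Sum>n\<in>R. \<Sum>a\<in>A. \<Sum>b\<in>B. \<Sum>c\<in>C. X n a b c) = (\<Sum>a\<in>A. \<Sum>b\<in>B. \<Sum>n\<in>R. \<Sum>c\<in>C. X n a b c)"
proof -
 have "(\<Sum>n\<in>R. \<Sum>b\<in>B. \<Sum>c\<in>C. X n a b c) = (\<Sum>b\<in>B. \<Sum>n\<in>R. \<Sum>c\<in>C. X n a b c)" for a
  by (rule sum.swap)
 then show ?thesis by (subst sum.swap) simp
qed

abbreviation binned3 :: "('a::ab_group_add => real) => 'a set => 'a set => 'a set => ('a => real) => ('a => real) => ('a => real) =>
  real => int => 'a => real" where
 "binned3 Q S1 S2 S3 f g h \<equiv> binned Q (S1 \<times> S2 \<times> S3) (\<lambda>(n1, n2, n3). f n1 * g n2 * h n3)"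

text \<open>The pair \<open>(n1, n2)\<close> is matched with \<open>(n, n3)\<close>: the output
  relation becomes \<open>n1 - n2 = n - n3\<close>, and the resonance a difference of one phase per
  pair. Each energy is paid by its localized member, \<open>n2\<close> or \<open>n3\<close>, so
  \<open>n1\<close> may be the high frequency.\<close>

lemma binned_dual_le1:
 fixes Q :: "'a::ab_group_add => real" and K2 K3 :: real
 assumes fin: "finite S1" "finite S2" "finite S3" "finite R"
  and pos: "\<And>n. f n >= 0" "\<And>n. g n >= 0" "\<And>n. h n >= 0" "\<And>n. w n >= 0"
  and K2: "\<And>a b. card {n \<in> S2. \<bar>Q n + Q (a - n) - b\<bar> < 1} <= K2"
  and K3: "\<And>a b. card {n \<in> S3. \<bar>Q n + Q (a - n) - b\<bar> < 1} <= K3"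
 shows "(\<Sum>n\<in>R. binned3 Q S1 S2 S3 f g h \<nu> j n * w n) <=
  2 * sqrt (K2 * K3) * (L2_set f S1 * L2_set g S2 * L2_set h S3 * L2_set w R)"
proof -
 have "(\<Sum>n\<in>R. binned3 Q S1 S2 S3 f g h \<nu> j n * w n) =
  (\<Sum>n1\<in>S1. \<Sum>n2\<in>S2. \<Sum>n\<in>R. \<Sum>n3\<in>S3.
   if n1 - n2 + n3 = n \<and> \<lfloor>Q n - Q n1 + Q n2 - Q n3 + \<nu>\<rfloor> = j then f n1 * g n2 * h n3 * w n else 0)"
  unfolding binned_dual_eq by (subst sum_rearrange4) (simp cong: if_cong)
 also have "... = (\<Sum>i\<in>S1\<times>S2. \<Sum>k\<in>R\<times>S3.
   if (\<lambda>(n, m). n - m) i = (\<lambda>(n, m). n - m) k \<and>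
     \<lfloor>(\<lambda>(n, m). Q n - Q m + \<nu>) k - (\<lambda>(n, m). Q n - Q m + 0) i\<rfloor> = j
   then (\<lambda>(n, m). f n * g m) i * (\<lambda>(n, m). w n * h m) k else 0)"
  unfolding sum.cartesian_product' by (intro sum.cong refl) (auto simp: algebra_simps)
 also have "... <= 2 * (sqrt (energy (S1\<times>S2) (\<lambda>(n, m). n - m) (\<lambda>(n, m). Q n - Q m + 0) (\<lambda>(n, m). f n * g m)) *
   sqrt (energy (R\<times>S3) (\<lambda>(n, m). n - m) (\<lambda>(n, m). Q n - Q m + \<nu>) (\<lambda>(n, m). w n * h m)))"
  by (rule sum_matching_bins_le) (use fin pos in auto)
 also have "... <= 2 * (sqrt (K2 * (\<Sum>n\<in>S1. (f n)\<^sup>2) * (\<Sum>n\<in>S2. (g n)\<^sup>2)) *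
   sqrt (K3 * (\<Sum>n\<in>R. (w n)\<^sup>2) * (\<Sum>n\<in>S3. (h n)\<^sup>2)))"
  by (intro mult_left_mono mult_mono real_sqrt_le_mono energy_differences_le real_sqrt_ge_zero)
   (use fin pos K2 K3 order_trans[OF of_nat_0_le_iff K2] order_trans[OF of_nat_0_le_iff K3] in \<open>auto intro!: mult_nonneg_nonneg sum_nonneg energy_nonneg\<close>)
 also have "... = 2 * sqrt (K2 * K3) * (L2_set f S1 * L2_set g S2 * L2_set h S3 * L2_set w R)"
  by (simp add: L2_set_def real_sqrt_mult)
 finally show ?thesis .
qed

text \<open>The same pairing with \<open>n1\<close> and \<open>n3\<close> localized, for a high
  conjugated frequency \<open>n2\<close>.\<close>

lemma binned_dual_le2:
 fixes Q :: "'a::ab_group_add => real" and K1 K3 :: real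
 assumes fin: "finite S1" "finite S2" "finite S3" "finite R"
  and pos: "\<And>n. f n >= 0" "\<And>n. g n >= 0" "\<And>n. h n >= 0" "\<And>n. w n >= 0"
  and K1: "\<And>a b. card {n \<in> S1. \<bar>Q n + Q (a - n) - b\<bar> < 1} <= K1"
  and K3: "\<And>a b. card {n \<in> S3. \<bar>Q n + Q (a - n) - b\<bar> < 1} <= K3"
 shows "(\<Sum>n\<in>R. binned3 Q S1 S2 S3 f g h \<nu> j n * w n) <=
  2 * sqrt (K1 * K3) * (L2_set f S1 * L2_set g S2 * L2_set h S3 * L2_set w R)"
proof -
 have "(\<Sum>n\<in>R. binned3 Q S1 S2 S3 f g h \<nu> j n * w n) =
  (\<Sum>n2\<in>S2. \<Sum>n1\<in>S1. \<Sum>n\<in>R. \<Sum>n3\<in>S3.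
   if n1 - n2 + n3 = n \<and> \<lfloor>Q n - Q n1 + Q n2 - Q n3 + \<nu>\<rfloor> = j then f n1 * g n2 * h n3 * w n else 0)"
  unfolding binned_dual_eq by (subst sum_rearrange4, subst sum.swap) (simp cong: if_cong)
 also have "... = (\<Sum>i\<in>S2\<times>S1. \<Sum>k\<in>R\<times>S3.
   if (\<lambda>(n, m). m - n) i = (\<lambda>(n, m). n - m) k \<and>
     \<lfloor>(\<lambda>(n, m). Q n - Q m + \<nu>) k - (\<lambda>(n, m). Q m - Q n) i\<rfloor> = j
   then (\<lambda>(n, m). g n * f m) i * (\<lambda>(n, m). w n * h m) k else 0)"
  unfolding sum.cartesian_product' by (intro sum.cong refl) (auto simp: algebra_simps)
 also have "... <= 2 * (sqrt (energy (S2\<times>S1) (\<lambda>(n, m). m - n) (\<lambda>(n, m). Q m - Q n) (\<lambda>(n, m). g n * f m)) *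
   sqrt (energy (R\<times>S3) (\<lambda>(n, m). n - m) (\<lambda>(n, m). Q n - Q m + \<nu>) (\<lambda>(n, m). w n * h m)))"
  by (rule sum_matching_bins_le) (use fin pos in auto)
 also have "... <= 2 * (sqrt (K1 * (\<Sum>n\<in>S2. (g n)\<^sup>2) * (\<Sum>n\<in>S1. (f n)\<^sup>2)) *
   sqrt (K3 * (\<Sum>n\<in>R. (w n)\<^sup>2) * (\<Sum>n\<in>S3. (h n)\<^sup>2)))"
  by (intro mult_left_mono mult_mono real_sqrt_le_mono energy_differences_le energy_differences_le' real_sqrt_ge_zero)
   (use fin pos K1 K3 order_trans[OF of_nat_0_le_iff K1] order_trans[OF of_nat_0_le_iff K3] in \<open>auto intro!: mult_nonneg_nonneg sum_nonneg energy_nonneg\<close>)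
 also have "... = 2 * sqrt (K1 * K3) * (L2_set f S1 * L2_set g S2 * L2_set h S3 * L2_set w R)"
  by (simp add: L2_set_def real_sqrt_mult)
 finally show ?thesis .
qed

text \<open>Output and resonance are symmetric in the first and third slots, so a high third
  frequency reduces to a high first one.\<close>

lemma binned_swap:
 fixes Q :: "'a::ab_group_add => real"
 shows "binned3 Q S1 S2 S3 f g h \<nu> j n =
  binned Q (S3 \<times> S2 \<times> S1) (\<lambda>(n1, n2, n3). h n1 * g n2 * f n3) \<nu> j n"
proof -
 have c: "n1 - n2 + n3 = n3 - n2 + n1" for n1 n2 n3 :: 'a by (simp add: algebra_simps)
 show ?thesis unfolding binned_def
  by (rule sum.reindex_bij_witness[of _ "\<lambda>(a,b,c). (c,b,a)" "\<lambda>(a,b,c). (c,b,a)"])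
   (auto simp: out_def res_def algebra_simps)
qed

text \<open>Turns the dual bounds into norm bounds by taking \<open>A\<close> itself as the test
  function.\<close>

lemma L2_set_le_of_dual:
 fixes A :: "'a => real"
 assumes "(\<Sum>n\<in>R. A n * A n) <= M * L2_set A R" "M >= 0"
 shows "L2_set A R <= M"
proof (cases "L2_set A R = 0")
 case False
 then have "L2_set A R > 0" using L2_set_nonneg[of A R] by linarith
 moreover have "(\<Sum>n\<in>R. A n * A n) = L2_set A R * L2_set A R"
  unfolding L2_set_def by (simp add: power2_eq_square sum_nonneg)
 ultimately show ?thesis using assms(1) by simp
qed (use assms in simp)

lemma binned_L2_le1:
 fixes Q :: "'a::ab_group_add => real" and K2 K3 :: real
 assumes fin: "finite S1" "finite S2" "finite S3" "finite R"
  and pos: "\<And>n. f n >= 0" "\<And>n. g n >= 0" "\<And>n. h n >= 0"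
  and K: "\<And>a b. card {n \<in> S2. \<bar>Q n + Q (a - n) - b\<bar> < 1} <= K2"
   "\<And>a b. card {n \<in> S3. \<bar>Q n + Q (a - n) - b\<bar> < 1} <= K3"
 shows "L2_set (binned3 Q S1 S2 S3 f g h \<nu> j) R <=
  2 * sqrt (K2 * K3) * (L2_set f S1 * L2_set g S2 * L2_set h S3)"
proof (rule L2_set_le_of_dual)
 have "K2 >= 0" "K3 >= 0" using K[of 0 0] of_nat_0_le_iff order_trans by blast+
 then show "0 <= 2 * sqrt (K2 * K3) * (L2_set f S1 * L2_set g S2 * L2_set h S3)" by simp
qed (use binned_dual_le1[OF fin pos _ K, where w = "binned3 Q S1 S2 S3 f g h \<nu> j" and \<nu> = \<nu> and j = j]
   binned_nonneg[of "\<lambda>(n1, n2, n3). f n1 * g n2 * h n3"] pos in \<open>auto simp: mult.assoc split_beta\<close>)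

lemma binned_L2_le2:
 fixes Q :: "'a::ab_group_add => real" and K1 K3 :: real
 assumes fin: "finite S1" "finite S2" "finite S3" "finite R"
  and pos: "\<And>n. f n >= 0" "\<And>n. g n >= 0" "\<And>n. h n >= 0"
  and K: "\<And>a b. card {n \<in> S1. \<bar>Q n + Q (a - n) - b\<bar> < 1} <= K1"
   "\<And>a b. card {n \<in> S3. \<bar>Q n + Q (a - n) - b\<bar> < 1} <= K3"
 shows "L2_set (binned3 Q S1 S2 S3 f g h \<nu> j) R <=
  2 * sqrt (K1 * K3) * (L2_set f S1 * L2_set g S2 * L2_set h S3)"
proof (rule L2_set_le_of_dual)
 have "K1 >= 0" "K3 >= 0" using K[of 0 0] of_nat_0_le_iff order_trans by blast+
 then show "0 <= 2 * sqrt (K1 * K3) * (L2_set f S1 * L2_set g S2 * L2_set h S3)" by simp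
qed (use binned_dual_le2[OF fin pos _ K, where w = "binned3 Q S1 S2 S3 f g h \<nu> j" and \<nu> = \<nu> and j = j]
   binned_nonneg[of "\<lambda>(n1, n2, n3). f n1 * g n2 * h n3"] pos in \<open>auto simp: mult.assoc split_beta\<close>)

lemma sum_sq_if_le:
 fixes x :: "int => real"
 assumes "finite J" "\<And>j. x j >= 0"
 shows "(\<Sum>j\<in>J. (x j)\<^sup>2) <= (\<Sum>j\<in>J. x j)\<^sup>2"
proof -
 have "(\<Sum>j\<in>J. x j * x j) <= (\<Sum>j\<in>J. x j * (\<Sum>i\<in>J. x i))"
  using assms by (intro sum_mono mult_left_mono member_le_sum) auto
 then show ?thesis by (simp add: power2_eq_square sum_distrib_right)
qed

text \<open>The crude half of the interpolation. For a fixed output every triple lies in one bin, so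
  the squares of the bins add up to at most the square of the whole fibre sum, and Cauchy-Schwarz on
  a fibre of at most \<open>D\<close> triples finishes. There is no loss in the number of bins, but
  \<open>D\<close> is a large power of the frequency.\<close>

lemma binned_sum_squares_le:
 fixes Q :: "'a::ab_group_add => real" and D :: real
 assumes fin: "finite \<Theta>" "finite R" "finite J" and F: "\<And>\<tau>. F \<tau> >= 0"
  and D: "\<And>n. card {\<tau> \<in> \<Theta>. out \<tau> = n} <= D"
 shows "(\<Sum>j\<in>J. (L2_set (binned Q \<Theta> F \<nu> j) R)\<^sup>2) <= D * (\<Sum>\<tau>\<in>\<Theta>. (F \<tau>)\<^sup>2)"
proof -
 have "(\<Sum>j\<in>J. (L2_set (binned Q \<Theta> F \<nu> j) R)\<^sup>2) = (\<Sum>n\<in>R. \<Sum>j\<in>J. (binned Q \<Theta> F \<nu> j n)\<^sup>2)"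
  unfolding L2_set_def by (subst sum.swap) (simp add: sum_nonneg)
 also have "... <= (\<Sum>n\<in>R. D * (\<Sum>\<tau>\<in>\<Theta>. if out \<tau> = n then (F \<tau>)\<^sup>2 else 0))"
 proof (rule sum_mono)
  fix n
  have "(\<Sum>j\<in>J. (binned Q \<Theta> F \<nu> j n)\<^sup>2) <= (\<Sum>j\<in>J. binned Q \<Theta> F \<nu> j n)\<^sup>2"
   by (intro sum_sq_if_le binned_nonneg fin F)
  also have "(\<Sum>j\<in>J. binned Q \<Theta> F \<nu> j n) = (\<Sum>\<tau>\<in>\<Theta>. \<Sum>j\<in>J. if out \<tau> = n \<and> \<lfloor>res Q \<tau> + \<nu>\<rfloor> = j then F \<tau> else 0)"
   unfolding binned_def by (rule sum.swap)
  also have "...\<^sup>2 <= (\<Sum>\<tau>\<in>\<Theta>. if out \<tau> = n then F \<tau> else 0)\<^sup>2"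
  proof (intro power_mono sum_mono sum_nonneg)
   fix \<tau>
   have "(\<Sum>j\<in>J. if out \<tau> = n \<and> \<lfloor>res Q \<tau> + \<nu>\<rfloor> = j then F \<tau> else 0) =
    (\<Sum>j\<in>J. if \<lfloor>res Q \<tau> + \<nu>\<rfloor> = j then (if out \<tau> = n then F \<tau> else 0) else 0)"
    by (intro sum.cong) auto
   also have "... <= (if out \<tau> = n then F \<tau> else 0)"
    using fin F by (subst sum.delta') auto
   finally show "(\<Sum>j\<in>J. if out \<tau> = n \<and> \<lfloor>res Q \<tau> + \<nu>\<rfloor> = j then F \<tau> else 0) <= (if out \<tau> = n then F \<tau> else 0)" .
  qed (use F in auto)
  also have "(\<Sum>\<tau>\<in>\<Theta>. if out \<tau> = n then F \<tau> else 0) = (\<Sum>\<tau>\<in>{\<tau> \<in> \<Theta>. out \<tau> = n}. F \<tau>)"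
   using fin by (simp add: sum.inter_filter)
  also have "...\<^sup>2 <= (\<Sum>\<tau>\<in>{\<tau> \<in> \<Theta>. out \<tau> = n}. (F \<tau>)\<^sup>2) * card {\<tau> \<in> \<Theta>. out \<tau> = n}"
   by (rule sum_squared_le_sum_of_squares)
  also have "... <= (\<Sum>\<tau>\<in>{\<tau> \<in> \<Theta>. out \<tau> = n}. (F \<tau>)\<^sup>2) * D"
   using D by (intro mult_left_mono sum_nonneg) auto
  also have "... = D * (\<Sum>\<tau>\<in>\<Theta>. if out \<tau> = n then (F \<tau>)\<^sup>2 else 0)"
   using fin by (simp add: sum.inter_filter)
  finally show "(\<Sum>j\<in>J. (binned Q \<Theta> F \<nu> j n)\<^sup>2) <= D * (\<Sum>\<tau>\<in>\<Theta>. if out \<tau> = n then (F \<tau>)\<^sup>2 else 0)" .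
 qed
 also have "... = D * (\<Sum>\<tau>\<in>\<Theta>. \<Sum>n\<in>R. if out \<tau> = n then (F \<tau>)\<^sup>2 else 0)"
  by (simp add: sum_distrib_left[symmetric] sum.swap[of _ R])
 also have "... <= D * (\<Sum>\<tau>\<in>\<Theta>. (F \<tau>)\<^sup>2)"
 proof (intro mult_left_mono sum_mono)
  show "D >= 0" using D[of 0] of_nat_0_le_iff order_trans by blast
 qed (use fin in auto)
 finally show ?thesis .
qed

text \<open>The terms with \<open>x j\<close> small are summed by the decay of the weight, the others by squares.\<close>

lemma sum_weighted_le:
 fixes x :: "int => real" and \<delta> L S D :: real
 assumes J: "finite J" and x: "\<And>j. 0 <= x j" "\<And>j. x j <= S" and sq: "(\<Sum>j\<in>J. (x j)\<^sup>2) <= D * S\<^sup>2"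
  and \<delta>: "0 < \<delta>" "\<delta> <= 1/12" and L: "L >= 1"
 shows "(\<Sum>j\<in>J. (1 + \<bar>real_of_int j\<bar>) powr (2*\<delta> - 1) * x j) <=
  S * (L * (\<Sum>j\<in>J. (1 + \<bar>real_of_int j\<bar>) powr (-1 - 2*\<delta>)) + L powr (-1/(8*\<delta>)) * D)"
proof (cases "S = 0")
 case True
 then have "x j = 0" for j using x[of j] by simp
 then show ?thesis using True by simp
next
 case False
 then have S: "S > 0" using x[of 0] by linarith
 have "(1 + \<bar>real_of_int j\<bar>) powr (2*\<delta> - 1) * x j <= S * L * (1 + \<bar>real_of_int j\<bar>) powr (-1 - 2*\<delta>) + L powr (-1/(8*\<delta>)) * (x j)\<^sup>2 / S" for j
 proof -
  define r where "r = 1 + \<bar>real_of_int j\<bar>"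
  have r: "r >= 1" by (simp add: r_def)
  show ?thesis
  \<comment> \<open>Below the threshold the exponent \<open>2*\<delta> - 1\<close> becomes the
    summable \<open>-1 - 2*\<delta>\<close>. Above it, \<open>x j <= S\<close> forces
    \<open>L < r powr (4*\<delta>)\<close>, so \<open>r\<close> is large and half a power of it buys
    \<open>L powr (-1/(8*\<delta>))\<close>; that half power is available since
    \<open>6*\<delta> - 1 <= -1/2\<close>.\<close>
  proof (cases "x j <= S * L * r powr (-4*\<delta>)")
   case True
   have "r powr (2*\<delta> - 1) * x j <= r powr (2*\<delta> - 1) * (S * L * r powr (-4*\<delta>))"
    using True by (intro mult_left_mono) auto
   also have "... = S * L * r powr (-1 - 2*\<delta>)"
    by (simp add: powr_add[symmetric] algebra_simps)
   also have "... <= S * L * r powr (-1 - 2*\<delta>) + L powr (-1/(8*\<delta>)) * (x j)\<^sup>2 / S"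
    using S by simp
   finally show ?thesis by (simp add: r_def)
  next
   case False
   have pos: "r powr (-4*\<delta>) > 0" using r by simp
   have "S * L * r powr (-4*\<delta>) < S * 1" using False x(2)[of j] by simp
   then have "L * r powr (-4*\<delta>) < 1" using S by (simp add: mult.assoc)
   then have Lr: "L < r powr (4*\<delta>)"
    using r by (simp add: powr_minus field_simps)
   have "L powr (1/(8*\<delta>)) <= (r powr (4*\<delta>)) powr (1/(8*\<delta>))"
    using Lr L \<delta> by (intro powr_mono2) auto
   also have "... = r powr (1/2)" using \<delta> by (simp add: powr_powr)
   finally have Lr2: "L powr (1/(8*\<delta>)) <= r powr (1/2)" .
   have "r powr (-1/2) = inverse (r powr (1/2))" by (simp add: powr_minus[symmetric])
   also have "... <= inverse (L powr (1/(8*\<delta>)))"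
    using Lr2 L by (intro le_imp_inverse_le) auto
   also have "... = L powr (-1/(8*\<delta>))" by (simp add: powr_minus[symmetric])
   finally have Lr3: "r powr (-1/2) <= L powr (-1/(8*\<delta>))" .
   have "r powr (2*\<delta> - 1) * S = r powr (6*\<delta> - 1) * (S * 1 * r powr (-4*\<delta>))"
    by (simp add: powr_add[symmetric] algebra_simps)
   also have "... <= r powr (6*\<delta> - 1) * (S * L * r powr (-4*\<delta>))"
    using L S by (intro mult_left_mono mult_right_mono) auto
   also have "... <= r powr (6*\<delta> - 1) * x j"
    using False by (intro mult_left_mono) auto
   also have "... <= r powr (-1/2) * x j"
    using r \<delta> x by (intro mult_right_mono powr_mono) auto
   also have "... <= L powr (-1/(8*\<delta>)) * x j"
    using Lr3 x by (intro mult_right_mono) auto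
   finally have "r powr (2*\<delta> - 1) * S * x j <= L powr (-1/(8*\<delta>)) * x j * x j"
    by (intro mult_right_mono x)
   then have "r powr (2*\<delta> - 1) * x j <= L powr (-1/(8*\<delta>)) * (x j)\<^sup>2 / S"
    using S by (simp add: field_simps power2_eq_square)
   also have "... <= S * L * r powr (-1 - 2*\<delta>) + L powr (-1/(8*\<delta>)) * (x j)\<^sup>2 / S"
    using S L by simp
   finally show ?thesis by (simp add: r_def)
  qed
 qed
 then have "(\<Sum>j\<in>J. (1 + \<bar>real_of_int j\<bar>) powr (2*\<delta> - 1) * x j) <=
  (\<Sum>j\<in>J. S * L * (1 + \<bar>real_of_int j\<bar>) powr (-1 - 2*\<delta>) + L powr (-1/(8*\<delta>)) * (x j)\<^sup>2 / S)"
  by (intro sum_mono)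
 also have "... = S * L * (\<Sum>j\<in>J. (1 + \<bar>real_of_int j\<bar>) powr (-1 - 2*\<delta>)) + L powr (-1/(8*\<delta>)) / S * (\<Sum>j\<in>J. (x j)\<^sup>2)"
  by (simp add: sum.distrib sum_distrib_left)
 also have "... <= S * L * (\<Sum>j\<in>J. (1 + \<bar>real_of_int j\<bar>) powr (-1 - 2*\<delta>)) + L powr (-1/(8*\<delta>)) / S * (D * S\<^sup>2)"
  using S by (intro add_left_mono mult_left_mono sq) auto
 also have "... = S * (L * (\<Sum>j\<in>J. (1 + \<bar>real_of_int j\<bar>) powr (-1 - 2*\<delta>)) + L powr (-1/(8*\<delta>)) * D)"
  using S by (simp add: field_simps power2_eq_square)
 finally show ?thesis .
qed

section \<open>Dyadic summation in an abstract dispersive setting\<close>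

lemma sum_int_powr_bounded:
 fixes p :: real
 assumes "p > 1"
 obtains B where "B >= 0" "\<And>J. finite J ==> (\<Sum>j\<in>J. (1 + \<bar>real_of_int j\<bar>) powr (-p)) <= B"
proof
 define a where "a i = (1 + real i) powr (-p)" for i :: nat
 have "summable (\<lambda>i. real i powr (-p))" using assms by (simp add: summable_real_powr_iff)
 then have "summable (\<lambda>i. real (Suc i) powr (-p))" by (rule summable_Suc_iff[THEN iffD2])
 then have s: "summable a" unfolding a_def by (simp add: add.commute)
 show "2 * suminf a >= 0" using s by (simp add: suminf_nonneg a_def)
 fix J :: "int set" assume J: "finite J"
 let ?f = "\<lambda>j. (1 + \<bar>real_of_int j\<bar>) powr (-p)"
 have le: "(\<Sum>j\<in>nat ` X. a j) <= suminf a" if "finite X" for X :: "int set"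
  by (rule sum_le_suminf[OF s]) (use that in \<open>auto simp: a_def\<close>)
 have "sum ?f J = sum ?f {j\<in>J. j >= 0} + sum ?f {j\<in>J. \<not> j >= 0}"
  using J by (subst sum.union_disjoint[symmetric]) (auto intro!: sum.cong)
 also have "sum ?f {j\<in>J. j >= 0} = sum a (nat ` {j\<in>J. j >= 0})"
  by (subst sum.reindex) (auto simp: inj_on_def a_def)
 also have "sum ?f {j\<in>J. \<not> j >= 0} = sum a ((\<lambda>j. nat (-j)) ` {j\<in>J. \<not> j >= 0})"
  by (subst sum.reindex) (auto simp: inj_on_def a_def)
 also have "(\<lambda>j. nat (-j)) ` {j\<in>J. \<not> j >= 0} = nat ` (uminus ` {j\<in>J. \<not> j >= 0})"
  by (simp add: image_image)
 finally show "sum ?f J <= 2 * suminf a"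
  using le[of "{j\<in>J. j >= 0}"] le[of "uminus ` {j\<in>J. \<not> j >= 0}"] J by simp
qed

lemma sum_powr_geometric_le:
 fixes e :: real
 assumes "e < 0" "finite M"
 shows "(\<Sum>m\<in>M. 2 powr (e * real m)) <= 1 / (1 - 2 powr e)"
proof -
 have e: "0 <= 2 powr e" "2 powr e < 1"
  using powr_less_mono[of e 0 2] assms(1) by auto
 have "2 powr (e * real m) = (2 powr e) ^ m" for m :: nat
  by (simp add: powr_realpow[symmetric] powr_powr)
 then have "(\<Sum>m\<in>M. 2 powr (e * real m)) = (\<Sum>m\<in>M. (2 powr e) ^ m)" by simp
 also have "... <= (\<Sum>m. (2 powr e) ^ m)"
  by (rule sum_le_suminf) (use assms e in \<open>auto intro!: summable_geometric\<close>)
 also have "... = 1 / (1 - 2 powr e)" using e by (intro suminf_geometric) auto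
 finally show ?thesis .
qed

lemma L2_set_sum_le:
 assumes "finite K"
 shows "L2_set (\<lambda>n. \<Sum>k\<in>K. F k n) R <= (\<Sum>k\<in>K. L2_set (F k) R)"
 using assms
proof (induction K rule: finite_induct)
 case empty
 then show ?case by (simp add: L2_set_def)
next
 case (insert x K)
 then show ?case using L2_set_triangle_ineq[of "F x" "\<lambda>n. \<Sum>k\<in>K. F k n" R] by simp
qed

lemma L2_set_mult_const: "c >= 0 ==> L2_set (\<lambda>n. c * F n) R = c * L2_set F R"
 by (simp add: L2_set_right_distrib)

lemma mult_rearrange_le:
 fixes x y :: real
 assumes "x <= A * G" "y <= B * H" "0 <= x" "0 <= y" "0 <= D" "0 <= c" "0 <= E" "E * (A * B) = M"
 shows "D * E * (c * x * y) <= D * (c * G * H) * M"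
proof -
 have "D * E * (c * x * y) = (D * E * c) * (x * y)" by simp
 also have "... <= (D * E * c) * ((A * G) * (B * H))"
  using assms by (intro mult_left_mono mult_mono) auto
 also have "... = D * (c * G * H) * (E * (A * B))" by simp
 finally show ?thesis unfolding assms(8) .
qed

text \<open>Everything that the trilinear estimate uses about the torus. With
  \<open>N = 2 powr m\<close>, a dyadic level contains \<open>N powr d\<close> points and at most
  \<open>N powr (2 * \<sigma>)\<close> representations, up to constants. The count is uniform in
  \<open>a\<close> and \<open>b\<close>, since the unlocalized frequencies enter through
  them.\<close>

locale dispersive =
 fixes Q jb :: "'a::ab_group_add => real" and lev :: "'a => nat" and C d \<sigma> s :: real
 assumes finite_lev: "\<And>m. finite {n. lev n = m}"
  and card_lev: "\<And>m. card {n. lev n = m} <= C * 2 powr (d * m)"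
  and count: "\<And>m a b. card {n. lev n = m \<and> \<bar>Q n + Q (a - n) - b\<bar> < 1} <= C * 2 powr (2 * \<sigma> * m)"
  and lev_le: "\<And>n. 2 powr (lev n) <= jb n"
  and jb_out: "\<And>n1 n2 n3. jb (n1 - n2 + n3) <= jb n1 + jb n2 + jb n3"
  and C_ge: "C >= 1" and d_ge: "d >= 2" and \<sigma>_ge: "0 <= \<sigma>" and \<sigma>_less: "\<sigma> < s"
begin

definition "\<eta> = min 1 ((s - \<sigma>) / 2)"
text \<open>Chosen so that \<open>L = 2 powr (\<eta> * p)\<close> gives
  \<open>L powr (-1/(8*\<delta>)) = 2 powr (- d * p)\<close>, which cancels the fibre size
  \<open>D\<close> of the crude bound. The value of \<open>\<eta>\<close> spends at most half of the
  gap between \<open>\<sigma>\<close> and \<open>s\<close> on this.\<close>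

definition "\<delta> = \<eta> / (8 * d)"
text \<open>The decay in the resonance of the Duhamel kernel summed over its cosine index; see
  \<open>kern_bound_sum\<close> with \<open>e = 2*\<delta>/3\<close>.\<close>

definition "\<rho> (j::int) = (1 + \<bar>real_of_int j\<bar>) powr (2 * \<delta> - 1)"
definition "\<Phi> J R \<nu> \<Theta> F = (\<Sum>j\<in>J. \<rho> j * L2_set (binned Q \<Theta> F \<nu> j) R)"

lemma eta: "0 < \<eta>" "\<eta> <= 1" "\<sigma> + \<eta> - s < 0"
proof -
 have "\<eta> <= (s - \<sigma>) / 2" unfolding \<eta>_def by (rule min.cobounded2)
 then have "\<eta> * 2 <= s - \<sigma>" by simp
 then show "\<sigma> + \<eta> - s < 0" using \<sigma>_less by linarith
qed (use \<sigma>_less in \<open>auto simp: \<eta>_def\<close>)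

lemma delta: "0 < \<delta>" "\<delta> <= 1/12"
proof -
 show "0 < \<delta>" using eta d_ge by (simp add: \<delta>_def)
 have "\<eta> / (8 * d) <= 1 / (8 * 2)" using eta d_ge by (intro frac_le) auto
 then show "\<delta> <= 1/12" by (simp add: \<delta>_def)
qed

lemma rho_nonneg: "\<rho> j >= 0" by (simp add: \<rho>_def)

lemma jb_ge_1: "jb n >= 1"
proof -
 have "(1::real) <= 2 powr (lev n)" by (simp add: powr_realpow)
 then show ?thesis using lev_le[of n] by simp
qed

definition "B0 = (SOME B. B >= 0 \<and> (\<forall>J. finite J \<longrightarrow> (\<Sum>j\<in>J. (1 + \<bar>real_of_int j\<bar>) powr (-1 - 2*\<delta>)) <= B))"

lemma B0: "B0 >= 0" "finite J ==> (\<Sum>j\<in>J. (1 + \<bar>real_of_int j\<bar>) powr (-1 - 2*\<delta>)) <= B0"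
proof -
 obtain B where B: "B >= 0" "\<And>J. finite J ==> (\<Sum>j\<in>J. (1 + \<bar>real_of_int j\<bar>) powr (-(1 + 2*\<delta>))) <= B"
  by (rule sum_int_powr_bounded[of "1 + 2 * \<delta>"]) (use delta in simp_all)
 have "-(1 + 2*\<delta>) = -1 - 2*\<delta>" by simp
 with B have "B >= 0 \<and> (\<forall>J. finite J \<longrightarrow> (\<Sum>j\<in>J. (1 + \<bar>real_of_int j\<bar>) powr (-1 - 2*\<delta>)) <= B)"
  by metis
 from someI[of "\<lambda>B. B >= 0 \<and> (\<forall>J. finite J \<longrightarrow> (\<Sum>j\<in>J. (1 + \<bar>real_of_int j\<bar>) powr (-1 - 2*\<delta>)) <= B)", OF this]
 show "B0 >= 0" "finite J ==> (\<Sum>j\<in>J. (1 + \<bar>real_of_int j\<bar>) powr (-1 - 2*\<delta>)) <= B0"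
  unfolding B0_def by auto
qed

definition "C1 = 2 * C * (B0 + C\<^sup>2)"

lemma C1_pos: "C1 > 0" unfolding C1_def using C_ge B0(1)
 by (intro mult_pos_pos add_nonneg_pos) auto

text \<open>Summing over all bins costs only \<open>2 powr (\<eta> * p)\<close>,
  \<open>p = m + l\<close>, compared with a single bin: \<open>sum_weighted_le\<close> is applied
  with this number as \<open>L\<close>.\<close>

lemma Phi_box_le:
 assumes fin: "finite J" "finite R" "finite \<Theta>" and F: "\<And>\<tau>. F \<tau> >= 0" and S0: "S0 >= 0"
  and sup: "\<And>j. L2_set (binned Q \<Theta> F \<nu> j) R <= 2 * (C * 2 powr (\<sigma> * (real m + real l))) * S0"
  and card: "\<And>n. card {\<tau> \<in> \<Theta>. out \<tau> = n} <= C\<^sup>2 * 2 powr (d * (real m + real l))"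
  and F2: "(\<Sum>\<tau>\<in>\<Theta>. (F \<tau>)\<^sup>2) <= S0\<^sup>2"
 shows "\<Phi> J R \<nu> \<Theta> F <= C1 * 2 powr ((\<sigma> + \<eta>) * (real m + real l)) * S0"
proof -
 define p where "p = real m + real l"
 define S where "S = 2 * (C * 2 powr (\<sigma> * p)) * S0"
 define D where "D = C\<^sup>2 * 2 powr (d * p)"
 define L where "L = 2 powr (\<eta> * p)"
 have p: "p >= 0" by (simp add: p_def)
 have D0: "D >= 0" by (simp add: D_def)
 have L1: "L >= 1" unfolding L_def using p eta by (intro ge_one_powr_ge_zero) auto
 have "1 * 1 <= C * 2 powr (\<sigma> * p)"
  using C_ge p \<sigma>_ge by (intro mult_mono ge_one_powr_ge_zero) auto
 then have "1 * S0 <= S" unfolding S_def using S0 by (intro mult_right_mono) auto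
 then have S0S: "S0 <= S" by simp
 have "(\<Sum>j\<in>J. (L2_set (binned Q \<Theta> F \<nu> j) R)\<^sup>2) <= D * (\<Sum>\<tau>\<in>\<Theta>. (F \<tau>)\<^sup>2)"
  by (rule binned_sum_squares_le) (use fin F card in \<open>auto simp: D_def p_def\<close>)
 also have "... <= D * S\<^sup>2"
  using F2 power_mono[OF S0S S0, of 2] D0 by (intro mult_left_mono) auto
 finally have sq: "(\<Sum>j\<in>J. (L2_set (binned Q \<Theta> F \<nu> j) R)\<^sup>2) <= D * S\<^sup>2" .
 have "\<Phi> J R \<nu> \<Theta> F <= S * (L * (\<Sum>j\<in>J. (1 + \<bar>real_of_int j\<bar>) powr (-1 - 2*\<delta>)) + L powr (-1/(8*\<delta>)) * D)"
  unfolding \<Phi>_def \<rho>_def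
  by (rule sum_weighted_le[OF fin(1) _ _ sq delta L1]) (use sup in \<open>auto simp: S_def p_def\<close>)
 also have "... <= S * (L * B0 + L * C\<^sup>2)"
 proof -
  have "L powr (-1/(8*\<delta>)) = 2 powr (- d * p)"
   unfolding L_def powr_powr \<delta>_def using eta d_ge by (simp add: field_simps)
  then have "L powr (-1/(8*\<delta>)) * D = C\<^sup>2"
   unfolding D_def by (simp add: powr_add[symmetric] algebra_simps)
  also have "... <= L * C\<^sup>2" using L1 by (simp add: mult_le_cancel_right1)
  finally show ?thesis
   using B0(2)[OF fin(1)] L1 S0 S0S by (intro mult_left_mono add_mono) auto
 qed
 also have "... = C1 * 2 powr ((\<sigma> + \<eta>) * p) * S0"
  unfolding S_def L_def C1_def by (simp add: algebra_simps powr_add)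
 finally show ?thesis by (simp add: p_def)
qed

lemma Phi_split:
 assumes fin: "finite J" "finite R" "finite \<Theta>" and "finite K" "\<kappa> ` \<Theta> \<subseteq> K" and F: "\<And>\<tau>. F \<tau> >= 0"
 shows "\<Phi> J R \<nu> \<Theta> F <= (\<Sum>k\<in>K. \<Phi> J R \<nu> {\<tau> \<in> \<Theta>. \<kappa> \<tau> = k} F)"
proof -
 have "binned Q \<Theta> F \<nu> j = (\<lambda>n. \<Sum>k\<in>K. binned Q {\<tau> \<in> \<Theta>. \<kappa> \<tau> = k} F \<nu> j n)" for j
  unfolding binned_def by (rule ext) (rule sum.group[symmetric], use assms in auto)
 then have "\<Phi> J R \<nu> \<Theta> F <= (\<Sum>j\<in>J. \<rho> j * (\<Sum>k\<in>K. L2_set (binned Q {\<tau> \<in> \<Theta>. \<kappa> \<tau> = k} F \<nu> j) R))"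
  unfolding \<Phi>_def using assms rho_nonneg
  by (auto intro!: sum_mono mult_left_mono L2_set_sum_le)
 also have "... = (\<Sum>k\<in>K. \<Phi> J R \<nu> {\<tau> \<in> \<Theta>. \<kappa> \<tau> = k} F)"
  unfolding \<Phi>_def sum_distrib_left by (rule sum.swap)
 finally show ?thesis .
qed

lemma L2_level_le:
 assumes "finite S"
 shows "L2_set g {n \<in> S. lev n = m} <= 2 powr (- s * m) * L2_set (\<lambda>n. jb n powr s * g n) S"
proof -
 have s: "s > 0" using \<sigma>_ge \<sigma>_less by simp
 have "L2_set g {n \<in> S. lev n = m} = L2_set (\<lambda>n. \<bar>g n\<bar>) {n \<in> S. lev n = m}"
  by (simp add: L2_set_def)
 also have "... <= L2_set (\<lambda>n. 2 powr (- s * m) * (jb n powr s * \<bar>g n\<bar>)) {n \<in> S. lev n = m}"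
 proof (rule L2_set_mono)
  fix n assume "n \<in> {n \<in> S. lev n = m}"
  then have "(2 powr m) powr s <= jb n powr s"
   using lev_le[of n] s by (intro powr_mono2) auto
  then have "2 powr (- s * m) * (2 powr m) powr s <= 2 powr (- s * m) * jb n powr s"
   by (intro mult_left_mono) auto
  also have "2 powr (- s * m) * (2 powr m) powr s = 1"
   by (simp add: powr_powr powr_add[symmetric])
  finally have "1 * \<bar>g n\<bar> <= 2 powr (- s * m) * jb n powr s * \<bar>g n\<bar>"
   by (intro mult_right_mono) auto
  then show "\<bar>g n\<bar> <= 2 powr (- s * m) * (jb n powr s * \<bar>g n\<bar>)"
   by (simp only: mult.assoc mult_1)
 qed auto
 also have "... = 2 powr (- s * m) * L2_set (\<lambda>n. jb n powr s * \<bar>g n\<bar>) {n \<in> S. lev n = m}"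
  by (rule L2_set_mult_const) simp
 also have "... <= 2 powr (- s * m) * L2_set (\<lambda>n. jb n powr s * g n) S"
  unfolding L2_set_def using assms
  by (intro mult_left_mono real_sqrt_le_mono) (auto simp: power_mult_distrib intro!: sum_mono2)
 finally show ?thesis .
qed

definition "C2 = C1 * (1 / (1 - 2 powr (\<sigma> + \<eta> - s)))\<^sup>2"

lemma C2_pos: "C2 > 0"
proof -
 have "2 powr (\<sigma> + \<eta> - s) < 1" using powr_less_mono[of "\<sigma> + \<eta> - s" 0 2] eta by auto
 then show ?thesis unfolding C2_def using C1_pos
  by (intro mult_pos_pos zero_less_power) simp_all
qed

text \<open>On a level the weight gains \<open>2 powr (- s * m)\<close>, against a cost of
  \<open>2 powr ((\<sigma> + \<eta>) * m)\<close>. The net exponent is negative for both localized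
  frequencies, so the two geometric series converge; the third frequency, inside \<open>c\<close>,
  is never decomposed.\<close>

lemma dyadic_sum_le:
 assumes "finite S" "finite S'" "c >= 0"
 shows "(\<Sum>(m, l)\<in>lev ` S \<times> lev ` S'. C1 * 2 powr ((\<sigma> + \<eta>) * (real m + real l)) *
   (c * L2_set g {n \<in> S. lev n = m} * L2_set h {n \<in> S'. lev n = l})) <=
  C2 * (c * L2_set (\<lambda>n. jb n powr s * g n) S * L2_set (\<lambda>n. jb n powr s * h n) S')"
proof -
 let ?g = "L2_set (\<lambda>n. jb n powr s * g n) S" and ?h = "L2_set (\<lambda>n. jb n powr s * h n) S'"
 let ?e = "\<sigma> + \<eta> - s"
 have e1: "2 powr ?e < 1" using powr_less_mono[of ?e 0 2] eta by auto
 have "(\<Sum>(m, l)\<in>lev ` S \<times> lev ` S'. C1 * 2 powr ((\<sigma> + \<eta>) * (real m + real l)) *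
   (c * L2_set g {n \<in> S. lev n = m} * L2_set h {n \<in> S'. lev n = l})) <=
  (\<Sum>(m, l)\<in>lev ` S \<times> lev ` S'. C1 * (c * ?g * ?h) * (2 powr (?e * m) * 2 powr (?e * l)))"
 proof (intro sum_mono, clarify)
  fix m l :: nat
  have P: "2 powr ((\<sigma> + \<eta>) * (real m + real l)) * (2 powr (- s * m) * 2 powr (- s * l)) = 2 powr (?e * m) * 2 powr (?e * l)"
   unfolding powr_add[symmetric] by (simp add: algebra_simps)
  show "C1 * 2 powr ((\<sigma> + \<eta>) * (real m + real l)) *
   (c * L2_set g {n \<in> S. lev n = m} * L2_set h {n \<in> S'. lev n = l}) <= C1 * (c * ?g * ?h) * (2 powr (?e * m) * 2 powr (?e * l))"
   by (rule mult_rearrange_le[OF L2_level_le[OF assms(1)] L2_level_le[OF assms(2)] _ _ _ assms(3) _ P])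
    (use C1_pos in simp_all)
 qed
 also have "... = C1 * (c * ?g * ?h) * ((\<Sum>m\<in>lev ` S. 2 powr (?e * m)) * (\<Sum>l\<in>lev ` S'. 2 powr (?e * l)))"
  unfolding sum_product sum.cartesian_product by (simp only: sum_distrib_left split_def)
 also have "... <= C1 * (c * ?g * ?h) * ((1 / (1 - 2 powr ?e)) * (1 / (1 - 2 powr ?e)))"
 proof (rule mult_left_mono)
  show "(\<Sum>m\<in>lev ` S. 2 powr (?e * m)) * (\<Sum>l\<in>lev ` S'. 2 powr (?e * l)) <= (1 / (1 - 2 powr ?e)) * (1 / (1 - 2 powr ?e))"
   by (intro mult_mono sum_powr_geometric_le[OF eta(3)] finite_imageI assms sum_nonneg) (use e1 in simp_all)
  show "0 <= C1 * (c * ?g * ?h)" using C1_pos assms by simp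
 qed
 also have "... = C2 * (c * ?g * ?h)" unfolding C2_def by (simp add: power2_eq_square)
 finally show ?thesis .
qed

lemma card_level_le: "S \<subseteq> {n. lev n = m} ==> card S <= C * 2 powr (d * m)"
 using card_mono[OF finite_lev[of m], of S] card_lev[of m] by linarith

lemma count_level_le:
 assumes "S \<subseteq> {n. lev n = m}"
 shows "card {n \<in> S. \<bar>Q n + Q (a - n) - b\<bar> < 1} <= C * 2 powr (2 * \<sigma> * m)"
proof -
 have "card {n \<in> S. \<bar>Q n + Q (a - n) - b\<bar> < 1} <= card {n. lev n = m \<and> \<bar>Q n + Q (a - n) - b\<bar> < 1}"
  by (intro card_mono finite_subset[OF _ finite_lev[of m]]) (use assms in auto)
 then show ?thesis using count[of m a b] by linarith
qed

lemma sqrt_counts: "sqrt (C * 2 powr (2 * \<sigma> * real m) * (C * 2 powr (2 * \<sigma> * real l))) = C * 2 powr (\<sigma> * (real m + real l))"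
proof -
 have "C * 2 powr (2 * \<sigma> * real m) * (C * 2 powr (2 * \<sigma> * real l)) = (C * 2 powr (\<sigma> * (real m + real l)))\<^sup>2"
  by (simp add: power2_eq_square powr_add[symmetric] algebra_simps)
 then show ?thesis using C_ge by simp
qed

lemma sum_product3_squares:
 fixes f g h :: "'a => real"
 shows "(\<Sum>\<tau>\<in>S1\<times>S2\<times>S3. ((\<lambda>(n1, n2, n3). f n1 * g n2 * h n3) \<tau>)\<^sup>2) =
  (L2_set f S1 * L2_set g S2 * L2_set h S3)\<^sup>2"
 by (simp add: sum.cartesian_product' power_mult_distrib L2_set_def sum_nonneg
   sum_distrib_left[symmetric] sum_distrib_right[symmetric])

text \<open>The output and two of the three frequencies determine a triple, so a fibre embeds into a
  product of two level sets.\<close>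

lemma card_prod_le:
 fixes X :: "('a \<times> 'a) set"
 assumes "inj_on p {\<tau> \<in> \<Theta>. out \<tau> = n}" "p ` {\<tau> \<in> \<Theta>. out \<tau> = n} \<subseteq> A \<times> B"
  "A \<subseteq> {n. lev n = m}" "B \<subseteq> {n. lev n = l}"
 shows "card {\<tau> \<in> \<Theta>. out \<tau> = n} <= C\<^sup>2 * 2 powr (d * (real m + real l))"
proof -
 have fin: "finite A" "finite B" using finite_lev assms(3,4) finite_subset by blast+
 have "card {\<tau> \<in> \<Theta>. out \<tau> = n} <= card (A \<times> B)"
  using card_inj_on_le[OF assms(1,2)] fin by simp
 also have "real ... = real (card A) * real (card B)" by (simp add: card_cartesian_product)
 also have "... <= (C * 2 powr (d * m)) * (C * 2 powr (d * l))"
  using card_level_le assms(3,4) C_ge by (intro mult_mono) auto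
 also have "... = C\<^sup>2 * 2 powr (d * (real m + real l))"
  by (simp add: power2_eq_square powr_add[symmetric] algebra_simps)
 finally show ?thesis by simp
qed

text \<open>Two factors spend \<open>s\<close> derivatives each and the first one spends none.
  Together with \<open>Phi_le2\<close> and \<open>Phi_le3\<close>, any of the three factors can be
  the one left in plain l2.\<close>

lemma Phi_le1:
 assumes fin: "finite J" "finite R" "finite S1" "finite S2" "finite S3"
  and pos: "\<And>n. f n >= 0" "\<And>n. g n >= 0" "\<And>n. h n >= 0"
 shows "\<Phi> J R \<nu> (S1 \<times> S2 \<times> S3) (\<lambda>(n1, n2, n3). f n1 * g n2 * h n3) <=
  C2 * (L2_set f S1 * L2_set (\<lambda>n. jb n powr s * g n) S2 * L2_set (\<lambda>n. jb n powr s * h n) S3)"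
proof -
 let ?F = "\<lambda>(n1, n2, n3). f n1 * g n2 * h n3"
 let ?\<kappa> = "\<lambda>(n1, n2, n3). (lev n2, lev n3)"
 have F: "?F \<tau> >= 0" for \<tau> using pos by (auto simp: split_beta)
 have "\<Phi> J R \<nu> (S1 \<times> S2 \<times> S3) ?F <= (\<Sum>k\<in>lev ` S2 \<times> lev ` S3. \<Phi> J R \<nu> {\<tau> \<in> S1 \<times> S2 \<times> S3. ?\<kappa> \<tau> = k} ?F)"
  by (rule Phi_split) (use fin F in auto)
 also have "... <= (\<Sum>(m, l)\<in>lev ` S2 \<times> lev ` S3. C1 * 2 powr ((\<sigma> + \<eta>) * (real m + real l)) *
   (L2_set f S1 * L2_set g {n \<in> S2. lev n = m} * L2_set h {n \<in> S3. lev n = l}))"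
 proof (intro sum_mono, clarify)
  fix m l
  let ?A = "{n \<in> S2. lev n = m}" and ?B = "{n \<in> S3. lev n = l}"
  have *: "{\<tau> \<in> S1 \<times> S2 \<times> S3. ?\<kappa> \<tau> = (m, l)} = S1 \<times> ?A \<times> ?B" by auto
  show "\<Phi> J R \<nu> {\<tau> \<in> S1 \<times> S2 \<times> S3. ?\<kappa> \<tau> = (m, l)} ?F <= C1 * 2 powr ((\<sigma> + \<eta>) * (real m + real l)) *
   (L2_set f S1 * L2_set g ?A * L2_set h ?B)" unfolding *
  proof (rule Phi_box_le)
   show "L2_set (binned Q (S1 \<times> ?A \<times> ?B) ?F \<nu> j) R <= 2 * (C * 2 powr (\<sigma> * (real m + real l))) * (L2_set f S1 * L2_set g ?A * L2_set h ?B)" for j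
    unfolding sqrt_counts[symmetric]
    by (intro binned_L2_le1 count_level_le) (use fin pos in auto)
   show "card {\<tau> \<in> S1 \<times> ?A \<times> ?B. out \<tau> = n} <= C\<^sup>2 * 2 powr (d * (real m + real l))" for n
    by (rule card_prod_le[where p = "\<lambda>(a, b, c). (b, c)" and A = ?A and B = ?B])
     (auto simp: inj_on_def out_def)
   show "(\<Sum>\<tau>\<in>S1 \<times> ?A \<times> ?B. (?F \<tau>)\<^sup>2) <= (L2_set f S1 * L2_set g ?A * L2_set h ?B)\<^sup>2"
    by (rule eq_refl, rule sum_product3_squares)
  qed (use fin F in auto)
 qed
 also have "... <= C2 * (L2_set f S1 * L2_set (\<lambda>n. jb n powr s * g n) S2 * L2_set (\<lambda>n. jb n powr s * h n) S3)"
  by (rule dyadic_sum_le) (use fin in auto)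
 finally show ?thesis .
qed

lemma Phi_le2:
 assumes fin: "finite J" "finite R" "finite S1" "finite S2" "finite S3"
  and pos: "\<And>n. f n >= 0" "\<And>n. g n >= 0" "\<And>n. h n >= 0"
 shows "\<Phi> J R \<nu> (S1 \<times> S2 \<times> S3) (\<lambda>(n1, n2, n3). f n1 * g n2 * h n3) <=
  C2 * (L2_set (\<lambda>n. jb n powr s * f n) S1 * L2_set g S2 * L2_set (\<lambda>n. jb n powr s * h n) S3)"
proof -
 let ?F = "\<lambda>(n1, n2, n3). f n1 * g n2 * h n3"
 let ?\<kappa> = "\<lambda>(n1, n2, n3). (lev n1, lev n3)"
 have F: "?F \<tau> >= 0" for \<tau> using pos by (auto simp: split_beta)
 have "\<Phi> J R \<nu> (S1 \<times> S2 \<times> S3) ?F <= (\<Sum>k\<in>lev ` S1 \<times> lev ` S3. \<Phi> J R \<nu> {\<tau> \<in> S1 \<times> S2 \<times> S3. ?\<kappa> \<tau> = k} ?F)"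
  by (rule Phi_split) (use fin F in auto)
 also have "... <= (\<Sum>(m, l)\<in>lev ` S1 \<times> lev ` S3. C1 * 2 powr ((\<sigma> + \<eta>) * (real m + real l)) *
   (L2_set g S2 * L2_set f {n \<in> S1. lev n = m} * L2_set h {n \<in> S3. lev n = l}))"
 proof (intro sum_mono, clarify)
  fix m l
  let ?A = "{n \<in> S1. lev n = m}" and ?B = "{n \<in> S3. lev n = l}"
  have *: "{\<tau> \<in> S1 \<times> S2 \<times> S3. ?\<kappa> \<tau> = (m, l)} = ?A \<times> S2 \<times> ?B" by auto
  have c: "L2_set g S2 * L2_set f ?A * L2_set h ?B = L2_set f ?A * L2_set g S2 * L2_set h ?B"
   by simp
  show "\<Phi> J R \<nu> {\<tau> \<in> S1 \<times> S2 \<times> S3. ?\<kappa> \<tau> = (m, l)} ?F <= C1 * 2 powr ((\<sigma> + \<eta>) * (real m + real l)) *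
   (L2_set g S2 * L2_set f ?A * L2_set h ?B)" unfolding * c
  proof (rule Phi_box_le)
   show "L2_set (binned Q (?A \<times> S2 \<times> ?B) ?F \<nu> j) R <= 2 * (C * 2 powr (\<sigma> * (real m + real l))) * (L2_set f ?A * L2_set g S2 * L2_set h ?B)" for j
    unfolding sqrt_counts[symmetric]
    by (intro binned_L2_le2 count_level_le) (use fin pos in auto)
   show "card {\<tau> \<in> ?A \<times> S2 \<times> ?B. out \<tau> = n} <= C\<^sup>2 * 2 powr (d * (real m + real l))" for n
    by (rule card_prod_le[where p = "\<lambda>(a, b, c). (a, c)" and A = ?A and B = ?B])
     (auto simp: inj_on_def out_def)
   show "(\<Sum>\<tau>\<in>?A \<times> S2 \<times> ?B. (?F \<tau>)\<^sup>2) <= (L2_set f ?A * L2_set g S2 * L2_set h ?B)\<^sup>2"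
    by (rule eq_refl, rule sum_product3_squares)
  qed (use fin F in auto)
 qed
 also have "... <= C2 * (L2_set g S2 * L2_set (\<lambda>n. jb n powr s * f n) S1 * L2_set (\<lambda>n. jb n powr s * h n) S3)"
  by (rule dyadic_sum_le) (use fin in auto)
 finally show ?thesis by (simp add: mult_ac)
qed

lemma Phi_le3:
 assumes fin: "finite J" "finite R" "finite S1" "finite S2" "finite S3"
  and pos: "\<And>n. f n >= 0" "\<And>n. g n >= 0" "\<And>n. h n >= 0"
 shows "\<Phi> J R \<nu> (S1 \<times> S2 \<times> S3) (\<lambda>(n1, n2, n3). f n1 * g n2 * h n3) <=
  C2 * (L2_set (\<lambda>n. jb n powr s * f n) S1 * L2_set (\<lambda>n. jb n powr s * g n) S2 * L2_set h S3)"
proof -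
 have "\<Phi> J R \<nu> (S1 \<times> S2 \<times> S3) (\<lambda>(n1, n2, n3). f n1 * g n2 * h n3) =
  \<Phi> J R \<nu> (S3 \<times> S2 \<times> S1) (\<lambda>(n1, n2, n3). h n1 * g n2 * f n3)"
 proof -
  have "binned3 Q S1 S2 S3 f g h \<nu> j =
   binned Q (S3 \<times> S2 \<times> S1) (\<lambda>(n1, n2, n3). h n1 * g n2 * f n3) \<nu> j" for j
   by (rule ext) (rule binned_swap)
  then show ?thesis by (simp add: \<Phi>_def)
 qed
 then show ?thesis using Phi_le1[of J R S3 S2 S1 h g f \<nu>] assms by (simp add: mult_ac)
qed

definition "C3 = 3 * 3 powr s * C2"

lemma C3_pos: "C3 > 0" using C2_pos by (simp add: C3_def)

text \<open>A Leibniz rule: the \<open>s\<close> derivatives of the output fall on the largest of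
  the three frequencies, and the estimate that leaves this factor unweighted is applied to it. The
  extra weight \<open>w\<close> distributes over all factors with constant 1, so \<open>C3\<close>
  does not depend on \<open>w\<close>.\<close>

theorem weighted_trilinear:
 fixes w :: "'a => real"
 assumes fin: "finite J" "finite R" "finite S"
  and pos: "\<And>n. f n >= 0" "\<And>n. g n >= 0" "\<And>n. h n >= 0"
  and w: "\<And>n. w n > 0" "\<And>n1 n2 n3. w (n1 - n2 + n3) <= w n1 * w n2 * w n3"
 defines "W \<equiv> (\<lambda>n. jb n powr s * w n)"
 shows "(\<Sum>j\<in>J. \<rho> j * L2_set (\<lambda>n. W n * binned Q (S \<times> S \<times> S) (\<lambda>(n1, n2, n3). f n1 * g n2 * h n3) \<nu> j n) R) <=
  C3 * (L2_set (\<lambda>n. W n * f n) S * L2_set (\<lambda>n. W n * g n) S * L2_set (\<lambda>n. W n * h n) S)"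
proof -
 have s: "s > 0" using \<sigma>_ge \<sigma>_less by simp
 have W: "W n >= 0" for n using w(1)[of n] by (simp add: W_def)
 have w0: "w n >= 0" for n using w(1)[of n] by simp
 let ?F = "\<lambda>(n1, n2, n3). f n1 * g n2 * h n3"
 let ?F1 = "\<lambda>(n1, n2, n3). W n1 * f n1 * (w n2 * g n2) * (w n3 * h n3)"
 let ?F2 = "\<lambda>(n1, n2, n3). w n1 * f n1 * (W n2 * g n2) * (w n3 * h n3)"
 let ?F3 = "\<lambda>(n1, n2, n3). w n1 * f n1 * (w n2 * g n2) * (W n3 * h n3)"
 let ?b = "\<lambda>F. binned Q (S \<times> S \<times> S) F \<nu>"
 let ?N = "L2_set (\<lambda>n. W n * f n) S * L2_set (\<lambda>n. W n * g n) S * L2_set (\<lambda>n. W n * h n) S"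
 \<comment> \<open>\<open>jb\<close> of the output is at most three times the largest
   \<open>jb\<close>, and the power of the largest is bounded by the sum of all three
   powers.\<close>
 have W_out: "W (n1 - n2 + n3) <= 3 powr s * (W n1 * w n2 * w n3 + w n1 * W n2 * w n3 + w n1 * w n2 * W n3)" for n1 n2 n3
 proof -
  define M where "M = max (jb n1) (max (jb n2) (jb n3))"
  have M: "jb n1 <= M" "jb n2 <= M" "jb n3 <= M" "M = jb n1 \<or> M = jb n2 \<or> M = jb n3"
   by (auto simp: M_def max_def)
  have "jb (n1 - n2 + n3) powr s <= (3 * M) powr s"
   using jb_out[of n1 n2 n3] M s jb_ge_1[of "n1 - n2 + n3"] by (intro powr_mono2) auto
  also have "... = 3 powr s * M powr s" using M jb_ge_1[of n1] by (simp add: powr_mult)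
  also have "... <= 3 powr s * (jb n1 powr s + jb n2 powr s + jb n3 powr s)"
   using M by (intro mult_left_mono) auto
  finally have "W (n1 - n2 + n3) <= 3 powr s * (jb n1 powr s + jb n2 powr s + jb n3 powr s) * (w n1 * w n2 * w n3)"
   unfolding W_def using w(2)[of n1 n2 n3] w0 by (intro mult_mono) auto
  also have "... = 3 powr s * (W n1 * w n2 * w n3 + w n1 * W n2 * w n3 + w n1 * w n2 * W n3)"
   unfolding W_def by (simp add: algebra_simps)
  finally show ?thesis .
 qed
 have le: "W n * ?b ?F j n <= 3 powr s * (?b ?F1 j n + ?b ?F2 j n + ?b ?F3 j n)" for j n
 proof -
  have "W n * (if out \<tau> = n \<and> \<lfloor>res Q \<tau> + \<nu>\<rfloor> = j then ?F \<tau> else 0) <=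
   3 powr s * ((if out \<tau> = n \<and> \<lfloor>res Q \<tau> + \<nu>\<rfloor> = j then ?F1 \<tau> else 0) +
   (if out \<tau> = n \<and> \<lfloor>res Q \<tau> + \<nu>\<rfloor> = j then ?F2 \<tau> else 0) +
   (if out \<tau> = n \<and> \<lfloor>res Q \<tau> + \<nu>\<rfloor> = j then ?F3 \<tau> else 0))" for \<tau>
  proof (cases "out \<tau> = n \<and> \<lfloor>res Q \<tau> + \<nu>\<rfloor> = j")
   case True
   obtain n1 n2 n3 where t: "\<tau> = (n1, n2, n3)" by (cases \<tau>) auto
   have "W n * (f n1 * g n2 * h n3) <= 3 powr s * (W n1 * w n2 * w n3 + w n1 * W n2 * w n3 + w n1 * w n2 * W n3) * (f n1 * g n2 * h n3)"
    using W_out[of n1 n2 n3] True pos by (intro mult_right_mono) (auto simp: t out_def)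
   then show ?thesis using True by (simp add: t algebra_simps)
  qed auto
  then show ?thesis
   unfolding binned_def sum_distrib_left sum.distrib[symmetric] by (intro sum_mono)
 qed
 have b0: "?b ?F j n >= 0" for j n by (rule binned_nonneg) (use pos in \<open>auto simp: split_beta\<close>)
 have "(\<Sum>j\<in>J. \<rho> j * L2_set (\<lambda>n. W n * ?b ?F j n) R) <=
  (\<Sum>j\<in>J. \<rho> j * (3 powr s * (L2_set (?b ?F1 j) R + L2_set (?b ?F2 j) R + L2_set (?b ?F3 j) R)))"
 proof (intro sum_mono mult_left_mono rho_nonneg)
  fix j
  have "L2_set (\<lambda>n. W n * ?b ?F j n) R <= L2_set (\<lambda>n. 3 powr s * (?b ?F1 j n + ?b ?F2 j n + ?b ?F3 j n)) R"
   using le b0 W by (intro L2_set_mono) auto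
  also have "... = 3 powr s * L2_set (\<lambda>n. ?b ?F1 j n + ?b ?F2 j n + ?b ?F3 j n) R"
   by (rule L2_set_mult_const) simp
  also have "... <= 3 powr s * (L2_set (?b ?F1 j) R + L2_set (?b ?F2 j) R + L2_set (?b ?F3 j) R)"
   using L2_set_triangle_ineq[of "\<lambda>n. ?b ?F1 j n + ?b ?F2 j n" "?b ?F3 j" R]
    L2_set_triangle_ineq[of "?b ?F1 j" "?b ?F2 j" R]
   by (intro mult_left_mono) auto
  finally show "L2_set (\<lambda>n. W n * ?b ?F j n) R <= 3 powr s * (L2_set (?b ?F1 j) R + L2_set (?b ?F2 j) R + L2_set (?b ?F3 j) R)" .
 qed
 also have "... = 3 powr s * (\<Phi> J R \<nu> (S\<times>S\<times>S) ?F1 + \<Phi> J R \<nu> (S\<times>S\<times>S) ?F2 + \<Phi> J R \<nu> (S\<times>S\<times>S) ?F3)"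
  unfolding \<Phi>_def by (simp add: sum_distrib_left sum.distrib algebra_simps)
 also have "... <= 3 powr s * (C2 * ?N + C2 * ?N + C2 * ?N)"
 proof (intro mult_left_mono add_mono)
  have fw: "(\<lambda>n. jb n powr s * (w n * F n)) = (\<lambda>n. W n * F n)" for F :: "'a => real"
   by (simp add: W_def mult.assoc)
  show "\<Phi> J R \<nu> (S\<times>S\<times>S) ?F1 <= C2 * ?N"
   using Phi_le1[OF fin(1,2) fin(3) fin(3) fin(3), of "\<lambda>n. W n * f n" "\<lambda>n. w n * g n" "\<lambda>n. w n * h n" \<nu>] W w0 pos
   by (simp add: fw)
  show "\<Phi> J R \<nu> (S\<times>S\<times>S) ?F2 <= C2 * ?N"
   using Phi_le2[OF fin(1,2) fin(3) fin(3) fin(3), of "\<lambda>n. w n * f n" "\<lambda>n. W n * g n" "\<lambda>n. w n * h n" \<nu>] W w0 pos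
   by (simp add: fw)
  show "\<Phi> J R \<nu> (S\<times>S\<times>S) ?F3 <= C2 * ?N"
   using Phi_le3[OF fin(1,2) fin(3) fin(3) fin(3), of "\<lambda>n. w n * f n" "\<lambda>n. w n * g n" "\<lambda>n. W n * h n" \<nu>] W w0 pos
   by (simp add: fw)
 qed auto
 also have "... = C3 * ?N" by (simp add: C3_def)
 finally show ?thesis .
qed

end

section \<open>Lattice points in thin ellipsoidal shells\<close>

lemma card_multiples_le:
 fixes a A L :: int
 assumes "a \<noteq> 0" "L >= 0"
 shows "card {w \<in> {A - L..A + L}. a dvd w} <= 2 * real_of_int L / \<bar>a\<bar> + 1"
proof -
 define k where "k = \<bar>a\<bar>"
 have k: "k > 0" using assms by (simp add: k_def)
 have "{w \<in> {A - L..A + L}. a dvd w} \<subseteq> (\<lambda>h. k * h) ` {\<lceil>(A - L) / k\<rceil>..\<lfloor>(A + L) / k\<rfloor>}"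
 proof
  fix w assume "w \<in> {w \<in> {A - L..A + L}. a dvd w}"
  then have w: "A - L <= w" "w <= A + L" "k dvd w" by (auto simp: k_def)
  then obtain h where h: "w = k * h" by (auto simp: dvd_def)
  have "real_of_int (A - L) <= real_of_int (k * h)" "real_of_int (k * h) <= real_of_int (A + L)"
   using w h by linarith+
  then have "real_of_int (A - L) / k <= h" "h <= real_of_int (A + L) / k"
   using k by (simp_all add: field_simps)
  then have "h \<in> {\<lceil>(A - L) / k\<rceil>..\<lfloor>(A + L) / k\<rfloor>}"
   by (simp add: ceiling_le_iff le_floor_iff)
  then show "w \<in> (\<lambda>h. k * h) ` {\<lceil>(A - L) / k\<rceil>..\<lfloor>(A + L) / k\<rfloor>}" using h by blast
 qed
 then have "card {w \<in> {A - L..A + L}. a dvd w} <= card {\<lceil>(A - L) / k\<rceil>..\<lfloor>(A + L) / k\<rfloor>}"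
  by (meson card_image_le card_mono finite_atLeastAtMost_int finite_imageI le_trans)
 also have "real ... <= 2 * real_of_int L / k + 1"
 proof -
  have "real_of_int \<lfloor>(A + L) / k\<rfloor> - real_of_int \<lceil>(A - L) / k\<rceil> <= (A + L) / k - (A - L) / k"
   by (intro diff_mono) (auto intro: of_int_floor_le le_of_int_ceiling)
  also have "... = 2 * real_of_int L / k" by (simp add: diff_divide_distrib[symmetric])
  finally have "real_of_int (\<lfloor>(A + L) / k\<rfloor> - \<lceil>(A - L) / k\<rceil> + 1) <= 2 * real_of_int L / k + 1" by simp
  moreover have "2 * real_of_int L / k + 1 >= 0" using k assms by simp
  ultimately show ?thesis by (simp add: nat_le_iff)
 qed
 finally show ?thesis by (simp add: k_def)
qed

lemma card_multiples_nat_le: "card {z \<in> {1..x}. d dvd z} <= x div (d::nat)"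
proof (cases "d = 0")
 case True
 have "{z \<in> {1..x}. d dvd z} = {}" using True by auto
 then show ?thesis by (simp only: card.empty)
next
 case False
 have "{z \<in> {1..x}. d dvd z} \<subseteq> (\<lambda>k. d * k) ` {1..x div d}"
 proof
  fix z assume z: "z \<in> {z \<in> {1..x}. d dvd z}"
  then obtain k where k: "z = d * k" by (auto simp: dvd_def)
  have "k >= 1" using z k by (cases k) auto
  moreover have "k <= x div d" using z k False by (simp add: less_eq_div_iff_mult_less_eq mult.commute)
  ultimately show "z \<in> (\<lambda>k. d * k) ` {1..x div d}" using k by auto
 qed
 then have "card {z \<in> {1..x}. d dvd z} <= card ((\<lambda>k. d * k) ` {1..x div d})"
  by (intro card_mono) auto
 also have "... <= x div d" using card_image_le[of "{1..x div d}" "\<lambda>k. d * k"] by simp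
 finally show ?thesis .
qed

text \<open>Each gcd is one of the divisors of \<open>x\<close> that also divide \<open>z\<close>,
  so it is bounded by their sum. After swapping the sums, a divisor \<open>d\<close> meets
  \<open>x div d\<close> values of \<open>z\<close> and contributes at most
  \<open>x\<close>.\<close>

lemma sum_gcd_le: "(\<Sum>z=1..x. gcd x z) <= x * card {d \<in> {1..x}. d dvd (x::nat)}"
proof -
 have "(\<Sum>z=1..x. gcd x z) <= (\<Sum>z=1..x. \<Sum>d\<in>{d \<in> {1..x}. d dvd x}. if d dvd z then d else 0)"
 proof (rule sum_mono)
  fix z assume z: "z \<in> {1..x}"
  have m: "gcd x z \<in> {d \<in> {1..x}. d dvd x}" using z
   by (auto simp: Suc_le_eq intro: gcd_le1_nat)
  have "gcd x z = (if gcd x z dvd z then gcd x z else 0)" by simp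
  also have "... <= (\<Sum>d\<in>{d \<in> {1..x}. d dvd x}. if d dvd z then d else 0)"
   by (rule member_le_sum[OF m]) auto
  finally show "gcd x z <= (\<Sum>d\<in>{d \<in> {1..x}. d dvd x}. if d dvd z then d else 0)" .
 qed
 also have "... = (\<Sum>d\<in>{d \<in> {1..x}. d dvd x}. \<Sum>z=1..x. if d dvd z then d else 0)"
  by (rule sum.swap)
 also have "... <= (\<Sum>d\<in>{d \<in> {1..x}. d dvd x}. x)"
 proof (rule sum_mono)
  fix d
  have "(\<Sum>z=1..x. if d dvd z then d else 0) = d * card {z \<in> {1..x}. d dvd z}"
   by (simp add: sum.inter_filter[symmetric])
  also have "... <= d * (x div d)" by (intro mult_left_mono card_multiples_nat_le) auto
  also have "... <= x" by simp
  finally show "(\<Sum>z=1..x. if d dvd z then d else 0) <= x" .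
 qed
 finally show ?thesis by (simp add: mult.commute)
qed

lemma sum_card_divisors_le: "(\<Sum>x=1..L. real (card {d \<in> {1..x}. d dvd (x::nat)})) <= L * harm L"
proof -
 have "(\<Sum>x=1..L. card {d \<in> {1..x}. d dvd x}) <= (\<Sum>x=1..L. \<Sum>d=1..L. if d dvd x then 1 else 0)"
 proof (rule sum_mono)
  fix x assume "x \<in> {1..L}"
  then have "card {d \<in> {1..x}. d dvd x} <= card {d \<in> {1..L}. d dvd x}"
   by (intro card_mono) auto
  then show "card {d \<in> {1..x}. d dvd x} <= (\<Sum>d=1..L. if d dvd x then 1 else 0)"
   by (simp add: sum.inter_filter[symmetric])
 qed
 also have "... = (\<Sum>d=1..L. \<Sum>x=1..L. if d dvd x then 1 else 0)" by (rule sum.swap)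
 also have "... = (\<Sum>d=1..L. card {x \<in> {1..L}. d dvd x})" by (simp add: sum.inter_filter[symmetric])
 also have "... <= (\<Sum>d=1..L. L div d)" by (intro sum_mono card_multiples_nat_le)
 finally have "real (\<Sum>x=1..L. card {d \<in> {1..x}. d dvd x}) <= real (\<Sum>d=1..L. L div d)"
  by (simp only: of_nat_le_iff)
 also have "... <= (\<Sum>d=1..L. real L / real d)"
  by (simp, intro sum_mono of_nat_div_le_of_nat)
 also have "... = L * harm L"
  by (simp add: harm_def sum_distrib_left divide_inverse)
 finally show ?thesis by simp
qed

text \<open>By symmetry \<open>z <= x\<close>; dividing \<open>sum_gcd_le\<close> by
  \<open>x\<close> then leaves the divisor count of \<open>x\<close>, whose average is
  harmonic.\<close>

lemma sum_gcd_over_max_le: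
 "(\<Sum>x=1..L. \<Sum>z=1..L. real (gcd x z) / real (max x z)) <= 2 * (real L * harm L)"
proof -
 let ?f = "\<lambda>x z. real (gcd x z) / real (max x z)"
 have "(\<Sum>x=1..L. \<Sum>z=1..L. ?f x z) <=
  (\<Sum>x=1..L. \<Sum>z=1..L. (if z <= x then ?f x z else 0) + (if x <= z then ?f x z else 0))"
  by (intro sum_mono) auto
 also have "... = (\<Sum>x=1..L. \<Sum>z=1..L. if z <= x then ?f x z else 0) + (\<Sum>x=1..L. \<Sum>z=1..L. if x <= z then ?f x z else 0)"
  by (simp add: sum.distrib)
 also have "(\<Sum>x=1..L. \<Sum>z=1..L. if x <= z then ?f x z else 0) = (\<Sum>x=1..L. \<Sum>z=1..L. if z <= x then ?f x z else 0)"
  by (subst sum.swap) (simp add: gcd.commute max.commute cong: if_cong)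
 finally have 1: "(\<Sum>x=1..L. \<Sum>z=1..L. ?f x z) <= 2 * (\<Sum>x=1..L. \<Sum>z=1..L. if z <= x then ?f x z else 0)" by simp
 have "(\<Sum>x=1..L. \<Sum>z=1..L. if z <= x then ?f x z else 0) <= (\<Sum>x=1..L. real (card {d \<in> {1..x}. d dvd x}))"
 proof (rule sum_mono)
  fix x assume x: "x \<in> {1..L}"
  have "(\<Sum>z=1..L. if z <= x then ?f x z else 0) = (\<Sum>z\<in>{z\<in>{1..L}. z <= x}. ?f x z)"
   by (rule sum.inter_filter[symmetric]) simp
  also have "{z\<in>{1..L}. z <= x} = {1..x}" using x by auto
  also have "(\<Sum>z=1..x. ?f x z) = real (\<Sum>z=1..x. gcd x z) / x"
   unfolding of_nat_sum sum_divide_distrib by (intro sum.cong) (auto simp: max_def)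
  also have "... <= real (x * card {d \<in> {1..x}. d dvd x}) / x"
   by (intro divide_right_mono of_nat_mono sum_gcd_le) auto
  also have "... = real (card {d \<in> {1..x}. d dvd x})" using x by simp
  finally show "(\<Sum>z=1..L. if z <= x then ?f x z else 0) <= real (card {d \<in> {1..x}. d dvd x})" .
 qed
 then show ?thesis using 1 sum_card_divisors_le[of L] by linarith
qed

lemma sum_nonzero_int:
 fixes \<phi> :: "nat => real"
 shows "(\<Sum>x\<in>{- int L..int L} - {0}. \<phi> (nat \<bar>x\<bar>)) = 2 * (\<Sum>x=1..L. \<phi> x)"
proof -
 have "{- int L..int L} - {0} = int ` {1..L} \<union> (\<lambda>n. - int n) ` {1..L}"
 proof (intro equalityI subsetI)
  fix x assume x: "x \<in> {- int L..int L} - {0}"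
  show "x \<in> int ` {1..L} \<union> (\<lambda>n. - int n) ` {1..L}"
  proof (cases "x > 0")
   case True
   then have "x = int (nat x)" "nat x \<in> {1..L}" using x by auto
   then show ?thesis by blast
  next
   case False
   then have "x = - int (nat (-x))" "nat (-x) \<in> {1..L}" using x by auto
   then show ?thesis by blast
  qed
 qed auto
 then have "(\<Sum>x\<in>{- int L..int L} - {0}. \<phi> (nat \<bar>x\<bar>)) =
  (\<Sum>x\<in>int ` {1..L}. \<phi> (nat \<bar>x\<bar>)) + (\<Sum>x\<in>(\<lambda>n. - int n) ` {1..L}. \<phi> (nat \<bar>x\<bar>))"
  by (simp only:) (rule sum.union_disjoint, auto)
 also have "(\<Sum>x\<in>int ` {1..L}. \<phi> (nat \<bar>x\<bar>)) = (\<Sum>x=1..L. \<phi> x)"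
  by (subst sum.reindex) (auto simp: inj_on_def)
 also have "(\<Sum>x\<in>(\<lambda>n. - int n) ` {1..L}. \<phi> (nat \<bar>x\<bar>)) = (\<Sum>x=1..L. \<phi> x)"
  by (subst sum.reindex) (auto simp: inj_on_def)
 finally show ?thesis by simp
qed

text \<open>For fixed nonzero \<open>X\<close>, \<open>Z\<close> the solutions \<open>(Y, W)\<close> are the multiples of a primitive vector.\<close>

lemma card_mult_fibre_le:
 fixes X Z A :: int
 assumes "X \<noteq> 0" "Z \<noteq> 0"
 shows "card {(Y, W). Y \<in> {A - int L..A + int L} \<and> W \<in> {A - int L..A + int L} \<and> X * Y = Z * W} <=
  2 * real L * (real (gcd (nat \<bar>X\<bar>) (nat \<bar>Z\<bar>)) / real (max (nat \<bar>X\<bar>) (nat \<bar>Z\<bar>))) + 1"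
proof -
 define g where "g = gcd X Z"
 define a b where "a = X div g" and "b = Z div g"
 have g: "g > 0" using assms by (simp add: g_def)
 have ab: "X = g * a" "Z = g * b" "coprime a b"
  unfolding a_def b_def g_def using assms by (auto intro: div_gcd_coprime)
 have ab0: "a \<noteq> 0" "b \<noteq> 0" using ab assms by auto
 let ?J = "{A - int L..A + int L}"
 let ?S = "{(Y, W). Y \<in> ?J \<and> W \<in> ?J \<and> X * Y = Z * W}"
 have eq: "a * Y = b * W" if "X * Y = Z * W" for Y W
  using that g unfolding ab(1,2) by (simp add: mult.assoc)
 have "inj_on snd ?S" using assms by (auto simp: inj_on_def) (metis mult_cancel_left)
 moreover have "snd ` ?S \<subseteq> {w \<in> ?J. a dvd w}"
 proof
  fix w assume "w \<in> snd ` ?S"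
  then obtain Y W where YW: "Y \<in> ?J" "W \<in> ?J" "X * Y = Z * W" "w = W"
   by (auto simp del: atLeastAtMost_iff)
  have "a dvd b * W" using eq[OF YW(3)] by (metis dvd_triv_left)
  then have "a dvd W" using ab(3) by (simp add: coprime_dvd_mult_right_iff)
  then show "w \<in> {w \<in> ?J. a dvd w}" using YW by auto
 qed
 ultimately have "card ?S <= card {w \<in> ?J. a dvd w}"
  by (rule card_inj_on_le) (rule finite_subset[of _ ?J], auto)
 then have 1: "real (card ?S) <= 2 * real L / \<bar>a\<bar> + 1"
  using card_multiples_le[OF ab0(1), of "int L" A] by simp
 \<comment> \<open>The other projection gives the same bound with \<open>b\<close> in place of
   \<open>a\<close>. The better of the two has the maximum of \<open>\<bar>X\<bar>\<close> and
   \<open>\<bar>Z\<bar>\<close> in the denominator.\<close>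
 have "inj_on fst ?S" using assms by (auto simp: inj_on_def)
 moreover have "fst ` ?S \<subseteq> {w \<in> ?J. b dvd w}"
 proof
  fix w assume "w \<in> fst ` ?S"
  then obtain Y W where YW: "Y \<in> ?J" "W \<in> ?J" "X * Y = Z * W" "w = Y" by auto
  have "b dvd a * Y" using eq[OF YW(3)] by (metis dvd_triv_left)
  then have "b dvd Y" using ab(3) by (simp add: coprime_commute coprime_dvd_mult_right_iff)
  then show "w \<in> {w \<in> ?J. b dvd w}" using YW by auto
 qed
 ultimately have "card ?S <= card {w \<in> ?J. b dvd w}"
  by (rule card_inj_on_le) (rule finite_subset[of _ ?J], auto)
 then have 2: "real (card ?S) <= 2 * real L / \<bar>b\<bar> + 1"
  using card_multiples_le[OF ab0(2), of "int L" A] by simp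
 have gg: "int (gcd (nat \<bar>X\<bar>) (nat \<bar>Z\<bar>)) = g" by (simp add: g_def)
 then have gr: "real (gcd (nat \<bar>X\<bar>) (nat \<bar>Z\<bar>)) = real_of_int g" by linarith
 have "1 / real_of_int \<bar>a\<bar> = g / real (nat \<bar>X\<bar>)" "1 / real_of_int \<bar>b\<bar> = g / real (nat \<bar>Z\<bar>)"
  using g ab0 by (simp_all add: ab(1,2) abs_mult)
 then show ?thesis
  using 1 2 unfolding gr by (auto simp: max_def divide_inverse)
qed

text \<open>The solutions with \<open>X = 0\<close> or \<open>Z = 0\<close> number O(L^2); the
  others bring the logarithm through \<open>sum_gcd_over_max_le\<close>. Only \<open>Y\<close> and
  \<open>W\<close> see the centre \<open>A\<close>: in the application they are sums of two
  coordinates while \<open>X\<close> and \<open>Z\<close> are differences, so the bound does not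
  depend on where the box lies.\<close>

lemma card_mult_eq_le:
 fixes A :: int and L :: nat
 assumes L: "L >= 1"
 shows "card {(X, Z, Y, W). X \<in> {- int L..int L} \<and> Z \<in> {- int L..int L} \<and>
   Y \<in> {A - int L..A + int L} \<and> W \<in> {A - int L..A + int L} \<and> X * Y = Z * W} <=
  47 * (real L)\<^sup>2 * (1 + ln L)"
proof -
 let ?I = "{- int L..int L}" and ?J = "{A - int L..A + int L}"
 let ?fib = "\<lambda>(X, Z). {(Y, W). Y \<in> ?J \<and> W \<in> ?J \<and> X * Y = Z * W}"
 let ?T = "{(X, Z, Y, W). X \<in> ?I \<and> Z \<in> ?I \<and> Y \<in> ?J \<and> W \<in> ?J \<and> X * Y = Z * W}"
 have fin: "finite (?fib p)" for p
  by (rule finite_subset[of _ "?J \<times> ?J"]) (auto split: prod.splits)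
 have cJ: "card ?J = 2 * L + 1" "card ?I = 2 * L + 1" by auto
 have "card ?T = card (Sigma (?I \<times> ?I) ?fib)"
  by (rule bij_betw_same_card[of "\<lambda>(X, Z, Y, W). ((X, Z), (Y, W))"])
   (auto simp: bij_betw_def inj_on_def image_iff)
 also have "... = (\<Sum>p\<in>?I \<times> ?I. card (?fib p))"
  using fin by (subst card_SigmaI) auto
 finally have T: "real (card ?T) = (\<Sum>p\<in>?I \<times> ?I. real (card (?fib p)))" by simp
 define F where "F X Z = 2 * real L * (real (gcd (nat \<bar>X\<bar>) (nat \<bar>Z\<bar>)) / real (max (nat \<bar>X\<bar>) (nat \<bar>Z\<bar>))) + 1" for X Z :: int
 define c where "c p = real (card (?fib p))" for p
 have c00: "c (0, 0) <= (2 * real L + 1)\<^sup>2"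
 proof -
  have "card (?fib (0, 0)) <= card (?J \<times> ?J)" by (intro card_mono) auto
  also have "... = (2 * L + 1)\<^sup>2" by (simp only: card_cartesian_product power2_eq_square cJ)
  finally have "real (card (?fib (0, 0))) <= real ((2 * L + 1)\<^sup>2)" by (simp only: of_nat_le_iff)
  then show ?thesis unfolding c_def by (simp add: algebra_simps)
 qed
 have c0: "c (0, Z) <= 2 * real L + 1" if "Z \<noteq> 0" for Z
 proof -
  have "card (?fib (0, Z)) <= card (?J \<times> {0::int})" using that by (intro card_mono) auto
  also have "... = 2 * L + 1" by (simp add: card_cartesian_product cJ)
  finally have "real (card (?fib (0, Z))) <= real (2 * L + 1)" by (simp only: of_nat_le_iff)
  then show ?thesis unfolding c_def by simp
 qed
 have c1: "c (X, 0) <= 2 * real L + 1" if "X \<noteq> 0" for X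
 proof -
  have "card (?fib (X, 0)) <= card ({0::int} \<times> ?J)" using that by (intro card_mono) auto
  also have "... = 2 * L + 1" by (simp add: card_cartesian_product cJ)
  finally have "real (card (?fib (X, 0))) <= real (2 * L + 1)" by (simp only: of_nat_le_iff)
  then show ?thesis unfolding c_def by simp
 qed
 have c2: "c (X, Z) <= F X Z" if "X \<noteq> 0" "Z \<noteq> 0" for X Z
  using card_mult_fibre_le[OF that, of A L] unfolding c_def F_def prod.case .
 have "real (card ?T) = (\<Sum>p\<in>?I \<times> ?I. c p)" unfolding T c_def ..
 also have "... <= (\<Sum>p\<in>?I \<times> ?I. (if p = (0, 0) then (2 * real L + 1)\<^sup>2 else 0) +
   ((if fst p = 0 then 2 * real L + 1 else 0) + ((if snd p = 0 then 2 * real L + 1 else 0) +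
   (if fst p \<noteq> 0 \<and> snd p \<noteq> 0 then F (fst p) (snd p) else 0))))"
 proof (rule sum_mono)
  fix p :: "int \<times> int"
  obtain X Z where p: "p = (X, Z)" by (cases p)
  show "c p <= (if p = (0, 0) then (2 * real L + 1)\<^sup>2 else 0) +
   ((if fst p = 0 then 2 * real L + 1 else 0) + ((if snd p = 0 then 2 * real L + 1 else 0) +
   (if fst p \<noteq> 0 \<and> snd p \<noteq> 0 then F (fst p) (snd p) else 0)))"
   using c00 c0[of Z] c1[of X] c2[of X Z] unfolding p by (cases "X = 0"; cases "Z = 0") auto
 qed
 also have "... = (2 * real L + 1)\<^sup>2 + (2 * real L + 1) * (2 * real L + 1) + (2 * real L + 1) * (2 * real L + 1) +
   (\<Sum>X\<in>?I - {0}. \<Sum>Z\<in>?I - {0}. F X Z)"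
 proof -
  have 0: "(0::int, 0::int) \<in> ?I \<times> ?I" by simp
  have p0: "(\<Sum>p\<in>?I \<times> ?I. if p = (0, 0) then (2 * real L + 1)\<^sup>2 else 0) = (2 * real L + 1)\<^sup>2"
   by (subst sum.delta) auto
  have p1: "(\<Sum>p\<in>?I \<times> ?I. if fst p = 0 then 2 * real L + 1 else 0) = (2 * real L + 1) * (2 * real L + 1)"
   by (simp add: sum.cartesian_product' if_distrib[of "times _"] cong: if_cong)
  have p2: "(\<Sum>p\<in>?I \<times> ?I. if snd p = 0 then 2 * real L + 1 else 0) = (2 * real L + 1) * (2 * real L + 1)"
   by (simp add: sum.cartesian_product' sum.delta)
  have p3: "(\<Sum>p\<in>?I \<times> ?I. if fst p \<noteq> 0 \<and> snd p \<noteq> 0 then F (fst p) (snd p) else 0) =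
   (\<Sum>X\<in>?I - {0}. \<Sum>Z\<in>?I - {0}. F X Z)" for F :: "int => int => real"
  proof -
   have "(\<Sum>p\<in>?I \<times> ?I. if fst p \<noteq> 0 \<and> snd p \<noteq> 0 then F (fst p) (snd p) else 0) =
    (\<Sum>p\<in>(?I - {0}) \<times> (?I - {0}). F (fst p) (snd p))"
    by (rule sum.mono_neutral_cong_right) auto
   then show ?thesis by (simp add: sum.cartesian_product')
  qed
  have p3': "(\<Sum>p\<in>?I \<times> ?I. if fst p \<noteq> 0 \<and> snd p \<noteq> 0 then
    F (fst p) (snd p) else 0) =
   (\<Sum>X\<in>?I - {0}. \<Sum>Z\<in>?I - {0}. F X Z)"
   by (rule p3)
  show ?thesis by (subst sum.distrib, subst sum.distrib, subst sum.distrib) (simp only: p0 p1 p2 p3' add.assoc)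
 qed
 also have "(\<Sum>X\<in>?I - {0}. \<Sum>Z\<in>?I - {0}. F X Z)
  = 2 * (\<Sum>x=1..L. 2 * (\<Sum>z=1..L. 2 * real L * (real (gcd x z) / real (max x z)) + 1))"
  unfolding F_def by (subst sum_nonzero_int[symmetric], subst sum_nonzero_int[symmetric]) rule
 also have "... = 8 * real L * (\<Sum>x=1..L. \<Sum>z=1..L. real (gcd x z) / real (max x z)) + 4 * (real L)\<^sup>2"
  by (simp add: sum.distrib sum_distrib_left power2_eq_square mult.assoc times_divide_eq_right[symmetric] del: times_divide_eq_right)
 finally have "real (card ?T) <= 3 * (2 * real L + 1)\<^sup>2 +
   (8 * real L * (\<Sum>x=1..L. \<Sum>z=1..L. real (gcd x z) / real (max x z)) + 4 * (real L)\<^sup>2)"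
  by (simp add: power2_eq_square)
 also have "... <= 3 * (3 * real L)\<^sup>2 + (8 * real L * (2 * (real L * (1 + ln L))) + 4 * (real L)\<^sup>2)"
 proof -
  have "harm L <= 1 + ln (real L)" 
  proof -
   obtain k where k: "L = Suc k" using L by (cases L) auto
   show ?thesis using decseqD[OF decseq_harm_diff_ln, of 0 k] by (simp add: k harm_expand)
  qed
  then have "2 * (real L * harm L) <= 2 * (real L * (1 + ln L))" by (intro mult_left_mono) auto
  then have "(\<Sum>x=1..L. \<Sum>z=1..L. real (gcd x z) / real (max x z)) <= 2 * (real L * (1 + ln L))"
   using sum_gcd_over_max_le[of L] by linarith
  then show ?thesis using L by (intro add_mono mult_left_mono power_mono) auto
 qed
 also have "... = (real L)\<^sup>2 * (31 + 16 * (1 + ln L))" by (simp add: power2_eq_square algebra_simps)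
 \<comment> \<open>The 47 is \<open>31 + 16\<close>, with \<open>1 <= 1 + ln L\<close>; the 31 is 27
   from the three axis terms and 4 from the summands 1 in the fibre bound.\<close>
 also have "... <= (real L)\<^sup>2 * (47 * (1 + ln L))" using L by (intro mult_left_mono) auto
 finally show ?thesis by (simp add: algebra_simps)
qed

text \<open>The bound of \<open>card_mult_eq_le\<close> at \<open>L = 2 * M\<close>, the range of
  sums and differences of two coordinates.\<close>

definition quad_bound :: "nat => real" where
 "quad_bound M = 47 * (2 * real M)\<^sup>2 * (1 + ln (2 * real M))"

lemma quad_bound_nonneg: "M >= 1 ==> quad_bound M >= 0"
 unfolding quad_bound_def by (intro mult_nonneg_nonneg add_nonneg_nonneg) auto

text \<open>A difference of squares factors into the difference and the sum of the coordinates,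
  which turns the equation into \<open>X * Y = Z * W\<close>.\<close>

lemma card_diff_squares_le:
 fixes c :: int
 assumes M: "M >= 1"
 defines "I \<equiv> {c - int M..c + int M}"
 shows "card {(p, r). p \<in> I \<times> I \<and> r \<in> I \<times> I \<and> (fst p)\<^sup>2 - (snd p)\<^sup>2 = (fst r)\<^sup>2 - (snd r)\<^sup>2} <= quad_bound M"
proof -
 let ?S = "{(p, r). p \<in> I \<times> I \<and> r \<in> I \<times> I \<and> (fst p)\<^sup>2 - (snd p)\<^sup>2 = (fst r)\<^sup>2 - (snd r)\<^sup>2}"
 define L where "L = 2 * M"
 define A where "A = 2 * c"
 let ?T = "{(X, Z, Y, W). X \<in> {- int L..int L} \<and> Z \<in> {- int L..int L} \<and>
   Y \<in> {A - int L..A + int L} \<and> W \<in> {A - int L..A + int L} \<and> X * Y = Z * W}"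
 let ?f = "\<lambda>(p, r). (fst p - snd p, fst r - snd r, fst p + snd p, fst r + snd r) :: int \<times> int \<times> int \<times> int"
 have "inj_on ?f ?S" by (rule inj_onI) auto
 moreover have "?f ` ?S \<subseteq> ?T"
  unfolding I_def L_def A_def by (auto simp: power2_eq_square algebra_simps)
 moreover have "finite ?T"
  by (rule finite_subset[of _ "{- int L..int L} \<times> {- int L..int L} \<times> {A - int L..A + int L} \<times> {A - int L..A + int L}"]) auto
 ultimately have "card ?S <= card ?T" by (rule card_inj_on_le)
 also have "real ... <= 47 * (real L)\<^sup>2 * (1 + ln L)"
  by (rule card_mult_eq_le) (use M in \<open>simp add: L_def\<close>)
 finally show ?thesis by (simp add: quad_bound_def L_def)
qed

section \<open>Near coincidences of real quadratic forms\<close>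

abbreviation isq :: "int => real" where "isq x \<equiv> (real_of_int x)\<^sup>2"

abbreviation energy1 :: "'i set => ('i => real) => real" where
 "energy1 I x \<equiv> energy I (\<lambda>_. ()) x (\<lambda>_. 1)"

lemma energy1_eq_card:
 assumes "finite I"
 shows "energy1 I x = card {(i, j). i \<in> I \<and> j \<in> I \<and> \<bar>x i - x j\<bar> < 1}"
proof -
 have "energy1 I x = (\<Sum>p\<in>I\<times>I. if \<bar>x (fst p) - x (snd p)\<bar> < 1 then 1 else 0)"
  unfolding energy_def by (simp add: sum.cartesian_product' cong: if_cong)
 also have "... = card {p \<in> I\<times>I. \<bar>x (fst p) - x (snd p)\<bar> < 1}"
  using assms by (simp add: sum.inter_filter[symmetric])
 also have "{p \<in> I\<times>I. \<bar>x (fst p) - x (snd p)\<bar> < 1} = {(i, j). i \<in> I \<and> j \<in> I \<and> \<bar>x i - x j\<bar> < 1}"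
  by auto
 finally show ?thesis .
qed

lemma energy1_reflect: "energy1 I (\<lambda>i. b - x i) = energy1 I x"
 unfolding energy_def by (simp add: abs_minus_commute)

text \<open>The integer part of \<open>b - y j - x i\<close> takes \<open>2 * k\<close> values, and
  each costs the factor 2 of \<open>sum_matching_bins_le\<close>. This is the device that splits a
  form into two groups of variables.\<close>

lemma card_sum_near_le:
 fixes k :: nat
 assumes fin: "finite I" "finite J"
 shows "card {(i, j). i \<in> I \<and> j \<in> J \<and> \<bar>x i + y j - b\<bar> < real k} <= 4 * real k * (sqrt (energy1 I x) * sqrt (energy1 J y))"
proof -
 let ?m = "\<lambda>m. \<Sum>i\<in>I. \<Sum>j\<in>J. if () = () \<and> \<lfloor>(b - y j) - x i\<rfloor> = m then 1 * 1 else (0::real)"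
 have "{(i, j). i \<in> I \<and> j \<in> J \<and> \<bar>x i + y j - b\<bar> < real k} = {p \<in> I \<times> J. \<bar>x (fst p) + y (snd p) - b\<bar> < real k}"
  by auto
 then have "real (card {(i, j). i \<in> I \<and> j \<in> J \<and> \<bar>x i + y j - b\<bar> < real k}) =
   (\<Sum>p\<in>I\<times>J. if \<bar>x (fst p) + y (snd p) - b\<bar> < real k then 1 else 0)"
  using fin by (simp add: sum.inter_filter[symmetric])
 also have "... <= (\<Sum>p\<in>I\<times>J. \<Sum>m\<in>{- int k..<int k}. if \<lfloor>(b - y (snd p)) - x (fst p)\<rfloor> = m then 1 else 0)"
 proof (rule sum_mono)
  fix p
  have "\<lfloor>(b - y (snd p)) - x (fst p)\<rfloor> \<in> {- int k..<int k}" if "\<bar>x (fst p) + y (snd p) - b\<bar> < real k"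
  proof -
   have "- real k <= (b - y (snd p)) - x (fst p)" "(b - y (snd p)) - x (fst p) < real k" using that by linarith+
   then show ?thesis by (simp add: le_floor_iff floor_less_iff)
  qed
  then show "(if \<bar>x (fst p) + y (snd p) - b\<bar> < real k then 1 else 0) <=
   (\<Sum>m\<in>{- int k..<int k}. if \<lfloor>(b - y (snd p)) - x (fst p)\<rfloor> = m then 1 else (0::real))"
   by (subst sum.delta') auto
 qed
 also have "... = (\<Sum>m\<in>{- int k..<int k}. ?m m)"
  by (subst sum.swap) (simp add: sum.cartesian_product' cong: if_cong)
 also have "... <= (\<Sum>m\<in>{- int k..<int k}. 2 * (sqrt (energy1 I x) * sqrt (energy1 J (\<lambda>j. b - y j))))"
  by (intro sum_mono sum_matching_bins_le fin) auto
 also have "... = 4 * real k * (sqrt (energy1 I x) * sqrt (energy1 J y))"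
  unfolding energy1_reflect by simp
 finally show ?thesis .
qed

lemma energy1_nonneg: "energy1 I x >= 0" by (rule energy_nonneg) simp

text \<open>Both differences carry the same factor \<open>\<beta> >= 1\<close>, so a distance below
  1 forces an integer to vanish: a near coincidence is an exact one. Distinct coordinates are never
  compared in this way, hence the independence from the ratios of the periods.\<close>

lemma energy1_diff_squares_le:
 fixes c :: int and \<beta> :: real
 assumes M: "M >= 1" and \<beta>: "\<beta> >= 1"
 defines "I \<equiv> {c - int M..c + int M}"
 shows "energy1 (I \<times> I) (\<lambda>p. \<beta> * isq (fst p) - \<beta> * isq (snd p)) <= quad_bound M"
proof -
 have fin: "finite (I \<times> I)" by (simp add: I_def)
 have "{(i, j). i \<in> I \<times> I \<and> j \<in> I \<times> I \<and> \<bar>\<beta> * isq (fst i) - \<beta> * isq (snd i) - (\<beta> * isq (fst j) - \<beta> * isq (snd j))\<bar> < 1}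
  \<subseteq> {(p, r). p \<in> I \<times> I \<and> r \<in> I \<times> I \<and> (fst p)\<^sup>2 - (snd p)\<^sup>2 = (fst r)\<^sup>2 - (snd r)\<^sup>2}" (is "?A \<subseteq> ?B")
 proof (rule subsetI)
  fix q assume q: "q \<in> ?A"
  obtain x x' y y' where qq: "q = ((x, x'), (y, y'))" by (cases q) auto
  have *: "\<bar>\<beta> * isq (fst (x, x')) - \<beta> * isq (snd (x, x')) - (\<beta> * isq (fst (y, y')) - \<beta> * isq (snd (y, y')))\<bar> < 1"
   using q unfolding qq by simp
  define k where "k = x\<^sup>2 - x'\<^sup>2 - (y\<^sup>2 - y'\<^sup>2)"
  have "\<beta> * isq (fst (x, x')) - \<beta> * isq (snd (x, x')) - (\<beta> * isq (fst (y, y')) - \<beta> * isq (snd (y, y'))) = \<beta> * k"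
   by (simp add: k_def algebra_simps)
  with * have "\<bar>\<beta> * real_of_int k\<bar> < 1" by simp
  then have "\<bar>\<beta>\<bar> * \<bar>real_of_int k\<bar> < 1" by (simp add: abs_mult)
  moreover have "1 * \<bar>real_of_int k\<bar> <= \<bar>\<beta>\<bar> * \<bar>real_of_int k\<bar>" using \<beta> by (intro mult_right_mono) auto
  ultimately have "\<bar>real_of_int k\<bar> < 1" by linarith
  then have "k = 0" by linarith
  then show "q \<in> ?B" using q unfolding qq k_def by simp
 qed
 then have "card ?A <= card ?B"
  by (intro card_mono finite_subset[of ?B "(I \<times> I) \<times> (I \<times> I)"]) (use fin in auto)
 also have "real ... <= quad_bound M" unfolding I_def by (rule card_diff_squares_le[OF M])
 finally show ?thesis unfolding energy1_eq_card[OF fin] by simp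
qed

text \<open>A near coincidence of two values of the form is regrouped by coordinates: a difference
  of squares in the first plus one in the second is close to 0. \<open>card_sum_near_le\<close>
  decouples the two, and each is an exact problem.\<close>

lemma energy1_two_squares_le:
 fixes c c' :: int and \<beta> \<beta>' :: real
 assumes M: "M >= 1" and \<beta>: "\<beta> >= 1" "\<beta>' >= 1"
 defines "I \<equiv> {c - int M..c + int M}" and "I' \<equiv> {c' - int M..c' + int M}"
 shows "energy1 (I \<times> I') (\<lambda>p. \<beta> * isq (fst p) + \<beta>' * isq (snd p)) <= 4 * quad_bound M"
proof -
 have fin: "finite I" "finite I'" by (simp_all add: I_def I'_def)
 let ?x = "\<lambda>p. \<beta> * isq (fst p) - \<beta> * isq (snd p)"
 let ?y = "\<lambda>p. \<beta>' * isq (fst p) - \<beta>' * isq (snd p)"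
 let ?A = "{(i, j). i \<in> I \<times> I' \<and> j \<in> I \<times> I' \<and> \<bar>\<beta> * isq (fst i) + \<beta>' * isq (snd i) - (\<beta> * isq (fst j) + \<beta>' * isq (snd j))\<bar> < 1}"
 let ?B = "{(i, j). i \<in> I \<times> I \<and> j \<in> I' \<times> I' \<and> \<bar>?x i + ?y j - 0\<bar> < real 1}"
 have finB: "finite ?B" by (rule finite_subset[of _ "(I \<times> I) \<times> (I' \<times> I')"]) (use fin in auto)
 have "inj_on (\<lambda>(i, j). ((fst i, fst j), (snd i, snd j))) ?A" by (rule inj_onI) auto
 moreover have "(\<lambda>(i, j). ((fst i, fst j), (snd i, snd j))) ` ?A \<subseteq> ?B"
  by (auto simp: algebra_simps)
 ultimately have "card ?A <= card ?B" using finB by (rule card_inj_on_le)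
 also have "real ... <= 4 * real 1 * (sqrt (energy1 (I \<times> I) ?x) * sqrt (energy1 (I' \<times> I') ?y))"
  using fin by (intro card_sum_near_le) auto
 also have "... <= 4 * real 1 * (sqrt (quad_bound M) * sqrt (quad_bound M))"
 proof -
  have "energy1 (I \<times> I) ?x <= quad_bound M" "energy1 (I' \<times> I') ?y <= quad_bound M"
   unfolding I_def I'_def by (rule energy1_diff_squares_le[OF M \<beta>(1)] energy1_diff_squares_le[OF M \<beta>(2)])+
  then show ?thesis
   by (intro mult_left_mono mult_mono real_sqrt_le_mono) (auto intro: order_trans[OF energy1_nonneg] energy1_nonneg quad_bound_nonneg[OF M])
 qed
 also have "... = 4 * quad_bound M"
  using M by (simp add: quad_bound_def)
 finally show ?thesis using fin by (subst energy1_eq_card) auto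
qed

lemma card_four_squares_le:
 fixes c :: "nat => int" and \<beta> :: "nat => real"
 assumes M: "M >= 1" and \<beta>: "\<And>k. \<beta> k >= 1"
 defines "I \<equiv> (\<lambda>k. {c k - int M..c k + int M})"
 shows "card {(p, r). p \<in> I 0 \<times> I 1 \<and> r \<in> I 2 \<times> I 3 \<and>
   \<bar>(\<beta> 0 * isq (fst p) + \<beta> 1 * isq (snd p)) + (\<beta> 2 * isq (fst r) + \<beta> 3 * isq (snd r)) - b\<bar> < real 2} <= 32 * quad_bound M"
proof -
 have e: "energy1 (I 0 \<times> I 1) (\<lambda>p. \<beta> 0 * isq (fst p) + \<beta> 1 * isq (snd p)) <= 4 * quad_bound M"
  "energy1 (I 2 \<times> I 3) (\<lambda>p. \<beta> 2 * isq (fst p) + \<beta> 3 * isq (snd p)) <= 4 * quad_bound M"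
  unfolding I_def by (rule energy1_two_squares_le[OF M \<beta> \<beta>])+
 have "real (card {(p, r). p \<in> I 0 \<times> I 1 \<and> r \<in> I 2 \<times> I 3 \<and>
   \<bar>(\<beta> 0 * isq (fst p) + \<beta> 1 * isq (snd p)) + (\<beta> 2 * isq (fst r) + \<beta> 3 * isq (snd r)) - b\<bar> < real 2}) <=
   4 * real 2 * (sqrt (energy1 (I 0 \<times> I 1) (\<lambda>p. \<beta> 0 * isq (fst p) + \<beta> 1 * isq (snd p))) *
   sqrt (energy1 (I 2 \<times> I 3) (\<lambda>p. \<beta> 2 * isq (fst p) + \<beta> 3 * isq (snd p))))"
  by (rule card_sum_near_le) (auto simp: I_def)
 also have "... <= 4 * real 2 * (sqrt (4 * quad_bound M) * sqrt (4 * quad_bound M))"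
  using e by (intro mult_left_mono mult_mono real_sqrt_le_mono) (auto intro: order_trans[OF energy1_nonneg] energy1_nonneg quad_bound_nonneg[OF M])
 also have "... = 32 * quad_bound M" using quad_bound_nonneg[OF M] by simp
 finally show ?thesis .
qed

text \<open>As \<open>\<beta> >= 1\<close> forces equal squares, each point has only itself and its
  negative as partners.\<close>

lemma energy1_square_le:
 fixes c :: int and \<beta> :: real and M :: nat
 assumes \<beta>: "\<beta> >= 1"
 defines "I \<equiv> {c - int M..c + int M}"
 shows "energy1 I (\<lambda>x. \<beta> * isq x) <= 2 * (2 * real M + 1)"
proof -
 have fin: "finite I" by (simp add: I_def)
 have "{(x, y). x \<in> I \<and> y \<in> I \<and> \<bar>\<beta> * isq x - \<beta> * isq y\<bar> < 1} \<subseteq>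
  (\<lambda>x. (x, x)) ` I \<union> (\<lambda>x. (x, - x)) ` I" (is "?A \<subseteq> ?B")
 proof
  fix p assume "p \<in> ?A"
  then obtain x y where p: "p = (x, y)" "x \<in> I" and *: "\<bar>\<beta> * isq x - \<beta> * isq y\<bar> < 1" by auto
  define k where "k = x\<^sup>2 - y\<^sup>2"
  have "\<beta> * isq x - \<beta> * isq y = \<beta> * k" by (simp add: k_def algebra_simps)
  with * have "\<bar>\<beta>\<bar> * \<bar>real_of_int k\<bar> < 1" by (simp add: abs_mult)
  moreover have "1 * \<bar>real_of_int k\<bar> <= \<bar>\<beta>\<bar> * \<bar>real_of_int k\<bar>" using \<beta> by (intro mult_right_mono) auto
  ultimately have "\<bar>real_of_int k\<bar> < 1" by linarith
  then have "k = 0" by linarith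
  then have "y = x \<or> y = - x" by (auto simp: k_def power2_eq_iff)
  then show "p \<in> ?B" using p by auto
 qed
 then have "card ?A <= card ?B" using fin by (intro card_mono) auto
 also have "... <= card I + card I"
  by (intro order_trans[OF card_Un_le] add_mono card_image_le fin)
 also have "real ... <= 2 * (2 * real M + 1)" by (simp add: I_def)
 finally show ?thesis unfolding energy1_eq_card[OF fin] by simp
qed

text \<open>Splitting the coordinates as 2 + 1 gives the square root of M^2 times M, that is M^(3/2)
  up to a logarithm. Half of this exponent is 3/4, which is d/2 - d/(d+1) for d = 3.\<close>

lemma card_three_squares_le:
 fixes c :: "nat => int" and \<beta> :: "nat => real"
 assumes M: "M >= 1" and \<beta>: "\<And>k. \<beta> k >= 1"
 defines "I \<equiv> (\<lambda>k. {c k - int M..c k + int M})"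
 shows "card {(p, z). p \<in> I 0 \<times> I 1 \<and> z \<in> I 2 \<and>
   \<bar>(\<beta> 0 * isq (fst p) + \<beta> 1 * isq (snd p)) + \<beta> 2 * isq z - b\<bar> < real 2} <=
   8 * (sqrt (4 * quad_bound M) * sqrt (2 * (2 * real M + 1)))"
proof -
 have e: "energy1 (I 0 \<times> I 1) (\<lambda>p. \<beta> 0 * isq (fst p) + \<beta> 1 * isq (snd p)) <= 4 * quad_bound M"
  "energy1 (I 2) (\<lambda>z. \<beta> 2 * isq z) <= 2 * (2 * real M + 1)"
  unfolding I_def by (rule energy1_two_squares_le[OF M \<beta> \<beta>] energy1_square_le[OF \<beta>])+
 have "real (card {(p, z). p \<in> I 0 \<times> I 1 \<and> z \<in> I 2 \<and>
   \<bar>(\<beta> 0 * isq (fst p) + \<beta> 1 * isq (snd p)) + \<beta> 2 * isq z - b\<bar> < real 2}) <=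
   4 * real 2 * (sqrt (energy1 (I 0 \<times> I 1) (\<lambda>p. \<beta> 0 * isq (fst p) + \<beta> 1 * isq (snd p))) *
   sqrt (energy1 (I 2) (\<lambda>z. \<beta> 2 * isq z)))"
  by (rule card_sum_near_le) (auto simp: I_def)
 also have "... <= 4 * real 2 * (sqrt (4 * quad_bound M) * sqrt (2 * (2 * real M + 1)))"
  using e by (intro mult_left_mono mult_mono real_sqrt_le_mono) (auto intro: order_trans[OF energy1_nonneg] energy1_nonneg quad_bound_nonneg[OF M])
 finally show ?thesis by simp
qed

section \<open>Lattice points near a planar ellipse\<close>

definition flat_arc :: "real => real => real => (int \<times> int) set" where
 "flat_arc \<beta>1 \<beta>2 b = {(x, y). \<bar>\<beta>1 * isq x + \<beta>2 * isq y - b\<bar> < 2 \<and> y >= 1 \<and> \<beta>1 * \<bar>real_of_int x\<bar> <= \<beta>2 * real_of_int y}"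

text \<open>The gradient of the form is proportional to \<open>(\<beta>1 * x, \<beta>2 * y)\<close>,
  so on \<open>flat_arc\<close> the curve is a graph of slope at most 1 over the x axis. The
  thickness of the shell adds \<open>4 / (\<beta>2 * (y + y'))\<close>, which is at most 2.\<close>

lemma flat_arc_slope:
 assumes \<beta>: "\<beta>1 >= 1" "\<beta>2 >= 1" and p: "(x, y) \<in> flat_arc \<beta>1 \<beta>2 b" "(x', y') \<in> flat_arc \<beta>1 \<beta>2 b"
 shows "\<bar>real_of_int y - real_of_int y'\<bar> <= \<bar>real_of_int x - real_of_int x'\<bar> + 2"
proof -
 define X Y X' Y' where "X = real_of_int x" and "Y = real_of_int y" and "X' = real_of_int x'" and "Y' = real_of_int y'"
 have h: "\<bar>\<beta>1 * X\<^sup>2 + \<beta>2 * Y\<^sup>2 - b\<bar> < 2" "\<bar>\<beta>1 * X'\<^sup>2 + \<beta>2 * Y'\<^sup>2 - b\<bar> < 2" "Y >= 1" "Y' >= 1"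
  "\<beta>1 * \<bar>X\<bar> <= \<beta>2 * Y" "\<beta>1 * \<bar>X'\<bar> <= \<beta>2 * Y'"
  using p by (auto simp: flat_arc_def X_def Y_def X'_def Y'_def)
 have "\<beta>2 * (Y - Y') * (Y + Y') = (\<beta>1 * X\<^sup>2 + \<beta>2 * Y\<^sup>2 - b) - (\<beta>1 * X'\<^sup>2 + \<beta>2 * Y'\<^sup>2 - b) - (X - X') * (\<beta>1 * (X + X'))"
  by (simp add: algebra_simps power2_eq_square)
 moreover have "\<bar>(X - X') * (\<beta>1 * (X + X'))\<bar> <= \<bar>X - X'\<bar> * (\<beta>2 * (Y + Y'))"
 proof -
  have "\<bar>\<beta>1 * (X + X')\<bar> = \<beta>1 * \<bar>X + X'\<bar>" using \<beta> by (simp add: abs_mult)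
  also have "... <= \<beta>1 * (\<bar>X\<bar> + \<bar>X'\<bar>)" using \<beta> by (intro mult_left_mono) auto
  also have "... <= \<beta>2 * (Y + Y')" using h(5,6) by (simp add: algebra_simps)
  finally show ?thesis unfolding abs_mult by (intro mult_left_mono) auto
 qed
 ultimately have "\<bar>\<beta>2 * (Y - Y') * (Y + Y')\<bar> <= 4 + \<bar>X - X'\<bar> * (\<beta>2 * (Y + Y'))"
  using h(1,2) by linarith
 moreover have "\<bar>\<beta>2 * (Y - Y') * (Y + Y')\<bar> = \<bar>Y - Y'\<bar> * (\<beta>2 * (Y + Y'))"
  using \<beta> h(3,4) by (simp add: abs_mult)
 ultimately have *: "(\<bar>Y - Y'\<bar> - \<bar>X - X'\<bar>) * (\<beta>2 * (Y + Y')) <= 4"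
  by (simp add: algebra_simps)
 have "\<bar>Y - Y'\<bar> - \<bar>X - X'\<bar> <= 2"
 proof (rule ccontr)
  assume "\<not> ?thesis"
  moreover have "1 * 2 <= \<beta>2 * (Y + Y')" using \<beta> h by (intro mult_mono) auto
  ultimately have "2 * 2 < (\<bar>Y - Y'\<bar> - \<bar>X - X'\<bar>) * (\<beta>2 * (Y + Y'))"
   by (intro mult_less_le_imp_less) auto
  then show False using * by simp
 qed
 then show ?thesis by (simp add: X_def Y_def X'_def Y'_def)
qed

text \<open>Twice the area of a lattice triangle is an integer; on a short arc it is smaller than one.\<close>

lemma flat_arc_collinear:
 fixes x1 x2 x3 y1 y2 y3 :: int
 assumes \<beta>: "\<beta>1 >= 1" "\<beta>2 >= 1" "\<beta>1 <= B" "\<beta>2 <= B"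
  and p: "(x1, y1) \<in> flat_arc \<beta>1 \<beta>2 b" "(x2, y2) \<in> flat_arc \<beta>1 \<beta>2 b" "(x3, y3) \<in> flat_arc \<beta>1 \<beta>2 b"
  and h: "\<bar>real_of_int (x2 - x1)\<bar> < h" "\<bar>real_of_int (x3 - x1)\<bar> < h"
  and small: "14 * B * h ^ 3 < real_of_int y1"
 shows "(x2 - x1) * (y3 - y1) = (x3 - x1) * (y2 - y1)"
proof (cases "h >= 1")
 case False
 then have "x2 - x1 = 0" "x3 - x1 = 0" using h by linarith+
 then show ?thesis by simp
next
 case True
 have B: "B >= 1" using \<beta> by linarith
 define X Y where "X = real_of_int x1" and "Y = real_of_int y1"
 define u v where "u = real_of_int (x2 - x1)" and "v = real_of_int (y2 - y1)"
 define u' v' where "u' = real_of_int (x3 - x1)" and "v' = real_of_int (y3 - y1)"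
 have q1: "\<bar>\<beta>1 * X\<^sup>2 + \<beta>2 * Y\<^sup>2 - b\<bar> < 2" and Y: "Y >= 1"
  and q2: "\<bar>\<beta>1 * (X + u)\<^sup>2 + \<beta>2 * (Y + v)\<^sup>2 - b\<bar> < 2" and q3: "\<bar>\<beta>1 * (X + u')\<^sup>2 + \<beta>2 * (Y + v')\<^sup>2 - b\<bar> < 2"
  using p by (auto simp: flat_arc_def X_def Y_def u_def v_def u'_def v'_def)
 have hu: "\<bar>u\<bar> <= h" "\<bar>u'\<bar> <= h" using h by (auto simp: u_def u'_def)
 have hv: "\<bar>v\<bar> <= h + 2" "\<bar>v'\<bar> <= h + 2"
  using flat_arc_slope[OF \<beta>(1,2) p(2,1)] flat_arc_slope[OF \<beta>(1,2) p(3,1)] hu by (auto simp: u_def v_def u'_def v'_def)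
 define r where "r = 2 * \<beta>1 * X * u + 2 * \<beta>2 * Y * v"
 define r' where "r' = 2 * \<beta>1 * X * u' + 2 * \<beta>2 * Y * v'"
 \<comment> \<open>Chords are nearly tangent: the derivative of the form along a chord is at most
   the two shell widths plus the quadratic remainder. With \<open>\<bar>V\<bar> <= 3 * h\<close> the
   constant is 14 = 4 + 1 + 9.\<close>
 have bnd: "\<bar>2 * \<beta>1 * X * U + 2 * \<beta>2 * Y * V\<bar> <= 14 * B * h\<^sup>2"
  if q: "\<bar>\<beta>1 * (X + U)\<^sup>2 + \<beta>2 * (Y + V)\<^sup>2 - b\<bar> < 2" and U: "\<bar>U\<bar> <= h" and V: "\<bar>V\<bar> <= h + 2" for U V
 proof -
  have e: "2 * \<beta>1 * X * U + 2 * \<beta>2 * Y * V = (\<beta>1 * (X + U)\<^sup>2 + \<beta>2 * (Y + V)\<^sup>2 - b) - (\<beta>1 * X\<^sup>2 + \<beta>2 * Y\<^sup>2 - b) - (\<beta>1 * U\<^sup>2 + \<beta>2 * V\<^sup>2)"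
   by (simp add: algebra_simps power2_eq_square)
  have "U\<^sup>2 <= h\<^sup>2" using U power_mono[of "\<bar>U\<bar>" h 2] by simp
  then have a: "\<beta>1 * U\<^sup>2 <= B * h\<^sup>2" "0 <= \<beta>1 * U\<^sup>2" using \<beta> B by (auto intro: mult_mono)
  have "V\<^sup>2 <= (3 * h)\<^sup>2" using V True power_mono[of "\<bar>V\<bar>" "3 * h" 2] by simp
  then have b: "\<beta>2 * V\<^sup>2 <= B * (3 * h)\<^sup>2" "0 <= \<beta>2 * V\<^sup>2" using \<beta> B by (auto intro: mult_mono)
  have "1 * 1 <= B * h\<^sup>2" using B True by (intro mult_mono) auto
  then have "4 <= 4 * (B * h\<^sup>2)" by simp
  moreover have "B * (3 * h)\<^sup>2 = 9 * (B * h\<^sup>2)" by (simp add: power2_eq_square)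
  ultimately show ?thesis unfolding e using q q1 a b by linarith
 qed
 have r: "\<bar>r\<bar> <= 14 * B * h\<^sup>2" "\<bar>r'\<bar> <= 14 * B * h\<^sup>2"
  unfolding r_def r'_def by (rule bnd[OF q2 hu(1) hv(1)] bnd[OF q3 hu(2) hv(2)])+
 define D where "D = (x2 - x1) * (y3 - y1) - (x3 - x1) * (y2 - y1)"
 have D: "real_of_int D = u * v' - u' * v" by (simp add: D_def u_def v_def u'_def v'_def)
 \<comment> \<open>Eliminating \<open>X\<close> between the two tangency relations leaves the
   determinant \<open>D\<close> alone, multiplied by the large factor
   \<open>2 * \<beta>2 * Y\<close>.\<close>
 have "2 * \<beta>2 * Y * (u * v' - u' * v) = u * r' - u' * r"
  unfolding r_def r'_def by (simp add: algebra_simps)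
 then have "\<bar>2 * \<beta>2 * Y * D\<bar> <= \<bar>u\<bar> * \<bar>r'\<bar> + \<bar>u'\<bar> * \<bar>r\<bar>"
  unfolding D by (simp add: abs_mult[symmetric] abs_triangle_ineq4)
 also have "... <= h * (14 * B * h\<^sup>2) + h * (14 * B * h\<^sup>2)"
  using hu r True by (intro add_mono mult_mono) auto
 also have "... = 2 * (14 * B * h ^ 3)" by (simp add: power2_eq_square power3_eq_cube)
 also have "... < 2 * Y" using small by (simp add: Y_def)
 finally have "\<beta>2 * Y * \<bar>real_of_int D\<bar> < Y" using \<beta> Y by (simp add: abs_mult)
 moreover have "1 * Y * \<bar>real_of_int D\<bar> <= \<beta>2 * Y * \<bar>real_of_int D\<bar>"
  using \<beta> Y by (intro mult_right_mono) auto
 ultimately have "Y * \<bar>real_of_int D\<bar> < Y * 1" by simp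
 then have "\<bar>real_of_int D\<bar> < 1" using Y by simp
 then have "D = 0" by linarith
 then show ?thesis by (simp add: D_def)
qed

text \<open>Along a line the form is convex with second difference at least that of
  \<open>\<beta>1 * x^2\<close>, while its values at the three points lie in a window of width 4.
  This gives \<open>u * (t - u) <= 4\<close> for the integer steps \<open>u\<close> and
  \<open>t - u\<close>, and \<open>t - 1 <= u * (t - u)\<close>.\<close>

lemma flat_arc_collinear_range:
 fixes a x c :: int
 assumes \<beta>: "\<beta>1 >= 1" "\<beta>2 >= 1"
  and p: "(a, y) \<in> flat_arc \<beta>1 \<beta>2 b" "(x, y') \<in> flat_arc \<beta>1 \<beta>2 b" "(c, y'') \<in> flat_arc \<beta>1 \<beta>2 b"
  and ord: "a < x" "x < c" and col: "(x - a) * (y'' - y) = (c - a) * (y' - y)"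
 shows "c - a <= 5"
proof -
 define t u where "t = real_of_int (c - a)" and "u = real_of_int (x - a)"
 define w v where "w = real_of_int (y'' - y)" and "v = real_of_int (y' - y)"
 define A Y where "A = real_of_int a" and "Y = real_of_int y"
 have tu: "0 < u" "u < t" using ord by (auto simp: t_def u_def)
 have uw: "u * w = t * v"
  unfolding t_def u_def w_def v_def using arg_cong[OF col, of real_of_int] by simp
 have q1: "\<bar>\<beta>1 * A\<^sup>2 + \<beta>2 * Y\<^sup>2 - b\<bar> < 2" and q2: "\<bar>\<beta>1 * (A + u)\<^sup>2 + \<beta>2 * (Y + v)\<^sup>2 - b\<bar> < 2"
  and q3: "\<bar>\<beta>1 * (A + t)\<^sup>2 + \<beta>2 * (Y + w)\<^sup>2 - b\<bar> < 2"
  using p by (auto simp: flat_arc_def A_def Y_def t_def u_def v_def w_def)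
 have yy: "u * w\<^sup>2 - t * v\<^sup>2 >= 0"
 proof -
  have "t * (u * w\<^sup>2 - t * v\<^sup>2) = t * (u * w\<^sup>2) - (t * v)\<^sup>2" by (simp add: algebra_simps power2_eq_square)
  also have "... = u * w\<^sup>2 * (t - u)" unfolding uw[symmetric] by (simp add: algebra_simps power2_eq_square)
  finally have "t * (u * w\<^sup>2 - t * v\<^sup>2) >= 0" using tu by simp
  then show ?thesis using tu by (simp add: zero_le_mult_iff)
 qed
 have "(t - u) * (\<beta>1 * A\<^sup>2 + \<beta>2 * Y\<^sup>2 - b) + u * (\<beta>1 * (A + t)\<^sup>2 + \<beta>2 * (Y + w)\<^sup>2 - b) - t * (\<beta>1 * (A + u)\<^sup>2 + \<beta>2 * (Y + v)\<^sup>2 - b)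
  = \<beta>1 * (u * t * (t - u)) + \<beta>2 * (u * w\<^sup>2 - t * v\<^sup>2) + 2 * \<beta>2 * Y * (u * w - t * v)"
  by (simp add: algebra_simps power2_eq_square)
 also have "2 * \<beta>2 * Y * (u * w - t * v) = 0" using uw by simp
 finally have e: "\<beta>1 * (u * t * (t - u)) + \<beta>2 * (u * w\<^sup>2 - t * v\<^sup>2) =
   (t - u) * (\<beta>1 * A\<^sup>2 + \<beta>2 * Y\<^sup>2 - b) + u * (\<beta>1 * (A + t)\<^sup>2 + \<beta>2 * (Y + w)\<^sup>2 - b) + t * - (\<beta>1 * (A + u)\<^sup>2 + \<beta>2 * (Y + v)\<^sup>2 - b)"
  unfolding mult_minus_right by linarith
 have "... <= (t - u) * 2 + u * 2 + t * 2"
  using q1 q2 q3 tu by (intro add_mono mult_left_mono) auto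
 then have "\<beta>1 * (u * t * (t - u)) + \<beta>2 * (u * w\<^sup>2 - t * v\<^sup>2) <= t * 4" unfolding e by simp
 moreover have "\<beta>2 * (u * w\<^sup>2 - t * v\<^sup>2) >= 0" using yy \<beta> by simp
 moreover have "1 * (u * t * (t - u)) <= \<beta>1 * (u * t * (t - u))"
  using \<beta> tu by (intro mult_right_mono) auto
 ultimately have "t * (u * (t - u)) <= t * 4" by (simp add: algebra_simps)
 then have ut: "u * (t - u) <= 4" using tu by simp
 have "u >= 1" "t - u >= 1" using ord by (auto simp: u_def t_def)
 then have "0 <= (u - 1) * (t - u - 1)" by simp
 then have "t - 1 <= u * (t - u)" by (simp add: algebra_simps)
 then have "t <= 5" using ut by simp
 then show ?thesis by (simp add: t_def)
qed

text \<open>The abscissae span at most 5 as soon as one lies strictly between the extremes, so there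
  are at most 6 of them; over each, \<open>flat_arc_slope\<close> allows 5 ordinates.\<close>

lemma card_collinear_flat_arc_le:
 assumes \<beta>: "\<beta>1 >= 1" "\<beta>2 >= 1" and S: "finite S" "S \<subseteq> flat_arc \<beta>1 \<beta>2 b"
  and col: "\<And>x1 y1 x2 y2 x3 y3. (x1, y1) \<in> S ==> (x2, y2) \<in> S ==> (x3, y3) \<in> S ==>
   (x2 - x1) * (y3 - y1) = (x3 - x1) * (y2 - y1)"
 shows "card S <= 30"
proof -
 define X where "X = fst ` S"
 have finX: "finite X" using S by (simp add: X_def)
 have cX: "card X <= 6"
 proof (rule ccontr)
  assume *: "\<not> card X <= 6"
  then have ne: "X \<noteq> {}" by auto
  define a c where "a = Min X" and "c = Max X"
  have ac: "a \<in> X" "c \<in> X" using finX ne by (auto simp: a_def c_def)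
  have sub: "X \<subseteq> {a..c}" using finX by (auto simp: a_def c_def)
  then have "card X <= nat (c - a + 1)" using card_mono[OF _ sub] by simp
  then have ca: "c - a >= 6" using * by simp
  have "\<not> X \<subseteq> {a, c}"
  proof
   assume "X \<subseteq> {a, c}"
   then have "card X <= card {a, c}" by (intro card_mono) auto
   also have "... <= 2" by (simp add: card_insert_if)
   finally show False using * by simp
  qed
  then obtain x where x: "x \<in> X" "x \<noteq> a" "x \<noteq> c" by auto
  then have ord: "a < x" "x < c" using sub by (auto simp: order_less_le subset_iff)
  obtain y y' y'' where S': "(a, y) \<in> S" "(x, y') \<in> S" "(c, y'') \<in> S" using ac x by (force simp: X_def)
  have "c - a <= 5"
  proof (rule flat_arc_collinear_range[OF \<beta> _ _ _ ord])
   show "(x - a) * (y'' - y) = (c - a) * (y' - y)" by (rule col[OF S'])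
  qed (use S' S in auto)
  then show False using ca by simp
 qed
 have "\<forall>x\<in>X. \<exists>y. (x, y) \<in> S" by (auto simp: X_def)
 then obtain f where f: "\<And>x. x \<in> X ==> (x, f x) \<in> S" by metis
 have "S \<subseteq> (\<lambda>(x, e). (x, f x + e)) ` (X \<times> {-2..2})"
 proof
  fix p assume p: "p \<in> S"
  obtain x y where xy: "p = (x, y)" by (cases p)
  have x: "x \<in> X" using imageI[OF p, of fst] xy by (simp add: X_def)
  have "\<bar>real_of_int y - real_of_int (f x)\<bar> <= 2"
   using flat_arc_slope[OF \<beta>, of x y b x "f x"] p f[OF x] S xy by auto
  then have "y - f x \<in> {-2..2}" by auto
  then show "p \<in> (\<lambda>(x, e). (x, f x + e)) ` (X \<times> {-2..2})"
   using x xy by (intro image_eqI[of _ _ "(x, y - f x)"]) auto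
 qed
 then have "card S <= card ((\<lambda>(x, e). (x, f x + e)) ` (X \<times> {-2..2::int}))"
  using finX by (intro card_mono) auto
 also have "... <= card (X \<times> {-2..2::int})" using finX by (intro card_image_le) auto
 also have "... <= 6 * 5" unfolding card_cartesian_product using cX by (intro mult_mono) auto
 finally show ?thesis by simp
qed

text \<open>The abscissae are cut into cells of length \<open>h\<close>, a multiple of the cube root
  of \<open>H\<close>. In a cell all points are collinear, so it holds at most 30 of them, and there
  are about \<open>H / h\<close> cells. Taking \<open>H\<close> as the smaller of \<open>M\<close>
  and the largest ordinate \<open>Y\<close> makes the bound uniform in the position of the box and
  in \<open>b\<close>.\<close>

lemma card_flat_arc_le:
 fixes c c' :: int
 assumes \<beta>: "\<beta>1 >= 1" "\<beta>2 >= 1" "\<beta>1 <= B" "\<beta>2 <= B" and M: "M >= 1"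
 shows "card (flat_arc \<beta>1 \<beta>2 b \<inter> {c - int M..c + int M} \<times> {c' - int M..c' + int M}) <=
  30 * (86 * B ^ 3 + 2) * M powr (2/3)"
proof -
 let ?P = "flat_arc \<beta>1 \<beta>2 b \<inter> {c - int M..c + int M} \<times> {c' - int M..c' + int M}"
 have B: "B >= 1" using \<beta> by linarith
 show ?thesis
 proof (cases "?P = {}")
  case True
  then show ?thesis using B by (simp only: card.empty) simp
 next
  case False
  have fin: "finite ?P" by auto
  define Y where "Y = Max (snd ` ?P)"
  have "Y \<in> snd ` ?P" unfolding Y_def using fin False by (intro Max_in) auto
  then obtain x0 where x0: "(x0, Y) \<in> ?P" by auto
  have Y1: "Y >= 1" using x0 by (auto simp: flat_arc_def)
  have Ymax: "y <= Y" if "(x, y) \<in> ?P" for x y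
   unfolding Y_def using fin that by (intro Max_ge) force+
  \<comment> \<open>All points lie on one shell and have their ordinate as dominant coordinate, so
    their ordinates are comparable with the largest one.\<close>
  have comp: "real_of_int Y <= 3 * B * real_of_int y" if "(x, y) \<in> ?P" for x y
  proof -
   have y: "real_of_int y >= 1" and bx: "\<beta>1 * \<bar>real_of_int x\<bar> <= \<beta>2 * real_of_int y" and q: "b < \<beta>1 * isq x + \<beta>2 * isq y + 2"
    using that by (auto simp: flat_arc_def abs_less_iff)
   have q0: "\<beta>1 * isq x0 + \<beta>2 * isq Y < b + 2" using x0 by (auto simp: flat_arc_def abs_less_iff)
   have "1 * isq Y <= \<beta>2 * isq Y" using \<beta> by (intro mult_right_mono) auto
   moreover have "0 <= \<beta>1 * isq x0" using \<beta> by simp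
   ultimately have 1: "isq Y < 4 + \<beta>1 * isq x + \<beta>2 * isq y" using q0 q by linarith
   have "\<beta>1 * isq x <= \<beta>1 * (\<beta>1 * isq x)" 
    using mult_right_mono[of 1 \<beta>1 "\<beta>1 * isq x"] \<beta> by simp
   also have "... = (\<beta>1 * \<bar>real_of_int x\<bar>)\<^sup>2" by (simp add: power2_eq_square abs_mult_self_eq algebra_simps)
   also have "... <= (\<beta>2 * real_of_int y)\<^sup>2" using bx \<beta> by (intro power_mono) auto
   also have "... <= (B * real_of_int y)\<^sup>2" using \<beta> y by (intro power_mono mult_right_mono) auto
   finally have 2: "\<beta>1 * isq x <= B\<^sup>2 * isq y" by (simp add: power_mult_distrib)
   have 3: "\<beta>2 * isq y <= B\<^sup>2 * isq y"
    using \<beta> B by (intro mult_right_mono) (auto intro: order_trans[OF \<beta>(4)] simp: power2_eq_square)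
   have "1 * 1 <= B\<^sup>2 * isq y" using B y by (intro mult_mono) auto
   then have "(real_of_int Y)\<^sup>2 <= (3 * B * real_of_int y)\<^sup>2"
    using 1 2 3 by (simp add: power_mult_distrib)
   then show ?thesis using B y by (simp add: power2_le_iff_abs_le) 
  qed
  define H where "H = min (real M) (real_of_int Y)"
  have H: "H >= 1" "H <= real M" "H <= real_of_int Y" using M Y1 by (auto simp: H_def)
  \<comment> \<open>The 43 exceeds \<open>3 * 14\<close>: the 14 comes from
    \<open>flat_arc_collinear\<close> and the 3 from \<open>comp\<close>, so the triangle condition
    holds strictly at every point.\<close>
  define h where "h = (H / (43 * B\<^sup>2)) powr (1/3)"
  have h0: "h > 0" using H B by (simp add: h_def)
  have h3: "h ^ 3 = H / (43 * B\<^sup>2)"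
  proof -
   have "h ^ 3 = h powr real 3" using h0 by (subst powr_realpow) auto
   also have "... = (H / (43 * B\<^sup>2)) powr 1" unfolding h_def powr_powr by simp
   also have "... = H / (43 * B\<^sup>2)" using H B by simp
   finally show ?thesis .
  qed
  have small: "14 * B * h ^ 3 < real_of_int y" if "(x, y) \<in> ?P" for x y
  proof -
   have "14 * B * h ^ 3 = 14 * H / (43 * B)" unfolding h3 using B by (simp add: power2_eq_square)
   also have "... < H / (3 * B)" using H B by (simp add: field_simps)
   also have "... <= real_of_int y" using comp[OF that] H B by (simp add: field_simps)
   finally show ?thesis .
  qed
  define \<kappa> where "\<kappa> p = \<lfloor>real_of_int (fst p) / h\<rfloor>" for p :: "int \<times> int"
  define lo hi where "lo = max (- B * real_of_int Y) (real_of_int c - real M)"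
   and "hi = min (B * real_of_int Y) (real_of_int c + real M)"
  have xr: "lo <= real_of_int x" "real_of_int x <= hi" if "(x, y) \<in> ?P" for x y
  proof -
   have y: "real_of_int y >= 1" and bx: "\<beta>1 * \<bar>real_of_int x\<bar> <= \<beta>2 * real_of_int y"
    using that by (auto simp: flat_arc_def)
   have "1 * \<bar>real_of_int x\<bar> <= \<beta>1 * \<bar>real_of_int x\<bar>" using \<beta> by (intro mult_right_mono) auto
   also note bx
   also have "\<beta>2 * real_of_int y <= B * real_of_int Y" using \<beta> y Ymax[OF that] by (intro mult_mono) auto
   finally show "lo <= real_of_int x" "real_of_int x <= hi" using that by (auto simp: lo_def hi_def)
  qed
  have lohi: "lo <= hi" using xr[OF x0] by linarith
  have len: "hi - lo <= 2 * B * H"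
  proof -
   have "1 * real M <= B * real M" using B by (intro mult_right_mono) auto
   moreover have "hi - lo <= 2 * real M" "hi - lo <= 2 * (B * real_of_int Y)"
    unfolding hi_def lo_def by linarith+
   ultimately show ?thesis unfolding H_def by (cases "real M <= real_of_int Y") (simp_all add: min_def)
  qed
  have img: "\<kappa> ` ?P \<subseteq> {\<lfloor>lo / h\<rfloor>..\<lfloor>hi / h\<rfloor>}"
  proof clarify
   fix x y assume "(x, y) \<in> flat_arc \<beta>1 \<beta>2 b" "x \<in> {c - int M..c + int M}" "y \<in> {c' - int M..c' + int M}"
   then have "(x, y) \<in> ?P" by blast
   from xr[OF this] show "\<kappa> (x, y) \<in> {\<lfloor>lo / h\<rfloor>..\<lfloor>hi / h\<rfloor>}"
    using h0 by (auto simp: \<kappa>_def intro!: floor_mono divide_right_mono)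
  qed
  have cell: "card {p \<in> ?P. \<kappa> p = k} <= 30" for k
  proof (rule card_collinear_flat_arc_le[OF \<beta>(1,2)])
   fix x1 y1 x2 y2 x3 y3
   assume p: "(x1, y1) \<in> {p \<in> ?P. \<kappa> p = k}" "(x2, y2) \<in> {p \<in> ?P. \<kappa> p = k}" "(x3, y3) \<in> {p \<in> ?P. \<kappa> p = k}"
   have d: "\<bar>real_of_int (x' - x1)\<bar> < h" if "(x', y') \<in> {p \<in> ?P. \<kappa> p = k}" for x' y'
   proof -
    have "\<lfloor>real_of_int x' / h\<rfloor> = \<lfloor>real_of_int x1 / h\<rfloor>" using that p(1) by (simp add: \<kappa>_def)
    then have "\<bar>real_of_int x' / h - real_of_int x1 / h\<bar> < 1" by linarith
    then have "\<bar>real_of_int (x' - x1) / h\<bar> < 1" by (simp add: diff_divide_distrib)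
    then show ?thesis using h0 by simp
   qed
   show "(x2 - x1) * (y3 - y1) = (x3 - x1) * (y2 - y1)"
    by (rule flat_arc_collinear[OF \<beta> _ _ _ d[OF p(2)] d[OF p(3)] small]) (use p in auto)
  qed (use fin in auto)
  have "card ?P = (\<Sum>k\<in>{\<lfloor>lo / h\<rfloor>..\<lfloor>hi / h\<rfloor>}. card {p \<in> ?P. \<kappa> p = k})"
   using sum.group[OF fin _ img, of "\<lambda>_. 1::nat"] by simp
  also have "... <= (\<Sum>k\<in>{\<lfloor>lo / h\<rfloor>..\<lfloor>hi / h\<rfloor>}. 30)" by (intro sum_mono cell)
  finally have "real (card ?P) <= 30 * real (nat (\<lfloor>hi / h\<rfloor> - \<lfloor>lo / h\<rfloor> + 1))"
   by (simp add: mult.commute flip: of_nat_le_iff)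
  also have "real (nat (\<lfloor>hi / h\<rfloor> - \<lfloor>lo / h\<rfloor> + 1)) <= 2 * B * H / h + 2"
  proof -
   have "\<lfloor>lo / h\<rfloor> <= \<lfloor>hi / h\<rfloor>" using lohi h0 by (intro floor_mono divide_right_mono) auto
   then have "real (nat (\<lfloor>hi / h\<rfloor> - \<lfloor>lo / h\<rfloor> + 1)) = real_of_int \<lfloor>hi / h\<rfloor> - real_of_int \<lfloor>lo / h\<rfloor> + 1" by simp
   also have "... <= hi / h - lo / h + 2" by linarith
   also have "hi / h - lo / h = (hi - lo) / h" by (simp add: diff_divide_distrib)
   also have "... <= 2 * B * H / h" using len h0 by (intro divide_right_mono) auto
   finally show ?thesis by simp
  qed
  also have "2 * B * H / h + 2 <= (86 * B ^ 3 + 2) * M powr (2/3)"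
  proof -
   have "H / h = H powr (2/3) * (43 * B\<^sup>2) powr (1/3)"
   proof -
    have "h = H powr (1/3) / (43 * B\<^sup>2) powr (1/3)" unfolding h_def by (rule powr_divide)
    moreover have "(43 * B\<^sup>2) powr (1/3) > 0" using B by simp
    ultimately have "H powr (1/3) = h * (43 * B\<^sup>2) powr (1/3)" by (simp add: field_simps)
    moreover have "H = H powr (2/3) * H powr (1/3)" using H by (simp add: powr_add[symmetric])
    ultimately have "H = H powr (2/3) * (h * (43 * B\<^sup>2) powr (1/3))" by simp
    then have "H / h = H powr (2/3) * (h * (43 * B\<^sup>2) powr (1/3)) / h" by simp
    then show ?thesis using h0 by simp
   qed
   also have "... <= M powr (2/3) * (43 * B\<^sup>2)"
   proof (rule mult_mono)
    show "H powr (2/3) <= M powr (2/3)" using H by (intro powr_mono2) auto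
    have "1 * 1 <= 43 * B\<^sup>2" using B by (intro mult_mono) auto
    then have "(43 * B\<^sup>2) powr (1/3) <= (43 * B\<^sup>2) powr 1" by (intro powr_mono) auto
    then show "(43 * B\<^sup>2) powr (1/3) <= 43 * B\<^sup>2" using B by simp
   qed auto
   finally have "2 * B * (H / h) <= 2 * B * (M powr (2/3) * (43 * B\<^sup>2))" using B by (intro mult_left_mono) auto
   moreover have "1 <= real M powr (2/3)" using M by (intro ge_one_powr_ge_zero) auto
   ultimately show ?thesis by (simp add: algebra_simps power2_eq_square power3_eq_cube)
  qed
  finally show ?thesis by (simp add: algebra_simps)
 qed
qed

text \<open>Reflections and the exchange of the coordinates cover the shell by four flat arcs and
  the origin: \<open>120 = 4 * 30\<close>, plus 1.\<close>

lemma card_two_squares_le: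
 fixes c c' :: int
 assumes \<beta>: "\<beta>1 >= 1" "\<beta>2 >= 1" "\<beta>1 <= B" "\<beta>2 <= B" and M: "M >= 1"
 shows "card {(x, y). x \<in> {c - int M..c + int M} \<and> y \<in> {c' - int M..c' + int M} \<and> \<bar>\<beta>1 * isq x + \<beta>2 * isq y - b\<bar> < 2} <=
  (120 * (86 * B ^ 3 + 2) + 1) * M powr (2/3)"
proof -
 let ?S = "{(x, y). x \<in> {c - int M..c + int M} \<and> y \<in> {c' - int M..c' + int M} \<and> \<bar>\<beta>1 * isq x + \<beta>2 * isq y - b\<bar> < 2}"
 let ?I = "\<lambda>c. {c - int M..c + int M}"
 let ?P = "\<lambda>\<beta>1 \<beta>2 c c'. flat_arc \<beta>1 \<beta>2 b \<inter> ?I c \<times> ?I c'"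
 let ?K = "30 * (86 * B ^ 3 + 2) * M powr (2/3)"
 have fin: "finite (?P \<beta> \<beta>' c c')" for \<beta> \<beta>' c c' by auto
 have "?S \<subseteq> ?P \<beta>1 \<beta>2 c c' \<union> (\<lambda>(x, y). (x, - y)) ` ?P \<beta>1 \<beta>2 c (- c') \<union>
   (\<lambda>(y, x). (x, y)) ` ?P \<beta>2 \<beta>1 c' c \<union> (\<lambda>(y, x). (- x, y)) ` ?P \<beta>2 \<beta>1 c' (- c) \<union> {(0, 0)}"
 proof
  fix p assume "p \<in> ?S"
  then obtain x y where p: "p = (x, y)" and I: "x \<in> ?I c" "y \<in> ?I c'" and q: "\<bar>\<beta>1 * isq x + \<beta>2 * isq y - b\<bar> < 2"
   by auto
  have q': "\<bar>\<beta>2 * isq y + \<beta>1 * isq x - b\<bar> < 2" using q by (simp add: add.commute)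
  consider "\<beta>1 * \<bar>real_of_int x\<bar> <= \<beta>2 * \<bar>real_of_int y\<bar>" "y >= 1" | "\<beta>1 * \<bar>real_of_int x\<bar> <= \<beta>2 * \<bar>real_of_int y\<bar>" "y <= -1" |
   "\<beta>1 * \<bar>real_of_int x\<bar> <= \<beta>2 * \<bar>real_of_int y\<bar>" "y = 0" |
   "\<beta>2 * \<bar>real_of_int y\<bar> <= \<beta>1 * \<bar>real_of_int x\<bar>" "x >= 1" | "\<beta>2 * \<bar>real_of_int y\<bar> <= \<beta>1 * \<bar>real_of_int x\<bar>" "x <= -1" |
   "\<beta>2 * \<bar>real_of_int y\<bar> <= \<beta>1 * \<bar>real_of_int x\<bar>" "x = 0"
   by linarith
  then show "p \<in> ?P \<beta>1 \<beta>2 c c' \<union> (\<lambda>(x, y). (x, - y)) ` ?P \<beta>1 \<beta>2 c (- c') \<union>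
   (\<lambda>(y, x). (x, y)) ` ?P \<beta>2 \<beta>1 c' c \<union> (\<lambda>(y, x). (- x, y)) ` ?P \<beta>2 \<beta>1 c' (- c) \<union> {(0, 0)}"
  proof cases
   case 1
   then have "(x, y) \<in> ?P \<beta>1 \<beta>2 c c'" using I q by (auto simp: flat_arc_def)
   then show ?thesis using p by blast
  next
   case 2
   then have "(x, - y) \<in> ?P \<beta>1 \<beta>2 c (- c')" using I q by (auto simp: flat_arc_def)
   then have "(\<lambda>(x, y). (x, - y)) (x, - y) \<in> (\<lambda>(x, y). (x, - y)) ` ?P \<beta>1 \<beta>2 c (- c')" by (rule imageI)
   then show ?thesis using p by simp
  next
   case 3
   then have "\<beta>1 * \<bar>real_of_int x\<bar> <= 0" by simp
   then have "x = 0" using \<beta> by (simp add: mult_le_0_iff)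
   then show ?thesis using 3 p by simp
  next
   case 4
   then have "(y, x) \<in> ?P \<beta>2 \<beta>1 c' c" using I q' by (auto simp: flat_arc_def)
   then have "(\<lambda>(y, x). (x, y)) (y, x) \<in> (\<lambda>(y, x). (x, y)) ` ?P \<beta>2 \<beta>1 c' c" by (rule imageI)
   then show ?thesis using p by simp
  next
   case 5
   then have "(y, - x) \<in> ?P \<beta>2 \<beta>1 c' (- c)" using I q' by (auto simp: flat_arc_def)
   then have "(\<lambda>(y, x). (- x, y)) (y, - x) \<in> (\<lambda>(y, x). (- x, y)) ` ?P \<beta>2 \<beta>1 c' (- c)" by (rule imageI)
   then show ?thesis using p by simp
  next
   case 6
   then have "\<beta>2 * \<bar>real_of_int y\<bar> <= 0" by simp
   then have "y = 0" using \<beta> by (simp add: mult_le_0_iff)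
   then show ?thesis using 6 p by simp
  qed
 qed
 then have "card ?S <= card (?P \<beta>1 \<beta>2 c c' \<union> (\<lambda>(x, y). (x, - y)) ` ?P \<beta>1 \<beta>2 c (- c') \<union>
   (\<lambda>(y, x). (x, y)) ` ?P \<beta>2 \<beta>1 c' c \<union> (\<lambda>(y, x). (- x, y)) ` ?P \<beta>2 \<beta>1 c' (- c) \<union> {(0, 0)})"
  using fin by (intro card_mono finite_UnI finite_imageI) auto
 also have "... <= card (?P \<beta>1 \<beta>2 c c') + card (?P \<beta>1 \<beta>2 c (- c')) + card (?P \<beta>2 \<beta>1 c' c) + card (?P \<beta>2 \<beta>1 c' (- c)) + 1"
  by (intro order_trans[OF card_Un_le] add_mono card_image_le fin) auto
 finally have "real (card ?S) <= real (card (?P \<beta>1 \<beta>2 c c')) + real (card (?P \<beta>1 \<beta>2 c (- c'))) +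
   real (card (?P \<beta>2 \<beta>1 c' c)) + real (card (?P \<beta>2 \<beta>1 c' (- c))) + 1"
  by (simp flip: of_nat_add of_nat_Suc of_nat_le_iff)
 also have "... <= ?K + ?K + ?K + ?K + M powr (2/3)"
  using M \<beta> by (intro add_mono card_flat_arc_le ge_one_powr_ge_zero) auto
 finally show ?thesis by (simp add: algebra_simps)
qed

section \<open>The quadratic form of the torus and its dyadic levels\<close>

definition beta :: "real^'d::finite => 'd => real" where
 "beta \<alpha> j = (2 * pi / \<alpha> $ j)\<^sup>2"

definition sqf :: "real^'d::finite => int^'d => real" where
 "sqf \<alpha> n = (norm (freq \<alpha> n))\<^sup>2"

definition japanese :: "real^'d::finite => int^'d => real" where
 "japanese \<alpha> n = sqrt (1 + sqf \<alpha> n)"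

lemma sqf_eq: "sqf \<alpha> n = (\<Sum>j\<in>UNIV. beta \<alpha> j * isq (n $ j))"
 unfolding sqf_def beta_def freq_def power2_norm_eq_inner inner_vec_def
 by (simp add: power2_eq_square mult_ac)

lemma freq_add: "freq \<alpha> (n + m) = freq \<alpha> n + freq \<alpha> m"
 by (vector freq_def add_divide_distrib distrib_left)

lemma freq_diff: "freq \<alpha> (n - m) = freq \<alpha> n - freq \<alpha> m"
 by (vector freq_def diff_divide_distrib right_diff_distrib)

lemma
 assumes fin: "\<And>j. finite (I j)"
 shows finite_int_box: "finite {n::int^'d::finite. \<forall>j. n $ j \<in> I j}"
  and card_int_box: "card {n::int^'d::finite. \<forall>j. n $ j \<in> I j} = (\<Prod>j\<in>UNIV. card (I j))"
proof -
 have b: "bij_betw (\<lambda>n. ($) n) {n::int^'d. \<forall>j. n $ j \<in> I j} (PiE UNIV I)"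
  by (rule bij_betw_byWitness[where f' = vec_lambda]) auto
 show "finite {n::int^'d::finite. \<forall>j. n $ j \<in> I j}"
  using bij_betw_finite[OF b] fin by (simp add: finite_PiE)
 show "card {n::int^'d::finite. \<forall>j. n $ j \<in> I j} = (\<Prod>j\<in>UNIV. card (I j))"
  using bij_betw_same_card[OF b] by (simp add: card_PiE)
qed

abbreviation thin_shell :: "('d => real) => 'd set => ('d => int set) => real => ('d => int) set" where
 "thin_shell \<beta> A I b \<equiv> {f \<in> PiE A I. \<bar>(\<Sum>j\<in>A. \<beta> j * isq (f j)) - b\<bar> < 2}"

text \<open>Freezing the coordinates outside \<open>A\<close> only moves the centre
  \<open>b\<close>, over which the hypothesis is uniform; each frozen coordinate costs a factor
  \<open>2 * M + 1\<close>.\<close>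

lemma card_shell_split_le:
 fixes A :: "'d::finite set" and c :: "'d => int" and M :: nat
 defines "I \<equiv> (\<lambda>j. {c j - int M..c j + int M})"
 assumes K: "\<And>b. card {f \<in> PiE A I. \<bar>(\<Sum>j\<in>A. \<beta> j * isq (f j)) - b\<bar> < (2::real)} <= (K::real)"
 shows "card {m :: int^'d. (\<forall>j. m $ j \<in> I j) \<and> \<bar>(\<Sum>j\<in>UNIV. \<beta> j * isq (m $ j)) - b\<bar> < 2} <=
  (2 * real M + 1) ^ card (- A) * K"
proof -
 let ?S = "{m :: int^'d. (\<forall>j. m $ j \<in> I j) \<and> \<bar>(\<Sum>j\<in>UNIV. \<beta> j * isq (m $ j)) - b\<bar> < 2}"
 let ?fib = "\<lambda>r. {f \<in> PiE A I. \<bar>(\<Sum>j\<in>A. \<beta> j * isq (f j)) - (b - (\<Sum>j\<in>-A. \<beta> j * isq (r j)))\<bar> < 2}"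
 let ?f = "\<lambda>m :: int^'d. (restrict (($) m) (- A), restrict (($) m) A)"
 have finI: "finite (I j)" for j by (simp add: I_def)
 have fin: "finite (PiE B I)" for B by (intro finite_PiE) (auto simp: finI)
 have finf: "finite (?fib r)" for r by (rule finite_subset[OF _ fin[of A]]) auto
 have split: "(\<Sum>j\<in>UNIV. \<beta> j * isq (m $ j)) = (\<Sum>j\<in>A. \<beta> j * isq (m $ j)) + (\<Sum>j\<in>-A. \<beta> j * isq (m $ j))" for m :: "int^'d"
  by (subst sum.union_disjoint[symmetric]) (auto simp: Compl_partition)
 have "inj_on ?f ?S"
 proof (rule inj_onI)
  fix m m' :: "int^'d" assume e: "?f m = ?f m'"
  have "m $ j = m' $ j" for j
   using e by (cases "j \<in> A") (auto dest: fun_cong[of _ _ j])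
  then show "m = m'" by (simp add: vec_eq_iff)
 qed
 moreover have "?f ` ?S \<subseteq> Sigma (PiE (- A) I) ?fib"
  by (auto simp: split algebra_simps)
 ultimately have "card ?S <= card (Sigma (PiE (- A) I) ?fib)"
  by (rule card_inj_on_le) (intro finite_SigmaI fin finf)
 also have "... = (\<Sum>r\<in>PiE (- A) I. card (?fib r))"
  by (rule card_SigmaI) (auto intro: fin finf)
 finally have "real (card ?S) <= (\<Sum>r\<in>PiE (- A) I. real (card (?fib r)))"
  unfolding of_nat_sum[symmetric] of_nat_le_iff .
 also have "... <= (\<Sum>r\<in>PiE (- A) I. K)"
  by (intro sum_mono K)
 also have "... = (2 * real M + 1) ^ card (- A) * K"
  by (simp add: card_PiE I_def add.commute)
 finally show ?thesis .
qed

lemma quad_bound_le_powr: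
 assumes "\<eta> > 0" "M >= 1"
 shows "quad_bound M <= 188 * (1 + 2 powr \<eta> / \<eta>) * M powr (2 + \<eta>)"
proof -
 have "ln (2 * real M) <= (2 * real M) powr \<eta> / \<eta>" using assms by (intro ln_powr_bound) auto
 also have "... = 2 powr \<eta> / \<eta> * M powr \<eta>" by (simp add: powr_mult)
 finally have "1 + ln (2 * real M) <= M powr \<eta> + 2 powr \<eta> / \<eta> * M powr \<eta>"
  using assms by (intro add_mono ge_one_powr_ge_zero) auto
 then have "quad_bound M <= 47 * (2 * real M)\<^sup>2 * (M powr \<eta> + 2 powr \<eta> / \<eta> * M powr \<eta>)"
  unfolding quad_bound_def by (intro mult_left_mono) auto
 also have "... = 188 * (1 + 2 powr \<eta> / \<eta>) * ((real M)\<^sup>2 * M powr \<eta>)"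
  by (simp add: algebra_simps power2_eq_square)
 also have "(real M)\<^sup>2 * M powr \<eta> = M powr (2 + \<eta>)"
  using assms by (simp add: powr_add)
 finally show ?thesis .
qed

lemma card_le_shell2:
 fixes i j :: "'d::finite" and c :: "'d => int" and M :: nat
 assumes ij: "i \<noteq> j" and \<beta>: "\<And>j. 1 <= \<beta> j" "\<And>j. \<beta> j <= B" and M: "M >= 1"
 defines "I \<equiv> (\<lambda>j. {c j - int M..c j + int M})"
 shows "card (thin_shell \<beta> {i, j} I b) <=
  (120 * (86 * B ^ 3 + 2) + 1) * M powr (2/3)"
proof -
 let ?T = "{(x, y). x \<in> {c i - int M..c i + int M} \<and> y \<in> {c j - int M..c j + int M} \<and> \<bar>\<beta> i * isq x + \<beta> j * isq y - b\<bar> < 2}"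
 have "card (thin_shell \<beta> {i, j} I b) <= card ?T"
 proof (rule card_inj_on_le[of "\<lambda>f. (f i, f j)"])
  show "inj_on (\<lambda>f. (f i, f j)) (thin_shell \<beta> {i, j} I b)"
  proof (rule inj_onI)
   fix f g assume f: "f \<in> (thin_shell \<beta> {i, j} I b)" and g: "g \<in> (thin_shell \<beta> {i, j} I b)" and e: "(f i, f j) = (g i, g j)"
   have "f \<in> PiE {i, j} I" "g \<in> PiE {i, j} I" using f g by blast+
   moreover have "f x = g x" if "x \<in> {i, j}" for x using e that by (elim insertE) simp_all
   ultimately show "f = g" by (rule PiE_ext)
  qed
  show "(\<lambda>f. (f i, f j)) ` (thin_shell \<beta> {i, j} I b) \<subseteq> ?T"
  proof (rule image_subsetI)
   fix f assume f: "f \<in> (thin_shell \<beta> {i, j} I b)"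
   have m: "f \<in> PiE {i, j} I" and n: "\<bar>(\<Sum>j\<in>{i, j}. \<beta> j * isq (f j)) - b\<bar> < 2" using f by blast+
   have "(\<Sum>j\<in>{i, j}. \<beta> j * isq (f j)) = \<beta> i * isq (f i) + \<beta> j * isq (f j)" using ij by (simp add: add.assoc)
   with n have "\<bar>\<beta> i * isq (f i) + \<beta> j * isq (f j) - b\<bar> < 2" by (simp only:)
   moreover have "f i \<in> I i" "f j \<in> I j" using m by (auto dest: PiE_mem)
   ultimately show "(f i, f j) \<in> ?T" by (simp add: I_def)
  qed
  show "finite ?T" by (rule finite_subset[of _ "{c i - int M..c i + int M} \<times> {c j - int M..c j + int M}"]) auto
 qed
 also have "real ... <= (120 * (86 * B ^ 3 + 2) + 1) * M powr (2/3)"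
  by (rule card_two_squares_le) (use \<beta> M in auto)
 finally show ?thesis by simp
qed

lemma card_le_shell3:
 fixes j0 j1 j2 :: "'d::finite" and c :: "'d => int" and M :: nat
 assumes d: "distinct [j0, j1, j2]" and \<beta>: "\<And>j. 1 <= \<beta> j" and M: "M >= 1"
 defines "I \<equiv> (\<lambda>j. {c j - int M..c j + int M})"
 shows "card (thin_shell \<beta> {j0, j1, j2} I b) <=
  8 * (sqrt (4 * quad_bound M) * sqrt (2 * (2 * real M + 1)))"
proof -
 define J where "J k = (if k = 0 then j0 else if k = 1 then j1 else j2)" for k :: nat
 have J: "J 0 = j0" "J 1 = j1" "J 2 = j2" by (auto simp: J_def)
 let ?c = "\<lambda>k. c (J k)" and ?\<beta> = "\<lambda>k. \<beta> (J k)"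
 let ?I = "\<lambda>k. {?c k - int M..?c k + int M}"
 let ?T = "{(p, z). p \<in> ?I 0 \<times> ?I 1 \<and> z \<in> ?I 2 \<and>
   \<bar>(?\<beta> 0 * isq (fst p) + ?\<beta> 1 * isq (snd p)) + ?\<beta> 2 * isq z - b\<bar> < real 2}"
 have "card (thin_shell \<beta> {j0, j1, j2} I b) <= card ?T"
 proof (rule card_inj_on_le[of "\<lambda>f. ((f j0, f j1), f j2)"])
  show "inj_on (\<lambda>f. ((f j0, f j1), f j2)) (thin_shell \<beta> {j0, j1, j2} I b)"
  proof (rule inj_onI)
   fix f g assume f: "f \<in> (thin_shell \<beta> {j0, j1, j2} I b)" and g: "g \<in> (thin_shell \<beta> {j0, j1, j2} I b)" and e: "((f j0, f j1), f j2) = ((g j0, g j1), g j2)"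
   have "f \<in> PiE {j0, j1, j2} I" "g \<in> PiE {j0, j1, j2} I" using f g by blast+
   moreover have "f x = g x" if "x \<in> {j0, j1, j2}" for x using e that by (elim insertE) simp_all
   ultimately show "f = g" by (rule PiE_ext)
  qed
  show "(\<lambda>f. ((f j0, f j1), f j2)) ` (thin_shell \<beta> {j0, j1, j2} I b) \<subseteq> ?T"
  proof (rule image_subsetI)
   fix f assume f: "f \<in> (thin_shell \<beta> {j0, j1, j2} I b)"
   have m: "f \<in> PiE {j0, j1, j2} I" and n: "\<bar>(\<Sum>j\<in>{j0, j1, j2}. \<beta> j * isq (f j)) - b\<bar> < 2" using f by blast+
   have "(\<Sum>j\<in>{j0, j1, j2}. \<beta> j * isq (f j)) = (\<beta> j0 * isq (f j0) + \<beta> j1 * isq (f j1)) + \<beta> j2 * isq (f j2)" using d by (simp add: add.assoc)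
   with n have "\<bar>(\<beta> j0 * isq (f j0) + \<beta> j1 * isq (f j1)) + \<beta> j2 * isq (f j2) - b\<bar> < 2" by (simp only:)
   moreover have "f j0 \<in> I j0" "f j1 \<in> I j1" "f j2 \<in> I j2" using m by (auto dest: PiE_mem)
   ultimately show "((f j0, f j1), f j2) \<in> ?T" by (simp add: I_def J J(2)[unfolded One_nat_def])
  qed
  show "finite ?T" by (rule finite_subset[of _ "(?I 0 \<times> ?I 1) \<times> ?I 2"]) auto
 qed
 also have "real ... <= 8 * (sqrt (4 * quad_bound M) * sqrt (2 * (2 * real M + 1)))"
  by (rule card_three_squares_le) (use \<beta> M in auto)
 finally show ?thesis by simp
qed

lemma card_le_shell4:
 fixes j0 j1 j2 j3 :: "'d::finite" and c :: "'d => int" and M :: nat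
 assumes d: "distinct [j0, j1, j2, j3]" and \<beta>: "\<And>j. 1 <= \<beta> j" and M: "M >= 1"
 defines "I \<equiv> (\<lambda>j. {c j - int M..c j + int M})"
 shows "card (thin_shell \<beta> {j0, j1, j2, j3} I b) <=
  32 * quad_bound M"
proof -
 define J where "J k = (if k = 0 then j0 else if k = 1 then j1 else if k = 2 then j2 else j3)" for k :: nat
 have J: "J 0 = j0" "J 1 = j1" "J 2 = j2" "J 3 = j3" by (auto simp: J_def)
 let ?c = "\<lambda>k. c (J k)" and ?\<beta> = "\<lambda>k. \<beta> (J k)"
 let ?I = "\<lambda>k. {?c k - int M..?c k + int M}"
 let ?T = "{(p, r). p \<in> ?I 0 \<times> ?I 1 \<and> r \<in> ?I 2 \<times> ?I 3 \<and>
   \<bar>(?\<beta> 0 * isq (fst p) + ?\<beta> 1 * isq (snd p)) + (?\<beta> 2 * isq (fst r) + ?\<beta> 3 * isq (snd r)) - b\<bar> < real 2}"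
 have "card (thin_shell \<beta> {j0, j1, j2, j3} I b) <= card ?T"
 proof (rule card_inj_on_le[of "\<lambda>f. ((f j0, f j1), (f j2, f j3))"])
  show "inj_on (\<lambda>f. ((f j0, f j1), (f j2, f j3))) (thin_shell \<beta> {j0, j1, j2, j3} I b)"
  proof (rule inj_onI)
   fix f g assume f: "f \<in> (thin_shell \<beta> {j0, j1, j2, j3} I b)" and g: "g \<in> (thin_shell \<beta> {j0, j1, j2, j3} I b)" and e: "((f j0, f j1), (f j2, f j3)) = ((g j0, g j1), (g j2, g j3))"
   have "f \<in> PiE {j0, j1, j2, j3} I" "g \<in> PiE {j0, j1, j2, j3} I" using f g by blast+
   moreover have "f x = g x" if "x \<in> {j0, j1, j2, j3}" for x using e that by (elim insertE) simp_all
   ultimately show "f = g" by (rule PiE_ext)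
  qed
  show "(\<lambda>f. ((f j0, f j1), (f j2, f j3))) ` (thin_shell \<beta> {j0, j1, j2, j3} I b) \<subseteq> ?T"
  proof (rule image_subsetI)
   fix f assume f: "f \<in> (thin_shell \<beta> {j0, j1, j2, j3} I b)"
   have m: "f \<in> PiE {j0, j1, j2, j3} I" and n: "\<bar>(\<Sum>j\<in>{j0, j1, j2, j3}. \<beta> j * isq (f j)) - b\<bar> < 2" using f by blast+
   have "(\<Sum>j\<in>{j0, j1, j2, j3}. \<beta> j * isq (f j)) = (\<beta> j0 * isq (f j0) + \<beta> j1 * isq (f j1)) + (\<beta> j2 * isq (f j2) + \<beta> j3 * isq (f j3))" using d by (simp add: add.assoc)
   with n have "\<bar>(\<beta> j0 * isq (f j0) + \<beta> j1 * isq (f j1)) + (\<beta> j2 * isq (f j2) + \<beta> j3 * isq (f j3)) - b\<bar> < 2" by (simp only:)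
   moreover have "f j0 \<in> I j0" "f j1 \<in> I j1" "f j2 \<in> I j2" "f j3 \<in> I j3" using m by (auto dest: PiE_mem)
   ultimately show "((f j0, f j1), (f j2, f j3)) \<in> ?T" by (simp add: I_def J J(2)[unfolded One_nat_def])
  qed
  show "finite ?T" by (rule finite_subset[of _ "(?I 0 \<times> ?I 1) \<times> (?I 2 \<times> ?I 3)"]) auto
 qed
 also have "real ... <= 32 * quad_bound M"
  by (rule card_four_squares_le) (use \<beta> M in auto)
 finally show ?thesis by simp
qed

abbreviation box_shell :: "real^'d::finite => ('d => int) => nat => real => (int^'d) set" where
 "box_shell \<alpha> c M b \<equiv> {m. (\<forall>j. m $ j \<in> {c j - int M..c j + int M}) \<and> \<bar>sqf \<alpha> m - b\<bar> < 2}"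

text \<open>The exponent \<open>2 * \<sigma>\<close> is 2/3 in dimension 2, where no epsilon is
  lost, slightly more than 3/2 in dimension 3, and slightly more than d - 2 from dimension 4 on:
  four coordinates give M^2 up to a logarithm and the other d - 4 are free. The logarithm is
  absorbed by part of the gap \<open>\<eta>\<close> to \<open>s\<close>.\<close>

lemma count_shell:
 fixes \<alpha> :: "real^'d::finite" and s B :: real
 assumes "CARD('d) >= 2" and \<beta>: "\<And>j. 1 <= beta \<alpha> j" "\<And>j. beta \<alpha> j <= B"
  and s2: "CARD('d) = 2 ==> s > 1/3"
  and s3: "CARD('d) = 3 ==> s > 3/4"
  and s4: "CARD('d) >= 4 ==> s > real CARD('d) / 2 - 1"
 obtains C \<sigma> where "C >= 1" "0 <= \<sigma>" "\<sigma> < s"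
  "\<And>(M::nat) (c::'d => int) b. M >= 1 ==>
   card (box_shell \<alpha> c M b) <= C * M powr (2 * \<sigma>)"
proof -
 have B: "B >= 1" using order_trans[OF \<beta>(1) \<beta>(2)] .
 have split: "card (box_shell \<alpha> c M b) <= (2 * real M + 1) ^ card (- A) * K"
  if "\<And>b. card {f \<in> PiE A (\<lambda>j. {c j - int M..c j + int M}). \<bar>(\<Sum>j\<in>A. beta \<alpha> j * isq (f j)) - b\<bar> < (2::real)} <= (K::real)"
  for A :: "'d set" and c M b K
  unfolding sqf_eq by (rule card_shell_split_le[OF that])
 consider "CARD('d) = 2" | "CARD('d) = 3" | "CARD('d) >= 4" using assms(1) by linarith
 then show ?thesis
 proof cases
  case 1
  then obtain i j :: 'd where ij: "UNIV = {i, j}" "i \<noteq> j" by (auto simp: card_2_iff)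
  show ?thesis
  proof (rule that[of "120 * (86 * B ^ 3 + 2) + 1" "1/3"])
   show "120 * (86 * B ^ 3 + 2) + 1 >= 1" using B by simp
   show "1/3 < s" using s2[OF 1] by simp
   fix M :: nat and c :: "'d => int" and b assume M: "M >= 1"
   have "card (- {i, j}) = 0" using ij(1) by (metis Compl_UNIV_eq card.empty)
   then show "card (box_shell \<alpha> c M b) <= (120 * (86 * B ^ 3 + 2) + 1) * M powr (2 * (1/3))"
    using split[OF card_le_shell2[OF ij(2) \<beta> M, of c], of b] by simp
  qed simp
 next
  case 2
  then obtain j0 j1 j2 :: 'd where j: "UNIV = {j0, j1, j2}" "distinct [j0, j1, j2]"
   by (auto simp: card_3_iff)
  define \<eta> where "\<eta> = s - 3/4"
  have \<eta>: "\<eta> > 0" using s3[OF 2] by (simp add: \<eta>_def)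
  define Kq where "Kq = 188 * (1 + 2 powr \<eta> / \<eta>)"
  have Kq: "Kq >= 188" using \<eta> by (simp add: Kq_def)
  show ?thesis
  proof (rule that[of "8 * sqrt (24 * Kq)" "3/4 + \<eta>/4"])
   have "1 <= sqrt (24 * Kq)" using Kq by (intro real_le_rsqrt) auto
   then show "8 * sqrt (24 * Kq) >= 1" by linarith
   show "3/4 + \<eta>/4 < s" "0 <= 3/4 + \<eta>/4" using \<eta> unfolding \<eta>_def by argo+
   fix M :: nat and c :: "'d => int" and b assume M: "M >= 1"
   have "card (- {j0, j1, j2}) = 0" using j(1) by (metis Compl_UNIV_eq card.empty)
   then have "card (box_shell \<alpha> c M b) <=
     8 * (sqrt (4 * quad_bound M) * sqrt (2 * (2 * real M + 1)))"
    using split[OF card_le_shell3[OF j(2) \<beta>(1) M, of c], of b] by simp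
   also have "... <= 8 * (sqrt (4 * (Kq * M powr (2 + \<eta>))) * sqrt (2 * (3 * real M)))"
    using quad_bound_le_powr[OF \<eta> M] M quad_bound_nonneg[OF M]
    by (intro mult_left_mono mult_mono real_sqrt_le_mono) (auto simp: Kq_def)
   also have "... = 8 * sqrt (24 * Kq * (M powr (2 + \<eta>) * M powr 1))"
    using M by (simp add: real_sqrt_mult[symmetric] mult_ac)
   also have "M powr (2 + \<eta>) * M powr 1 = (M powr (3/2 + \<eta>/2))\<^sup>2"
    unfolding power2_eq_square powr_add[symmetric] by (rule arg_cong[of _ _ "(powr) (real M)"]) simp
   also have "8 * sqrt (24 * Kq * (M powr (3/2 + \<eta>/2))\<^sup>2) = 8 * sqrt (24 * Kq) * M powr (2 * (3/4 + \<eta>/4))"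
    by (simp add: real_sqrt_mult)
   finally show "card (box_shell \<alpha> c M b) <=
     8 * sqrt (24 * Kq) * M powr (2 * (3/4 + \<eta>/4))" .
  qed
 next
  case 3
  let ?d = "CARD('d)"
  obtain A :: "'d set" where A: "card A = 4" using 3 by (metis obtain_subset_with_card_n)
  then obtain xs where xs: "distinct xs" "set xs = A" "length xs = 4"
   by (metis finite_distinct_list finite distinct_card)
  then obtain j0 j1 j2 j3 where "xs = [j0, j1, j2, j3]"
   by (auto simp: eval_nat_numeral length_Suc_conv)
  then have j: "distinct [j0, j1, j2, j3]" "A = {j0, j1, j2, j3}" using xs by auto
  define \<eta> where "\<eta> = s - (real ?d / 2 - 1)"
  have \<eta>: "\<eta> > 0" using s4[OF 3] by (simp add: \<eta>_def)
  define Kq where "Kq = 188 * (1 + 2 powr \<eta> / \<eta>)"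
  have Kq: "Kq >= 188" using \<eta> by (simp add: Kq_def)
  show ?thesis
  proof (rule that[of "3 ^ (?d - 4) * (32 * Kq)" "(real ?d - 2 + \<eta>) / 2"])
   have "1 * 1 <= (3::real) ^ (?d - 4) * (32 * Kq)" using Kq by (intro mult_mono) auto
   then show "3 ^ (?d - 4) * (32 * Kq) >= 1" by simp
   show "(real ?d - 2 + \<eta>) / 2 < s" using \<eta> by (simp add: \<eta>_def field_simps)
   show "0 <= (real ?d - 2 + \<eta>) / 2" using 3 \<eta> by simp
   fix M :: nat and c :: "'d => int" and b assume M: "M >= 1"
   have cA: "card (- A) = ?d - 4" using card_Diff_subset[of A UNIV] A by (simp add: Compl_eq_Diff_UNIV)
   have "card (box_shell \<alpha> c M b) <=
     (2 * real M + 1) ^ (?d - 4) * (32 * quad_bound M)"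
    using split[OF card_le_shell4[OF j(1) \<beta>(1) M, of c], of b] unfolding j(2)[symmetric] cA .
   also have "... <= (3 * real M) ^ (?d - 4) * (32 * (Kq * M powr (2 + \<eta>)))"
    using quad_bound_le_powr[OF \<eta> M] M quad_bound_nonneg[OF M]
    by (intro mult_mono power_mono) (auto simp: Kq_def)
   also have "... = 3 ^ (?d - 4) * (32 * Kq) * (real M powr (real (?d - 4)) * M powr (2 + \<eta>))"
    using M by (simp add: power_mult_distrib powr_realpow)
   also have "real M powr (real (?d - 4)) * M powr (2 + \<eta>) = M powr (2 * ((real ?d - 2 + \<eta>) / 2))"
    unfolding powr_add[symmetric] by (rule arg_cong[of _ _ "(powr) (real M)"]) (use 3 in \<open>simp add: of_nat_diff\<close>)
   finally show "card (box_shell \<alpha> c M b) <=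
     3 ^ (?d - 4) * (32 * Kq) * M powr (2 * ((real ?d - 2 + \<eta>) / 2))" .
  qed
 qed
qed

definition level :: "int^'d::finite => nat" where
 "level n = (LEAST m. \<forall>j. \<bar>n $ j\<bar> <= 2 ^ m)"

lemma level_ex: "\<exists>m::nat. \<forall>j. \<bar>(n::int^'d::finite) $ j\<bar> <= 2 ^ m"
proof -
 define K where "K = Max (range (\<lambda>j. nat \<bar>n $ j\<bar>))"
 have "\<bar>n $ j\<bar> <= 2 ^ K" for j
 proof -
  have "nat \<bar>n $ j\<bar> <= K" unfolding K_def by (intro Max_ge) auto
  also have "K < 2 ^ K" by (rule less_exp)
  finally have "int (nat \<bar>n $ j\<bar>) < int (2 ^ K)" by (simp only: of_nat_less_iff)
  then show ?thesis by simp
 qed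
 then show ?thesis by blast
qed

lemma level_le_iff: "level n <= m \<longleftrightarrow> (\<forall>j. \<bar>(n::int^'d::finite) $ j\<bar> <= 2 ^ m)"
proof
 assume "level n <= m"
 then have "(2::int) ^ level n <= 2 ^ m" by (intro power_increasing) auto
 moreover have "\<forall>j. \<bar>n $ j\<bar> <= 2 ^ level n"
  unfolding level_def by (rule LeastI_ex[OF level_ex])
 ultimately show "\<forall>j. \<bar>n $ j\<bar> <= 2 ^ m" by (meson order_trans)
next
 assume "\<forall>j. \<bar>n $ j\<bar> <= 2 ^ m"
 then show "level n <= m" unfolding level_def by (rule Least_le)
qed

lemma level_le_set: "{n::int^'d::finite. level n <= m} = {n. \<forall>j. n $ j \<in> {- (2 ^ m)..2 ^ m}}"
 by (auto simp: level_le_iff abs_le_iff minus_le_iff)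

lemma finite_level_le: "finite {n::int^'d::finite. level n <= m}"
 unfolding level_le_set by (rule finite_int_box) simp

lemma card_level_le_set: "card {n::int^'d::finite. level n <= m} <= 3 ^ CARD('d) * 2 powr (real CARD('d) * m)"
proof -
 have "card {n::int^'d::finite. level n <= m} = (2 * 2 ^ m + 1) ^ CARD('d)"
 proof -
  have "card {- (2 ^ m)..2 ^ m :: int} = 2 * 2 ^ m + 1"
   by (simp add: nat_eq_iff)
  then show ?thesis unfolding level_le_set
   by (subst card_int_box) (simp_all add: prod_constant del: card_atLeastAtMost_int)
 qed
 also have "real ... = (2 * 2 ^ m + 1) ^ CARD('d)" by (simp add: add.commute)
 also have "... <= (3 * 2 ^ m) ^ CARD('d)" by (intro power_mono) auto
 also have "... = 3 ^ CARD('d) * 2 powr (real CARD('d) * m)"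
  by (simp add: power_mult_distrib powr_realpow[symmetric] powr_powr mult.commute)
 finally show ?thesis by simp
qed

lemma beta_bounds:
 fixes \<alpha> :: "real^'d::finite"
 assumes "\<alpha> $ j \<in> {1/2..2}"
 shows "9 <= beta \<alpha> j" "beta \<alpha> j <= 16 * pi\<^sup>2"
proof -
 have a: "1/2 <= \<alpha> $ j" "\<alpha> $ j <= 2" using assms by auto
 have "3 <= 2 * pi / \<alpha> $ j"
 proof -
  have "3 * \<alpha> $ j <= 3 * 2" using a by simp
  also have "... <= 2 * pi" using pi_gt3 by simp
  finally show ?thesis using a by (simp add: field_simps)
 qed
 then have "3\<^sup>2 <= beta \<alpha> j" unfolding beta_def by (intro power_mono) auto
 then show "9 <= beta \<alpha> j" by simp
 have "2 * pi / \<alpha> $ j <= 2 * pi / (1/2)" using a by (intro divide_left_mono) auto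
 then have "beta \<alpha> j <= (4 * pi)\<^sup>2" unfolding beta_def using a by (intro power_mono) auto
 then show "beta \<alpha> j <= 16 * pi\<^sup>2" by (simp add: power_mult_distrib)
qed

lemma sqf_nonneg: "sqf \<alpha> n >= 0" by (simp add: sqf_def)

lemma japanese_eq_norm: "japanese \<alpha> n = norm (1::real, freq \<alpha> n)"
 by (simp add: japanese_def sqf_def norm_Pair)

lemma norm_freq_le_japanese: "norm (freq \<alpha> n) <= japanese \<alpha> n"
 unfolding japanese_def sqf_def by (intro real_le_rsqrt) auto

text \<open>The bracket is the norm of \<open>(1, freq)\<close>; the 1 is given to the first
  summand, and the triangle inequality applies.\<close>

lemma japanese_out: "japanese \<alpha> (n1 - n2 + n3) <= japanese \<alpha> n1 + japanese \<alpha> n2 + japanese \<alpha> n3"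
proof -
 have "(1::real, freq \<alpha> (n1 - n2 + n3)) = (1, freq \<alpha> n1) + (0, - freq \<alpha> n2) + (0, freq \<alpha> n3)"
  by (simp add: freq_add freq_diff)
 then have "japanese \<alpha> (n1 - n2 + n3) <= norm (1::real, freq \<alpha> n1) + norm (0::real, - freq \<alpha> n2) + norm (0::real, freq \<alpha> n3)"
  unfolding japanese_eq_norm by (simp only:) (meson norm_triangle_ineq norm_triangle_mono order_refl)
 also have "... <= japanese \<alpha> n1 + japanese \<alpha> n2 + japanese \<alpha> n3"
  using norm_freq_le_japanese[of \<alpha> n2] norm_freq_le_japanese[of \<alpha> n3]
  by (simp add: japanese_eq_norm norm_Pair)
 finally show ?thesis .
qed

lemma level_le_japanese:
 fixes \<alpha> :: "real^'d::finite"
 assumes "\<And>j. \<alpha> $ j \<in> {1/2..2}"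
 shows "2 powr (level n) <= japanese \<alpha> n"
proof (cases "level n")
 case 0
 then show ?thesis using sqf_nonneg[of \<alpha> n] by (simp add: japanese_def)
next
 case (Suc m)
 then have "\<not> level n <= m" by simp
 then obtain j where j: "2 ^ m < \<bar>n $ j\<bar>" unfolding level_le_iff by (auto simp: not_le)
 then have "real_of_int (2 ^ m) <= real_of_int \<bar>n $ j\<bar>" by (simp only: of_int_le_iff)
 then have "(2 ^ m)\<^sup>2 <= isq (n $ j)" using power_mono[of "2 ^ m" "real_of_int \<bar>n $ j\<bar>" 2] by simp
 \<comment> \<open>The level only guarantees a coordinate above \<open>2 ^ m\<close>, half of what
   is claimed; \<open>beta \<alpha> j >= 9\<close> makes up for the factor 4 in the squares.\<close>
 then have "4 * (2 ^ m)\<^sup>2 <= beta \<alpha> j * isq (n $ j)"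
  using beta_bounds(1)[OF assms, of j] by (intro mult_mono) auto
 also have "... <= sqf \<alpha> n" unfolding sqf_eq
  by (rule member_le_sum) (auto intro!: mult_nonneg_nonneg order_trans[OF _ beta_bounds(1)[OF assms]])
 finally have "(2 ^ Suc m)\<^sup>2 <= 1 + sqf \<alpha> n" by (simp add: power_mult_distrib)
 then have "2 ^ Suc m <= japanese \<alpha> n" unfolding japanese_def by (intro real_le_rsqrt) auto
 then show ?thesis using Suc by (simp add: powr_realpow[symmetric] del: of_nat_Suc power_Suc)
qed

text \<open>Turns the representation count of \<open>dispersive\<close>, with its two terms in
  \<open>n\<close>, into a count on a single shell, that of the point
  \<open>2 * n - a\<close>.\<close>

lemma sqf_parallelogram: fixes \<alpha> :: "real^'b::finite" shows "sqf \<alpha> n + sqf \<alpha> (a - n) = (sqf \<alpha> a + sqf \<alpha> (n + n - a)) / 2"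
proof -
 have "x \<bullet> x + (b - x) \<bullet> (b - x) = (b \<bullet> b + (x + x - b) \<bullet> (x + x - b)) / 2" for x b :: "real^'b"
  unfolding inner_diff_left inner_diff_right inner_add_left inner_add_right by (simp add: inner_commute)
 then show ?thesis unfolding sqf_def freq_add freq_diff power2_norm_eq_inner .
qed

text \<open>The injective map sending \<open>n\<close> to \<open>n + n - a\<close> doubles the
  radius of the box and the width of the shell; hence the half-width 2 in all shell counts. The box
  centre \<open>- a\<close> is arbitrary, which is why the counts had to be uniform in it.\<close>

lemma dispersive_torus:
 fixes \<alpha> :: "real^'d::finite" and s :: real
 assumes "CARD('d) >= 2"
  and \<alpha>: "\<And>j. \<alpha> $ j \<in> {1/2..2}"
  and "CARD('d) = 2 ==> s > 1/3"
  and "CARD('d) = 3 ==> s > 3/4"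
  and "CARD('d) >= 4 ==> s > real CARD('d) / 2 - 1"
 obtains C \<sigma> where "dispersive (sqf \<alpha>) (japanese \<alpha>) level C (real CARD('d)) \<sigma> s"
proof -
 have \<beta>: "1 <= beta \<alpha> j" "beta \<alpha> j <= 16 * pi\<^sup>2" for j
  using beta_bounds[OF \<alpha>, of j] by auto
 show ?thesis
 proof (rule count_shell[OF assms(1) \<beta>, of s])
 fix C \<sigma> assume C: "C >= 1" "0 <= \<sigma>" "\<sigma> < s" and count:
  "\<And>(M::nat) (c::'d => int) b. M >= 1 ==>
   card (box_shell \<alpha> c M b) <= C * M powr (2 * \<sigma>)"
 define K where "K = max (C * 2 powr (2 * \<sigma>)) (3 ^ CARD('d))"
 have K: "K >= 1" "C * 2 powr (2 * \<sigma>) <= K" "3 ^ CARD('d) <= K"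
 proof -
  have "(1::real) <= 3 ^ CARD('d)" by simp
  then show "K >= 1" unfolding K_def by linarith
 qed (auto simp: K_def)
 have "dispersive (sqf \<alpha>) (japanese \<alpha>) level K (real CARD('d)) \<sigma> s"
 proof
  fix m :: nat
  have sub: "{n::int^'d. level n = m} \<subseteq> {n. level n <= m}" by auto
  show "finite {n::int^'d. level n = m}" by (rule finite_subset[OF sub finite_level_le])
  have "card {n::int^'d. level n = m} <= card {n::int^'d. level n <= m}"
   by (rule card_mono[OF finite_level_le sub])
  also have "real ... <= 3 ^ CARD('d) * 2 powr (real CARD('d) * m)" by (rule card_level_le_set)
  also have "... <= K * 2 powr (real CARD('d) * m)" using K by (intro mult_right_mono) auto
  finally show "real (card {n::int^'d. level n = m}) <= K * 2 powr (real CARD('d) * m)" by simp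
  fix a :: "int^'d" and b :: real
  let ?S = "{n. level n = m \<and> \<bar>sqf \<alpha> n + sqf \<alpha> (a - n) - b\<bar> < 1}"
  let ?M = "2 ^ Suc m :: nat"
  let ?T = "{k::int^'d. (\<forall>j. k $ j \<in> {- a $ j - int ?M..- a $ j + int ?M}) \<and> \<bar>sqf \<alpha> k - (2 * b - sqf \<alpha> a)\<bar> < 2}"
  have "card ?S <= card ?T"
  proof (rule card_inj_on_le[of "\<lambda>n. n + n - a"])
   show "inj_on (\<lambda>n. n + n - a) ?S" by (rule inj_onI) (simp add: vec_eq_iff)
   show "(\<lambda>n. n + n - a) ` ?S \<subseteq> ?T"
   proof (rule image_subsetI)
    fix n assume n: "n \<in> ?S"
    then have "level n <= m" by simp
    then have l: "\<bar>n $ j\<bar> <= 2 ^ m" for j unfolding level_le_iff by blast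
    have "(n + n - a) $ j \<in> {- a $ j - int ?M..- a $ j + int ?M}" for j
    proof -
     have "- (2 ^ m) <= n $ j" "n $ j <= 2 ^ m" using l[of j] by linarith+
     then show ?thesis by simp
    qed
    moreover have "\<bar>sqf \<alpha> (n + n - a) - (2 * b - sqf \<alpha> a)\<bar> < 2"
    proof -
     have "\<bar>sqf \<alpha> n + sqf \<alpha> (a - n) - b\<bar> < 1" using n by simp
     moreover have "sqf \<alpha> (n + n - a) - (2 * b - sqf \<alpha> a) = 2 * (sqf \<alpha> n + sqf \<alpha> (a - n) - b)"
      using sqf_parallelogram[of \<alpha> n a] by simp
     ultimately show ?thesis by (simp add: abs_mult)
    qed
    ultimately show "n + n - a \<in> ?T" by (intro CollectI conjI allI)
   qed
   show "finite ?T"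
    by (rule finite_subset[OF _ finite_int_box[of "\<lambda>j. {- a $ j - int ?M..- a $ j + int ?M}"]]) (rule subsetI, elim CollectE conjE, rule CollectI, assumption, simp)
  qed
  also have "real ... <= C * ?M powr (2 * \<sigma>)" by (rule count) simp
  also have "... = C * 2 powr (2 * \<sigma>) * 2 powr (2 * \<sigma> * m)"
   by (simp add: powr_realpow[symmetric] powr_mult powr_powr mult_ac)
  also have "... <= K * 2 powr (2 * \<sigma> * m)" using K by (intro mult_right_mono) auto
  finally show "real (card ?S) <= K * 2 powr (2 * \<sigma> * m)" by simp
 qed (use level_le_japanese[OF \<alpha>] japanese_out assms(1) K C in auto)
 then show thesis by (rule that)
 qed (use assms(3-5) in auto)
qed

section \<open>Cosine series in time\<close>

definition cosT :: "real => nat => real => real" where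
 "cosT T k t = cos (pi * real k * t / T)"

lemma cosT_0 [simp]: "cosT T 0 t = 1" by (simp add: cosT_def)

lemma abs_cosT_le: "\<bar>cosT T k t\<bar> <= 1" by (simp add: cosT_def)

lemma continuous_cosT [continuous_intros]: "continuous_on S (cosT T k)"
 unfolding cosT_def by (cases "T = 0") (auto intro!: continuous_intros)

lemma cosT_mult: "cosT T k t * cosT T l t = (cosT T (k + l) t + cosT T (if l <= k then k - l else l - k) t) / 2"
proof -
 have "cos (pi * (real k - real l) * t / T) = cosT T (if l <= k then k - l else l - k) t"
 proof (cases "l <= k")
  case False
  have "pi * (real k - real l) * t / T = - (pi * (real l - real k) * t / T)" by (simp add: algebra_simps diff_divide_distrib)
  then show ?thesis using False by (simp add: cosT_def of_nat_diff)
 qed (simp add: cosT_def of_nat_diff)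
 then show ?thesis unfolding cosT_def cos_times_cos
  by (simp add: add_divide_distrib diff_divide_distrib algebra_simps)
qed

lemma integral_cosT:
 assumes T: "T > 0"
 shows "integral {0..T} (cosT T k) = (if k = 0 then T else 0)"
proof (cases "k = 0")
 case False
 define w where "w = pi * real k / T"
 have w: "w \<noteq> 0" using False T by (simp add: w_def)
 have "((\<lambda>t. cos (w * t)) has_integral sin (w * T) / w - sin (w * 0) / w) {0..T}"
  by (rule fundamental_theorem_of_calculus)
   (use T w in \<open>auto intro!: derivative_eq_intros simp flip: has_real_derivative_iff_has_vector_derivative\<close>)
 moreover have "sin (w * T) = 0"
 proof -
  have "w * T = real k * pi" using T by (simp add: w_def)
  then show ?thesis by (simp add: sin_npi)
 qed
 ultimately have "integral {0..T} (\<lambda>t. cos (w * t)) = 0" by (simp add: integral_unique)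
 moreover have "cosT T k = (\<lambda>t. cos (w * t))" by (auto simp: cosT_def w_def fun_eq_iff)
 ultimately show ?thesis using False by simp
next
 case True
 then have "cosT T k = (\<lambda>_. 1)" by (simp add: fun_eq_iff)
 then show ?thesis using T True by simp
qed

definition cosN :: "nat => real" where "cosN k = (if k = 0 then 1 else 2)"

lemma integral_cosT_mult:
 assumes T: "T > 0"
 shows "integral {0..T} (\<lambda>t. cosT T k t * cosT T l t) = (if k = l then T / cosN k else 0)"
proof -
 let ?m = "if l <= k then k - l else l - k"
 have i: "cosT T j integrable_on {0..T}" for j by (intro integrable_continuous_interval continuous_intros)
 have "integral {0..T} (\<lambda>t. cosT T k t * cosT T l t) = integral {0..T} (\<lambda>t. (cosT T (k + l) t + cosT T ?m t) / 2)"
  by (simp only: cosT_mult)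
 also have "... = (integral {0..T} (cosT T (k + l)) + integral {0..T} (cosT T ?m)) / 2"
  using i by (subst integral_divide) (simp_all add: Henstock_Kurzweil_Integration.integral_add)
 also have "... = (if k = l then T / cosN k else 0)"
  unfolding integral_cosT[OF T] by (auto simp: cosN_def)
 finally show ?thesis .
qed

text \<open>Uniqueness of cosine coefficients, by uniform approximation with polynomials in the cosine.\<close>

lemma cosT_orthogonal_imp_zero_real:
 fixes f :: "real => real"
 assumes T: "T > 0" and f: "continuous_on {0..T} f"
  and orth: "\<And>k. integral {0..T} (\<lambda>t. f t * cosT T k t) = 0" and t: "t \<in> {0..T}"
 shows "f t = 0"
proof -
 define c where "c t = cos (pi * t / T)" for t
 have c1: "c = cosT T 1" by (auto simp: c_def cosT_def)
 have cc: "continuous_on S c" for S unfolding c1 by (rule continuous_cosT)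
 have fi: "(\<lambda>t. f t * (c t ^ i * cosT T k t)) integrable_on {0..T}" for i k
  by (intro integrable_continuous_interval continuous_intros f cc)
 \<comment> \<open>Multiplying \<open>cosT T k\<close> by \<open>c\<close> averages two neighbouring
   cosines, so orthogonality propagates from the cosines to all powers of \<open>c\<close>.\<close>
 have pow: "integral {0..T} (\<lambda>t. f t * (c t ^ i * cosT T k t)) = 0" for i k
 proof (induction i arbitrary: k)
  case (Suc i)
  have e: "f t * (c t ^ Suc i * cosT T k t) = (f t * (c t ^ i * cosT T (k + 1) t) + f t * (c t ^ i * cosT T (if 1 <= k then k - 1 else 1 - k) t)) / 2" for t
  proof -
   have "f t * (c t ^ Suc i * cosT T k t) = f t * (c t ^ i * (cosT T k t * cosT T 1 t))"
    by (simp add: c1)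
   then show ?thesis unfolding cosT_mult by (simp add: algebra_simps)
  qed
  have "integral {0..T} (\<lambda>t. f t * (c t ^ Suc i * cosT T k t)) =
   (integral {0..T} (\<lambda>t. f t * (c t ^ i * cosT T (k + 1) t)) +
    integral {0..T} (\<lambda>t. f t * (c t ^ i * cosT T (if 1 <= k then k - 1 else 1 - k) t))) / 2"
   unfolding e integral_divide by (subst Henstock_Kurzweil_Integration.integral_add[OF fi fi]) (rule refl)
  also have "... = 0" unfolding Suc by simp
  finally show ?case .
 qed (simp add: orth)
 \<comment> \<open>Since \<open>c\<close> is strictly monotone on [0,T], \<open>f\<close> is a
   continuous function of \<open>c\<close> on [-1,1], where polynomials are dense.\<close>
 define g where "g s = f (T / pi * arccos s)" for s
 have g: "continuous_on {-1..1} g" unfolding g_def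
 proof (rule continuous_on_compose2[OF f])
  show "continuous_on {-1..1} (\<lambda>s. T / pi * arccos s)"
   by (intro continuous_intros continuous_on_arccos') 
  show "(\<lambda>s. T / pi * arccos s) ` {-1..1} \<subseteq> {0..T}"
  proof (rule image_subsetI)
   fix s :: real assume "s \<in> {-1..1}"
   then have a: "0 <= arccos s" "arccos s <= pi" using arccos_bounded[of s] by auto
   have "T / pi * arccos s <= T / pi * pi" using a T by (intro mult_left_mono) auto
   then show "T / pi * arccos s \<in> {0..T}" using a T by simp
  qed
 qed
 have fg: "f t = g (c t)" if "t \<in> {0..T}" for t
 proof -
  have "0 <= pi * t / T" "pi * t / T <= pi" using that T by (auto simp: field_simps)
  then have "arccos (c t) = pi * t / T" unfolding c_def by (rule arccos_cos)
  then show ?thesis using T by (simp add: g_def)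
 qed
 obtain B where B: "\<And>t. t \<in> {0..T} ==> \<bar>f t\<bar> <= B" "B > 0"
 proof -
  have "bounded (f ` {0..T})" by (intro compact_imp_bounded compact_continuous_image f) auto
  then obtain b where b: "b > 0" "\<forall>x\<in>{0..T}. \<bar>f x\<bar> <= b" by (auto simp: bounded_pos)
  show ?thesis by (rule that[of b]) (use b in auto)
 qed
 have ff: "(\<lambda>t. f t * f t) integrable_on {0..T}" by (intro integrable_continuous_interval continuous_intros f)
 have small: "integral {0..T} (\<lambda>t. f t * f t) <= B * e * T" if e: "e > 0" for e
 proof -
  obtain p where p: "real_polynomial_function p" "\<And>x. x \<in> {-1..1} ==> \<bar>g x - p x\<bar> < e"
   using Stone_Weierstrass_real_polynomial_function[OF compact_Icc g e] by blast
  obtain a n where pa: "p = (\<lambda>x. \<Sum>i\<le>n. a i * x ^ i)"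
   using p(1) unfolding real_polynomial_function_iff_sum by blast
  have pi0: "integral {0..T} (\<lambda>t. f t * p (c t)) = 0"
  proof -
   have i: "(\<lambda>t. a i * (f t * (c t ^ i * cosT T 0 t))) integrable_on {0..T}" for i
    using fi[of i 0] by (rule integrable_on_mult_right)
   have "(\<lambda>t. f t * p (c t)) = (\<lambda>t. \<Sum>i\<le>n. a i * (f t * (c t ^ i * cosT T 0 t)))"
    by (auto simp: pa sum_distrib_left mult_ac)
   then have "integral {0..T} (\<lambda>t. f t * p (c t)) = (\<Sum>i\<le>n. integral {0..T} (\<lambda>t. a i * (f t * (c t ^ i * cosT T 0 t))))"
    using i by (simp only: integral_sum finite_atMost)
   also have "... = 0" unfolding integral_mult_right pow by simp
   finally show ?thesis .
  qed
  have fp: "(\<lambda>t. f t * p (c t)) integrable_on {0..T}"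
   unfolding pa by (intro integrable_continuous_interval continuous_intros f cc)
  have "integral {0..T} (\<lambda>t. f t * f t) = integral {0..T} (\<lambda>t. f t * f t - f t * p (c t))"
   using Henstock_Kurzweil_Integration.integral_diff[OF ff fp] unfolding pi0 by (simp only: diff_zero)
  also have "... <= integral {0..T} (\<lambda>t. B * e)"
  proof (rule integral_le)
   show "(\<lambda>t. f t * f t - f t * p (c t)) integrable_on {0..T}" using ff fp by (rule integrable_diff)
   fix t assume t: "t \<in> {0..T}"
   have "f t * f t - f t * p (c t) = f t * (f t - p (c t))" by (rule right_diff_distrib[symmetric])
   also have "... = f t * (g (c t) - p (c t))" using fg[OF t] by simp
   also have "... <= \<bar>f t\<bar> * \<bar>g (c t) - p (c t)\<bar>" unfolding abs_mult[symmetric] by (rule abs_ge_self)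
   also have "... <= B * e"
   proof (rule mult_mono)
    have "c t \<in> {-1..1}" by (simp add: c_def)
    then show "\<bar>g (c t) - p (c t)\<bar> <= e" using p(2) less_imp_le by blast
   qed (use B t in auto)
   finally show "f t * f t - f t * p (c t) <= B * e" .
  qed (intro integrable_continuous_interval continuous_intros)
  also have "... = B * e * T" using T by simp
  finally show ?thesis .
 qed
 have "integral {0..T} (\<lambda>t. f t * f t) <= 0"
 proof (rule field_le_epsilon)
  fix e :: real assume e: "e > 0"
  show "integral {0..T} (\<lambda>t. f t * f t) <= 0 + e"
   using small[of "e / (B * T)"] e B T by simp
 qed
 moreover have "0 <= integral {0..T} (\<lambda>t. f t * f t)" using ff by (rule integral_nonneg) simp
 ultimately have "integral {0..T} (\<lambda>t. f t * f t) = 0" by simp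
 then have "\<forall>t\<in>{0..T}. f t * f t = 0"
  by (subst (asm) integral_eq_0_iff) (intro continuous_intros f, use T in simp_all)
 then show ?thesis using t by simp
qed

lemma cosT_orthogonal_imp_zero:
 fixes f :: "real => complex"
 assumes T: "T > 0" and f: "continuous_on {0..T} f"
  and orth: "\<And>k. integral {0..T} (\<lambda>t. f t * of_real (cosT T k t)) = 0" and t: "t \<in> {0..T}"
 shows "f t = 0"
proof -
 have i: "(\<lambda>t. f t * of_real (cosT T k t)) integrable_on {0..T}" for k
  by (intro integrable_continuous_interval continuous_intros f)
 have "Re (f t) = 0"
 proof (rule cosT_orthogonal_imp_zero_real[OF T _ _ t, of "\<lambda>t. Re (f t)"])
  show "integral {0..T} (\<lambda>t. Re (f t) * cosT T k t) = 0" for k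
   using integral_linear[OF i[of k] bounded_linear_Re] orth[of k] by (simp add: o_def)
 qed (intro continuous_intros f)
 moreover have "Im (f t) = 0"
 proof (rule cosT_orthogonal_imp_zero_real[OF T _ _ t, of "\<lambda>t. Im (f t)"])
  show "integral {0..T} (\<lambda>t. Im (f t) * cosT T k t) = 0" for k
   using integral_linear[OF i[of k] bounded_linear_Im] orth[of k] by (simp add: o_def)
 qed (intro continuous_intros f)
 ultimately show ?thesis by (simp add: complex_eq_iff)
qed

definition cseries :: "real => (nat => complex) => real => complex" where
 "cseries T c t = (\<Sum>\<^sub>\<infinity>k. c k * of_real (cosT T k t))"

lemma cseries_sums:
 assumes "(\<lambda>k. cmod (c k)) summable_on UNIV"
 shows "(\<lambda>k. c k * of_real (cosT T k t)) sums cseries T c t"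
  and "(\<lambda>k. cmod (c k * of_real (cosT T k t))) summable_on UNIV"
proof -
 show a: "(\<lambda>k. cmod (c k * of_real (cosT T k t))) summable_on UNIV"
  by (rule summable_on_comparison_test[OF assms])
   (auto simp: norm_mult intro!: mult_left_le abs_cosT_le)
 show "(\<lambda>k. c k * of_real (cosT T k t)) sums cseries T c t"
  unfolding cseries_def by (rule has_sum_imp_sums, rule has_sum_infsum, rule abs_summable_summable, rule a)
qed

lemma continuous_cseries:
 assumes c: "(\<lambda>k. cmod (c k)) summable_on UNIV"
 shows "continuous_on S (cseries T c)"
proof (rule uniform_limit_theorem[OF _ _ sequentially_bot])
 have s: "summable (\<lambda>k. cmod (c k))" using c by (rule summable_on_imp_summable)
 have "uniform_limit S (\<lambda>n t. \<Sum>k<n. c k * of_real (cosT T k t)) (\<lambda>t. \<Sum>k. c k * of_real (cosT T k t)) sequentially"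
  by (rule Weierstrass_m_test[OF _ s]) (auto simp: norm_mult intro!: mult_left_le abs_cosT_le)
 moreover have "(\<Sum>k. c k * of_real (cosT T k t)) = cseries T c t" for t
  using cseries_sums(1)[OF c] by (rule sums_unique[symmetric])
 ultimately show "uniform_limit S (\<lambda>n t. \<Sum>k<n. c k * of_real (cosT T k t)) (cseries T c) sequentially" by simp
 show "\<forall>\<^sub>F n in sequentially. continuous_on S (\<lambda>t. \<Sum>k<n. c k * of_real (cosT T k t))"
  by (intro always_eventually allI continuous_intros)
qed

lemma integral_cseries_cosT:
 assumes T: "T > 0" and c: "(\<lambda>k. cmod (c k)) summable_on UNIV"
 shows "integral {0..T} (\<lambda>t. cseries T c t * of_real (cosT T l t)) = c l * of_real (T / cosN l)"
proof -
 have s: "summable (\<lambda>k. cmod (c k))" using c by (rule summable_on_imp_summable)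
 let ?F = "\<lambda>n t. (\<Sum>k<n. c k * of_real (cosT T k t)) * of_real (cosT T l t)"
 have lim: "(\<lambda>n. integral {0..T} (?F n)) \<longlonglongrightarrow> integral {0..T} (\<lambda>t. cseries T c t * of_real (cosT T l t))"
 proof (rule dominated_convergence(2))
  show "?F n integrable_on {0..T}" for n
   by (intro integrable_continuous_interval continuous_intros)
  show "(\<lambda>t. suminf (\<lambda>k. cmod (c k))) integrable_on {0..T}"
   by (intro integrable_continuous_interval continuous_intros)
  show "norm (?F n t) <= suminf (\<lambda>k. cmod (c k))" for n t
  proof -
   have "norm (?F n t) <= norm (\<Sum>k<n. c k * of_real (cosT T k t)) * 1"
    unfolding norm_mult by (intro mult_left_mono) (auto simp: abs_cosT_le)
   also have "... <= (\<Sum>k<n. cmod (c k))"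
    by (simp, rule sum_norm_le) (auto simp: norm_mult intro!: mult_left_le abs_cosT_le)
   also have "... <= suminf (\<lambda>k. cmod (c k))" by (rule sum_le_suminf[OF s]) auto
   finally show ?thesis .
  qed
  show "(\<lambda>n. ?F n t) \<longlonglongrightarrow> cseries T c t * of_real (cosT T l t)" for t
   using cseries_sums(1)[OF c, of T t] unfolding sums_def by (intro tendsto_intros)
 qed
 have i: "(\<lambda>t. complex_of_real (cosT T k t * cosT T l t)) integrable_on {0..T}" for k
  by (intro integrable_continuous_interval continuous_intros)
 have e: "integral {0..T} (\<lambda>t. complex_of_real (cosT T k t * cosT T l t)) = of_real (if k = l then T / cosN k else 0)" for k
 proof -
  have i2: "(\<lambda>t. cosT T k t * cosT T l t) integrable_on {0..T}"
   by (intro integrable_continuous_interval continuous_intros)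
  have "integral {0..T} (\<lambda>t. complex_of_real (cosT T k t * cosT T l t)) = complex_of_real (integral {0..T} (\<lambda>t. cosT T k t * cosT T l t))"
   by (rule integral_linear[OF i2 bounded_linear_of_real, unfolded o_def])
  then show ?thesis unfolding integral_cosT_mult[OF T] .
 qed
 have "integral {0..T} (?F n) = (\<Sum>k<n. c k * of_real (if k = l then T / cosN k else 0))" for n
 proof -
  have "?F n t = (\<Sum>k<n. c k * complex_of_real (cosT T k t * cosT T l t))" for t
   unfolding sum_distrib_right of_real_mult mult.assoc ..
  then have F: "?F n = (\<lambda>t. \<Sum>k<n. c k * complex_of_real (cosT T k t * cosT T l t))" by (rule ext)
  have "integral {0..T} (?F n) = (\<Sum>k<n. integral {0..T} (\<lambda>t. c k * complex_of_real (cosT T k t * cosT T l t)))"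
   unfolding F by (rule integral_sum) (rule finite_lessThan, rule integrable_on_mult_right, rule i)
  then show ?thesis unfolding integral_mult_right e .
 qed
 moreover have "(\<Sum>k<n. c k * of_real (if k = l then T / cosN k else 0)) = c l * of_real (T / cosN l)" if "n > l" for n
 proof -
  have "(\<Sum>k<n. c k * of_real (if k = l then T / cosN k else 0)) = (\<Sum>k<n. if k = l then c l * of_real (T / cosN l) else 0)"
   by (intro sum.cong) auto
  then show ?thesis using that by simp
 qed
 ultimately have "\<forall>\<^sub>F n in sequentially. integral {0..T} (?F n) = c l * of_real (T / cosN l)"
  by (auto intro!: eventually_sequentiallyI[of "Suc l"])
 then have "(\<lambda>n. integral {0..T} (?F n)) \<longlonglongrightarrow> c l * of_real (T / cosN l)"
  by (rule tendsto_eventually)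
 from LIMSEQ_unique[OF lim this] show ?thesis .
qed

lemma cosN_pos: "cosN k > 0" by (simp add: cosN_def)

lemma cseries_inject:
 assumes T: "T > 0" and c: "(\<lambda>k. cmod (c k)) summable_on UNIV" and c': "(\<lambda>k. cmod (c' k)) summable_on UNIV"
  and eq: "\<And>t. t \<in> {0..T} ==> cseries T c t = cseries T c' t"
 shows "c = c'"
proof
 fix l
 have "integral {0..T} (\<lambda>t. cseries T c t * of_real (cosT T l t)) = integral {0..T} (\<lambda>t. cseries T c' t * of_real (cosT T l t))"
  by (rule integral_cong) (simp add: eq)
 then show "c l = c' l"
  unfolding integral_cseries_cosT[OF T c] integral_cseries_cosT[OF T c'] using T cosN_pos[of l] by simp
qed

definition cos_coeff :: "real => (real => complex) => nat => complex" where
 "cos_coeff T f k = of_real (cosN k / T) * integral {0..T} (\<lambda>t. f t * of_real (cosT T k t))"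

text \<open>The sum of the series is continuous because the coefficients are absolutely summable,
  and its difference from \<open>f\<close> is orthogonal to every cosine.\<close>

lemma cseries_cos_coeff:
 assumes T: "T > 0" and f: "continuous_on {0..T} f"
  and s: "(\<lambda>k. cmod (cos_coeff T f k)) summable_on UNIV" and t: "t \<in> {0..T}"
 shows "cseries T (cos_coeff T f) t = f t"
proof -
 let ?g = "cseries T (cos_coeff T f)"
 have "?g t - f t = 0"
 proof (rule cosT_orthogonal_imp_zero[OF T _ _ t, of "\<lambda>t. ?g t - f t"])
  show "continuous_on {0..T} (\<lambda>t. ?g t - f t)" by (intro continuous_intros continuous_cseries s f)
  show "integral {0..T} (\<lambda>t. (?g t - f t) * of_real (cosT T k t)) = 0" for k
  proof -
   have "integral {0..T} (\<lambda>t. (?g t - f t) * of_real (cosT T k t)) =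
    integral {0..T} (\<lambda>t. ?g t * of_real (cosT T k t)) - integral {0..T} (\<lambda>t. f t * of_real (cosT T k t))"
    unfolding left_diff_distrib
    by (intro Henstock_Kurzweil_Integration.integral_diff integrable_continuous_interval continuous_intros continuous_cseries s f)
   also have "... = 0"
    unfolding integral_cseries_cosT[OF T s] cos_coeff_def using T cosN_pos[of k] by simp
   finally show ?thesis .
  qed
 qed
 then show ?thesis by simp
qed

section \<open>Cosine coefficients of the Duhamel integral of one oscillation\<close>

text \<open>The damped Duhamel integral of \<open>e\<^bsup>i\<mu>t\<^esup>\<close>: the solution of \<open>E' = e\<^bsup>i\<mu>t\<^esup> - M E\<close>, \<open>E(0) = 0\<close>.\<close>

definition duh :: "real => real => real => complex" where
 "duh M \<mu> t = (if M = 0 \<and> \<mu> = 0 then of_real t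
   else (exp (\<i> * of_real \<mu> * of_real t) - exp (- of_real M * of_real t)) / Complex M \<mu>)"

lemma duh_0 [simp]: "duh M \<mu> 0 = 0" by (simp add: duh_def)

lemma has_vector_derivative_duh:
 "(duh M \<mu> has_vector_derivative (cis (\<mu> * t) - of_real M * duh M \<mu> t)) (at t within S)"
proof (cases "M = 0 \<and> \<mu> = 0")
 case True
 then have "duh M \<mu> = (\<lambda>t. of_real t)" by (simp add: duh_def fun_eq_iff)
 then show ?thesis using True by (auto intro!: derivative_eq_intros)
next
 case False
 define z where "z = Complex M \<mu>"
 have z: "z \<noteq> 0" using False by (auto simp: z_def complex_eq_iff)
 let ?F = "\<lambda>w. (exp (\<i> * of_real \<mu> * w) - exp (- of_real M * w)) / z"
 have zz: "z = of_real M + \<i> * of_real \<mu>" by (simp add: z_def complex_eq_iff)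
 have "(?F has_field_derivative (\<i> * of_real \<mu> * exp (\<i> * of_real \<mu> * of_real t) + of_real M * exp (- of_real M * of_real t)) / z) (at (of_real t))"
  by (auto intro!: derivative_eq_intros simp: z)
 then have 1: "((\<lambda>x. ?F (of_real x)) has_vector_derivative (\<i> * of_real \<mu> * exp (\<i> * of_real \<mu> * of_real t) + of_real M * exp (- of_real M * of_real t)) / z) (at t within S)"
  by (rule has_vector_derivative_real_field)
 have d: "duh M \<mu> = (\<lambda>x. ?F (of_real x))" using False by (auto simp: duh_def z_def fun_eq_iff)
 have eq: "(\<i> * of_real \<mu> * exp (\<i> * of_real \<mu> * of_real t) + of_real M * exp (- of_real M * of_real t)) / z =
  exp (\<i> * of_real \<mu> * of_real t) - of_real M * ?F (of_real t)"
  using z unfolding zz by (simp add: field_simps)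
 have ce: "exp (\<i> * of_real \<mu> * of_real t) = cis (\<mu> * t)" by (simp add: cis_conv_exp mult.assoc)
 show ?thesis unfolding d ce[symmetric] using 1 unfolding eq .
qed

lemma continuous_duh [continuous_intros]: "continuous_on S (duh M \<mu>)"
 by (rule continuous_on_vector_derivative) (rule has_vector_derivative_duh)

lemma duh_has_integral:
 assumes "t >= 0"
 shows "((\<lambda>r. of_real (exp (- M * (t - r))) * cis (\<mu> * r)) has_integral duh M \<mu> t) {0..t}"
proof -
 have "((\<lambda>r. of_real (exp (- M * (t - r))) * cis (\<mu> * r)) has_integral
   of_real (exp (- M * (t - t))) * duh M \<mu> t - of_real (exp (- M * (t - 0))) * duh M \<mu> 0) {0..t}"
 proof (rule fundamental_theorem_of_calculus[OF assms])
  fix r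
  have 1: "((\<lambda>r. complex_of_real (exp (- M * (t - r)))) has_vector_derivative of_real (M * exp (- M * (t - r)))) (at r within {0..t})"
   by (intro has_vector_derivative_of_real) (auto intro!: derivative_eq_intros simp flip: has_real_derivative_iff_has_vector_derivative)
  show "((\<lambda>r. of_real (exp (- M * (t - r))) * duh M \<mu> r) has_vector_derivative of_real (exp (- M * (t - r))) * cis (\<mu> * r)) (at r within {0..t})"
   using has_vector_derivative_mult[OF 1 has_vector_derivative_duh[of M \<mu> r]] by (simp add: algebra_simps)
 qed
 then show ?thesis by simp
qed

text \<open>Combines the trivial bound \<open>T\<close> with
  \<open>4 / (M + \<bar>\<mu>\<bar>)\<close> from the explicit formula: multiplied by
  \<open>1 + T * M + T * \<bar>\<mu>\<bar>\<close> they give at most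
  \<open>T + 4 * T\<close>.\<close>

lemma norm_duh_le:
 assumes t: "0 <= t" "t <= T" and M: "M >= 0" and T: "T > 0"
 shows "cmod (duh M \<mu> t) <= 5 * T / (1 + T * M + T * \<bar>\<mu>\<bar>)"
proof -
 have "cmod (duh M \<mu> t) <= 1 * measure lborel {0..t}"
  by (rule has_integral_bound_real[where S = "{}", OF _ _ duh_has_integral[OF t(1)]])
   (use M in \<open>auto simp: norm_mult mult_nonneg_nonneg\<close>)
 then have 1: "cmod (duh M \<mu> t) <= T" using t by simp
 have 2: "cmod (duh M \<mu> t) * (M + \<bar>\<mu>\<bar>) <= 4"
 proof (cases "M = 0 \<and> \<mu> = 0")
  case False
  define z where "z = Complex M \<mu>"
  have z: "cmod z > 0" using False by (auto simp: z_def complex_eq_iff)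
  have "M + \<bar>\<mu>\<bar> <= 2 * cmod z" using abs_Re_le_cmod[of z] abs_Im_le_cmod[of z] M by (simp add: z_def)
  moreover have "cmod (duh M \<mu> t) * cmod z <= 2"
  proof -
   have "cmod (duh M \<mu> t) * cmod z = cmod (exp (\<i> * of_real \<mu> * of_real t) - exp (- of_real M * of_real t))"
    using False z by (auto simp: duh_def z_def norm_divide)
   also have "... <= cmod (exp (\<i> * of_real \<mu> * of_real t)) + cmod (exp (- of_real M * of_real t))"
    by (rule norm_triangle_ineq4)
   also have "... <= 1 + 1" using M t by (intro add_mono) (auto simp: norm_exp_eq_Re)
   finally show ?thesis by simp
  qed
  moreover have "cmod (duh M \<mu> t) * (M + \<bar>\<mu>\<bar>) <= cmod (duh M \<mu> t) * (2 * cmod z)"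
   using calculation(1) by (intro mult_left_mono) auto
  ultimately show ?thesis by simp
 qed simp
 have "cmod (duh M \<mu> t) * (1 + T * M + T * \<bar>\<mu>\<bar>) = cmod (duh M \<mu> t) + T * (cmod (duh M \<mu> t) * (M + \<bar>\<mu>\<bar>))"
  by (simp add: algebra_simps)
 also have "... <= T + T * 4" using 1 2 T by (intro add_mono mult_left_mono) auto
 finally have "cmod (duh M \<mu> t) * (1 + T * M + T * \<bar>\<mu>\<bar>) <= 5 * T" by simp
 moreover have "1 + T * M + T * \<bar>\<mu>\<bar> > 0" using M T by (intro add_pos_nonneg) auto
 ultimately show ?thesis by (simp add: pos_le_divide_eq)
qed

lemma cis_has_integral:
 assumes "T >= 0"
 shows "((\<lambda>t. cis (\<nu> * t)) has_integral duh 0 \<nu> T) {0..T}"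
 using duh_has_integral[OF assms, of 0 \<nu>] by simp

text \<open>The equation for \<open>duh\<close>, integrated against the sine and the cosine of
  frequency \<open>w\<close>, gives two linear relations for the integrals \<open>A\<close> and
  \<open>S\<close>. At the end points the sine vanishes, so the only boundary term sits in the
  cosine relation and reaches \<open>A\<close> with the factor \<open>M\<close>. Hence without
  damping there is no boundary term, and the coefficients decay like a product of two
  reciprocals.\<close>

lemma norm_cos_coeff_duh_le:
 assumes T: "T > 0" and M: "M >= 0" and k: "k >= 1"
 shows "cmod (cos_coeff T (duh M \<mu>) k) <=
  20 * T / (T * M + k) * (1 / (1 + \<bar>T * \<mu> + pi * k\<bar>) + 1 / (1 + \<bar>T * \<mu> - pi * k\<bar>)) +
  10 * T * (T * M / ((T * M)\<^sup>2 + (real k)\<^sup>2)) / (1 + T * M + \<bar>T * \<mu>\<bar>)"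
proof -
 define w where "w = pi * real k / T"
 define E where "E = duh M \<mu>"
 define m where "m = T * M"
 have w: "w > 0" "T * w = pi * k" using T k by (auto simp: w_def)
 have cw: "cosT T k t = cos (w * t)" for t by (simp add: cosT_def w_def)
 have sinT: "sin (w * T) = 0" using T by (simp add: w_def sin_npi mult.commute[of pi])
 define G where "G = 5 * T / (1 + \<bar>T * \<mu> + pi * k\<bar>) + 5 * T / (1 + \<bar>T * \<mu> - pi * k\<bar>)"
 have dG: "cmod (duh 0 (\<mu> + w) T) + cmod (duh 0 (\<mu> - w) T) <= G"
 proof -
  have "T * \<bar>a\<bar> = \<bar>T * a\<bar>" for a using T by (simp add: abs_mult)
  then have "T * \<bar>\<mu> + w\<bar> = \<bar>T * \<mu> + pi * k\<bar>" "T * \<bar>\<mu> - w\<bar> = \<bar>T * \<mu> - pi * k\<bar>"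
   unfolding w(2)[symmetric] by (simp_all only: distrib_left right_diff_distrib)
  then show ?thesis unfolding G_def
   using norm_duh_le[of T T 0 "\<mu> + w"] norm_duh_le[of T T 0 "\<mu> - w"] T by (intro add_mono) auto
 qed
 define c where "c = (duh 0 (\<mu> + w) T + duh 0 (\<mu> - w) T) / 2"
 define s where "s = (duh 0 (\<mu> + w) T - duh 0 (\<mu> - w) T) / (2 * \<i>)"
 have cs: "cis (\<mu> * t) * of_real (cos (w * t)) = (cis ((\<mu> + w) * t) + cis ((\<mu> - w) * t)) / 2"
  "cis (\<mu> * t) * of_real (sin (w * t)) = (cis ((\<mu> + w) * t) - cis ((\<mu> - w) * t)) / (2 * \<i>)" for t
 proof -
  have p: "cis ((\<mu> + w) * t) = cis (\<mu> * t) * cis (w * t)" "cis ((\<mu> - w) * t) = cis (\<mu> * t) * cis (- (w * t))"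
   unfolding cis_mult by (simp_all add: algebra_simps)
  have q: "cis (w * t) + cis (- (w * t)) = 2 * of_real (cos (w * t))" "cis (w * t) - cis (- (w * t)) = 2 * \<i> * of_real (sin (w * t))"
   by (simp_all add: complex_eq_iff)
  show "cis (\<mu> * t) * of_real (cos (w * t)) = (cis ((\<mu> + w) * t) + cis ((\<mu> - w) * t)) / 2"
   unfolding p distrib_left[symmetric] q by simp
  show "cis (\<mu> * t) * of_real (sin (w * t)) = (cis ((\<mu> + w) * t) - cis ((\<mu> - w) * t)) / (2 * \<i>)"
  proof -
   have "(cis ((\<mu> + w) * t) - cis ((\<mu> - w) * t)) / (2 * \<i>) = (2 * \<i>) * (cis (\<mu> * t) * of_real (sin (w * t))) / (2 * \<i>)"
    unfolding p right_diff_distrib[symmetric] q by (simp only: mult_ac)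
   then show ?thesis by (subst (asm) nonzero_mult_div_cancel_left) simp_all
  qed
 qed
 have c: "((\<lambda>t. cis (\<mu> * t) * of_real (cos (w * t))) has_integral c) {0..T}"
  unfolding cs c_def using T by (intro has_integral_divide has_integral_add cis_has_integral) auto
 have s: "((\<lambda>t. cis (\<mu> * t) * of_real (sin (w * t))) has_integral s) {0..T}"
  unfolding cs s_def using T by (intro has_integral_divide has_integral_diff cis_has_integral) auto
 have cG: "cmod c <= G" and sG: "cmod s <= G"
 proof -
  have "cmod c = cmod (duh 0 (\<mu> + w) T + duh 0 (\<mu> - w) T) / 2" by (simp add: c_def norm_divide)
  also have "... <= (cmod (duh 0 (\<mu> + w) T) + cmod (duh 0 (\<mu> - w) T)) / 1"
   by (intro frac_le norm_triangle_ineq) auto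
  finally show "cmod c <= G" using dG by simp
  have "cmod s = cmod (duh 0 (\<mu> + w) T - duh 0 (\<mu> - w) T) / 2" by (simp add: s_def norm_divide norm_mult)
  also have "... <= (cmod (duh 0 (\<mu> + w) T) + cmod (duh 0 (\<mu> - w) T)) / 1"
   by (intro frac_le norm_triangle_ineq4) auto
  finally show "cmod s <= G" using dG by simp
 qed
 define A where "A = integral {0..T} (\<lambda>t. E t * of_real (cos (w * t)))"
 define S where "S = integral {0..T} (\<lambda>t. E t * of_real (sin (w * t)))"
 have contE: "continuous_on X E" for X unfolding E_def by (rule continuous_duh)
 have A: "((\<lambda>t. E t * of_real (cos (w * t))) has_integral A) {0..T}"
  unfolding A_def by (intro integrable_integral integrable_continuous_interval continuous_intros contE)
 have S: "((\<lambda>t. E t * of_real (sin (w * t))) has_integral S) {0..T}"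
  unfolding S_def by (intro integrable_integral integrable_continuous_interval continuous_intros contE)
 have dE: "(E has_vector_derivative (cis (\<mu> * t) - of_real M * E t)) (at t within X)" for t X
  unfolding E_def by (rule has_vector_derivative_duh)
 have dsin: "((\<lambda>t. complex_of_real (sin (w * t))) has_vector_derivative of_real (w * cos (w * t))) (at t within X)" for t X
  by (intro has_vector_derivative_of_real) (auto intro!: derivative_eq_intros simp flip: has_real_derivative_iff_has_vector_derivative)
 have dcos: "((\<lambda>t. complex_of_real (cos (w * t))) has_vector_derivative of_real (- w * sin (w * t))) (at t within X)" for t X
  by (intro has_vector_derivative_of_real) (auto intro!: derivative_eq_intros simp flip: has_real_derivative_iff_has_vector_derivative)
 have "((\<lambda>t. E t * of_real (w * cos (w * t)) + (cis (\<mu> * t) - of_real M * E t) * of_real (sin (w * t))) has_integral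
   E T * of_real (sin (w * T)) - E 0 * of_real (sin (w * 0))) {0..T}"
  by (rule fundamental_theorem_of_calculus) (use T in simp, rule has_vector_derivative_mult[OF dE dsin])
 moreover have "((\<lambda>t. E t * of_real (w * cos (w * t)) + (cis (\<mu> * t) - of_real M * E t) * of_real (sin (w * t))) has_integral
   (of_real w * A + (s - of_real M * S))) {0..T}"
 proof -
  have "((\<lambda>t. of_real w * (E t * of_real (cos (w * t))) + (cis (\<mu> * t) * of_real (sin (w * t)) - of_real M * (E t * of_real (sin (w * t))))) has_integral
   (of_real w * A + (s - of_real M * S))) {0..T}"
   by (intro has_integral_add has_integral_diff has_integral_mult_right A S s)
  then show ?thesis by (simp add: algebra_simps)
 qed
 ultimately have "E T * of_real (sin (w * T)) - E 0 * of_real (sin (w * 0)) = of_real w * A + (s - of_real M * S)"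
  by (rule has_integral_unique)
 then have eq1: "of_real M * S = of_real w * A + s" using sinT by (simp add: algebra_simps)
 have "((\<lambda>t. E t * of_real (- w * sin (w * t)) + (cis (\<mu> * t) - of_real M * E t) * of_real (cos (w * t))) has_integral
   E T * of_real (cos (w * T)) - E 0 * of_real (cos (w * 0))) {0..T}"
  by (rule fundamental_theorem_of_calculus) (use T in simp, rule has_vector_derivative_mult[OF dE dcos])
 moreover have "((\<lambda>t. E t * of_real (- w * sin (w * t)) + (cis (\<mu> * t) - of_real M * E t) * of_real (cos (w * t))) has_integral
   (- of_real w * S + (c - of_real M * A))) {0..T}"
 proof -
  have "((\<lambda>t. - of_real w * (E t * of_real (sin (w * t))) + (cis (\<mu> * t) * of_real (cos (w * t)) - of_real M * (E t * of_real (cos (w * t))))) has_integral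
   (- of_real w * S + (c - of_real M * A))) {0..T}"
   by (intro has_integral_add has_integral_diff has_integral_mult_right A S c)
  then show ?thesis by (simp add: algebra_simps)
 qed
 ultimately have "E T * of_real (cos (w * T)) - E 0 * of_real (cos (w * 0)) = - of_real w * S + (c - of_real M * A)"
  by (rule has_integral_unique)
 then have eq2: "of_real w * S = c - of_real M * A - E T * of_real (cos (w * T))" by (simp add: E_def algebra_simps)
 \<comment> \<open>\<open>S\<close> is eliminated by writing \<open>w * M * S\<close> in two ways,
   with \<open>eq1\<close> and with \<open>eq2\<close>.\<close>
 have "of_real (M\<^sup>2 + w\<^sup>2) * A = of_real M * c - of_real w * s - of_real M * (E T * of_real (cos (w * T)))"
 proof -
  have "of_real w * (of_real M * S) = of_real M * (of_real w * S)" by simp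
  then show ?thesis unfolding eq1 eq2 by (simp add: algebra_simps power2_eq_square)
 qed
 then have "(M\<^sup>2 + w\<^sup>2) * cmod A = cmod (of_real M * c - of_real w * s - of_real M * (E T * of_real (cos (w * T))))"
  by (metis norm_mult norm_of_real abs_of_nonneg sum_power2_ge_zero)
 also have "... <= cmod (of_real M * c) + cmod (of_real w * s) + cmod (of_real M * (E T * of_real (cos (w * T))))"
  by (intro order_trans[OF norm_triangle_ineq4] add_mono norm_triangle_ineq4) auto
 also have "... <= M * G + w * G + M * cmod (E T)"
 proof (intro add_mono)
  show "cmod (of_real M * c) <= M * G" "cmod (of_real w * s) <= w * G"
   using cG sG M w by (auto simp: norm_mult intro!: mult_left_mono)
  show "cmod (of_real M * (E T * of_real (cos (w * T)))) <= M * cmod (E T)"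
   using M by (auto simp: norm_mult intro!: mult_left_mono mult_left_le)
 qed
 finally have A1: "(M\<^sup>2 + w\<^sup>2) * cmod A <= (M + w) * G + M * cmod (E T)" by (simp add: algebra_simps)
 have G0: "G >= 0" unfolding G_def using T by (intro add_nonneg_nonneg divide_nonneg_nonneg) auto
 have pos: "M\<^sup>2 + w\<^sup>2 > 0" "M + w > 0" using w M by (auto intro: add_nonneg_pos)
 have m0: "m >= 0" using M T by (simp add: m_def)
 have mk: "m + k > 0" "m\<^sup>2 + (real k)\<^sup>2 > 0" using m0 k by (auto intro: add_nonneg_pos)
 have wk: "real k <= T * w" unfolding w(2) using k pi_ge_two mult_right_mono[of 1 pi "real k"] by simp
 have B1: "(M + w) / (M\<^sup>2 + w\<^sup>2) <= 2 * T / (m + k)"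
 proof -
  have "2 * (M\<^sup>2 + w\<^sup>2) = (M + w)\<^sup>2 + (M - w)\<^sup>2" by (simp add: algebra_simps power2_eq_square)
  then have "(M + w)\<^sup>2 <= 2 * (M\<^sup>2 + w\<^sup>2)" using zero_le_power2[of "M - w"] by linarith
  then have "(M + w) * (m + k) <= (M + w) * (T * (M + w))"
   using wk pos unfolding m_def by (intro mult_left_mono) (auto simp: distrib_left)
  also have "... = T * (M + w)\<^sup>2" by (simp add: power2_eq_square)
  also have "... <= T * (2 * (M\<^sup>2 + w\<^sup>2))" using \<open>(M + w)\<^sup>2 <= _\<close> T by (intro mult_left_mono) auto
  finally have "(M + w) * (m + k) <= 2 * T * (M\<^sup>2 + w\<^sup>2)" by (simp only: mult.assoc mult.left_commute[of T])
  then show ?thesis using pos(1) mk(1) by (simp add: divide_le_eq le_divide_eq)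
 qed
 have B2: "M / (M\<^sup>2 + w\<^sup>2) <= T * (m / (m\<^sup>2 + (real k)\<^sup>2))"
 proof -
  have "(real k)\<^sup>2 <= (T * w)\<^sup>2" using wk by (intro power_mono) auto
  then have "M * (m\<^sup>2 + (real k)\<^sup>2) <= M * (T\<^sup>2 * (M\<^sup>2 + w\<^sup>2))"
   using M unfolding m_def by (intro mult_left_mono) (auto simp: algebra_simps power_mult_distrib)
  also have "... = T * m * (M\<^sup>2 + w\<^sup>2)" by (simp add: m_def power2_eq_square)
  finally show ?thesis using pos(1) mk(2) by (simp add: divide_le_eq le_divide_eq)
 qed
 have A2: "cmod A <= 2 * T / (m + k) * G + T * (m / (m\<^sup>2 + (real k)\<^sup>2)) * cmod (E T)"
 proof -
  have "cmod A <= ((M + w) * G + M * cmod (E T)) / (M\<^sup>2 + w\<^sup>2)"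
   using A1 pos(1) by (simp add: le_divide_eq mult.commute)
  also have "... = (M + w) / (M\<^sup>2 + w\<^sup>2) * G + M / (M\<^sup>2 + w\<^sup>2) * cmod (E T)"
   by (simp only: add_divide_distrib[of "_ * _"] times_divide_eq_left)
  also have "... <= 2 * T / (m + k) * G + T * (m / (m\<^sup>2 + (real k)\<^sup>2)) * cmod (E T)"
   by (intro add_mono mult_right_mono B1 B2 G0 norm_ge_zero)
  finally show ?thesis .
 qed
 have "cmod (cos_coeff T (duh M \<mu>) k) = 2 / T * cmod A"
  unfolding cos_coeff_def A_def E_def cw using k T by (simp add: norm_mult cosN_def norm_divide)
 also have "... <= 2 / T * (2 * T / (m + k) * G + T * (m / (m\<^sup>2 + (real k)\<^sup>2)) * (5 * T / (1 + T * M + T * \<bar>\<mu>\<bar>)))"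
 proof -
  have "m >= 0" using M T by (simp add: m_def)
  then have "T * (m / (m\<^sup>2 + (real k)\<^sup>2)) * cmod (E T) <= T * (m / (m\<^sup>2 + (real k)\<^sup>2)) * (5 * T / (1 + T * M + T * \<bar>\<mu>\<bar>))"
   using norm_duh_le[of T T M \<mu>] T M unfolding E_def by (intro mult_left_mono) auto
  then show ?thesis using A2 T by (intro mult_left_mono) auto
 qed
 also have "... = 20 * T / (T * M + k) * (1 / (1 + \<bar>T * \<mu> + pi * k\<bar>) + 1 / (1 + \<bar>T * \<mu> - pi * k\<bar>)) +
  10 * T * (T * M / ((T * M)\<^sup>2 + (real k)\<^sup>2)) / (1 + T * M + \<bar>T * \<mu>\<bar>)"
  unfolding G_def m_def using T by (simp add: distrib_left abs_mult)
 finally show ?thesis .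
qed

lemma norm_cos_coeff_duh_0_le:
 assumes T: "T > 0" and M: "M >= 0"
 shows "cmod (cos_coeff T (duh M \<mu>) 0) <= 5 * T / (1 + T * M + \<bar>T * \<mu>\<bar>)"
proof -
 have "cmod (integral {0..T} (duh M \<mu>)) <= 5 * T / (1 + T * M + T * \<bar>\<mu>\<bar>) * (T - 0)"
  by (rule integral_bound) (use T M in \<open>auto intro!: continuous_duh norm_duh_le\<close>)
 then show ?thesis unfolding cos_coeff_def using T by (simp add: cosN_def norm_divide field_simps abs_mult)
qed

text \<open>Twice the bounds just proved, with an integer in place of \<open>\<mu>\<close>. For
  \<open>T <= 1\<close>, passing to the integer part moves \<open>T * \<mu>\<close> by at most 1,
  which costs at most the factor 2. A majorant depending on the bin alone is what permits sorting
  triples by bins.\<close>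

definition kern_bound :: "real => real => nat => int => real" where
 "kern_bound T M k j = (if k = 0 then 10 * T / (1 + T * M + \<bar>T * j\<bar>) else
  40 * T / (T * M + k) * (1 / (1 + \<bar>T * j + pi * k\<bar>) + 1 / (1 + \<bar>T * j - pi * k\<bar>)) +
  20 * T * (T * M / ((T * M)\<^sup>2 + (real k)\<^sup>2)) / (1 + T * M + \<bar>T * j\<bar>))"

lemma norm_cos_coeff_duh_le_kern_bound:
 assumes T: "0 < T" "T <= 1" and M: "M >= 0"
 shows "cmod (cos_coeff T (duh M \<mu>) k) <= kern_bound T M k \<lfloor>\<mu>\<rfloor>"
proof -
 define y where "y = T * real_of_int \<lfloor>\<mu>\<rfloor>"
 define x where "x = T * \<mu>"
 have xy: "\<bar>x - y\<bar> <= 1"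
 proof -
  have "\<bar>x - y\<bar> = T * \<bar>\<mu> - \<lfloor>\<mu>\<rfloor>\<bar>" using T by (simp add: x_def y_def right_diff_distrib[symmetric] abs_mult)
  also have "... <= 1 * 1" using T by (intro mult_mono) (auto simp: abs_le_iff, linarith+)
  finally show ?thesis by simp
 qed
 have inv: "1 / (1 + a + \<bar>x + r\<bar>) <= 2 / (1 + a + \<bar>y + r\<bar>)" if "a >= 0" for a r
 proof -
  have "1 + a + \<bar>y + r\<bar> <= 2 * (1 + a + \<bar>x + r\<bar>)" using xy that by (smt (verit))
  moreover have "1 + a + \<bar>y + r\<bar> > 0" "1 + a + \<bar>x + r\<bar> > 0" using that by linarith+
  ultimately show ?thesis by (simp add: field_simps)
 qed
 have m: "T * M >= 0" using T M by simp
 have e: "1 / (1 + T * M + \<bar>x\<bar>) <= 2 / (1 + T * M + \<bar>y\<bar>)" using inv[OF m, of 0] by simp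
 show ?thesis
 proof (cases "k = 0")
  case True
  have "cmod (cos_coeff T (duh M \<mu>) k) <= 5 * T * (1 / (1 + T * M + \<bar>x\<bar>))"
   using norm_cos_coeff_duh_0_le[OF T(1) M, of \<mu>] True by (simp add: x_def)
  also have "... <= 5 * T * (2 / (1 + T * M + \<bar>y\<bar>))" using e T by (intro mult_left_mono) auto
  finally show ?thesis using True by (simp add: kern_bound_def y_def)
 next
  case False
  define P where "P = 20 * T / (T * M + k)"
  define R where "R = 10 * T * (T * M / ((T * M)\<^sup>2 + (real k)\<^sup>2))"
  have PR: "P >= 0" "R >= 0" using T M by (auto simp: P_def R_def)
  have "cmod (cos_coeff T (duh M \<mu>) k) <= P * (1 / (1 + \<bar>x + pi * k\<bar>) + 1 / (1 + \<bar>x - pi * k\<bar>)) + R * (1 / (1 + T * M + \<bar>x\<bar>))"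
   using norm_cos_coeff_duh_le[OF T(1) M, of k \<mu>] False by (simp add: P_def R_def x_def)
  also have "... <= P * (2 / (1 + \<bar>y + pi * k\<bar>) + 2 / (1 + \<bar>y - pi * k\<bar>)) + R * (2 / (1 + T * M + \<bar>y\<bar>))"
   using inv[of 0 "pi * k"] inv[of 0 "- pi * k"] e PR by (intro add_mono mult_left_mono) auto
  also have "... = kern_bound T M k \<lfloor>\<mu>\<rfloor>"
   using False unfolding kern_bound_def P_def R_def y_def by (simp add: distrib_left)
  finally show ?thesis .
 qed
qed

text \<open>Decay is redistributed. A power \<open>-e\<close> of \<open>m + u\<close> becomes the
  damping gain; the larger of \<open>u\<close> and \<open>v\<close> is at least \<open>Y / 5\<close>
  and supplies \<open>Y powr (3*e - 1)\<close>; what is left is summable in the smaller of the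
  two.\<close>

lemma inverse_product_le:
 fixes u v m Y e :: real
 assumes e: "0 < e" "e < 1/3" and uv: "u >= 1" "v >= 1" and m: "m >= 0" and Y: "Y > 0" "Y <= 5 * max u v"
 shows "1 / (m + u) * (1 / v) <= 5 * ((1 + m) powr (-e) * Y powr (3*e - 1)) * (u powr (-1-e) + v powr (-1-e))"
proof -
 define w where "w = max u v"
 have w: "w >= 1" using uv by (simp add: w_def)
 have 1: "1 / (m + u) <= (1 + m) powr (-e) * u powr (e - 1)"
 proof -
  have "1 / (m + u) = (m + u) powr (-e + (e - 1))" using m uv by (simp add: powr_minus_divide)
  also have "... = (m + u) powr (-e) * (m + u) powr (e - 1)" by (rule powr_add)
  also have "... <= (1 + m) powr (-e) * u powr (e - 1)"
   using m uv e by (intro mult_mono powr_mono2') auto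
  finally show ?thesis .
 qed
 have a: "z powr (3*e - 1) * z powr (-2*e) = z powr (e - 1)" "z powr (-2*e) * z powr (-1) = z powr (-1-2*e)"
  "z powr (3*e - 1) * z powr (-3*e) = z powr (-1)" "z powr (-3*e) * z powr (e - 1) = z powr (-1-2*e)" for z
  unfolding powr_add[symmetric] by (rule arg_cong[of _ _ "(powr) z"], simp)+
 have b: "1 / v = v powr (-1)" using uv by (simp add: powr_minus_divide)
 have 2: "u powr (e - 1) * (1 / v) <= w powr (3*e - 1) * (u powr (-1-e) + v powr (-1-e))"
 proof (cases "u >= v")
  case True
  have "u powr (e - 1) * (1 / v) = u powr (3*e - 1) * (u powr (-2*e) * v powr (-1))"
   unfolding a(1)[symmetric] b by (simp only: mult.assoc)
  also have "... <= u powr (3*e - 1) * (v powr (-2*e) * v powr (-1))"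
   using True uv e by (intro mult_left_mono mult_right_mono powr_mono2') auto
  also have "... = u powr (3*e - 1) * v powr (-1-2*e)" unfolding a ..
  also have "... <= u powr (3*e - 1) * v powr (-1-e)"
   using uv e by (intro mult_left_mono powr_mono) auto
  also have "... <= u powr (3*e - 1) * (u powr (-1-e) + v powr (-1-e))" by (intro mult_left_mono) auto
  finally show ?thesis using True by (simp add: w_def max_def)
 next
  case False
  have "u powr (e - 1) * (1 / v) = v powr (3*e - 1) * (v powr (-3*e) * u powr (e - 1))"
   unfolding b a(3)[symmetric] by (simp only: mult_ac)
  also have "... <= v powr (3*e - 1) * (u powr (-3*e) * u powr (e - 1))"
   using False uv e by (intro mult_left_mono mult_right_mono powr_mono2') auto
  also have "... = v powr (3*e - 1) * u powr (-1-2*e)" unfolding a ..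
  also have "... <= v powr (3*e - 1) * u powr (-1-e)"
   using uv e by (intro mult_left_mono powr_mono) auto
  also have "... <= v powr (3*e - 1) * (u powr (-1-e) + v powr (-1-e))" by (intro mult_left_mono) auto
  finally show ?thesis using False by (simp add: w_def max_def)
 qed
 have 3: "w powr (3*e - 1) <= 5 * Y powr (3*e - 1)"
 proof -
  have "w powr (3*e - 1) <= (Y / 5) powr (3*e - 1)"
   using Y e by (intro powr_mono2') (auto simp: w_def)
  also have "... = 5 powr (1 - 3*e) * Y powr (3*e - 1)"
   using Y by (simp add: powr_divide powr_minus_divide[of 5 "1 - 3*e", symmetric] powr_diff field_simps)
  also have "... <= 5 powr 1 * Y powr (3*e - 1)" using e by (intro mult_right_mono powr_mono) auto
  finally show ?thesis by simp
 qed
 have "1 / (m + u) * (1 / v) <= (1 + m) powr (-e) * u powr (e - 1) * (1 / v)"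
  using 1 uv by (intro mult_right_mono) auto
 also have "... = (1 + m) powr (-e) * (u powr (e - 1) * (1 / v))" by simp
 also have "... <= (1 + m) powr (-e) * (w powr (3*e - 1) * (u powr (-1-e) + v powr (-1-e)))"
  using 2 by (intro mult_left_mono) auto
 also have "... <= (1 + m) powr (-e) * (5 * Y powr (3*e - 1) * (u powr (-1-e) + v powr (-1-e)))"
  using 3 by (intro mult_left_mono mult_right_mono) auto
 also have "... = 5 * ((1 + m) powr (-e) * Y powr (3*e - 1)) * (u powr (-1-e) + v powr (-1-e))" by simp
 finally show ?thesis .
qed

text \<open>The sum over the cosine index leaves almost the full decay in \<open>j\<close>, together
  with two gains used for different purposes: the power of \<open>T\<close> gives existence for
  short times, the power of \<open>1 + T * M\<close> gives uniqueness.\<close>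

lemma kern_bound_sum:
 fixes e :: real
 assumes e: "0 < e" "e < 1/3"
 obtains C where "C > 0" "\<And>T M j K. 0 < T ==> T <= 1 ==> M >= 0 ==> finite K ==>
  (\<Sum>k\<in>K. kern_bound T M k j) <= C * (T powr (3*e) * (1 + T * M) powr (-e)) * (1 + \<bar>real_of_int j\<bar>) powr (3*e - 1)"
proof -
 obtain B where B0: "B >= 0" and B: "\<And>J. finite J ==> (\<Sum>j\<in>J. (1 + \<bar>real_of_int j\<bar>) powr (-(1 + e))) <= B"
  by (rule sum_int_powr_bounded[of "1 + e"]) (use e in simp_all)
 \<comment> \<open>The points \<open>pi * k\<close> are spaced by more than 1, so after recentring
   at \<open>k0\<close> they are compared with the integers, uniformly in \<open>y\<close>.\<close>
 have shift: "(\<Sum>k\<in>K. (1 + \<bar>y - pi * real k\<bar>) powr (-1-e)) <= 4 * B" if K: "finite K" for y K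
 proof -
  define k0 where "k0 = \<lfloor>y / pi\<rfloor>"
  have "(1 + \<bar>y - pi * real k\<bar>) powr (-1-e) <= 4 * (1 + \<bar>real_of_int (int k - k0)\<bar>) powr (-(1+e))" for k
  proof -
   have "\<bar>y - pi * real k\<bar> = pi * \<bar>y / pi - real k\<bar>"
   proof -
    have "y - pi * real k = pi * (y / pi - real k)" by (simp add: right_diff_distrib)
    then show ?thesis by (simp only: abs_mult abs_of_pos[OF pi_gt_zero])
   qed
   also have "... >= 1 * \<bar>y / pi - real k\<bar>" using pi_ge_two by (intro mult_right_mono) auto
   finally have "\<bar>y - pi * real k\<bar> >= \<bar>y / pi - real k\<bar>" by simp
   moreover have "\<bar>y / pi - real k\<bar> >= \<bar>real_of_int (int k - k0)\<bar> - 1" unfolding k0_def by linarith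
   ultimately have D: "\<bar>real_of_int (int k - k0)\<bar> <= 1 + \<bar>y - pi * real k\<bar>" by linarith
   have half: "(1 + a) / 2 <= 1 + b" if "a <= 1 + b" "0 <= b" for a b :: real
    using that by (simp add: divide_le_eq)
   have "(1 + \<bar>real_of_int (int k - k0)\<bar>) / 2 <= 1 + \<bar>y - pi * real k\<bar>"
    by (rule half[OF D]) simp
   then have "(1 + \<bar>y - pi * real k\<bar>) powr (-1-e) <= ((1 + \<bar>real_of_int (int k - k0)\<bar>) / 2) powr (-1-e)"
    using e by (intro powr_mono2') auto
   also have "... = 2 powr (1 + e) * (1 + \<bar>real_of_int (int k - k0)\<bar>) powr (-(1+e))"
   proof -
    have "inverse ((2::real) powr (-1-e)) = 2 powr (1 + e)"
     by (rule inverse_unique) (simp only: powr_add[symmetric], simp)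
    then show ?thesis unfolding powr_divide unfolding divide_inverse by (simp only: mult.commute minus_add_distrib diff_conv_add_uminus)
   qed
   also have "... <= 2 powr 2 * (1 + \<bar>real_of_int (int k - k0)\<bar>) powr (-(1+e))"
    using e by (intro mult_right_mono powr_mono) auto
   finally show ?thesis by simp
  qed
  then have "(\<Sum>k\<in>K. (1 + \<bar>y - pi * real k\<bar>) powr (-1-e)) <= (\<Sum>k\<in>K. 4 * (1 + \<bar>real_of_int (int k - k0)\<bar>) powr (-(1+e)))"
   by (intro sum_mono)
  also have "... = 4 * (\<Sum>j\<in>(\<lambda>k. int k - k0) ` K. (1 + \<bar>real_of_int j\<bar>) powr (-(1+e)))"
   by (subst sum.reindex) (auto simp: inj_on_def sum_distrib_left)
  also have "... <= 4 * B" by (intro mult_left_mono B finite_imageI K) simp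
  finally show ?thesis .
 qed
 have zeta: "(\<Sum>k\<in>K. real k powr (-1-e)) <= 4 * B" if K: "finite K" "0 \<notin> K" for K :: "nat set"
 proof -
  have "(\<Sum>k\<in>K. real k powr (-1-e)) <= (\<Sum>k\<in>K. 4 * (1 + \<bar>real_of_int (int k)\<bar>) powr (-(1+e)))"
  proof (rule sum_mono)
   fix k assume "k \<in> K"
   then have k: "k >= 1" using K by (cases k) auto
   have "real k powr (-1-e) <= ((1 + real k) / 2) powr (-1-e)" using k e by (intro powr_mono2') auto
   also have "... = 2 powr (1 + e) * (1 + real k) powr (-(1+e))"
   proof -
    have "inverse ((2::real) powr (-1-e)) = 2 powr (1 + e)"
     by (rule inverse_unique) (simp only: powr_add[symmetric], simp)
    then show ?thesis unfolding powr_divide unfolding divide_inverse by (simp only: mult.commute minus_add_distrib diff_conv_add_uminus)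
   qed
   also have "... <= 2 powr 2 * (1 + real k) powr (-(1+e))" using e by (intro mult_right_mono powr_mono) auto
   finally show "real k powr (-1-e) <= 4 * (1 + \<bar>real_of_int (int k)\<bar>) powr (-(1+e))" by simp
  qed
  also have "... = 4 * (\<Sum>j\<in>int ` K. (1 + \<bar>real_of_int j\<bar>) powr (-(1+e)))"
   by (subst sum.reindex) (auto simp: inj_on_def sum_distrib_left)
  also have "... <= 4 * B" by (intro mult_left_mono B finite_imageI K) simp
  finally show ?thesis .
 qed
 \<comment> \<open>Here \<open>3280 = 4 * (420 + 200 + 200)\<close>, where
   \<open>420 = 2 * 200 + 20\<close> collects the terms in \<open>k\<close> of both products and of
   the boundary term; the 10 comes from the index 0.\<close>
 have main: "(\<Sum>k\<in>K. kern_bound T M k j) <= (10 + 3280 * B) * (T powr (3*e) * (1 + T * M) powr (-e)) * (1 + \<bar>real_of_int j\<bar>) powr (3*e - 1)"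
  if T: "0 < T" "T <= 1" and M: "M >= 0" and K: "finite K" for T M j K
 proof -
  define m where "m = T * M"
  define y where "y = T * real_of_int j"
  define Y where "Y = 1 + \<bar>y\<bar>"
  define X where "X = (1 + m) powr (-e) * Y powr (3*e - 1)"
  have m: "m >= 0" using T M by (simp add: m_def)
  have Y: "Y >= 1" by (simp add: Y_def)
  have X0: "X >= 0" by (simp add: X_def)
  have split: "1 / (1 + m + \<bar>y\<bar>) <= (1 + m) powr (-p) * Y powr (p - 1)" if "0 <= p" "p <= 1" for p
  proof -
   have "1 / (1 + m + \<bar>y\<bar>) = (1 + m + \<bar>y\<bar>) powr (-p + (p - 1))" using m by (simp add: powr_minus_divide)
   also have "... = (1 + m + \<bar>y\<bar>) powr (-p) * (1 + m + \<bar>y\<bar>) powr (p - 1)" by (rule powr_add)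
   also have "... <= (1 + m) powr (-p) * Y powr (p - 1)"
    using m that by (intro mult_mono powr_mono2') (auto simp: Y_def)
   finally show ?thesis .
  qed
  have k0: "kern_bound T M 0 j <= 10 * T * X"
  proof -
   have "1 / (1 + m + \<bar>y\<bar>) <= (1 + m) powr (-e) * Y powr (e - 1)" using split[of e] e by simp
   also have "... <= X" unfolding X_def using Y e by (intro mult_left_mono powr_mono) auto
   finally have "10 * T * (1 / (1 + m + \<bar>y\<bar>)) <= 10 * T * X" using T by (intro mult_left_mono) auto
   then show ?thesis by (simp add: kern_bound_def m_def y_def)
  qed
  have kk: "kern_bound T M k j <= T * X * (420 * real k powr (-1-e) + 200 * (1 + \<bar>(-y) - pi * k\<bar>) powr (-1-e) + 200 * (1 + \<bar>y - pi * k\<bar>) powr (-1-e))"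
   if k: "k >= 1" for k
  proof -
   have prod: "1 / (m + k) * (1 / (1 + \<bar>z - pi * k\<bar>)) <= 5 * X * (real k powr (-1-e) + (1 + \<bar>z - pi * k\<bar>) powr (-1-e))"
    if z: "\<bar>z\<bar> = \<bar>y\<bar>" for z
   proof -
    have "\<bar>z\<bar> <= \<bar>z - pi * k\<bar> + \<bar>pi * k\<bar>" using abs_triangle_ineq[of "z - pi * k" "pi * k"] by simp
    moreover have "\<bar>pi * k\<bar> <= 4 * real k" using pi_less_4 by (simp add: abs_mult mult_right_mono)
    moreover have "real k <= max (real k) (1 + \<bar>z - pi * k\<bar>)" "1 + \<bar>z - pi * k\<bar> <= max (real k) (1 + \<bar>z - pi * k\<bar>)"
     by simp_all
    ultimately have "1 + \<bar>z\<bar> <= 5 * max (real k) (1 + \<bar>z - pi * k\<bar>)" by linarith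
    then have "Y <= 5 * max (real k) (1 + \<bar>z - pi * k\<bar>)" unfolding Y_def z .
    then show ?thesis unfolding X_def using k m Y e by (intro inverse_product_le) auto
   qed
   have t2: "m / (m\<^sup>2 + (real k)\<^sup>2) / (1 + m + \<bar>y\<bar>) <= X * real k powr (-1-e)"
   proof -
    define kk where "kk = real k powr (1 + e)"
    have kk: "kk > 0" using k by (simp add: kk_def)
    have me: "m powr e <= (1 + m) powr e" using m e by (intro powr_mono2) auto
    \<comment> \<open>The boundary term becomes summable in \<open>k\<close> at the price of a
      growth \<open>(1 + m) powr e\<close>; \<open>split\<close> with exponent \<open>2*e\<close>
      recovers this loss and still leaves \<open>(1 + m) powr (-e)\<close>.\<close>
    have key: "m * kk <= (1 + m) powr e * (m\<^sup>2 + (real k)\<^sup>2)"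
    proof (cases "real k <= m")
     case True
     have "kk = real k * real k powr e" using k by (simp add: kk_def powr_add)
     also have "... <= m * (1 + m) powr e"
      by (rule mult_mono) (use True k e m in \<open>auto intro: powr_mono2\<close>)
     finally have "m * kk <= m * (m * (1 + m) powr e)" using m by (rule mult_left_mono)
     also have "... = (1 + m) powr e * m\<^sup>2" by (simp only: power2_eq_square mult_ac)
     also have "... <= (1 + m) powr e * (m\<^sup>2 + (real k)\<^sup>2)" by (rule mult_left_mono) auto
     finally show ?thesis .
    next
     case False
     show ?thesis
     proof (cases "m = 0")
      case m0: False
      have "kk * m powr (1 - e) <= kk * real k powr (1 - e)"
       by (rule mult_left_mono, rule powr_mono2) (use False m e kk in auto)
      also have "... = (real k)\<^sup>2" unfolding kk_def powr_add[symmetric] using k by (simp add: powr_numeral)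
      finally have a: "kk * m powr (1 - e) <= (real k)\<^sup>2" .
      have "m powr (1 - e) * m powr e = m" unfolding powr_add[symmetric] using m0 m by simp
      then have "m * kk = (m powr (1 - e) * m powr e) * kk" by (simp only:)
      also have "... = m powr e * (kk * m powr (1 - e))" by (simp only: mult_ac)
      also have "... <= (1 + m) powr e * (m\<^sup>2 + (real k)\<^sup>2)"
       by (rule mult_mono[OF me order_trans[OF a]]) (use kk in auto)
      finally show ?thesis .
     qed simp
    qed
    have D: "m\<^sup>2 + (real k)\<^sup>2 > 0" using k by (intro add_nonneg_pos) auto
    have "real k powr (-1-e) = 1 / kk"
     unfolding kk_def using powr_minus_divide[of "real k" "1 + e"] by simp
    then have "m / (m\<^sup>2 + (real k)\<^sup>2) <= (1 + m) powr e * real k powr (-1-e)"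
     using key D kk by (simp add: divide_le_eq le_divide_eq mult.commute)
    then have "m / (m\<^sup>2 + (real k)\<^sup>2) * (1 / (1 + m + \<bar>y\<bar>)) <= ((1 + m) powr e * real k powr (-1-e)) * ((1 + m) powr (-(2*e)) * Y powr (2*e - 1))"
     using split[of "2*e"] e m by (intro mult_mono) auto
    also have "... = (1 + m) powr (-e) * Y powr (2*e - 1) * real k powr (-1-e)"
     by (simp add: powr_add[symmetric] mult_ac)
    also have "... <= (1 + m) powr (-e) * Y powr (3*e - 1) * real k powr (-1-e)"
     using Y e by (intro mult_left_mono mult_right_mono powr_mono) auto
    finally show ?thesis unfolding X_def by simp
   qed
   have "kern_bound T M k j = 40 * T * (1 / (m + k) * (1 / (1 + \<bar>(-y) - pi * k\<bar>)) + 1 / (m + k) * (1 / (1 + \<bar>y - pi * k\<bar>))) +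
    20 * T * (m / (m\<^sup>2 + (real k)\<^sup>2) / (1 + m + \<bar>y\<bar>))"
   proof -
    have "\<bar>(-y) - pi * k\<bar> = \<bar>y + pi * k\<bar>" by linarith
    then show ?thesis using k unfolding kern_bound_def m_def y_def by (simp add: distrib_left add_divide_distrib)
   qed
   also have "... <= 40 * T * (5 * X * (real k powr (-1-e) + (1 + \<bar>(-y) - pi * k\<bar>) powr (-1-e)) + 5 * X * (real k powr (-1-e) + (1 + \<bar>y - pi * k\<bar>) powr (-1-e)))
    + 20 * T * (X * real k powr (-1-e))"
    using prod[of "-y"] prod[of y] t2 T by (intro add_mono mult_left_mono) auto
   also have "... = T * X * (420 * real k powr (-1-e) + 200 * (1 + \<bar>(-y) - pi * k\<bar>) powr (-1-e) + 200 * (1 + \<bar>y - pi * k\<bar>) powr (-1-e))"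
    by (simp add: algebra_simps)
   finally show ?thesis .
  qed
  have "(\<Sum>k\<in>K. kern_bound T M k j) <= (\<Sum>k\<in>insert 0 (K - {0}). kern_bound T M k j)"
  proof (rule sum_mono2)
   show "0 <= kern_bound T M k j" for k unfolding kern_bound_def using T M by (auto intro!: add_nonneg_nonneg mult_nonneg_nonneg divide_nonneg_nonneg)
  qed (use K in auto)
  also have "... = kern_bound T M 0 j + (\<Sum>k\<in>K - {0}. kern_bound T M k j)"
   using K by (subst sum.insert) auto
  also have "... <= 10 * T * X + (\<Sum>k\<in>K - {0}. T * X * (420 * real k powr (-1-e) + 200 * (1 + \<bar>(-y) - pi * k\<bar>) powr (-1-e) + 200 * (1 + \<bar>y - pi * k\<bar>) powr (-1-e)))"
   by (intro add_mono k0 sum_mono kk) auto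
  also have "... = 10 * T * X + T * X * (420 * (\<Sum>k\<in>K - {0}. real k powr (-1-e)) + 200 * (\<Sum>k\<in>K - {0}. (1 + \<bar>(-y) - pi * k\<bar>) powr (-1-e)) + 200 * (\<Sum>k\<in>K - {0}. (1 + \<bar>y - pi * k\<bar>) powr (-1-e)))"
   by (simp only: sum_distrib_left[symmetric] sum.distrib)
  also have "... <= 10 * T * X + T * X * (420 * (4 * B) + 200 * (4 * B) + 200 * (4 * B))"
   using zeta[of "K - {0}"] shift[of "K - {0}" "-y"] shift[of "K - {0}" y] K T X0
   by (intro add_mono mult_left_mono order_refl) auto
  also have "... = (10 + 3280 * B) * (T * X)" by (simp add: algebra_simps)
  also have "... <= (10 + 3280 * B) * ((T powr (3*e) * (1 + T * M) powr (-e)) * (1 + \<bar>real_of_int j\<bar>) powr (3*e - 1))"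
  proof (rule mult_left_mono)
   \<comment> \<open>The power of \<open>T\<close> arises here: \<open>T <= 1\<close> gives
     \<open>Y >= T * (1 + \<bar>j\<bar>)\<close>, and \<open>T\<close> times
     \<open>T powr (3*e - 1)\<close> is \<open>T powr (3*e)\<close>.\<close>
   have "T * (1 + \<bar>real_of_int j\<bar>) <= Y" unfolding Y_def y_def using T by (simp add: abs_mult algebra_simps)
   then have "Y powr (3*e - 1) <= (T * (1 + \<bar>real_of_int j\<bar>)) powr (3*e - 1)"
    using T e by (intro powr_mono2') auto
   also have "... = T powr (3*e - 1) * (1 + \<bar>real_of_int j\<bar>) powr (3*e - 1)"
    by (rule powr_mult)
   finally have "T * X <= T * ((1 + m) powr (-e) * (T powr (3*e - 1) * (1 + \<bar>real_of_int j\<bar>) powr (3*e - 1)))"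
    unfolding X_def using T by (intro mult_left_mono) auto
   also have "... = (T powr 1 * T powr (3*e - 1)) * (1 + m) powr (-e) * (1 + \<bar>real_of_int j\<bar>) powr (3*e - 1)"
    using T by simp
   also have "T powr 1 * T powr (3*e - 1) = T powr (3*e)" unfolding powr_add[symmetric] by simp
   finally show "T * X <= T powr (3*e) * (1 + T * M) powr (-e) * (1 + \<bar>real_of_int j\<bar>) powr (3*e - 1)"
    unfolding m_def .
  qed (use B0 in simp)
  finally show ?thesis by (simp add: mult.assoc)
 qed
 show ?thesis by (rule that[OF _ main]) (use B0 in simp)
qed

section \<open>The trilinear Duhamel operator\<close>

type_synonym 'a coeffs = "nat => 'a => complex"

text \<open>A truncation of the l1 norm in the cosine index of a weighted l2 norm in frequency.
  Working with suprema over finite truncations avoids any summability assumption in the definition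
  of the norm.\<close>

definition snorm :: "('a => real) => nat set => 'a set => 'a coeffs => real" where
 "snorm W K S c = (\<Sum>k\<in>K. L2_set (\<lambda>n. W n * cmod (c k n)) S)"

definition inX :: "('a => real) => 'a coeffs => bool" where
 "inX W c \<longleftrightarrow> (\<exists>B. \<forall>K S. finite K \<longrightarrow> finite S \<longrightarrow> snorm W K S c <= B)"

definition nX :: "('a => real) => 'a coeffs => real" where
 "nX W c = (SUP (K, S)\<in>{(K, S). finite K \<and> finite S}. snorm W K S c)"

lemma snorm_nonneg: "snorm W K S c >= 0"
 unfolding snorm_def by (intro sum_nonneg) auto

lemma snorm_le_nX:
 assumes "inX W c" "finite K" "finite S"
 shows "snorm W K S c <= nX W c"
proof -
 obtain B where B: "\<And>K S. finite K ==> finite S ==> snorm W K S c <= B"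
  using assms(1) unfolding inX_def by blast
 have "(case (K, S) of (K, S) => snorm W K S c) <= nX W c" unfolding nX_def
  by (rule cSUP_upper) (use assms B in \<open>auto intro!: bdd_aboveI2[where M = B]\<close>)
 then show ?thesis by simp
qed

lemma nX_leI:
 assumes "\<And>K S. finite K ==> finite S ==> snorm W K S c <= B"
 shows "nX W c <= B" "inX W c"
proof -
 show "nX W c <= B" unfolding nX_def
  by (rule cSUP_least) (use assms in auto)
 show "inX W c" unfolding inX_def using assms by blast
qed

lemma nX_nonneg: "inX W c ==> nX W c >= 0"
 using snorm_le_nX[of W c "{}" "{}"] by (simp add: snorm_def)

lemma norm_le_nX:
 assumes "inX W c" "W n > 0"
 shows "cmod (c k n) <= nX W c / W n"
proof -
 have "W n * cmod (c k n) <= nX W c"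
  using snorm_le_nX[OF assms(1), of "{k}" "{n}"] assms(2) by (simp add: snorm_def L2_set_def)
 then show ?thesis using assms(2) by (simp add: pos_le_divide_eq mult.commute)
qed

lemma snorm_add_le: "(\<And>n. W n >= 0) ==> snorm W K S (\<lambda>k n. a k n + b k n) <= snorm W K S a + snorm W K S b"
 unfolding snorm_def sum.distrib[symmetric]
proof (rule sum_mono)
 fix k assume W: "\<And>n. W n >= 0"
 have "L2_set (\<lambda>n. W n * cmod (a k n + b k n)) S <= L2_set (\<lambda>n. W n * cmod (a k n) + W n * cmod (b k n)) S"
  using W by (intro L2_set_mono) (auto simp: distrib_left[symmetric] intro!: mult_left_mono norm_triangle_ineq)
 also have "... <= L2_set (\<lambda>n. W n * cmod (a k n)) S + L2_set (\<lambda>n. W n * cmod (b k n)) S"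
  by (rule L2_set_triangle_ineq)
 finally show "L2_set (\<lambda>n. W n * cmod (a k n + b k n)) S <= L2_set (\<lambda>n. W n * cmod (a k n)) S + L2_set (\<lambda>n. W n * cmod (b k n)) S" .
qed

lemma snorm_scale: "snorm W K S (\<lambda>k n. z * c k n) = cmod z * snorm W K S c"
proof -
 have "L2_set (\<lambda>n. W n * cmod (z * c k n)) S = cmod z * L2_set (\<lambda>n. W n * cmod (c k n)) S" for k
  by (subst L2_set_mult_const[symmetric]) (auto simp: norm_mult mult_ac)
 then show ?thesis by (simp add: snorm_def sum_distrib_left)
qed

lemma nX_add:
 assumes "inX W a" "inX W b" "\<And>n. W n >= 0"
 shows "inX W (\<lambda>k n. a k n + b k n)" "nX W (\<lambda>k n. a k n + b k n) <= nX W a + nX W b"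
 using nX_leI[of W "\<lambda>k n. a k n + b k n" "nX W a + nX W b"]
  order_trans[OF snorm_add_le[OF assms(3)] add_mono[OF snorm_le_nX[OF assms(1)] snorm_le_nX[OF assms(2)]]] by blast+

lemma nX_scale_le:
 assumes "inX W c"
 shows "inX W (\<lambda>k n. z * c k n)" "nX W (\<lambda>k n. z * c k n) <= cmod z * nX W c"
proof -
 have "snorm W K S (\<lambda>k n. z * c k n) <= cmod z * nX W c" if "finite K" "finite S" for K S
  unfolding snorm_scale by (intro mult_left_mono snorm_le_nX assms that) auto
 then show "inX W (\<lambda>k n. z * c k n)" "nX W (\<lambda>k n. z * c k n) <= cmod z * nX W c"
  using nX_leI[of W "\<lambda>k n. z * c k n" "cmod z * nX W c"] by blast+
qed

lemma nX_scale:
 assumes "inX W c"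
 shows "nX W (\<lambda>k n. z * c k n) = cmod z * nX W c"
proof (cases "z = 0")
 case True
 then show ?thesis using nX_scale_le[OF assms, of z] nX_nonneg[OF nX_scale_le(1)[OF assms, of z]] by simp
next
 case False
 have "nX W (\<lambda>k n. inverse z * (z * c k n)) <= cmod (inverse z) * nX W (\<lambda>k n. z * c k n)"
  by (rule nX_scale_le(2)[OF nX_scale_le(1)[OF assms]])
 then have "cmod z * nX W c <= nX W (\<lambda>k n. z * c k n)"
  using False by (simp add: mult.assoc[symmetric] norm_inverse norm_divide field_simps)
 then show ?thesis using nX_scale_le(2)[OF assms, of z] by simp
qed

abbreviation cdiff :: "'a coeffs => 'a coeffs => 'a coeffs" where
 "cdiff a b \<equiv> (\<lambda>k n. a k n - b k n)"

lemma nX_diff: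
 assumes "inX W a" "inX W b" "\<And>n. W n >= 0"
 shows "inX W (cdiff a b)" "nX W (cdiff a b) <= nX W a + nX W b"
 using nX_add[OF assms(1) nX_scale_le(1)[OF assms(2), of "-1"] assms(3)] nX_scale[OF assms(2), of "-1"] by simp_all

lemma nX_eq_0:
 assumes "inX W c" "\<And>n. W n > 0" "nX W c = 0"
 shows "c = (\<lambda>_ _. 0)"
 using norm_le_nX[OF assms(1,2)] assms(3) by (auto simp: fun_eq_iff)

lemma nX_zero: "inX W (\<lambda>_ _. 0)" "nX W (\<lambda>_ _. 0) = 0"
proof -
 have "snorm W K S (\<lambda>_ _. 0) <= 0" for K S by (simp add: snorm_def L2_set_def)
 then show "inX W (\<lambda>_ _. 0)" "nX W (\<lambda>_ _. 0) = 0"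
  using nX_leI[of W "\<lambda>_ _. 0" 0] nX_nonneg[of W "\<lambda>_ _. 0"] by fastforce+
qed

lemma nX_triangle_diff:
 assumes "inX W a" "inX W b" "inX W c" "\<And>n. W n >= 0"
 shows "nX W (cdiff a c) <= nX W (cdiff a b) + nX W (cdiff b c)"
 using nX_add(2)[OF nX_diff(1)[OF assms(1,2,4)] nX_diff(1)[OF assms(2,3,4)] assms(4)] by simp

lemma nX_diff_commute:
 assumes "inX W a" "inX W b" "\<And>n. W n >= 0"
 shows "nX W (cdiff a b) = nX W (cdiff b a)"
 using nX_scale[OF nX_diff(1)[OF assms], of "-1"] by simp

text \<open>The limit is taken coefficientwise; bounds on finite truncations pass to it, and the
  supremum gives the norm back.\<close>

lemma nX_complete:
 fixes f :: "nat => nat => 'a => complex"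
 assumes W: "\<And>n. W n > 0" and f: "\<And>i. inX W (f i)"
  and cauchy: "\<And>e. e > 0 ==> \<exists>M. \<forall>i\<ge>M. \<forall>j\<ge>M. nX W (cdiff (f i) (f j)) < e"
 obtains u where "inX W u" "(\<lambda>i. nX W (cdiff (f i) u)) \<longlonglongrightarrow> 0" "\<And>k n. (\<lambda>i. f i k n) \<longlonglongrightarrow> u k n"
proof -
 have W0: "\<And>n. W n >= 0" using W less_imp_le by blast
 have D: "inX W (cdiff (f i) (f j))" for i j by (rule nX_diff(1)[OF f f W0])
 have conv: "convergent (\<lambda>i. f i k n)" for k n
 proof (rule Cauchy_convergent, rule metric_CauchyI)
  fix e :: real assume e: "e > 0"
  obtain M where M: "\<And>i j. i >= M ==> j >= M ==> nX W (cdiff (f i) (f j)) < e * W n"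
   using cauchy[of "e * W n"] e W[of n] by auto
  show "\<exists>M. \<forall>i\<ge>M. \<forall>j\<ge>M. dist (f i k n) (f j k n) < e"
  proof (intro exI allI impI)
   fix i j assume ij: "i >= M" "j >= M"
   have "dist (f i k n) (f j k n) <= nX W (cdiff (f i) (f j)) / W n"
    unfolding dist_norm by (rule norm_le_nX[OF D W])
   also have "... < e" using M[OF ij] W[of n] by (simp add: divide_less_eq)
   finally show "dist (f i k n) (f j k n) < e" .
  qed
 qed
 define u where "u k n = lim (\<lambda>i. f i k n)" for k n
 have lim: "(\<lambda>i. f i k n) \<longlonglongrightarrow> u k n" for k n
  unfolding u_def using conv by (simp add: convergent_LIMSEQ_iff)
 have bound: "snorm W K S (cdiff (f i) u) <= e"
  if "finite K" "finite S" "\<And>j. j >= M ==> nX W (cdiff (f i) (f j)) < e" for K S i M e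
 proof (rule tendsto_upperbound)
  show "(\<lambda>j. snorm W K S (cdiff (f i) (f j))) \<longlonglongrightarrow> snorm W K S (cdiff (f i) u)"
   unfolding snorm_def L2_set_def by (intro tendsto_intros lim)
  show "\<forall>\<^sub>F j in sequentially. snorm W K S (cdiff (f i) (f j)) <= e"
   using snorm_le_nX[OF D that(1,2)] that(3) by (intro eventually_sequentiallyI[of M]) (meson less_imp_le order_trans)
 qed simp
 obtain M1 where M1: "\<And>i j. i >= M1 ==> j >= M1 ==> nX W (cdiff (f i) (f j)) < 1"
  using cauchy[of 1] by auto
 have "inX W (cdiff (f M1) u)"
  by (rule nX_leI(2)[where B = 1]) (rule bound[where M = M1], auto intro: M1)
 from nX_diff(1)[OF f[of M1] this W0] have u: "inX W u" by simp
 have "(\<lambda>i. nX W (cdiff (f i) u)) \<longlonglongrightarrow> 0"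
 proof (rule LIMSEQ_I)
  fix e :: real assume e: "e > 0"
  obtain M where M: "\<And>i j. i >= M ==> j >= M ==> nX W (cdiff (f i) (f j)) < e / 2"
   using cauchy[of "e / 2"] e by auto
  have le: "nX W (cdiff (f i) u) <= e / 2" if "i >= M" for i
   by (rule nX_leI(1), rule bound[where M = M], assumption, assumption, rule M[OF that])
  have ge: "nX W (cdiff (f i) u) >= 0" for i
   by (rule nX_nonneg[OF nX_diff(1)[OF f u W0]])
  have e2: "e / 2 < e" using e by simp
  show "\<exists>M. \<forall>i\<ge>M. norm (nX W (cdiff (f i) u) - 0) < e"
   using ge le_less_trans[OF le e2] by (intro exI[of _ M]) simp
 qed
 then show ?thesis using that[OF u _ lim] by blast
qed

section \<open>Modes, their Duhamel kernel and the trilinear operator\<close>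

type_synonym 'a mode = "nat \<times> 'a"
type_synonym 'a modes = "'a mode \<times> 'a mode \<times> 'a mode"

definition out3 :: "'a::ab_group_add mode \<times> 'a mode \<times> 'a mode => 'a" where
 "out3 = (\<lambda>((k1, n1), (k2, n2), (k3, n3)). n1 - n2 + n3)"

definition res3 :: "('a::ab_group_add => real) => 'a modes => real" where
 "res3 Q = (\<lambda>((k1, n1), (k2, n2), (k3, n3)). Q (n1 - n2 + n3) - Q n1 + Q n2 - Q n3)"

text \<open>A product of three cosines is the mean of eight exponentials, one for each choice of
  signs; each choice adds its own \<open>shift3\<close> to the resonance.\<close>

definition signs :: "(real \<times> real \<times> real) set" where
 "signs = {1, -1} \<times> {1, -1} \<times> {1, -1}"

definition shift3 :: "real => real \<times> real \<times> real => 'a modes => real" where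
 "shift3 T = (\<lambda>(e1, e2, e3) ((k1, n1), (k2, n2), (k3, n3)). pi / T * (e1 * real k1 + e2 * real k2 + e3 * real k3))"

definition prod3 :: "'a coeffs => 'a coeffs => 'a coeffs =>
  'a modes => complex" where
 "prod3 a b c = (\<lambda>((k1, n1), (k2, n2), (k3, n3)). a k1 n1 * cnj (b k2 n2) * c k3 n3)"

definition ker3 :: "('a::ab_group_add => real) => real => real => nat => 'a modes => complex" where
 "ker3 Q T M k \<tau> = (\<Sum>\<epsilon>\<in>signs. cos_coeff T (duh M (res3 Q \<tau> + shift3 T \<epsilon> \<tau>)) k) / 8"

definition kerb :: "('a::ab_group_add => real) => real => real => nat => 'a modes => real" where
 "kerb Q T M k \<tau> = (\<Sum>\<epsilon>\<in>signs. kern_bound T M k \<lfloor>res3 Q \<tau> + shift3 T \<epsilon> \<tau>\<rfloor>)"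

abbreviation tri_term :: "('a::ab_group_add => real) => real => real => 'a coeffs => 'a coeffs => 'a coeffs => nat => 'a => 'a modes => complex" where
 "tri_term Q T M a b c k n \<tau> \<equiv> (if out3 \<tau> = n then prod3 a b c \<tau> * ker3 Q T M k \<tau> else 0)"

text \<open>The infinite sum is 0 by default on a divergent family; \<open>tri_summable\<close>
  excludes this case on the space.\<close>

definition tri :: "('a::ab_group_add => real) => real => real => 'a coeffs => 'a coeffs => 'a coeffs =>
  nat => 'a => complex" where
 "tri Q T M a b c k n = (\<Sum>\<^sub>\<infinity>\<tau>. tri_term Q T M a b c k n \<tau>)"

lemma finite_signs: "finite signs" by (simp add: signs_def)

lemma kern_bound_nonneg: "T >= 0 ==> M >= 0 ==> kern_bound T M k j >= 0"
 unfolding kern_bound_def by (auto intro!: add_nonneg_nonneg mult_nonneg_nonneg divide_nonneg_nonneg)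

lemma kerb_nonneg: "T >= 0 ==> M >= 0 ==> kerb Q T M k \<tau> >= 0"
 unfolding kerb_def by (intro sum_nonneg kern_bound_nonneg)

lemma norm_ker3_le:
 assumes "0 < T" "T <= 1" "M >= 0"
 shows "cmod (ker3 Q T M k \<tau>) <= kerb Q T M k \<tau>"
proof -
 have "cmod (ker3 Q T M k \<tau>) <= kerb Q T M k \<tau> / 8"
  unfolding ker3_def kerb_def norm_divide
  by (simp, intro divide_right_mono sum_norm_le norm_cos_coeff_duh_le_kern_bound assms)
 also have "... <= kerb Q T M k \<tau>" using kerb_nonneg[of T M Q k \<tau>] assms by simp
 finally show ?thesis .
qed

context dispersive
begin

definition good_weight :: "('a => real) => bool" where
 "good_weight w \<longleftrightarrow> (\<forall>n. w n >= 1) \<and> (\<forall>n1 n2 n3. w (n1 - n2 + n3) <= w n1 * w n2 * w n3)"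

definition Wt :: "('a => real) => 'a => real" where
 "Wt w n = jb n powr s * w n"

text \<open>The gain of \<open>kern_bound_sum\<close> at \<open>e = 2*\<delta>/3\<close>: small for
  small \<open>T\<close> when \<open>M = 0\<close>, and small for large \<open>M\<close> when
  \<open>T\<close> is fixed.\<close>

definition kap :: "real => real => real" where
 "kap T M = T powr (2*\<delta>) * (1 + T * M) powr (-(2*\<delta>/3))"

lemma Wt_pos: "good_weight w ==> Wt w n > 0"
 unfolding good_weight_def Wt_def using jb_ge_1[of n] by (intro mult_pos_pos) (auto intro: less_le_trans[OF zero_less_one])

lemma good_weight_1: "good_weight (\<lambda>_. 1)" by (simp add: good_weight_def)

lemma Wt_1_le: "good_weight w ==> Wt (\<lambda>_. 1) n <= Wt w n"
 unfolding good_weight_def Wt_def by (intro mult_left_mono) auto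

text \<open>The kernel sees a triple through its bin only. Summed over the cosine index it becomes a
  multiple of \<open>\<rho> j\<close>, the weight of \<open>weighted_trilinear\<close>.\<close>

lemma tri_box_estimate:
 obtains C5 where "C5 > 0" "\<And>T M w f g h R S K \<nu>. 0 < T ==> T <= 1 ==> M >= 0 ==> good_weight w ==>
   finite R ==> finite S ==> finite K ==> (\<And>n. f n >= 0) ==> (\<And>n. g n >= 0) ==> (\<And>n. h n >= 0) ==>
  (\<Sum>k\<in>K. L2_set (\<lambda>n. Wt w n * (\<Sum>\<theta>\<in>S\<times>S\<times>S. if out \<theta> = n then (\<lambda>(n1, n2, n3). f n1 * g n2 * h n3) \<theta> * kern_bound T M k \<lfloor>res Q \<theta> + \<nu>\<rfloor> else 0)) R) <=
  C5 * kap T M * (L2_set (\<lambda>n. Wt w n * f n) S * L2_set (\<lambda>n. Wt w n * g n) S * L2_set (\<lambda>n. Wt w n * h n) S)"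
proof -
 have d3: "0 < 2*\<delta>/3" "2*\<delta>/3 < 1/3" using delta by auto
 obtain C4 where C4: "C4 > 0" and kb: "\<And>T M j K. 0 < T ==> T <= 1 ==> M >= 0 ==> finite K ==>
  (\<Sum>k\<in>K. kern_bound T M k j) <= C4 * (T powr (3*(2*\<delta>/3)) * (1 + T * M) powr (-(2*\<delta>/3))) * (1 + \<bar>real_of_int j\<bar>) powr (3*(2*\<delta>/3) - 1)"
  using kern_bound_sum[OF d3] by blast
 have d33: "3 * (2 * \<delta> / 3) = 2 * \<delta>" by simp
 have kb': "(\<Sum>k\<in>K. kern_bound T M k j) <= C4 * kap T M * \<rho> j" if "0 < T" "T <= 1" "M >= 0" "finite K" for T M j K
  using kb[OF that, of j] unfolding kap_def \<rho>_def d33 .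
 have main: "(\<Sum>k\<in>K. L2_set (\<lambda>n. Wt w n * (\<Sum>\<theta>\<in>S\<times>S\<times>S. if out \<theta> = n then (\<lambda>(n1, n2, n3). f n1 * g n2 * h n3) \<theta> * kern_bound T M k \<lfloor>res Q \<theta> + \<nu>\<rfloor> else 0)) R) <=
  C4 * C3 * kap T M * (L2_set (\<lambda>n. Wt w n * f n) S * L2_set (\<lambda>n. Wt w n * g n) S * L2_set (\<lambda>n. Wt w n * h n) S)"
  if T: "0 < T" "T <= 1" "M >= 0" and w: "good_weight w" and fin: "finite R" "finite S" "finite K"
   and pos: "\<And>n. f n >= 0" "\<And>n. g n >= 0" "\<And>n. h n >= 0" for T M w f g h R S K \<nu>
 proof -
  let ?F = "\<lambda>(n1, n2, n3). f n1 * g n2 * h n3"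
  let ?b = "binned Q (S\<times>S\<times>S) ?F \<nu>"
  let ?N = "L2_set (\<lambda>n. Wt w n * f n) S * L2_set (\<lambda>n. Wt w n * g n) S * L2_set (\<lambda>n. Wt w n * h n) S"
  define J where "J = (\<lambda>\<theta>. \<lfloor>res Q \<theta> + \<nu>\<rfloor>) ` (S\<times>S\<times>S)"
  have J: "finite J" using fin by (simp add: J_def)
  have b0: "?b j n >= 0" for j n by (rule binned_nonneg) (use pos in \<open>simp add: split_beta\<close>)
  have W0: "Wt w n >= 0" for n using Wt_pos[OF w, of n] by simp
  have k0: "kern_bound T M k j >= 0" for k j using T by (intro kern_bound_nonneg) auto
  have eq: "(\<Sum>\<theta>\<in>S\<times>S\<times>S. if out \<theta> = n then ?F \<theta> * kern_bound T M k \<lfloor>res Q \<theta> + \<nu>\<rfloor> else 0) = (\<Sum>j\<in>J. kern_bound T M k j * ?b j n)" for k n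
  proof -
   have "(\<Sum>j\<in>J. kern_bound T M k j * ?b j n) = (\<Sum>\<theta>\<in>S\<times>S\<times>S. \<Sum>j\<in>J. kern_bound T M k j * (if out \<theta> = n \<and> \<lfloor>res Q \<theta> + \<nu>\<rfloor> = j then ?F \<theta> else 0))"
    unfolding binned_def sum_distrib_left by (rule sum.swap)
   also have "... = (\<Sum>\<theta>\<in>S\<times>S\<times>S. if out \<theta> = n then ?F \<theta> * kern_bound T M k \<lfloor>res Q \<theta> + \<nu>\<rfloor> else 0)"
   proof (rule sum.cong[OF refl])
    fix \<theta> assume th: "\<theta> \<in> S\<times>S\<times>S"
    have "(\<Sum>j\<in>J. kern_bound T M k j * (if out \<theta> = n \<and> \<lfloor>res Q \<theta> + \<nu>\<rfloor> = j then ?F \<theta> else 0)) =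
     (\<Sum>j\<in>J. if \<lfloor>res Q \<theta> + \<nu>\<rfloor> = j then (if out \<theta> = n then ?F \<theta> * kern_bound T M k \<lfloor>res Q \<theta> + \<nu>\<rfloor> else 0) else 0)"
     by (rule sum.cong[OF refl]) (simp add: mult.commute)
    also have "... = (if out \<theta> = n then ?F \<theta> * kern_bound T M k \<lfloor>res Q \<theta> + \<nu>\<rfloor> else 0)"
     using J th by (subst sum.delta') (auto simp: J_def)
    finally show "(\<Sum>j\<in>J. kern_bound T M k j * (if out \<theta> = n \<and> \<lfloor>res Q \<theta> + \<nu>\<rfloor> = j then ?F \<theta> else 0)) = (if out \<theta> = n then ?F \<theta> * kern_bound T M k \<lfloor>res Q \<theta> + \<nu>\<rfloor> else 0)" .
   qed
   finally show ?thesis by (rule sym)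
  qed
  have "L2_set (\<lambda>n. Wt w n * (\<Sum>j\<in>J. kern_bound T M k j * ?b j n)) R <= (\<Sum>j\<in>J. kern_bound T M k j * L2_set (\<lambda>n. Wt w n * ?b j n) R)" for k
  proof -
   have "L2_set (\<lambda>n. Wt w n * (\<Sum>j\<in>J. kern_bound T M k j * ?b j n)) R = L2_set (\<lambda>n. \<Sum>j\<in>J. kern_bound T M k j * (Wt w n * ?b j n)) R"
    unfolding sum_distrib_left by (simp only: mult.left_commute)
   also have "... <= (\<Sum>j\<in>J. L2_set (\<lambda>n. kern_bound T M k j * (Wt w n * ?b j n)) R)"
    by (rule L2_set_sum_le[OF J])
   also have "... = (\<Sum>j\<in>J. kern_bound T M k j * L2_set (\<lambda>n. Wt w n * ?b j n) R)"
    by (intro sum.cong refl L2_set_mult_const k0)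
   finally show ?thesis .
  qed
  then have "(\<Sum>k\<in>K. L2_set (\<lambda>n. Wt w n * (\<Sum>j\<in>J. kern_bound T M k j * ?b j n)) R) <= (\<Sum>k\<in>K. \<Sum>j\<in>J. kern_bound T M k j * L2_set (\<lambda>n. Wt w n * ?b j n) R)"
   by (intro sum_mono)
  also have "... = (\<Sum>j\<in>J. (\<Sum>k\<in>K. kern_bound T M k j) * L2_set (\<lambda>n. Wt w n * ?b j n) R)"
   unfolding sum_distrib_right by (rule sum.swap)
  also have "... <= (\<Sum>j\<in>J. (C4 * kap T M * \<rho> j) * L2_set (\<lambda>n. Wt w n * ?b j n) R)"
   by (intro sum_mono mult_right_mono kb' T fin) auto
  also have "... = C4 * kap T M * (\<Sum>j\<in>J. \<rho> j * L2_set (\<lambda>n. Wt w n * ?b j n) R)"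
   unfolding sum_distrib_left by (simp only: mult.assoc)
  also have "... <= C4 * kap T M * (C3 * ?N)"
  proof (rule mult_left_mono)
   have w1: "\<And>n. w n > 0" using w unfolding good_weight_def by (meson less_le_trans zero_less_one)
   have w2: "\<And>n1 n2 n3. w (n1 - n2 + n3) <= w n1 * w n2 * w n3" using w unfolding good_weight_def by blast
   show "(\<Sum>j\<in>J. \<rho> j * L2_set (\<lambda>n. Wt w n * ?b j n) R) <= C3 * ?N"
    unfolding Wt_def by (rule weighted_trilinear[OF J fin(1,2) pos w1 w2])
   show "0 <= C4 * kap T M" using C4 unfolding kap_def by simp
  qed
  finally show ?thesis unfolding eq by (simp only: mult_ac)
 qed
 show ?thesis by (rule that[OF _ main]) (use C3_pos C4 in simp)
qed

end

text \<open>Separates cosine indices from frequencies: \<open>out3\<close> and \<open>res3\<close>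
  depend on the frequencies alone, \<open>shift3\<close> on the indices alone.\<close>

definition pack :: "nat \<times> nat \<times> nat => 'a \<times> 'a \<times> 'a => 'a modes" where
 "pack = (\<lambda>(k1, k2, k3) (n1, n2, n3). ((k1, n1), (k2, n2), (k3, n3)))"

lemma pack_simps:
 "out3 (pack \<kappa> \<theta>) = out \<theta>" "res3 Q (pack \<kappa> \<theta>) = res Q \<theta>" "shift3 T \<epsilon> (pack \<kappa> \<theta>) = shift3 T \<epsilon> (pack \<kappa> \<theta>')"
 by (auto simp: pack_def out3_def out_def res3_def res_def shift3_def split_beta)

lemma bij_pack: "bij_betw (\<lambda>(\<theta>, \<kappa>). pack \<kappa> \<theta>) UNIV UNIV"
 by (rule bij_betw_byWitness[where f' = "\<lambda>((k1, n1), (k2, n2), (k3, n3)). ((n1, n2, n3), (k1, k2, k3))"])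
  (auto simp: pack_def)

lemma sum_pack:
 "(\<Sum>\<tau>\<in>(K\<times>S)\<times>(K\<times>S)\<times>(K\<times>S). f \<tau>) = (\<Sum>\<kappa>\<in>K\<times>K\<times>K. \<Sum>\<theta>\<in>S\<times>S\<times>S. f (pack \<kappa> \<theta>))"
 unfolding sum.cartesian_product
 by (rule sum.reindex_bij_witness[where i = "\<lambda>(\<kappa>, \<theta>). pack \<kappa> \<theta>"
    and j = "\<lambda>((k1, n1), (k2, n2), (k3, n3)). ((k1, k2, k3), (n1, n2, n3))"])
  (auto simp: pack_def)

lemma subset_modes:
 assumes "finite \<Omega>"
 obtains K S where "finite K" "finite S" "\<Omega> \<subseteq> (K\<times>S)\<times>(K\<times>S)\<times>(K\<times>S)"
proof (rule that)
 define P where "P = fst ` \<Omega> \<union> fst ` snd ` \<Omega> \<union> snd ` snd ` \<Omega>"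
 show "finite (fst ` P)" "finite (snd ` P)" using assms by (auto simp: P_def)
 show "\<Omega> \<subseteq> (fst ` P \<times> snd ` P) \<times> (fst ` P \<times> snd ` P) \<times> (fst ` P \<times> snd ` P)"
 proof
  fix \<tau> assume t: "\<tau> \<in> \<Omega>"
  then have "fst \<tau> \<in> P" "fst (snd \<tau>) \<in> P" "snd (snd \<tau>) \<in> P" unfolding P_def by blast+
  then show "\<tau> \<in> (fst ` P \<times> snd ` P) \<times> (fst ` P \<times> snd ` P) \<times> (fst ` P \<times> snd ` P)"
   unfolding mem_Times_iff by (intro conjI imageI)
 qed
qed

lemma sum_prod3: "(\<Sum>(k1, k2, k3)\<in>K\<times>K\<times>K. f k1 * g k2 * h k3) = (sum f K * sum g K * sum h K :: real)"
 unfolding sum.cartesian_product' prod.case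
 by (simp only: sum_distrib_left[symmetric] sum_distrib_right[symmetric])

context dispersive
begin

abbreviation tri_abs :: "real => real => 'a coeffs => 'a coeffs => 'a coeffs => nat => 'a => 'a modes => real" where
 "tri_abs T M a b c k n \<tau> \<equiv> (if out3 \<tau> = n then cmod (prod3 a b c \<tau>) * kerb Q T M k \<tau> else 0)"

definition tri_bound :: "real => bool" where
 "tri_bound C6 \<longleftrightarrow> (\<forall>T M w a b c K R Kf S. 0 < T \<longrightarrow> T <= 1 \<longrightarrow> M >= 0 \<longrightarrow> good_weight w \<longrightarrow>
   finite K \<longrightarrow> finite R \<longrightarrow> finite Kf \<longrightarrow> finite S \<longrightarrow>
  (\<Sum>k\<in>K. L2_set (\<lambda>n. Wt w n * (\<Sum>\<tau>\<in>(Kf\<times>S)\<times>(Kf\<times>S)\<times>(Kf\<times>S). tri_abs T M a b c k n \<tau>)) R) <=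
  C6 * kap T M * (snorm (Wt w) Kf S a * snorm (Wt w) Kf S b * snorm (Wt w) Kf S c))"

text \<open>For fixed signs and cosine indices the sum is that of \<open>tri_box_estimate\<close>
  with a constant shift. Uniformity in the shift lets the sum over the indices factor into three l1
  sums; the eight sign choices give the 8.\<close>

lemma tri_finite_estimate:
 "\<exists>C6>0. tri_bound C6"
proof -
 obtain C5 where C5: "C5 > 0" and est: "\<And>T M w f g h R S K \<nu>. 0 < T ==> T <= 1 ==> M >= 0 ==> good_weight w ==>
   finite R ==> finite S ==> finite K ==> (\<And>n. f n >= 0) ==> (\<And>n. g n >= 0) ==> (\<And>n. h n >= 0) ==>
  (\<Sum>k\<in>K. L2_set (\<lambda>n. Wt w n * (\<Sum>\<theta>\<in>S\<times>S\<times>S. if out \<theta> = n then (\<lambda>(n1, n2, n3). f n1 * g n2 * h n3) \<theta> * kern_bound T M k \<lfloor>res Q \<theta> + \<nu>\<rfloor> else 0)) R) <=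
  C5 * kap T M * (L2_set (\<lambda>n. Wt w n * f n) S * L2_set (\<lambda>n. Wt w n * g n) S * L2_set (\<lambda>n. Wt w n * h n) S)"
  using tri_box_estimate by blast
 have main: "(\<Sum>k\<in>K. L2_set (\<lambda>n. Wt w n * (\<Sum>\<tau>\<in>(Kf\<times>S)\<times>(Kf\<times>S)\<times>(Kf\<times>S). tri_abs T M a b c k n \<tau>)) R) <=
  8 * C5 * kap T M * (snorm (Wt w) Kf S a * snorm (Wt w) Kf S b * snorm (Wt w) Kf S c)"
  if T: "0 < T" "T <= 1" "M >= 0" and w: "good_weight w" and fin: "finite K" "finite R" "finite Kf" "finite S"
  for T M w a b c K R Kf S
 proof -
  define I where "I = signs \<times> (Kf \<times> Kf \<times> Kf)"
  have finI: "finite I" using fin finite_signs by (simp add: I_def)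
  define \<nu> where "\<nu> p = shift3 T (fst p) (pack (snd p) (undefined::'a\<times>'a\<times>'a))" for p
  define F where "F p = (\<lambda>(n1::'a, n2::'a, n3::'a). cmod (a (fst (snd p)) n1) * cmod (b (fst (snd (snd p))) n2) * cmod (c (snd (snd (snd p))) n3))"
   for p :: "(real \<times> real \<times> real) \<times> nat \<times> nat \<times> nat"
  define Y where "Y p k n = (\<Sum>\<theta>\<in>S\<times>S\<times>S. if out \<theta> = n then F p \<theta> * kern_bound T M k \<lfloor>res Q \<theta> + \<nu> p\<rfloor> else 0)" for p k n
  have sh: "shift3 T \<epsilon> (pack \<kappa> \<theta>) = \<nu> (\<epsilon>, \<kappa>)" for \<epsilon> \<kappa> and \<theta> :: "'a \<times> 'a \<times> 'a"
   unfolding \<nu>_def fst_conv snd_conv by (rule pack_simps(3))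
  have pr: "cmod (prod3 a b c (pack \<kappa> \<theta>)) = F (\<epsilon>, \<kappa>) \<theta>" for \<epsilon> \<kappa> \<theta>
   by (auto simp: F_def prod3_def pack_def norm_mult split_beta)
  have eq: "(\<Sum>\<tau>\<in>(Kf\<times>S)\<times>(Kf\<times>S)\<times>(Kf\<times>S). tri_abs T M a b c k n \<tau>) = (\<Sum>p\<in>I. Y p k n)" for k n
  proof -
   have "(\<Sum>\<tau>\<in>(Kf\<times>S)\<times>(Kf\<times>S)\<times>(Kf\<times>S). tri_abs T M a b c k n \<tau>)
    = (\<Sum>\<kappa>\<in>Kf\<times>Kf\<times>Kf. \<Sum>\<theta>\<in>S\<times>S\<times>S. \<Sum>\<epsilon>\<in>signs. if out \<theta> = n then F (\<epsilon>, \<kappa>) \<theta> * kern_bound T M k \<lfloor>res Q \<theta> + \<nu> (\<epsilon>, \<kappa>)\<rfloor> else 0)"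
    unfolding sum_pack
   proof (intro sum.cong refl)
    fix \<kappa> and \<theta> :: "'a \<times> 'a \<times> 'a"
    show "(if out3 (pack \<kappa> \<theta>) = n then cmod (prod3 a b c (pack \<kappa> \<theta>)) * kerb Q T M k (pack \<kappa> \<theta>) else 0) =
     (\<Sum>\<epsilon>\<in>signs. if out \<theta> = n then F (\<epsilon>, \<kappa>) \<theta> * kern_bound T M k \<lfloor>res Q \<theta> + \<nu> (\<epsilon>, \<kappa>)\<rfloor> else 0)"
    proof (cases "out \<theta> = n")
     case True
     show ?thesis unfolding pack_simps(1) if_P[OF True] kerb_def pack_simps(2) sh sum_distrib_left
      by (rule sum.cong[OF refl], rule arg_cong2[where f = times, OF pr refl])
    next
     case False
     show ?thesis unfolding pack_simps(1) if_not_P[OF False] by simp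
    qed
   qed
   also have "... = (\<Sum>\<kappa>\<in>Kf\<times>Kf\<times>Kf. \<Sum>\<epsilon>\<in>signs. Y (\<epsilon>, \<kappa>) k n)"
    unfolding Y_def by (rule sum.cong[OF refl]) (rule sum.swap)
   also have "... = (\<Sum>\<epsilon>\<in>signs. \<Sum>\<kappa>\<in>Kf\<times>Kf\<times>Kf. Y (\<epsilon>, \<kappa>) k n)" by (rule sum.swap)
   also have "... = (\<Sum>(\<epsilon>, \<kappa>)\<in>I. Y (\<epsilon>, \<kappa>) k n)" unfolding I_def by (rule sum.cartesian_product)
   also have "... = (\<Sum>p\<in>I. Y p k n)" by (rule sum.cong[OF refl]) (simp add: split_beta)
   finally show ?thesis .
  qed
  define La where "La k = L2_set (\<lambda>n. Wt w n * cmod (a k n)) S" for k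
  define Lb where "Lb k = L2_set (\<lambda>n. Wt w n * cmod (b k n)) S" for k
  define Lc where "Lc k = L2_set (\<lambda>n. Wt w n * cmod (c k n)) S" for k
  have "L2_set (\<lambda>n. Wt w n * (\<Sum>p\<in>I. Y p k n)) R <= (\<Sum>p\<in>I. L2_set (\<lambda>n. Wt w n * Y p k n) R)" for k
   unfolding sum_distrib_left by (rule L2_set_sum_le[OF finI])
  then have "(\<Sum>k\<in>K. L2_set (\<lambda>n. Wt w n * (\<Sum>p\<in>I. Y p k n)) R) <= (\<Sum>k\<in>K. \<Sum>p\<in>I. L2_set (\<lambda>n. Wt w n * Y p k n) R)"
   by (intro sum_mono)
  also have "... = (\<Sum>p\<in>I. \<Sum>k\<in>K. L2_set (\<lambda>n. Wt w n * Y p k n) R)" by (rule sum.swap)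
  also have "... <= (\<Sum>p\<in>I. C5 * kap T M * (La (fst (snd p)) * Lb (fst (snd (snd p))) * Lc (snd (snd (snd p)))))"
   unfolding Y_def F_def La_def Lb_def Lc_def
   by (intro sum_mono est[OF T w]) (use fin in auto)
  also have "... = (\<Sum>\<epsilon>\<in>signs. \<Sum>(k1, k2, k3)\<in>Kf\<times>Kf\<times>Kf. C5 * kap T M * (La k1 * Lb k2 * Lc k3))"
   unfolding I_def sum.cartesian_product by (rule sum.cong[OF refl]) (simp add: split_beta)
  also have "... = (\<Sum>\<epsilon>\<in>signs. C5 * kap T M * (\<Sum>(k1, k2, k3)\<in>Kf\<times>Kf\<times>Kf. La k1 * Lb k2 * Lc k3))"
   unfolding sum_distrib_left by (intro sum.cong refl) (simp only: split_beta)
  also have "... = 8 * C5 * kap T M * (snorm (Wt w) Kf S a * snorm (Wt w) Kf S b * snorm (Wt w) Kf S c)"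
   unfolding sum_prod3 by (simp add: signs_def snorm_def La_def Lb_def Lc_def)
  finally show ?thesis unfolding eq .
 qed
 have "0 < 8 * C5" using C5 by simp
 then show ?thesis unfolding tri_bound_def by (intro exI[of _ "8 * C5"] conjI allI impI) (assumption, rule main)
qed

text \<open>One constant for all \<open>T\<close>, \<open>M\<close> and \<open>w\<close>; the
  smallness conditions of existence, regularity and uniqueness are all stated with it.\<close>

definition Ctri :: real where "Ctri = (SOME C6. C6 > 0 \<and> tri_bound C6)"

lemma Ctri:
 "Ctri > 0"
 "0 < T ==> T <= 1 ==> M >= 0 ==> good_weight w ==> finite K ==> finite R ==> finite Kf ==> finite S ==>
  (\<Sum>k\<in>K. L2_set (\<lambda>n. Wt w n * (\<Sum>\<tau>\<in>(Kf\<times>S)\<times>(Kf\<times>S)\<times>(Kf\<times>S). tri_abs T M a b c k n \<tau>)) R) <=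
  Ctri * kap T M * (snorm (Wt w) Kf S a * snorm (Wt w) Kf S b * snorm (Wt w) Kf S c)"
 using someI_ex[OF tri_finite_estimate, folded Ctri_def] unfolding tri_bound_def by blast+

lemma kap_nonneg: "kap T M >= 0" unfolding kap_def by simp

context
 fixes T M :: real and w :: "'a => real" and a b c
 assumes T: "0 < T" "T <= 1" "M >= 0" and w: "good_weight w"
  and abc: "inX (Wt w) a" "inX (Wt w) b" "inX (Wt w) c"
begin

lemma Wt_ge_0: "Wt w n >= 0" using Wt_pos[OF w, of n] by simp

lemma tri_finite_estimate_subset:
 assumes "finite \<Omega>" "finite K" "finite R"
 shows "(\<Sum>k\<in>K. L2_set (\<lambda>n. Wt w n * (\<Sum>\<tau>\<in>\<Omega>. tri_abs T M a b c k n \<tau>)) R) <=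
  Ctri * kap T M * (nX (Wt w) a * nX (Wt w) b * nX (Wt w) c)"
proof -
 obtain Kf S where KS: "finite Kf" "finite S" "\<Omega> \<subseteq> (Kf\<times>S)\<times>(Kf\<times>S)\<times>(Kf\<times>S)"
  using subset_modes[OF assms(1)] by blast
 let ?Z = "(Kf\<times>S)\<times>(Kf\<times>S)\<times>(Kf\<times>S)"
 have le: "(\<Sum>\<tau>\<in>\<Omega>. tri_abs T M a b c k n \<tau>) <=
  (\<Sum>\<tau>\<in>?Z. tri_abs T M a b c k n \<tau>)" for n k
  using T KS by (intro sum_mono2) (auto intro!: mult_nonneg_nonneg kerb_nonneg)
 have "(\<Sum>k\<in>K. L2_set (\<lambda>n. Wt w n * (\<Sum>\<tau>\<in>\<Omega>. tri_abs T M a b c k n \<tau>)) R) <=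
   (\<Sum>k\<in>K. L2_set (\<lambda>n. Wt w n * (\<Sum>\<tau>\<in>?Z. tri_abs T M a b c k n \<tau>)) R)"
  using T by (intro sum_mono L2_set_mono mult_left_mono le Wt_ge_0 mult_nonneg_nonneg sum_nonneg)
   (auto intro!: mult_nonneg_nonneg kerb_nonneg)
 also have "... <= Ctri * kap T M * (snorm (Wt w) Kf S a * snorm (Wt w) Kf S b * snorm (Wt w) Kf S c)"
  by (rule Ctri(2)[OF T w assms(2,3) KS(1,2)])
 also have "... <= Ctri * kap T M * (nX (Wt w) a * nX (Wt w) b * nX (Wt w) c)"
  using Ctri(1) KS by (intro mult_left_mono mult_mono snorm_le_nX abc mult_nonneg_nonneg snorm_nonneg nX_nonneg kap_nonneg) auto
 finally show ?thesis .
qed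

lemma tri_summand_le:
 "cmod (tri_term Q T M a b c k n \<tau>) <= (tri_abs T M a b c k n \<tau>)"
 using norm_ker3_le[OF T, of Q k \<tau>] by (simp add: norm_mult mult_left_mono)

lemma tri_summable: "(\<lambda>\<tau>. cmod (tri_term Q T M a b c k n \<tau>)) summable_on UNIV"
proof (rule nonneg_bdd_above_summable_on)
 show "bdd_above (sum (\<lambda>\<tau>. cmod (tri_term Q T M a b c k n \<tau>)) ` {F. F \<subseteq> UNIV \<and> finite F})"
 proof (rule bdd_aboveI2)
  fix F :: "'a modes set" assume F: "F \<in> {F. F \<subseteq> UNIV \<and> finite F}"
  have "Wt w n * (\<Sum>\<tau>\<in>F. cmod (tri_term Q T M a b c k n \<tau>)) <=
   Wt w n * (\<Sum>\<tau>\<in>F. tri_abs T M a b c k n \<tau>)"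
   by (intro mult_left_mono sum_mono tri_summand_le Wt_ge_0)
  also have "... <= (\<Sum>k\<in>{k}. L2_set (\<lambda>n. Wt w n * (\<Sum>\<tau>\<in>F. tri_abs T M a b c k n \<tau>)) {n})"
   by (simp add: L2_set_def)
  also have "... <= Ctri * kap T M * (nX (Wt w) a * nX (Wt w) b * nX (Wt w) c)"
   by (rule tri_finite_estimate_subset) (use F in auto)
  finally show "(\<Sum>\<tau>\<in>F. cmod (tri_term Q T M a b c k n \<tau>)) <=
    Ctri * kap T M * (nX (Wt w) a * nX (Wt w) b * nX (Wt w) c) / Wt w n"
   using Wt_pos[OF w, of n] by (simp add: pos_le_divide_eq mult.commute)
 qed
qed simp

lemma tri_tendsto:
 "((\<lambda>\<Omega>. \<Sum>\<tau>\<in>\<Omega>. tri_term Q T M a b c k n \<tau>) \<longlongrightarrow> tri Q T M a b c k n) (finite_subsets_at_top UNIV)"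
 unfolding tri_def by (rule infsum_tendsto, rule abs_summable_summable, rule tri_summable)

lemma tri_snorm_le:
 assumes "finite K" "finite R"
 shows "snorm (Wt w) K R (tri Q T M a b c) <= Ctri * kap T M * (nX (Wt w) a * nX (Wt w) b * nX (Wt w) c)"
proof (rule tendsto_upperbound)
 let ?t = "\<lambda>\<Omega> k n. \<Sum>\<tau>\<in>\<Omega>. tri_term Q T M a b c k n \<tau>"
 show "((\<lambda>\<Omega>. snorm (Wt w) K R (?t \<Omega>)) \<longlongrightarrow> snorm (Wt w) K R (tri Q T M a b c)) (finite_subsets_at_top UNIV)"
  unfolding snorm_def L2_set_def by (intro tendsto_intros tri_tendsto)
 show "\<forall>\<^sub>F \<Omega> in finite_subsets_at_top UNIV. snorm (Wt w) K R (?t \<Omega>) <= Ctri * kap T M * (nX (Wt w) a * nX (Wt w) b * nX (Wt w) c)"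
 proof (rule eventually_finite_subsets_at_top_weakI)
  fix \<Omega> :: "'a modes set" assume "finite \<Omega>"
  have "snorm (Wt w) K R (?t \<Omega>) <= (\<Sum>k\<in>K. L2_set (\<lambda>n. Wt w n * (\<Sum>\<tau>\<in>\<Omega>. tri_abs T M a b c k n \<tau>)) R)"
   unfolding snorm_def
   by (intro sum_mono L2_set_mono mult_left_mono sum_norm_le tri_summand_le Wt_ge_0 mult_nonneg_nonneg norm_ge_zero)
  also have "... <= Ctri * kap T M * (nX (Wt w) a * nX (Wt w) b * nX (Wt w) c)"
   by (rule tri_finite_estimate_subset[OF \<open>finite \<Omega>\<close> assms])
  finally show "snorm (Wt w) K R (?t \<Omega>) <= Ctri * kap T M * (nX (Wt w) a * nX (Wt w) b * nX (Wt w) c)" .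
 qed
qed simp

lemma tri_inX: "inX (Wt w) (tri Q T M a b c)"
 and nX_tri_le: "nX (Wt w) (tri Q T M a b c) <= Ctri * kap T M * (nX (Wt w) a * nX (Wt w) b * nX (Wt w) c)"
 using nX_leI[OF tri_snorm_le] by blast+

end

lemma tri_diff:
 assumes T: "0 < T" "T <= 1" "M >= 0" and w: "good_weight w"
  and "inX (Wt w) a" "inX (Wt w) b" "inX (Wt w) c" "inX (Wt w) a'" "inX (Wt w) b'" "inX (Wt w) c'"
 shows "tri Q T M (cdiff a a') b c = (\<lambda>k n. tri Q T M a b c k n - tri Q T M a' b c k n)"
  "tri Q T M a (cdiff b b') c = (\<lambda>k n. tri Q T M a b c k n - tri Q T M a b' c k n)"
  "tri Q T M a b (cdiff c c') = (\<lambda>k n. tri Q T M a b c k n - tri Q T M a b c' k n)"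
proof -
 have W0: "\<And>n. Wt w n >= 0" using Wt_pos[OF w] less_imp_le by blast
 have gen: "tri Q T M a b c = (\<lambda>k n. tri Q T M a1 b1 c1 k n - tri Q T M a2 b2 c2 k n)"
  if "inX (Wt w) a1" "inX (Wt w) b1" "inX (Wt w) c1" "inX (Wt w) a2" "inX (Wt w) b2" "inX (Wt w) c2"
   and eq: "\<And>\<tau>. prod3 a b c \<tau> = prod3 a1 b1 c1 \<tau> - prod3 a2 b2 c2 \<tau>" for a b c a1 b1 c1 a2 b2 c2
 proof (intro ext)
  fix k n
  have s1: "(\<lambda>\<tau>. tri_term Q T M a1 b1 c1 k n \<tau>) summable_on UNIV"
   by (rule abs_summable_summable, rule tri_summable[OF T w that(1-3)])
  have s2: "(\<lambda>\<tau>. tri_term Q T M a2 b2 c2 k n \<tau>) summable_on UNIV"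
   by (rule abs_summable_summable, rule tri_summable[OF T w that(4-6)])
  have e: "(tri_term Q T M a b c k n \<tau>) =
   (tri_term Q T M a1 b1 c1 k n \<tau>) + (- 1) * (tri_term Q T M a2 b2 c2 k n \<tau>)" for \<tau>
   unfolding eq by (simp add: algebra_simps)
  show "tri Q T M a b c k n = tri Q T M a1 b1 c1 k n - tri Q T M a2 b2 c2 k n"
   unfolding tri_def e infsum_add[OF s1 summable_on_cmult_right[OF s2]] infsum_cmult_right'
   by simp
 qed
 note [intro] = assms(5-) nX_diff(1)[OF _ _ W0]
 show "tri Q T M (cdiff a a') b c = (\<lambda>k n. tri Q T M a b c k n - tri Q T M a' b c k n)"
  by (rule gen) (auto simp: prod3_def algebra_simps)
 show "tri Q T M a (cdiff b b') c = (\<lambda>k n. tri Q T M a b c k n - tri Q T M a b' c k n)"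
  by (rule gen) (auto simp: prod3_def algebra_simps)
 show "tri Q T M a b (cdiff c c') = (\<lambda>k n. tri Q T M a b c k n - tri Q T M a b c' k n)"
  by (rule gen) (auto simp: prod3_def algebra_simps)
qed

end

section \<open>Cosine coefficients of products, and the damping factor\<close>

lemma uniform_limit_integral':
 fixes f :: "'i => real => complex"
 assumes "uniform_limit {a..b} f g F" "\<And>n. continuous_on {a..b} (f n)" "F \<noteq> bot"
 shows "((\<lambda>n. integral {a..b} (f n)) \<longlongrightarrow> integral {a..b} g) F"
proof -
 obtain I J where I: "\<And>n. (f n has_integral I n) {a..b}" and J: "(g has_integral J) {a..b}" and lim: "(I \<longlongrightarrow> J) F"
  using uniform_limit_integral[OF assms] by blast
 show ?thesis unfolding integral_unique[OF I] integral_unique[OF J] by (rule lim)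
qed

lemma cos_coeff_tendsto:
 assumes u: "uniform_limit {0..T} f g F" and c: "\<And>n. continuous_on {0..T} (f n)" and F: "F \<noteq> bot"
 shows "((\<lambda>n. cos_coeff T (f n) k) \<longlongrightarrow> cos_coeff T g k) F"
 unfolding cos_coeff_def
proof (intro tendsto_mult_left uniform_limit_integral' F)
 show "uniform_limit {0..T} (\<lambda>n t. f n t * of_real (cosT T k t)) (\<lambda>t. g t * of_real (cosT T k t)) F"
 proof (rule uniform_limitI)
  fix e :: real assume "e > 0"
  from uniform_limitD[OF u this] show "\<forall>\<^sub>F n in F. \<forall>t\<in>{0..T}. dist (f n t * of_real (cosT T k t)) (g t * of_real (cosT T k t)) < e"
  proof eventually_elim
   case (elim n)
   show ?case
   proof
    fix t assume t: "t \<in> {0..T}"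
    have "dist (f n t * of_real (cosT T k t)) (g t * of_real (cosT T k t)) = dist (f n t) (g t) * \<bar>cosT T k t\<bar>"
     by (simp add: dist_norm left_diff_distrib[symmetric] norm_mult)
    also have "... <= dist (f n t) (g t)" by (intro mult_left_le abs_cosT_le) simp
    also have "... < e" using elim t by blast
    finally show "dist (f n t * of_real (cosT T k t)) (g t * of_real (cosT T k t)) < e" .
   qed
  qed
 qed
qed (intro continuous_intros c)

lemma cos_coeff_sum:
 assumes "finite L" "\<And>l. l \<in> L ==> continuous_on {0..T} (f l)"
 shows "cos_coeff T (\<lambda>t. \<Sum>l\<in>L. z l * f l t) k = (\<Sum>l\<in>L. z l * cos_coeff T (f l) k)"
proof -
 have "integral {0..T} (\<lambda>t. (\<Sum>l\<in>L. z l * f l t) * of_real (cosT T k t)) = integral {0..T} (\<lambda>t. \<Sum>l\<in>L. z l * (f l t * of_real (cosT T k t)))"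
  by (simp add: sum_distrib_right mult.assoc)
 also have "... = (\<Sum>l\<in>L. integral {0..T} (\<lambda>t. z l * (f l t * of_real (cosT T k t))))"
  by (rule integral_sum[OF assms(1)]) (intro integrable_continuous_interval continuous_intros assms(2))
 finally show ?thesis unfolding cos_coeff_def by (simp add: sum_distrib_left mult_ac)
qed

lemma norm_cos_coeff_cosT_mult_cseries_le:
 assumes T: "T > 0" and c: "(\<lambda>k. cmod (c k)) summable_on UNIV"
 shows "cmod (cos_coeff T (\<lambda>t. of_real (cosT T l t) * cseries T c t) k) <=
  cmod (c (k + l)) + cmod (c (if l <= k then k - l else l - k))"
proof -
 let ?i = "k + l" and ?j = "if l <= k then k - l else l - k"
 have cont: "continuous_on {0..T} (cseries T c)" by (rule continuous_cseries[OF c])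
 have "integral {0..T} (\<lambda>t. of_real (cosT T l t) * cseries T c t * of_real (cosT T k t)) =
  integral {0..T} (\<lambda>t. (1/2) * (cseries T c t * of_real (cosT T ?i t)) + (1/2) * (cseries T c t * of_real (cosT T ?j t)))"
 proof (rule integral_cong)
  fix t
  have "of_real (cosT T l t) * cseries T c t * of_real (cosT T k t) = cseries T c t * of_real (cosT T k t * cosT T l t)" by simp
  also have "... = (1/2) * (cseries T c t * of_real (cosT T ?i t)) + (1/2) * (cseries T c t * of_real (cosT T ?j t))"
   unfolding cosT_mult by (simp add: algebra_simps add_divide_distrib)
  finally show "of_real (cosT T l t) * cseries T c t * of_real (cosT T k t) =
   (1/2) * (cseries T c t * of_real (cosT T ?i t)) + (1/2) * (cseries T c t * of_real (cosT T ?j t))" .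
 qed
 also have "... = (1/2) * (c ?i * of_real (T / cosN ?i)) + (1/2) * (c ?j * of_real (T / cosN ?j))"
  unfolding integral_cseries_cosT[OF T c, symmetric]
  by (subst integral_add) (auto intro!: integrable_continuous_interval continuous_intros cont)
 finally have eq: "cos_coeff T (\<lambda>t. of_real (cosT T l t) * cseries T c t) k =
  of_real (cosN k / T) * ((1/2) * (c ?i * of_real (T / cosN ?i)) + (1/2) * (c ?j * of_real (T / cosN ?j)))"
  unfolding cos_coeff_def by simp
 have tm: "cmod (of_real (cosN k / T) * ((1/2) * (c i * of_real (T / cosN i)))) <= cmod (c i)" for i
 proof -
  have "cosN k / cosN i / 2 <= 1" by (simp add: cosN_def)
  then have "cmod (c i) * (cosN k / cosN i / 2) <= cmod (c i)" by (intro mult_left_le) auto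
  moreover have "cmod (of_real (cosN k / T) * ((1/2) * (c i * of_real (T / cosN i)))) = cmod (c i) * (cosN k / cosN i / 2)"
   using T cosN_pos[of k] cosN_pos[of i] by (simp add: norm_mult norm_divide mult_ac)
  ultimately show ?thesis by simp
 qed
 show ?thesis unfolding eq distrib_left[of "of_real (cosN k / T)"]
  by (rule order_trans[OF norm_triangle_ineq add_mono[OF tm tm]])
qed

lemma sum_reindex_le:
 fixes N :: "nat => real"
 assumes "\<And>K. finite K ==> sum N K <= B" "finite K" "inj_on h K"
 shows "(\<Sum>k\<in>K. N (h k)) <= B"
 using assms(1)[of "h ` K"] assms(2,3) by (simp add: sum.reindex)

lemma inX_summable:
 assumes "inX W c" "W n > 0"
 shows "(\<lambda>k. cmod (c k n)) summable_on UNIV"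
proof (rule nonneg_bdd_above_summable_on)
 show "bdd_above (sum (\<lambda>k. cmod (c k n)) ` {F. F \<subseteq> UNIV \<and> finite F})"
 proof (rule bdd_aboveI2)
  fix F :: "nat set" assume F: "F \<in> {F. F \<subseteq> UNIV \<and> finite F}"
  have "W n * (\<Sum>k\<in>F. cmod (c k n)) = snorm W F {n} c"
   using assms(2) by (simp add: snorm_def L2_set_def sum_distrib_left)
  also have "... <= nX W c" by (rule snorm_le_nX[OF assms(1)]) (use F in auto)
  finally show "(\<Sum>k\<in>F. cmod (c k n)) <= nX W c / W n" using assms(2) by (simp add: pos_le_divide_eq mult.commute)
 qed
qed simp

definition absum :: "'a coeffs => 'a => real" where
 "absum c n = (\<Sum>\<^sub>\<infinity>k. cmod (c k n))"

lemma absum_nonneg: "absum c n >= 0" unfolding absum_def by (rule infsum_nonneg) simp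

lemma sum_le_absum:
 assumes "inX W c" "W n > 0" "finite K"
 shows "(\<Sum>k\<in>K. cmod (c k n)) <= absum c n"
 unfolding absum_def by (rule finite_sum_le_infsum[OF inX_summable[OF assms(1,2)] assms(3)]) auto

abbreviation cval :: "real => 'a coeffs => 'a => real => complex" where
 "cval T c n \<equiv> cseries T (\<lambda>k. c k n)"

lemma norm_cseries_le_absum:
 assumes "inX W c" "W n > 0"
 shows "cmod (cval T c n t) <= absum c n"
 unfolding cseries_def absum_def
 by (rule norm_infsum_le[OF has_sum_infsum has_sum_infsum]) 
  (auto simp: norm_mult intro!: mult_left_le abs_cosT_le inX_summable[of W] assms abs_summable_summable[OF cseries_sums(2)])

lemma L2_set_absum_le:
 assumes c: "inX W c" and W: "\<And>n. W n > 0" and S: "finite S"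
 shows "L2_set (\<lambda>n. W n * absum c n) S <= nX W c"
proof (rule tendsto_upperbound)
 show "((\<lambda>K. L2_set (\<lambda>n. W n * (\<Sum>k\<in>K. cmod (c k n))) S) \<longlongrightarrow> L2_set (\<lambda>n. W n * absum c n) S) (finite_subsets_at_top UNIV)"
  unfolding L2_set_def absum_def by (intro tendsto_intros infsum_tendsto inX_summable[OF c W])
 show "\<forall>\<^sub>F K in finite_subsets_at_top UNIV. L2_set (\<lambda>n. W n * (\<Sum>k\<in>K. cmod (c k n))) S <= nX W c"
 proof (rule eventually_finite_subsets_at_top_weakI)
  fix K :: "nat set" assume K: "finite K"
  have "L2_set (\<lambda>n. W n * (\<Sum>k\<in>K. cmod (c k n))) S <= snorm W K S c"
   unfolding snorm_def sum_distrib_left by (rule L2_set_sum_le[OF K])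
  also have "... <= nX W c" by (rule snorm_le_nX[OF c K S])
  finally show "L2_set (\<lambda>n. W n * (\<Sum>k\<in>K. cmod (c k n))) S <= nX W c" .
 qed
qed simp

text \<open>Multiplication by a function with absolutely convergent cosine series preserves the space.\<close>

lemma inX_cos_coeff_mult:
 assumes T: "T > 0" and g: "(\<lambda>l. cmod (g l)) summable_on UNIV" and c: "inX W c" and W: "\<And>n. W n > 0"
 shows "inX W (\<lambda>k n. cos_coeff T (\<lambda>t. cseries T g t * cval T c n t) k)"
proof (rule nX_leI(2))
 fix K :: "nat set" and S :: "'a set" assume fin: "finite K" "finite S"
 let ?A = "\<lambda>n. cval T c n"
 define p where "p L n t = (\<Sum>l\<in>L. g l * (of_real (cosT T l t) * ?A n t))" for L n t
 have s: "(\<lambda>k. cmod (c k n)) summable_on UNIV" for n by (rule inX_summable[OF c W])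
 have A: "continuous_on X (?A n)" for n X by (rule continuous_cseries[OF s])
 have ul: "uniform_limit {0..T} (\<lambda>L. p L n) (\<lambda>t. \<Sum>\<^sub>\<infinity>l. g l * (of_real (cosT T l t) * ?A n t)) (finite_subsets_at_top UNIV)" for n
  unfolding p_def
 proof (rule Weierstrass_m_test_general)
  show "(\<lambda>l. cmod (g l) * absum c n) summable_on UNIV" by (rule summable_on_cmult_left[OF g])
  fix l t
  have "cmod (of_real (cosT T l t) * ?A n t) <= 1 * absum c n"
   unfolding norm_mult norm_of_real by (intro mult_mono abs_cosT_le norm_cseries_le_absum[OF c W]) auto
  then show "cmod (g l * (of_real (cosT T l t) * ?A n t)) <= cmod (g l) * absum c n"
   unfolding norm_mult[of "g l"] by (intro mult_left_mono) auto
 qed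
 have lim: "(\<Sum>\<^sub>\<infinity>l. g l * (of_real (cosT T l t) * ?A n t)) = cseries T g t * ?A n t" for t n
  unfolding mult.assoc[symmetric] infsum_cmult_left' cseries_def ..
 have coeff: "((\<lambda>L. cos_coeff T (p L n) k) \<longlongrightarrow> cos_coeff T (\<lambda>t. cseries T g t * ?A n t) k) (finite_subsets_at_top UNIV)" for n k
  by (rule cos_coeff_tendsto[OF ul[unfolded lim]]) (auto simp: p_def intro!: continuous_intros A)
 define N where "N k = L2_set (\<lambda>n. W n * cmod (c k n)) S" for k
 have N: "sum N K <= nX W c" if "finite K" for K
  using snorm_le_nX[OF c that fin(2)] by (simp add: N_def snorm_def)
 have N0: "N k >= 0" for k by (simp add: N_def)
 define dst where "dst l k = (if l <= k then k - l else l - k)" for l k :: nat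
 \<comment> \<open>The index \<open>k + l\<close> is injective in \<open>k\<close>, and the distance
   of \<open>k\<close> and \<open>l\<close> is at most two-to-one, hence the 3.\<close>
 have shifts: "(\<Sum>k\<in>K. N (k + l)) + (\<Sum>k\<in>K. N (dst l k)) <= 3 * nX W c" for l
 proof -
  have 1: "(\<Sum>k\<in>K. N (k + l)) <= nX W c" by (rule sum_reindex_le[OF N fin(1)]) auto
  have "(\<Sum>k\<in>K. N (dst l k)) = (\<Sum>k\<in>{k\<in>K. l <= k}. N (dst l k)) + (\<Sum>k\<in>{k\<in>K. \<not> l <= k}. N (dst l k))"
   using fin(1) by (subst sum.union_disjoint[symmetric]) (auto intro!: sum.cong)
  also have "... <= nX W c + nX W c"
   using fin(1) by (intro add_mono sum_reindex_le[OF N]) (auto simp: inj_on_def dst_def)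
  finally show ?thesis using 1 by simp
 qed
 show "snorm W K S (\<lambda>k n. cos_coeff T (\<lambda>t. cseries T g t * ?A n t) k) <= (\<Sum>\<^sub>\<infinity>l. cmod (g l)) * (3 * nX W c)"
 proof (rule tendsto_upperbound)
  show "((\<lambda>L. snorm W K S (\<lambda>k n. cos_coeff T (p L n) k)) \<longlongrightarrow> snorm W K S (\<lambda>k n. cos_coeff T (\<lambda>t. cseries T g t * ?A n t) k)) (finite_subsets_at_top UNIV)"
   unfolding snorm_def L2_set_def by (intro tendsto_intros coeff)
  show "\<forall>\<^sub>F L in finite_subsets_at_top UNIV. snorm W K S (\<lambda>k n. cos_coeff T (p L n) k) <= (\<Sum>\<^sub>\<infinity>l. cmod (g l)) * (3 * nX W c)"
  proof (rule eventually_finite_subsets_at_top_weakI)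
   fix L :: "nat set" assume L: "finite L"
   have pt: "W n * cmod (cos_coeff T (p L n) k) <= (\<Sum>l\<in>L. cmod (g l) * (W n * cmod (c (k + l) n) + W n * cmod (c (dst l k) n)))" for k n
   proof -
    have "cmod (cos_coeff T (p L n) k) <= (\<Sum>l\<in>L. cmod (g l) * (cmod (c (k + l) n) + cmod (c (dst l k) n)))"
     unfolding p_def
    proof (subst cos_coeff_sum[OF L])
     show "cmod (\<Sum>l\<in>L. g l * cos_coeff T (\<lambda>t. of_real (cosT T l t) * ?A n t) k) <= (\<Sum>l\<in>L. cmod (g l) * (cmod (c (k + l) n) + cmod (c (dst l k) n)))"
      unfolding dst_def
      by (intro sum_norm_le) (simp only: norm_mult, intro mult_left_mono norm_cos_coeff_cosT_mult_cseries_le T s norm_ge_zero)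
    qed (intro continuous_intros A)
    then have "W n * cmod (cos_coeff T (p L n) k) <= W n * (\<Sum>l\<in>L. cmod (g l) * (cmod (c (k + l) n) + cmod (c (dst l k) n)))"
     using W[of n] by (intro mult_left_mono) auto
    then show ?thesis by (simp add: sum_distrib_left algebra_simps)
   qed
   have "L2_set (\<lambda>n. W n * cmod (cos_coeff T (p L n) k)) S <= (\<Sum>l\<in>L. cmod (g l) * (N (k + l) + N (dst l k)))" for k
   proof -
    have W0: "W n >= 0" for n using W less_imp_le by blast
    have "L2_set (\<lambda>n. W n * cmod (cos_coeff T (p L n) k)) S <= L2_set (\<lambda>n. \<Sum>l\<in>L. cmod (g l) * (W n * cmod (c (k + l) n) + W n * cmod (c (dst l k) n))) S"
     by (intro L2_set_mono pt mult_nonneg_nonneg W0 norm_ge_zero)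
    also have "... <= (\<Sum>l\<in>L. L2_set (\<lambda>n. cmod (g l) * (W n * cmod (c (k + l) n) + W n * cmod (c (dst l k) n))) S)"
     by (rule L2_set_sum_le[OF L])
    also have "... <= (\<Sum>l\<in>L. cmod (g l) * (N (k + l) + N (dst l k)))"
     unfolding N_def L2_set_mult_const[OF norm_ge_zero] by (intro sum_mono mult_left_mono L2_set_triangle_ineq norm_ge_zero)
    finally show ?thesis .
   qed
   then have "snorm W K S (\<lambda>k n. cos_coeff T (p L n) k) <= (\<Sum>k\<in>K. \<Sum>l\<in>L. cmod (g l) * (N (k + l) + N (dst l k)))"
    unfolding snorm_def by (intro sum_mono)
   also have "... = (\<Sum>l\<in>L. cmod (g l) * ((\<Sum>k\<in>K. N (k + l)) + (\<Sum>k\<in>K. N (dst l k))))"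
    by (subst sum.swap) (simp only: sum_distrib_left[symmetric] sum.distrib)
   also have "... <= (\<Sum>l\<in>L. cmod (g l) * (3 * nX W c))" by (intro sum_mono mult_left_mono shifts norm_ge_zero)
   also have "... <= (\<Sum>\<^sub>\<infinity>l. cmod (g l)) * (3 * nX W c)"
    unfolding sum_distrib_right[symmetric] using nX_nonneg[OF c]
    by (intro mult_right_mono finite_sum_le_infsum g L) auto
   finally show "snorm W K S (\<lambda>k n. cos_coeff T (p L n) k) <= (\<Sum>\<^sub>\<infinity>l. cmod (g l)) * (3 * nX W c)" .
  qed
 qed simp
qed

lemma cos_coeff_duh_summable:
 assumes T: "0 < T" "T <= 1" and M: "M >= 0"
 shows "(\<lambda>k. cmod (cos_coeff T (duh M \<mu>) k)) summable_on UNIV"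
proof -
 \<comment> \<open>Any exponent strictly between 0 and 1/3 serves.\<close>
 define e :: real where "e = 1/6"
 have e: "0 < e" "e < 1/3" by (auto simp: e_def)
 obtain C where "C > 0" and C: "\<And>T M j K. 0 < T ==> T <= 1 ==> M >= 0 ==> finite K ==>
  (\<Sum>k\<in>K. kern_bound T M k j) <= C * (T powr (3*e) * (1 + T * M) powr (-e)) * (1 + \<bar>real_of_int j\<bar>) powr (3*e - 1)"
  using kern_bound_sum[OF e] by blast
 show ?thesis
 proof (rule nonneg_bdd_above_summable_on)
  show "bdd_above (sum (\<lambda>k. cmod (cos_coeff T (duh M \<mu>) k)) ` {F. F \<subseteq> UNIV \<and> finite F})"
  proof (rule bdd_aboveI2)
   fix F :: "nat set" assume "F \<in> {F. F \<subseteq> UNIV \<and> finite F}"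
   then have F: "finite F" by simp
   have "(\<Sum>k\<in>F. cmod (cos_coeff T (duh M \<mu>) k)) <= (\<Sum>k\<in>F. kern_bound T M k \<lfloor>\<mu>\<rfloor>)"
    by (rule sum_mono, rule norm_cos_coeff_duh_le_kern_bound[OF T M])
   from order_trans[OF this C[OF T M F, of "\<lfloor>\<mu>\<rfloor>"]]
   show "(\<Sum>k\<in>F. cmod (cos_coeff T (duh M \<mu>) k)) <=
    C * (T powr (3*e) * (1 + T * M) powr (-e)) * (1 + \<bar>real_of_int \<lfloor>\<mu>\<rfloor>\<bar>) powr (3*e - 1)" .
  qed
 qed simp
qed

text \<open>Here \<open>duh M 0\<close> is the solution of E' = 1 - M E with E(0) = 0. Its cosine
  coefficients are summable by the kernel bound, so the exponential gets an absolutely convergent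
  cosine series without a separate computation.\<close>

lemma exp_eq_duh: "complex_of_real (exp (- M * t)) = 1 - of_real M * duh M 0 t"
proof (cases "M = 0")
 case False
 have M: "Complex M 0 = of_real M" by (simp add: complex_of_real_def)
 have i: "exp (\<i> * of_real 0 * of_real t) = (1::complex)" by simp
 have "duh M 0 t = (1 - exp (- of_real M * of_real t)) / of_real M"
  unfolding duh_def M i using False by (simp only: simp_thms if_False)
 then have "of_real M * duh M 0 t = 1 - exp (- of_real M * of_real t)" using False by simp
 moreover have "complex_of_real (exp (- M * t)) = exp (of_real (- M * t))" by (rule exp_of_real[symmetric])
 moreover have "complex_of_real (- M * t) = - of_real M * of_real t" by simp
 ultimately show ?thesis by (simp only: diff_diff_eq2 add_diff_cancel_left')
qed simp

text \<open>Damping stays inside the space: with \<open>p\<close> the coefficients of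
  \<open>duh M 0\<close> times the function, \<open>c - M * p\<close> represents the damped function
  by \<open>exp_eq_duh\<close>.\<close>

lemma inX_damp:
 assumes T: "0 < T" "T <= 1" and M: "M >= 0" and c: "inX W c" and W: "\<And>n. W n > 0"
 obtains e where "inX W e" "\<And>n t. t \<in> {0..T} ==> cval T e n t = of_real (exp (- M * t)) * cval T c n t"
proof -
 let ?A = "\<lambda>n. cval T c n"
 define g where "g = cos_coeff T (duh M 0)"
 have g: "(\<lambda>l. cmod (g l)) summable_on UNIV" unfolding g_def by (rule cos_coeff_duh_summable[OF T M])
 have gs: "cseries T g t = duh M 0 t" if "t \<in> {0..T}" for t
  unfolding g_def by (rule cseries_cos_coeff[OF T(1) continuous_duh g[unfolded g_def] that])
 define p where "p k n = cos_coeff T (\<lambda>t. cseries T g t * ?A n t) k" for k n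
 have p: "inX W p" unfolding p_def by (rule inX_cos_coeff_mult[OF T(1) g c W])
 have W0: "W n >= 0" for n using W less_imp_le by blast
 have s: "(\<lambda>k. cmod (b k n)) summable_on UNIV" if "inX W b" for b n by (rule inX_summable[OF that W])
 have ps: "cval T p n t = cseries T g t * ?A n t" if "t \<in> {0..T}" for n t
  unfolding p_def by (rule cseries_cos_coeff[OF T(1) _ s[OF p, unfolded p_def] that])
   (intro continuous_intros continuous_cseries g s c)
 show ?thesis
 proof (rule that)
  show "inX W (\<lambda>k n. c k n - of_real M * p k n)" by (intro nX_diff nX_scale_le c p W0)
  fix n t assume t: "t \<in> {0..T}"
  have "(\<lambda>k. c k n * of_real (cosT T k t) - of_real M * (p k n * of_real (cosT T k t))) sums (?A n t - of_real M * cval T p n t)"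
   by (intro sums_diff sums_mult cseries_sums(1) s c p)
  then have "(\<lambda>k. (c k n - of_real M * p k n) * of_real (cosT T k t)) sums (?A n t - of_real M * cval T p n t)"
   by (simp add: algebra_simps)
  moreover have "(\<lambda>k. (c k n - of_real M * p k n) * of_real (cosT T k t)) sums cseries T (\<lambda>k. c k n - of_real M * p k n) t"
   by (rule cseries_sums(1), rule s) (intro nX_diff nX_scale_le c p W0)
  ultimately have "cseries T (\<lambda>k. c k n - of_real M * p k n) t = ?A n t - of_real M * cval T p n t"
   by (rule sums_unique2[rotated])
  then show "cseries T (\<lambda>k. c k n - of_real M * p k n) t = of_real (exp (- M * t)) * ?A n t"
   unfolding exp_eq_duh ps[OF t] gs[OF t] by (simp add: algebra_simps)
 qed
qed

section \<open>The nonlinearity at a fixed time\<close>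

definition cos3 :: "real => 'a modes => real => real" where
 "cos3 T = (\<lambda>((k1, n1), (k2, n2), (k3, n3)) r. cosT T k1 r * cosT T k2 r * cosT T k3 r)"

abbreviation nonlin_term :: "('a::ab_group_add => real) => real => 'a coeffs => 'a coeffs => 'a coeffs => 'a => real => 'a modes => complex" where
 "nonlin_term Q T a b c n r \<tau> \<equiv> (if out3 \<tau> = n then prod3 a b c \<tau> * (cis (res3 Q \<tau> * r) * of_real (cos3 T \<tau> r)) else 0)"

text \<open>The coefficient at \<open>n\<close> of the nonlinearity pulled back by the free group;
  \<open>fourier_cubic_mk\<close> makes this precise on the torus.\<close>

definition nonlin :: "('a::ab_group_add => real) => real => 'a coeffs => 'a coeffs => 'a coeffs =>
  'a => real => complex" where
 "nonlin Q T a b c n r = (\<Sum>\<^sub>\<infinity>\<tau>. nonlin_term Q T a b c n r \<tau>)"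

lemma abs_cos3_le: "\<bar>cos3 T \<tau> r\<bar> <= 1"
proof -
 obtain k1 n1 k2 n2 k3 n3 where t: "\<tau> = ((k1, n1), (k2, n2), (k3, n3))" by (metis surj_pair)
 have "\<bar>cosT T k1 r\<bar> * \<bar>cosT T k2 r\<bar> * \<bar>cosT T k3 r\<bar> <= 1 * 1 * 1"
  by (intro mult_mono abs_cosT_le) auto
 then show ?thesis by (simp add: t cos3_def abs_mult)
qed

lemma continuous_cos3 [continuous_intros]: "continuous_on S (cos3 T \<tau>)"
 unfolding cos3_def split_beta by (intro continuous_intros)

lemma continuous_cis_mult [continuous_intros]: "continuous_on S (\<lambda>r. cis (l * r))"
 unfolding cis_conv_exp by (intro continuous_intros)

lemma cis_cos3: "cis (l * r) * of_real (cos3 T \<tau> r) = (\<Sum>\<epsilon>\<in>signs. cis ((l + shift3 T \<epsilon> \<tau>) * r)) / 8"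
proof -
 obtain k1 n1 k2 n2 k3 n3 where t: "\<tau> = ((k1, n1), (k2, n2), (k3, n3))" by (metis surj_pair)
 define x where "x k = pi * real k * r / T" for k
 have c: "of_real (cosT T k r) = (cis (x k) + cis (- x k)) / 2" for k
  by (simp add: cosT_def x_def complex_eq_iff)
 have sh: "cis ((l + shift3 T (e1, e2, e3) \<tau>) * r) = cis (l * r) * (cis (e1 * x k1) * (cis (e2 * x k2) * cis (e3 * x k3)))" for e1 e2 e3
  unfolding cis_mult by (rule arg_cong[where f = cis]) (simp add: t shift3_def x_def algebra_simps add_divide_distrib)
 have s: "(\<Sum>\<epsilon>\<in>signs. cis ((l + shift3 T \<epsilon> \<tau>) * r)) =
  cis (l * r) * ((cis (x k1) + cis (- x k1)) * ((cis (x k2) + cis (- x k2)) * (cis (x k3) + cis (- x k3))))"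
  unfolding signs_def sum.cartesian_product' prod.case sh by (simp add: algebra_simps)
 show ?thesis unfolding s unfolding t cos3_def prod.case of_real_mult c by (simp add: field_simps)
qed

definition duh3 :: "('a::ab_group_add => real) => real => real => 'a modes => real => complex" where
 "duh3 Q T M \<tau> t = (\<Sum>\<epsilon>\<in>signs. (1/8) * duh M (res3 Q \<tau> + shift3 T \<epsilon> \<tau>) t)"

lemma continuous_duh3 [continuous_intros]: "continuous_on S (duh3 Q T M \<tau>)"
 unfolding duh3_def by (intro continuous_intros)

lemma ker3_eq: "ker3 Q T M k \<tau> = cos_coeff T (duh3 Q T M \<tau>) k"
 unfolding duh3_def ker3_def
 by (subst cos_coeff_sum[OF finite_signs]) (auto intro!: continuous_intros simp: sum_divide_distrib)

lemma duh3_has_integral: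
 assumes "t >= 0"
 shows "((\<lambda>r. of_real (exp (- M * (t - r))) * (cis (res3 Q \<tau> * r) * of_real (cos3 T \<tau> r))) has_integral duh3 Q T M \<tau> t) {0..t}"
proof -
 have "((\<lambda>r. \<Sum>\<epsilon>\<in>signs. (1/8) * (of_real (exp (- M * (t - r))) * cis ((res3 Q \<tau> + shift3 T \<epsilon> \<tau>) * r))) has_integral duh3 Q T M \<tau> t) {0..t}"
  unfolding duh3_def by (intro has_integral_sum finite_signs has_integral_mult_right duh_has_integral assms)
 also have "(\<lambda>r. \<Sum>\<epsilon>\<in>signs. (1/8) * (of_real (exp (- M * (t - r))) * cis ((res3 Q \<tau> + shift3 T \<epsilon> \<tau>) * r))) =
  (\<lambda>r. of_real (exp (- M * (t - r))) * (cis (res3 Q \<tau> * r) * of_real (cos3 T \<tau> r)))"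
  unfolding cis_cos3 by (simp add: sum_distrib_left sum_divide_distrib)
 finally show ?thesis .
qed

lemma norm_duh3_le:
 assumes "0 <= t" "t <= T" "T > 0" "T <= 1" "M >= 0"
 shows "cmod (duh3 Q T M \<tau> t) <= 5"
proof -
 have d: "cmod (duh M \<mu> t) <= 5" for \<mu>
 proof -
  have "cmod (duh M \<mu> t) <= 5 * T / (1 + T * M + T * \<bar>\<mu>\<bar>)" by (rule norm_duh_le) (use assms in auto)
  also have "... <= 5 / 1" using assms by (intro frac_le) auto
  finally show ?thesis by simp
 qed
 have "cmod (duh3 Q T M \<tau> t) <= (\<Sum>\<epsilon>\<in>signs. 5/8)"
  unfolding duh3_def by (intro sum_norm_le) (use d in \<open>simp add: norm_mult norm_divide\<close>)
 then show ?thesis by (simp add: signs_def)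
qed

abbreviation prod_at :: "'a::ab_group_add coeffs => 'a coeffs => 'a coeffs => 'a => 'a modes => complex" where
 "prod_at a b c n \<tau> \<equiv> (if out3 \<tau> = n then prod3 a b c \<tau> else 0)"

lemma infsum_triple_product:
 fixes f g h :: "nat => complex"
 assumes s: "(\<lambda>k. cmod (f k)) summable_on UNIV" "(\<lambda>k. cmod (g k)) summable_on UNIV" "(\<lambda>k. cmod (h k)) summable_on UNIV"
 shows "(\<Sum>\<^sub>\<infinity>(k1, k2, k3). f k1 * g k2 * h k3) = infsum f UNIV * infsum g UNIV * infsum h UNIV"
proof -
 have prodsum: "((\<lambda>(x, y). u x * v y) has_sum (infsum u UNIV * infsum v UNIV)) (UNIV \<times> UNIV)"
  "(\<lambda>p. cmod (case p of (x, y) => u x * v y)) summable_on UNIV \<times> UNIV"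
  if "(\<lambda>k. cmod (u k)) summable_on UNIV" "(\<lambda>k. cmod (v k)) summable_on UNIV" for u :: "nat => complex" and v :: "'i => complex"
 proof -
  show n: "(\<lambda>p. cmod (case p of (x, y) => u x * v y)) summable_on UNIV \<times> UNIV"
   by (rule summable_on_SigmaI[where g = "\<lambda>x. cmod (u x) * infsum (\<lambda>y. cmod (v y)) UNIV"])
    (auto simp: norm_mult intro!: has_sum_cmult_right has_sum_infsum summable_on_cmult_left that)
  show "((\<lambda>(x, y). u x * v y) has_sum (infsum u UNIV * infsum v UNIV)) (UNIV \<times> UNIV)"
  proof (rule has_sum_SigmaI)
   show "(\<lambda>(x, y). u x * v y) summable_on UNIV \<times> UNIV" by (rule abs_summable_summable[OF n])
   show "((\<lambda>x. u x * infsum v UNIV) has_sum (infsum u UNIV * infsum v UNIV)) UNIV"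
    by (intro has_sum_cmult_left has_sum_infsum abs_summable_summable[OF that(1)])
   show "((\<lambda>y. case (x, y) of (x, y) => u x * v y) has_sum u x * infsum v UNIV) UNIV" for x
    unfolding prod.case by (intro has_sum_cmult_right has_sum_infsum abs_summable_summable[OF that(2)])
  qed
 qed
 define v where "v = (\<lambda>(k2, k3). g k2 * h k3)"
 have v: "(\<lambda>p. cmod (v p)) summable_on UNIV" "infsum v UNIV = infsum g UNIV * infsum h UNIV"
  using prodsum[OF s(2,3)] unfolding v_def by (auto dest: infsumI)
 have "((\<lambda>(k1, p). f k1 * v p) has_sum (infsum f UNIV * infsum v UNIV)) (UNIV \<times> UNIV)"
  by (rule prodsum(1)[OF s(1) v(1)])
 then have "(\<Sum>\<^sub>\<infinity>(k1, p). f k1 * v p) = infsum f UNIV * infsum v UNIV" by (simp add: infsumI)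
 moreover have "(\<lambda>(k1, p). f k1 * v p) = (\<lambda>(k1, k2, k3). f k1 * g k2 * h k3)"
  by (auto simp: v_def fun_eq_iff mult.assoc)
 ultimately show ?thesis by (simp add: v(2) mult.assoc)
qed

text \<open>Gives the nonlinearity a meaning at each time, so that \<open>tri\<close> can be read as
  a time integral. On the torus it comes from the physical side, in
  \<open>conv_summable_torus\<close>.\<close>

locale nls = dispersive +
 assumes conv_summable: "\<And>V n. (\<And>n. V n >= (0::real)) ==> (\<exists>B. \<forall>S. finite S \<longrightarrow> L2_set (\<lambda>n. jb n powr s * V n) S <= B) ==>
  (\<lambda>\<theta>. if out \<theta> = n then (case \<theta> of (n1, n2, n3) => V n1 * V n2 * V n3) else 0) summable_on UNIV"
begin

abbreviation X1 :: "'a coeffs => bool" where "X1 \<equiv> inX (Wt (\<lambda>_. 1))"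

lemma W1_pos: "Wt (\<lambda>_. 1) n > 0" by (rule Wt_pos[OF good_weight_1])

lemma W1_nonneg: "Wt (\<lambda>_. 1) n >= 0" using W1_pos[of n] by simp

lemma X1_summable: "X1 a ==> (\<lambda>k. cmod (a k n)) summable_on UNIV"
 by (erule inX_summable) (rule W1_pos)

text \<open>The locale assumption speaks of a single \<open>V\<close>. Taking the sum of the three
  majorants dominates mixed products of \<open>a\<close>, \<open>b\<close> and
  \<open>c\<close>.\<close>

lemma absum_conv_summable:
 assumes "X1 a" "X1 b" "X1 c"
 shows "(\<lambda>\<theta>. if out \<theta> = n then (case \<theta> of (n1, n2, n3) => (absum a n1 + absum b n1 + absum c n1) *
  (absum a n2 + absum b n2 + absum c n2) * (absum a n3 + absum b n3 + absum c n3)) else 0) summable_on UNIV"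
proof (rule conv_summable)
 show "absum a n + absum b n + absum c n >= 0" for n by (intro add_nonneg_nonneg absum_nonneg)
 show "\<exists>B. \<forall>S. finite S \<longrightarrow> L2_set (\<lambda>n. jb n powr s * (absum a n + absum b n + absum c n)) S <= B"
 proof (intro exI allI impI)
  fix S :: "'a set" assume S: "finite S"
  let ?W = "Wt (\<lambda>_. 1)"
  have e: "jb n powr s * (absum a n + absum b n + absum c n) = (?W n * absum a n + ?W n * absum b n) + ?W n * absum c n" for n
   by (simp add: Wt_def algebra_simps)
  have "L2_set (\<lambda>n. (?W n * absum a n + ?W n * absum b n) + ?W n * absum c n) S <=
   (L2_set (\<lambda>n. ?W n * absum a n) S + L2_set (\<lambda>n. ?W n * absum b n) S) + L2_set (\<lambda>n. ?W n * absum c n) S"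
   by (rule order_trans[OF L2_set_triangle_ineq add_right_mono[OF L2_set_triangle_ineq]])
  also have "... <= (nX ?W a + nX ?W b) + nX ?W c"
   by (intro add_mono L2_set_absum_le[OF _ W1_pos S] assms)
  finally show "L2_set (\<lambda>n. jb n powr s * (absum a n + absum b n + absum c n)) S <= (nX ?W a + nX ?W b) + nX ?W c" unfolding e .
 qed
qed

lemma modes_summable:
 assumes abc: "X1 a" "X1 b" "X1 c"
 shows "(\<lambda>\<tau>. cmod (prod_at a b c n \<tau>)) summable_on UNIV"
proof -
 define V where "V n = absum a n + absum b n + absum c n" for n
 define f where "f = (\<lambda>\<theta>. if out \<theta> = n then (case \<theta> of (n1, n2, n3) => V n1 * V n2 * V n3) else 0)"
 have V: "(\<Sum>k\<in>K. cmod (a k n)) <= V n" "(\<Sum>k\<in>K. cmod (b k n)) <= V n" "(\<Sum>k\<in>K. cmod (c k n)) <= V n" if "finite K" for K n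
  using sum_le_absum[OF abc(1) W1_pos that, of n] sum_le_absum[OF abc(2) W1_pos that, of n] sum_le_absum[OF abc(3) W1_pos that, of n]
   absum_nonneg[of a n] absum_nonneg[of b n] absum_nonneg[of c n] unfolding V_def by linarith+
 have f: "f summable_on UNIV" unfolding f_def V_def by (rule absum_conv_summable[OF abc])
 have f0: "f \<theta> >= 0" for \<theta>
  unfolding f_def V_def by (auto simp: split_beta intro!: mult_nonneg_nonneg add_nonneg_nonneg absum_nonneg)
 show ?thesis
 proof (rule nonneg_bdd_above_summable_on)
  show "bdd_above (sum (\<lambda>\<tau>. cmod (prod_at a b c n \<tau>)) ` {F. F \<subseteq> UNIV \<and> finite F})"
  proof (rule bdd_aboveI2)
   fix F :: "'a modes set" assume "F \<in> {F. F \<subseteq> UNIV \<and> finite F}"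
   then have F: "finite F" by simp
   obtain K S where KS: "finite K" "finite S" "F \<subseteq> (K\<times>S)\<times>(K\<times>S)\<times>(K\<times>S)"
    using subset_modes[OF F] by blast
   have "(\<Sum>\<tau>\<in>F. cmod (prod_at a b c n \<tau>)) <= (\<Sum>\<tau>\<in>(K\<times>S)\<times>(K\<times>S)\<times>(K\<times>S). cmod (prod_at a b c n \<tau>))"
    by (rule sum_mono2) (use KS in auto)
   also have "... = (\<Sum>\<theta>\<in>S\<times>S\<times>S. \<Sum>\<kappa>\<in>K\<times>K\<times>K. cmod (if out3 (pack \<kappa> \<theta>) = n then prod3 a b c (pack \<kappa> \<theta>) else 0))"
    unfolding sum_pack by (rule sum.swap)
   also have "... <= (\<Sum>\<theta>\<in>S\<times>S\<times>S. f \<theta>)"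
   proof (rule sum_mono)
    fix \<theta> :: "'a \<times> 'a \<times> 'a"
    obtain n1 n2 n3 where th: "\<theta> = (n1, n2, n3)" by (metis surj_pair)
    show "(\<Sum>\<kappa>\<in>K\<times>K\<times>K. cmod (if out3 (pack \<kappa> \<theta>) = n then prod3 a b c (pack \<kappa> \<theta>) else 0)) <= f \<theta>"
    proof (cases "out \<theta> = n")
     case True
     have "(\<Sum>\<kappa>\<in>K\<times>K\<times>K. cmod (if out3 (pack \<kappa> \<theta>) = n then prod3 a b c (pack \<kappa> \<theta>) else 0)) =
      (\<Sum>(k1, k2, k3)\<in>K\<times>K\<times>K. cmod (a k1 n1) * cmod (b k2 n2) * cmod (c k3 n3))"
      unfolding pack_simps if_P[OF True] unfolding th
      by (rule sum.cong[OF refl]) (auto simp: prod3_def pack_def norm_mult)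
     also have "... = (\<Sum>k\<in>K. cmod (a k n1)) * (\<Sum>k\<in>K. cmod (b k n2)) * (\<Sum>k\<in>K. cmod (c k n3))" by (rule sum_prod3)
     also have "... <= V n1 * V n2 * V n3"
      unfolding V_def by (intro mult_mono V[OF KS(1), unfolded V_def] mult_nonneg_nonneg sum_nonneg norm_ge_zero add_nonneg_nonneg absum_nonneg)
     finally show ?thesis using True th by (simp add: f_def)
    next
     case False
     show ?thesis unfolding pack_simps if_not_P[OF False] using f0[of \<theta>] by simp
    qed
   qed
   also have "... <= infsum f UNIV" by (rule finite_sum_le_infsum[OF f]) (use KS f0 in auto)
   finally show "(\<Sum>\<tau>\<in>F. cmod (prod_at a b c n \<tau>)) <= infsum f UNIV" .
  qed
 qed simp
qed

lemma nonlin_uniform_limit: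
 assumes abc: "X1 a" "X1 b" "X1 c"
 shows "uniform_limit Y (\<lambda>\<Omega> r. \<Sum>\<tau>\<in>\<Omega>. nonlin_term Q T a b c n r \<tau>)
  (nonlin Q T a b c n) (finite_subsets_at_top UNIV)"
 unfolding nonlin_def
proof (rule Weierstrass_m_test_general)
 show "(\<lambda>\<tau>. cmod (prod_at a b c n \<tau>)) summable_on UNIV" by (rule modes_summable[OF abc])
 fix \<tau> :: "'a modes" and r
 show "cmod (nonlin_term Q T a b c n r \<tau>) <= cmod (prod_at a b c n \<tau>)"
  by (simp add: norm_mult mult_left_le abs_cos3_le)
qed

lemma continuous_nonlin:
 assumes abc: "X1 a" "X1 b" "X1 c"
 shows "continuous_on Y (nonlin Q T a b c n)"
proof (rule uniform_limit_theorem[OF _ nonlin_uniform_limit[OF abc]])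
 have "continuous_on Y (\<lambda>r. if P then z * (cis (l * r) * of_real (cos3 T \<tau> r)) else 0)" for P z l and \<tau> :: "'a modes"
  by (cases P) (auto intro!: continuous_intros)
 then show "\<forall>\<^sub>F \<Omega> in finite_subsets_at_top UNIV. continuous_on Y (\<lambda>r. \<Sum>\<tau>\<in>\<Omega>. nonlin_term Q T a b c n r \<tau>)"
  by (intro always_eventually allI continuous_on_sum)
qed simp

text \<open>Both sides are limits over finite sets of modes of the same sums of \<open>duh3\<close>.
  On one side the uniform limit \<open>F\<close> has the coefficients \<open>tri\<close>, which are
  summable, so its cosine series returns \<open>F\<close>; on the other the integrands converge
  uniformly on [0,t].\<close>

lemma cseries_tri:
 assumes T: "0 < T" "T <= 1" "M >= 0" and abc: "X1 a" "X1 b" "X1 c" and t: "t \<in> {0..T}"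
 shows "cval T (tri Q T M a b c) n t = integral {0..t} (\<lambda>r. of_real (exp (- M * (t - r))) * nonlin Q T a b c n r)"
proof -
 let ?z = "\<lambda>\<tau>. prod_at a b c n \<tau>"
 define P where "P \<Omega> t = (\<Sum>\<tau>\<in>\<Omega>. ?z \<tau> * duh3 Q T M \<tau> t)" for \<Omega> t
 define F where "F t = (\<Sum>\<^sub>\<infinity>\<tau>. ?z \<tau> * duh3 Q T M \<tau> t)" for t
 have ul: "uniform_limit {0..T} P F (finite_subsets_at_top UNIV)"
  unfolding P_def F_def
 proof (rule Weierstrass_m_test_general)
  show "(\<lambda>\<tau>. cmod (?z \<tau>) * 5) summable_on UNIV" by (rule summable_on_cmult_left[OF modes_summable[OF abc]])
  fix \<tau> :: "'a modes" and t assume "t \<in> {0..T}"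
  then show "cmod (?z \<tau> * duh3 Q T M \<tau> t) <= cmod (?z \<tau>) * 5"
   unfolding norm_mult by (intro mult_left_mono norm_duh3_le T norm_ge_zero) auto
 qed
 have contP: "continuous_on {0..T} (P \<Omega>)" for \<Omega> unfolding P_def by (intro continuous_intros)
 have contF: "continuous_on {0..T} F"
  by (rule uniform_limit_theorem[OF _ ul]) (auto intro!: always_eventually contP)
 have coeff: "cos_coeff T F k = tri Q T M a b c k n" for k
 proof (rule tendsto_unique[OF _ cos_coeff_tendsto[OF ul contP]])
  have "(\<Sum>\<tau>\<in>\<Omega>. tri_term Q T M a b c k n \<tau>) = cos_coeff T (P \<Omega>) k" if "finite \<Omega>" for \<Omega>
   unfolding P_def ker3_eq by (subst cos_coeff_sum[OF that]) (auto intro!: continuous_intros sum.cong)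
  then have "\<forall>\<^sub>F \<Omega> in finite_subsets_at_top UNIV. (\<Sum>\<tau>\<in>\<Omega>. tri_term Q T M a b c k n \<tau>) = cos_coeff T (P \<Omega>) k"
   by (rule eventually_finite_subsets_at_top_weakI)
  then show "((\<lambda>\<Omega>. cos_coeff T (P \<Omega>) k) \<longlongrightarrow> tri Q T M a b c k n) (finite_subsets_at_top UNIV)"
   by (rule Lim_transform_eventually[OF tri_tendsto[OF T good_weight_1 abc]])
 qed auto
 have "(\<lambda>k. cmod (cos_coeff T F k)) summable_on UNIV"
  unfolding coeff by (rule inX_summable[OF tri_inX[OF T good_weight_1 abc] W1_pos])
 from cseries_cos_coeff[OF T(1) contF this t] have 1: "cval T (tri Q T M a b c) n t = F t"
  unfolding coeff by simp
 let ?g = "\<lambda>\<Omega> r. \<Sum>\<tau>\<in>\<Omega>. nonlin_term Q T a b c n r \<tau>"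
 let ?e = "\<lambda>r. complex_of_real (exp (- M * (t - r)))"
 have ule: "uniform_limit {0..t} (\<lambda>\<Omega> r. ?e r * ?g \<Omega> r) (\<lambda>r. ?e r * nonlin Q T a b c n r) (finite_subsets_at_top UNIV)"
 proof (rule uniform_limitI)
  fix d :: real assume "d > 0"
  from uniform_limitD[OF nonlin_uniform_limit[OF abc] this, of "{0..t}" n T]
  show "\<forall>\<^sub>F \<Omega> in finite_subsets_at_top UNIV. \<forall>r\<in>{0..t}. dist (?e r * ?g \<Omega> r) (?e r * nonlin Q T a b c n r) < d"
  proof eventually_elim
   case (elim \<Omega>)
   show ?case
   proof
    fix r assume r: "r \<in> {0..t}"
    have "dist (?e r * ?g \<Omega> r) (?e r * nonlin Q T a b c n r) = exp (- M * (t - r)) * dist (?g \<Omega> r) (nonlin Q T a b c n r)"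
     unfolding dist_norm right_diff_distrib[symmetric] norm_mult norm_of_real by simp
    also have "... <= 1 * dist (?g \<Omega> r) (nonlin Q T a b c n r)"
     using r T by (intro mult_right_mono) auto
    also have "... < d" using elim r by simp
    finally show "dist (?e r * ?g \<Omega> r) (?e r * nonlin Q T a b c n r) < d" .
   qed
  qed
 qed
 have hi: "((\<lambda>r. ?e r * (nonlin_term Q T a b c n r \<tau>)) has_integral ?z \<tau> * duh3 Q T M \<tau> t) {0..t}" for \<tau>
 proof -
  have "((\<lambda>r. ?z \<tau> * (?e r * (cis (res3 Q \<tau> * r) * of_real (cos3 T \<tau> r)))) has_integral ?z \<tau> * duh3 Q T M \<tau> t) {0..t}"
   by (intro has_integral_mult_right duh3_has_integral) (use t in simp)
  also have "(\<lambda>r. ?z \<tau> * (?e r * (cis (res3 Q \<tau> * r) * of_real (cos3 T \<tau> r)))) =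
   (\<lambda>r. ?e r * (nonlin_term Q T a b c n r \<tau>))"
   by (auto simp: fun_eq_iff)
  finally show ?thesis .
 qed
 have I: "integral {0..t} (\<lambda>r. ?e r * ?g \<Omega> r) = P \<Omega> t" if "finite \<Omega>" for \<Omega>
  unfolding P_def sum_distrib_left by (intro integral_unique has_integral_sum that hi)
 have cg: "continuous_on {0..t} (\<lambda>r. ?e r * ?g \<Omega> r)" for \<Omega>
 proof -
  have "continuous_on {0..t} (\<lambda>r. if P then z * (cis (l * r) * of_real (cos3 T \<tau> r)) else 0)" for P z l and \<tau> :: "'a modes"
   by (cases P) (auto intro!: continuous_intros)
  then show ?thesis by (intro continuous_on_mult continuous_on_sum continuous_intros)
 qed
 have "((\<lambda>\<Omega>. P \<Omega> t) \<longlongrightarrow> integral {0..t} (\<lambda>r. ?e r * nonlin Q T a b c n r)) (finite_subsets_at_top UNIV)"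
  by (rule Lim_transform_eventually[OF uniform_limit_integral'[OF ule cg]])
   (simp, rule eventually_finite_subsets_at_top_weakI, rule I)
 then have A: "((\<lambda>\<Omega>. P \<Omega> t) \<longlongrightarrow> integral {0..t} (\<lambda>r. ?e r * nonlin Q T a b c n r)) (finite_subsets_at_top UNIV)" .
 have B: "((\<lambda>\<Omega>. P \<Omega> t) \<longlongrightarrow> F t) (finite_subsets_at_top UNIV)"
  by (rule tendsto_uniform_limitI[OF ul t])
 show ?thesis unfolding 1 by (rule tendsto_unique[OF _ B A]) simp
qed

text \<open>Absolute summability over the modes allows summing the three cosine indices first, which
  restores the three functions of time.\<close>

lemma nonlin_eq:
 assumes abc: "X1 a" "X1 b" "X1 c"
 shows "nonlin Q T a b c n r = (\<Sum>\<^sub>\<infinity>\<theta>. if out \<theta> = n then cis (res Q \<theta> * r) *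
  (case \<theta> of (n1, n2, n3) => cval T a n1 r * cnj (cval T b n2 r) * cval T c n3 r) else 0)"
proof -
 define F where "F \<tau> = (nonlin_term Q T a b c n r \<tau>)" for \<tau>
 have s: "(\<lambda>\<tau>. cmod (F \<tau>)) summable_on UNIV"
  by (rule summable_on_comparison_test[OF modes_summable[OF abc, of n]]) (auto simp: F_def norm_mult mult_left_le abs_cos3_le)
 have s2: "(\<lambda>(\<theta>, \<kappa>). F (pack \<kappa> \<theta>)) summable_on UNIV \<times> UNIV"
 proof -
  have "(\<lambda>x. F ((\<lambda>(\<theta>, \<kappa>). pack \<kappa> \<theta>) x)) summable_on UNIV"
   unfolding summable_on_reindex_bij_betw[OF bij_pack] by (rule abs_summable_summable[OF s])
  then show ?thesis by (simp add: split_def)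
 qed
 have "nonlin Q T a b c n r = infsum F UNIV" unfolding nonlin_def F_def ..
 also have "... = infsum (\<lambda>x. F ((\<lambda>(\<theta>, \<kappa>). pack \<kappa> \<theta>) x)) UNIV"
  by (rule infsum_reindex_bij_betw[OF bij_pack, symmetric])
 also have "... = infsum (\<lambda>(\<theta>, \<kappa>). F (pack \<kappa> \<theta>)) (UNIV \<times> UNIV)" by (simp add: split_def)
 also have "... = (\<Sum>\<^sub>\<infinity>\<theta>. \<Sum>\<^sub>\<infinity>\<kappa>. F (pack \<kappa> \<theta>))" by (rule infsum_Sigma'_banach[OF s2, symmetric])
 also have "... = (\<Sum>\<^sub>\<infinity>\<theta>. if out \<theta> = n then cis (res Q \<theta> * r) *
  (case \<theta> of (n1, n2, n3) => cval T a n1 r * cnj (cval T b n2 r) * cval T c n3 r) else 0)"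
 proof (rule infsum_cong)
  fix \<theta> :: "'a \<times> 'a \<times> 'a"
  obtain n1 n2 n3 where th: "\<theta> = (n1, n2, n3)" by (metis surj_pair)
  show "(\<Sum>\<^sub>\<infinity>\<kappa>. F (pack \<kappa> \<theta>)) = (if out \<theta> = n then cis (res Q \<theta> * r) *
   (case \<theta> of (n1, n2, n3) => cval T a n1 r * cnj (cval T b n2 r) * cval T c n3 r) else 0)"
  proof (cases "out \<theta> = n")
   case True
   have "F (pack \<kappa> \<theta>) = cis (res Q \<theta> * r) * ((\<lambda>(k1, k2, k3). (a k1 n1 * of_real (cosT T k1 r)) *
    (cnj (b k2 n2 * of_real (cosT T k2 r))) * (c k3 n3 * of_real (cosT T k3 r))) \<kappa>)" for \<kappa>
    unfolding F_def pack_simps if_P[OF True] by (auto simp: th prod3_def pack_def cos3_def split_beta)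
   moreover have "(\<Sum>\<^sub>\<infinity>(k1, k2, k3). (a k1 n1 * of_real (cosT T k1 r)) *
    (cnj (b k2 n2 * of_real (cosT T k2 r))) * (c k3 n3 * of_real (cosT T k3 r))) =
    cval T a n1 r * cnj (cval T b n2 r) * cval T c n3 r"
    unfolding cseries_def infsum_cnj[symmetric]
    by (rule infsum_triple_product) (simp_all only: complex_mod_cnj cseries_sums(2)[OF X1_summable] abc)
   ultimately have "(\<Sum>\<^sub>\<infinity>\<kappa>. F (pack \<kappa> \<theta>)) = cis (res Q \<theta> * r) *
    (cval T a n1 r * cnj (cval T b n2 r) * cval T c n3 r)"
    by (simp only: infsum_cmult_right')
   then show ?thesis unfolding if_P[OF True] by (simp only: th prod.case)
  next
   case False
   then show ?thesis by (simp add: F_def pack_simps)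
  qed
 qed
 finally show ?thesis .
qed

end

text \<open>A free solution pulled back by the free group is constant in time, so only the cosine
  index 0 occurs.\<close>

definition iota :: "('a => complex) => nat => 'a => complex" where
 "iota a k n = (if k = 0 then a n else 0)"

lemma snorm_iota: "finite K ==> snorm W K S (iota a) = (if 0 \<in> K then L2_set (\<lambda>n. W n * cmod (a n)) S else 0)"
proof -
 have "L2_set (\<lambda>n. W n * cmod (iota a k n)) S = (if 0 = k then L2_set (\<lambda>n. W n * cmod (a n)) S else 0)" for k
  by (simp add: iota_def L2_set_def)
 then show "finite K ==> snorm W K S (iota a) = (if 0 \<in> K then L2_set (\<lambda>n. W n * cmod (a n)) S else 0)"
  by (simp add: snorm_def)
qed

lemma iota_inX:
 assumes "B >= 0" "\<And>S. finite S ==> L2_set (\<lambda>n. W n * cmod (a n)) S <= B"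
 shows "inX W (iota a)" "nX W (iota a) <= B"
 using nX_leI[of W "iota a" B] assms by (auto simp: snorm_iota)

lemma cseries_iota: "cseries T (\<lambda>k. iota a k n) t = a n"
proof -
 have "(\<lambda>k. iota a k n * of_real (cosT T k t)) = (\<lambda>k. if k \<in> {0} then a n else 0)" by (auto simp: iota_def fun_eq_iff)
 then show ?thesis unfolding cseries_def
  by (simp only:) (subst infsum_cong_neutral[where T = "{0}" and g = "\<lambda>_. a n"], auto)
qed

lemma cseries_diff:
 assumes "(\<lambda>k. cmod (a k)) summable_on UNIV" "(\<lambda>k. cmod (b k)) summable_on UNIV"
 shows "cseries T (\<lambda>k. a k - b k) t = cseries T a t - cseries T b t"
proof -
 have "(\<lambda>k. cmod (a k - b k)) summable_on UNIV"
  by (rule summable_on_comparison_test[OF summable_on_add[OF assms]]) (auto intro: norm_triangle_ineq4)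
 from cseries_sums(1)[OF this] have "(\<lambda>k. a k * of_real (cosT T k t) - b k * of_real (cosT T k t)) sums cseries T (\<lambda>k. a k - b k) t"
  by (simp add: left_diff_distrib)
 from sums_unique2[OF this sums_diff[OF cseries_sums(1)[OF assms(1)] cseries_sums(1)[OF assms(2)]]] show ?thesis .
qed

lemma cseries_scale: "cseries T (\<lambda>k. z * a k) t = z * cseries T a t"
 unfolding cseries_def mult.assoc by (rule infsum_cmult_right')

lemma tri_zero: "tri Q T M (\<lambda>_ _. 0) b c = (\<lambda>_ _. 0)"
proof -
 have "prod3 (\<lambda>_ _. 0) b c \<tau> = 0" for \<tau> by (simp add: prod3_def split_beta)
 then show ?thesis unfolding tri_def by (simp cong: if_cong)
qed

section \<open>The fixed point equation\<close>

context dispersive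
begin

text \<open>In these coordinates the free evolution is the identity, and \<open>tri\<close> without
  damping is the Duhamel integral; \<open>fixp_iff\<close> states the equation as one between
  functions of time.\<close>

definition fixp :: "real => ('a => complex) => 'a coeffs => bool" where
 "fixp T a c \<longleftrightarrow> c = (\<lambda>k n. iota a k n - \<i> * tri Q T 0 c c c k n)"

lemma Wt_nonneg: "good_weight w ==> Wt w n >= 0" using Wt_pos[of w n] by simp

lemma tri_cube_diff:
 assumes T: "0 < T" "T <= 1" "M >= 0" and w: "good_weight w" and c: "inX (Wt w) c" "inX (Wt w) c'"
 shows "(\<lambda>k n. tri Q T M c c c k n - tri Q T M c' c' c' k n) = (\<lambda>k n. tri Q T M (cdiff c c') c c k n +
  tri Q T M c' (cdiff c c') c k n + tri Q T M c' c' (cdiff c c') k n)"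
 unfolding tri_diff(1)[OF T w c(1) c(1) c(1) c(2) c(2) c(2)] tri_diff(2)[OF T w c(2) c(1) c(1) c(2) c(2) c(2)]
  tri_diff(3)[OF T w c(2) c(2) c(1) c(2) c(2) c(2)] by simp

lemma tri_terms_le:
 assumes T: "0 < T" "T <= 1" "M >= 0" and w: "good_weight w"
  and c: "inX (Wt w) c" "inX (Wt w) c'" "inX (Wt w) e" and r: "nX (Wt w) c <= r" "nX (Wt w) c' <= r"
 shows "inX (Wt w) (\<lambda>k n. tri Q T M e c c k n + tri Q T M c' e c k n + tri Q T M c' c' e k n)"
  "nX (Wt w) (\<lambda>k n. tri Q T M e c c k n + tri Q T M c' e c k n + tri Q T M c' c' e k n) <=
   3 * (Ctri * kap T M * r\<^sup>2) * nX (Wt w) e"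
proof -
 note i = tri_inX[OF T w]
 note W0 = Wt_nonneg[OF w]
 have r0: "r >= 0" using nX_nonneg[OF c(1)] r by simp
 show "inX (Wt w) (\<lambda>k n. tri Q T M e c c k n + tri Q T M c' e c k n + tri Q T M c' c' e k n)"
  by (intro nX_add i c W0)
 have "nX (Wt w) (\<lambda>k n. tri Q T M e c c k n + tri Q T M c' e c k n + tri Q T M c' c' e k n) <=
  nX (Wt w) (tri Q T M e c c) + nX (Wt w) (tri Q T M c' e c) + nX (Wt w) (tri Q T M c' c' e)"
  by (rule order_trans[OF nX_add(2)[OF nX_add(1)[OF i i W0] i W0] add_right_mono[OF nX_add(2)[OF i i W0]]]) (rule c)+
 also have "... <= Ctri * kap T M * (nX (Wt w) e * r * r) + Ctri * kap T M * (r * nX (Wt w) e * r) + Ctri * kap T M * (r * r * nX (Wt w) e)"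
  using Ctri(1)
  by (intro add_mono order_trans[OF nX_tri_le[OF T w] mult_left_mono] mult_mono c r r0 nX_nonneg mult_nonneg_nonneg kap_nonneg order_refl) auto
 also have "... = 3 * (Ctri * kap T M * r\<^sup>2) * nX (Wt w) e" by (simp add: power2_eq_square algebra_simps)
 finally show "nX (Wt w) (\<lambda>k n. tri Q T M e c c k n + tri Q T M c' e c k n + tri Q T M c' c' e k n) <=
   3 * (Ctri * kap T M * r\<^sup>2) * nX (Wt w) e" .
qed

text \<open>By telescoping, the difference solves a linear equation whose operator has norm at most
  1/2 on the ball, so it is bounded by twice the difference of the data.\<close>

lemma fixp_lipschitz:
 assumes T: "0 < T" "T <= 1" and w: "good_weight w"
  and c: "inX (Wt w) c" "inX (Wt w) c'" and r: "nX (Wt w) c <= r" "nX (Wt w) c' <= r"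
  and small: "3 * (Ctri * kap T 0 * r\<^sup>2) <= 1/2"
  and sol: "fixp T a c" "fixp T a' c'" and a: "inX (Wt w) (iota (\<lambda>n. a n - a' n))"
 shows "nX (Wt w) (cdiff c c') <= 2 * nX (Wt w) (iota (\<lambda>n. a n - a' n))"
proof -
 let ?W = "Wt w" and ?e = "\<lambda>k n. c k n - c' k n"
 note W0 = Wt_nonneg[OF w]
 have T0: "0 <= (0::real)" by simp
 have e: "inX ?W ?e" by (rule nX_diff(1)[OF c W0])
 define t where "t = (\<lambda>k n. tri Q T 0 ?e c c k n + tri Q T 0 c' ?e c k n + tri Q T 0 c' c' ?e k n)"
 have t: "inX ?W t" "nX ?W t <= 3 * (Ctri * kap T 0 * r\<^sup>2) * nX ?W ?e"
  unfolding t_def by (rule tri_terms_le[OF T T0 w c e r])+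
 have "?e k n = iota (\<lambda>n. a n - a' n) k n - \<i> * (tri Q T 0 c c c k n - tri Q T 0 c' c' c' k n)" for k n
 proof -
  have c1: "c k n = iota a k n - \<i> * tri Q T 0 c c c k n" by (rule fun_cong[OF fun_cong[OF sol(1)[unfolded fixp_def]]])
  have c2: "c' k n = iota a' k n - \<i> * tri Q T 0 c' c' c' k n" by (rule fun_cong[OF fun_cong[OF sol(2)[unfolded fixp_def]]])
  have i: "iota (\<lambda>n. a n - a' n) k n = iota a k n - iota a' k n" by (simp add: iota_def)
  show ?thesis unfolding i by (simp only: c1 c2 right_diff_distrib) simp
 qed
 moreover have "tri Q T 0 c c c k n - tri Q T 0 c' c' c' k n = t k n" for k n
  using fun_cong[OF fun_cong[OF tri_cube_diff[OF T T0 w c]], of k n] by (simp add: t_def)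
 ultimately have eq: "?e = (\<lambda>k n. iota (\<lambda>n. a n - a' n) k n - \<i> * t k n)" by (simp add: fun_eq_iff)
 have "nX ?W ?e <= nX ?W (iota (\<lambda>n. a n - a' n)) + nX ?W (\<lambda>k n. \<i> * t k n)"
  by (subst eq) (rule nX_diff(2)[OF a nX_scale_le(1)[OF t(1)] W0])
 also have "nX ?W (\<lambda>k n. \<i> * t k n) = nX ?W t" using nX_scale[OF t(1), of \<i>] by simp
 also have "nX ?W t <= 1/2 * nX ?W ?e"
  by (rule order_trans[OF t(2) mult_right_mono[OF small nX_nonneg[OF e]]])
 finally show ?thesis by simp
qed

text \<open>Picard iteration from 0. The data have norm at most \<open>R\<close>, and a Lipschitz
  constant 1/2 keeps the iterates in the ball of radius \<open>2 * R\<close>.\<close>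

lemma fixp_exists:
 assumes T: "0 < T" "T <= 1" and w: "good_weight w" and R: "R >= 0"
  and a: "inX (Wt w) (iota a)" "nX (Wt w) (iota a) <= R"
  and small: "3 * (Ctri * kap T 0 * (2*R)\<^sup>2) <= 1/2"
 obtains c where "inX (Wt w) c" "nX (Wt w) c <= 2 * R" "fixp T a c"
proof -
 let ?W = "Wt w"
 note W0 = Wt_nonneg[OF w]
 have T0: "0 <= (0::real)" by simp
 define \<Phi> where "\<Phi> c = (\<lambda>k n. iota a k n - \<i> * tri Q T 0 c c c k n)" for c
 define f where "f i = (\<Phi> ^^ i) (\<lambda>_ _. 0)" for i
 have f0: "f 0 = (\<lambda>_ _. 0)" and fS: "f (Suc i) = \<Phi> (f i)" for i by (simp_all add: f_def)
 have \<Phi>X: "inX ?W (\<Phi> c)" if "inX ?W c" for c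
  unfolding \<Phi>_def by (intro nX_diff nX_scale_le a tri_inX[OF T T0 w] that W0)
 have lip: "nX ?W (cdiff (\<Phi> c) (\<Phi> c')) <= 1/2 * nX ?W (cdiff c c')"
  if c: "inX ?W c" "inX ?W c'" "nX ?W c <= 2*R" "nX ?W c' <= 2*R" for c c'
 proof -
  have e: "inX ?W (cdiff c c')" by (rule nX_diff(1)[OF c(1,2) W0])
  have "\<Phi> c k n - \<Phi> c' k n = (-\<i>) * (tri Q T 0 c c c k n - tri Q T 0 c' c' c' k n)" for k n
   by (simp add: \<Phi>_def algebra_simps)
  then have "(cdiff (\<Phi> c) (\<Phi> c')) = (\<lambda>k n. (-\<i>) * ((\<lambda>k n. tri Q T 0 c c c k n - tri Q T 0 c' c' c' k n) k n))" by simp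
  then have "nX ?W (cdiff (\<Phi> c) (\<Phi> c')) <= cmod (-\<i>) * nX ?W (\<lambda>k n. tri Q T 0 c c c k n - tri Q T 0 c' c' c' k n)"
   by (simp only:) (intro nX_scale_le(2) nX_diff(1) tri_inX[OF T T0 w] c W0)
  also have "... <= 3 * (Ctri * kap T 0 * (2*R)\<^sup>2) * nX ?W (cdiff c c')"
   unfolding tri_cube_diff[OF T T0 w c(1,2)] using tri_terms_le(2)[OF T T0 w c(1,2) e c(3,4)] by simp
  also have "... <= 1/2 * nX ?W (cdiff c c')" by (rule mult_right_mono[OF small nX_nonneg[OF e]])
  finally show ?thesis .
 qed
 have bd: "inX ?W (f i) \<and> nX ?W (f i) <= 2 * R" for i
 proof (induction i)
  case 0
  then show ?case using nX_zero[of ?W] R by (simp add: f0)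
 next
  case (Suc i)
  have z: "inX ?W (\<lambda>_ _. 0)" "nX ?W (\<lambda>_ _. 0) <= 2 * R" using nX_zero[of ?W] R by simp_all
  have "\<Phi> (\<lambda>_ _. 0) = iota a" by (simp add: \<Phi>_def tri_zero)
  then have "nX ?W (\<lambda>k n. \<Phi> (f i) k n - iota a k n) <= 1/2 * nX ?W (f i)"
   using lip[OF _ z(1) _ z(2), of "f i"] Suc by simp
  moreover have "nX ?W (\<Phi> (f i)) <= nX ?W (\<lambda>k n. \<Phi> (f i) k n - iota a k n) + nX ?W (iota a)"
   using nX_add(2)[OF nX_diff(1)[OF \<Phi>X[of "f i"] a(1) W0] a(1) W0] Suc by simp
  ultimately show ?case using Suc a(2) \<Phi>X[of "f i"] by (simp add: fS)
 qed
 define D where "D = nX ?W (cdiff (f 1) (f 0))"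
 have D0: "D >= 0" unfolding D_def using bd W0 by (intro nX_nonneg nX_diff) auto
 have step: "nX ?W (cdiff (f (Suc i)) (f i)) <= (1/2)^i * D" for i
 proof (induction i)
  case 0 then show ?case by (simp add: D_def)
 next
  case (Suc i)
  have "nX ?W (cdiff (f (Suc (Suc i))) (f (Suc i))) <= 1/2 * nX ?W (cdiff (f (Suc i)) (f i))"
   unfolding fS[of "Suc i"] fS[of i] using lip[of "\<Phi> (f i)" "f i"] bd[of i] bd[of "Suc i"] by (simp add: fS)
  then show ?case using Suc by simp
 qed
 have tail: "nX ?W (cdiff (f (i + p)) (f i)) <= 2 * (1/2)^i * D" for i p
 proof -
  \<comment> \<open>The exact partial sum of the geometric series is what makes the induction on
    \<open>p\<close> close.\<close>
  have "nX ?W (cdiff (f (i + p)) (f i)) <= (2 - 2 * (1/2)^p) * (1/2)^i * D"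
  proof (induction p)
   case 0 then show ?case using nX_zero[of ?W] by simp
  next
   case (Suc p)
   have "nX ?W (cdiff (f (i + Suc p)) (f i)) <= nX ?W (\<lambda>k n. f (Suc (i + p)) k n - f (i + p) k n) + nX ?W (cdiff (f (i + p)) (f i))"
    using nX_triangle_diff[of ?W "f (Suc (i+p))" "f (i+p)" "f i"] bd W0 by simp
   also have "... <= (1/2)^(i+p) * D + (2 - 2 * (1/2)^p) * (1/2)^i * D" by (intro add_mono step Suc)
   also have "... = (2 - 2 * (1/2)^Suc p) * (1/2)^i * D" by (simp add: power_add algebra_simps)
   finally show ?case .
  qed
  also have "... <= 2 * (1/2)^i * D" using D0 by (intro mult_right_mono) auto
  finally show ?thesis .
 qed
 have cauchy: "\<exists>N. \<forall>i\<ge>N. \<forall>j\<ge>N. nX ?W (cdiff (f i) (f j)) < e" if "e > 0" for e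
 proof -
  have "(\<lambda>N. 4 * (1/2)^N * D) \<longlonglongrightarrow> 4 * 0 * D" by (intro tendsto_intros) auto
  then have "\<forall>\<^sub>F N in sequentially. 4 * (1/2)^N * D < e" using that by (intro order_tendstoD) auto
  then obtain N where N: "4 * (1/2)^N * D < e" by (auto simp: eventually_sequentially)
  have le: "nX ?W (cdiff (f i) (f N)) <= 2 * (1/2)^N * D" if "i >= N" for i
   using tail[of N "i - N"] that by simp
  show ?thesis
  proof (intro exI allI impI)
   fix i j assume ij: "N <= i" "N <= j"
   have "nX ?W (cdiff (f i) (f j)) <= nX ?W (cdiff (f i) (f N)) + nX ?W (cdiff (f N) (f j))"
    using nX_triangle_diff[of ?W "f i" "f N" "f j"] bd W0 by simp
   also have "nX ?W (cdiff (f N) (f j)) = nX ?W (cdiff (f j) (f N))"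
    using nX_diff_commute[of ?W "f N" "f j"] bd W0 by simp
   finally show "nX ?W (cdiff (f i) (f j)) < e" using le[OF ij(1)] le[OF ij(2)] N by linarith
  qed
 qed
 have fX: "\<And>i. inX ?W (f i)" using bd by blast
 obtain u where u: "inX ?W u" and lim: "(\<lambda>i. nX ?W (cdiff (f i) u)) \<longlonglongrightarrow> 0" and pt: "\<And>k n. (\<lambda>i. f i k n) \<longlonglongrightarrow> u k n"
  by (rule nX_complete[of ?W f, OF Wt_pos[OF w] fX cauchy]) (assumption, blast)
 have uR: "nX ?W u <= 2 * R"
 proof (rule nX_leI(1), rule tendsto_upperbound)
  fix K :: "nat set" and S :: "'a set" assume KS: "finite K" "finite S"
  show "(\<lambda>i. snorm ?W K S (f i)) \<longlonglongrightarrow> snorm ?W K S u" unfolding snorm_def L2_set_def by (intro tendsto_intros pt)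
  show "\<forall>\<^sub>F i in sequentially. snorm ?W K S (f i) <= 2 * R"
   by (intro always_eventually allI order_trans[OF snorm_le_nX[OF fX KS]]) (use bd in blast)
 qed simp
 have "fixp T a u" unfolding fixp_def
 proof (intro ext)
  fix k n
  have "(\<lambda>i. f (Suc i) k n - \<Phi> u k n) \<longlonglongrightarrow> 0"
  proof (rule tendsto_norm_zero_cancel, rule tendsto_sandwich[where f = "\<lambda>_. 0"])
   show "(\<lambda>i. (1/2 * nX ?W (cdiff (f i) u)) / ?W n) \<longlonglongrightarrow> 0"
    using tendsto_divide[OF tendsto_mult[OF tendsto_const lim] tendsto_const[of "?W n"], of "1/2"] Wt_pos[OF w, of n] by simp
   show "\<forall>\<^sub>F i in sequentially. cmod (f (Suc i) k n - \<Phi> u k n) <= (1/2 * nX ?W (cdiff (f i) u)) / ?W n"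
   proof (intro always_eventually allI)
    fix i
    have "cmod (f (Suc i) k n - \<Phi> u k n) <= nX ?W (\<lambda>k n. \<Phi> (f i) k n - \<Phi> u k n) / ?W n"
     unfolding fS by (rule norm_le_nX[OF nX_diff(1)[OF \<Phi>X[OF fX] \<Phi>X[OF u] W0] Wt_pos[OF w]])
    also have "... <= (1/2 * nX ?W (cdiff (f i) u)) / ?W n"
     using bd u uR by (intro divide_right_mono lip W0) auto
    finally show "cmod (f (Suc i) k n - \<Phi> u k n) <= (1/2 * nX ?W (cdiff (f i) u)) / ?W n" .
   qed
  qed auto
  then have "(\<lambda>i. f (Suc i) k n) \<longlonglongrightarrow> \<Phi> u k n" by (simp add: LIM_zero_iff)
  from LIMSEQ_unique[OF LIMSEQ_Suc[OF pt] this] show "u k n = iota a k n - \<i> * tri Q T 0 u u u k n" by (simp add: \<Phi>_def)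
 qed
 with u uR show ?thesis by (rule that)
qed

end

context nls
begin

text \<open>The kernel factor \<open>exp (- M * (t - r))\<close> and one damped input
  \<open>exp (- M * r)\<close> multiply to \<open>exp (- M * t)\<close>, which leaves the integral.
  So exactly one of the three factors may carry the damping.\<close>

lemma cseries_tri_damped:
 assumes T: "0 < T" "T <= 1" "M >= 0" and abc: "X1 a" "X1 b" "X1 c" "X1 a'" "X1 b'" "X1 c'" and t: "t \<in> {0..T}"
  and eq: "\<And>n1 n2 n3 r. r \<in> {0..T} ==> cval T a' n1 r * cnj (cval T b' n2 r) * cval T c' n3 r =
   of_real (exp (- M * r)) * (cval T a n1 r * cnj (cval T b n2 r) * cval T c n3 r)"
 shows "cval T (tri Q T M a' b' c') n t = of_real (exp (- M * t)) * cval T (tri Q T 0 a b c) n t"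
proof -
 have nl: "nonlin Q T a' b' c' n r = of_real (exp (- M * r)) * nonlin Q T a b c n r" if "r \<in> {0..T}" for r
  unfolding nonlin_eq[OF abc(1-3)] nonlin_eq[OF abc(4-6)] infsum_cmult_right'[symmetric]
  by (rule infsum_cong) (use eq[OF that] in \<open>simp add: split_beta mult_ac\<close>)
 have "cval T (tri Q T M a' b' c') n t = integral {0..t} (\<lambda>r. of_real (exp (- M * t)) * nonlin Q T a b c n r)"
  unfolding cseries_tri[OF T abc(4-6) t]
 proof (rule integral_cong)
  fix r assume "r \<in> {0..t}"
  then have r: "r \<in> {0..T}" using t by auto
  have "exp (- M * (t - r)) * exp (- M * r) = exp (- M * t)" unfolding exp_add[symmetric] by (simp add: algebra_simps)
  then show "complex_of_real (exp (- M * (t - r))) * nonlin Q T a' b' c' n r = of_real (exp (- M * t)) * nonlin Q T a b c n r"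
   unfolding nl[OF r] mult.assoc[symmetric] of_real_mult[symmetric] by (simp only:)
 qed
 also have "... = of_real (exp (- M * t)) * integral {0..t} (nonlin Q T a b c n)" by simp
 also have "integral {0..t} (nonlin Q T a b c n) = cval T (tri Q T 0 a b c) n t"
  using cseries_tri[OF T(1,2) order_refl abc(1-3) t] by simp
 finally show ?thesis .
qed

lemma kap_tendsto_0:
 assumes T: "T > 0"
 shows "(kap T \<longlongrightarrow> 0) at_top"
proof -
 have "filterlim (\<lambda>M. 1 + T * M) at_top at_top"
  using T by (intro filterlim_tendsto_add_at_top[OF tendsto_const] filterlim_tendsto_pos_mult_at_top[OF tendsto_const _ filterlim_ident])
 then have "((\<lambda>M. (1 + T * M) powr (-(2*\<delta>/3))) \<longlongrightarrow> 0) at_top"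
  using delta by (intro tendsto_neg_powr) auto
 then show ?thesis unfolding kap_def by (rule tendsto_mult_right_zero)
qed

text \<open>The two solutions may be of any size \<open>r\<close>, so \<open>T\<close> cannot be
  used for smallness. The damped difference \<open>d\<close> satisfies the linearized equation with
  the damped kernel, whose norm is below 1 for large \<open>M\<close>. Hence \<open>d = 0\<close>,
  and the exponential never vanishes.\<close>

lemma fixp_unique:
 assumes T: "0 < T" "T <= 1" and c: "X1 c" "X1 c'" and sol: "fixp T a c" "fixp T a c'"
 shows "c = c'"
proof -
 let ?W = "Wt (\<lambda>_. 1)" and ?e = "\<lambda>k n. c k n - c' k n"
 have T0: "0 <= (0::real)" by simp
 note w = good_weight_1
 define r where "r = max (nX ?W c) (nX ?W c')"
 have r: "nX ?W c <= r" "nX ?W c' <= r" by (auto simp: r_def)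
 have "((\<lambda>M. 3 * (Ctri * kap T M * r\<^sup>2)) \<longlongrightarrow> 3 * (Ctri * 0 * r\<^sup>2)) at_top"
  by (intro tendsto_intros kap_tendsto_0 T)
 then have "\<forall>\<^sub>F M in at_top. 3 * (Ctri * kap T M * r\<^sup>2) < 1" by (intro order_tendstoD) auto
 then have "\<forall>\<^sub>F M in at_top. M >= 0 \<and> 3 * (Ctri * kap T M * r\<^sup>2) < 1"
  using eventually_ge_at_top[of "0::real"] by eventually_elim simp
 from eventually_happens[OF this] obtain M where M: "M >= 0" "3 * (Ctri * kap T M * r\<^sup>2) < 1"
  by auto
 have e: "X1 ?e" by (rule nX_diff(1)[OF c W1_nonneg])
 obtain d where d: "X1 d" and ds: "\<And>n t. t \<in> {0..T} ==> cval T d n t = of_real (exp (- M * t)) * cval T ?e n t"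
  using inX_damp[OF T M(1) e W1_pos] by blast
 define u where "u = (\<lambda>k n. tri Q T M d c c k n + tri Q T M c' d c k n + tri Q T M c' c' d k n)"
 have u: "X1 u" "nX ?W u <= 3 * (Ctri * kap T M * r\<^sup>2) * nX ?W d"
  unfolding u_def by (rule tri_terms_le[OF T M(1) w c d r])+
 note trX = tri_inX[OF T M(1) w] tri_inX[OF T T0 w]
 have add: "cseries T (\<lambda>k. f k n + g k n) t = cval T f n t + cval T g n t" if "X1 f" "X1 g" for f g n t
 proof -
  have "cseries T (\<lambda>k. f k n - (-1) * g k n) t = cval T f n t - cseries T (\<lambda>k. (-1) * g k n) t"
   using X1_summable[OF that(1)] X1_summable[OF nX_scale_le(1)[OF that(2), of "-1"]] by (rule cseries_diff)
  then show ?thesis unfolding cseries_scale by simp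
 qed
 have "d = (\<lambda>k n. (-\<i>) * u k n)"
 proof (rule ext, rule ext)
  fix k n
  have "(\<lambda>k. d k n) = (\<lambda>k. (-\<i>) * u k n)"
  proof (rule cseries_inject[OF T(1) X1_summable[OF d] X1_summable[OF nX_scale_le(1)[OF u(1)]]])
   fix t assume t: "t \<in> {0..T}"
   let ?E = "complex_of_real (exp (- M * t))"
   have e1: "cval T (tri Q T M d c c) n t = ?E * cval T (tri Q T 0 ?e c c) n t"
    by (rule cseries_tri_damped[OF T M(1) e c(1) c(1) d c(1) c(1) t]) (simp only: ds mult.assoc)
   have e2: "cval T (tri Q T M c' d c) n t = ?E * cval T (tri Q T 0 c' ?e c) n t"
    by (rule cseries_tri_damped[OF T M(1) c(2) e c(1) c(2) d c(1) t]) (simp only: ds complex_cnj_mult complex_cnj_complex_of_real mult_ac)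
   have e3: "cval T (tri Q T M c' c' d) n t = ?E * cval T (tri Q T 0 c' c' ?e) n t"
    by (rule cseries_tri_damped[OF T M(1) c(2) c(2) e c(2) c(2) d t]) (simp only: ds mult_ac)
   have us: "cval T u n t = ?E * (cval T (tri Q T 0 ?e c c) n t + cval T (tri Q T 0 c' ?e c) n t + cval T (tri Q T 0 c' c' ?e) n t)"
    unfolding u_def add[OF nX_add(1)[OF trX(1)[OF d c(1) c(1)] trX(1)[OF c(2) d c(1)] W1_nonneg] trX(1)[OF c(2) c(2) d]]
     add[OF trX(1)[OF d c(1) c(1)] trX(1)[OF c(2) d c(1)]] e1 e2 e3 by (simp only: distrib_left)
   have ek: "?e k n = (-\<i>) * (tri Q T 0 ?e c c k n + tri Q T 0 c' ?e c k n + tri Q T 0 c' c' ?e k n)" for k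
   proof -
    have "?e k n = (-\<i>) * (tri Q T 0 c c c k n - tri Q T 0 c' c' c' k n)"
     using fun_cong[OF fun_cong[OF sol(1)[unfolded fixp_def]], of k n] fun_cong[OF fun_cong[OF sol(2)[unfolded fixp_def]], of k n]
     by (simp add: algebra_simps)
    then show ?thesis using fun_cong[OF fun_cong[OF tri_cube_diff[OF T T0 w c]], of k n] by simp
   qed
   have "cval T ?e n t = (-\<i>) * cseries T (\<lambda>k. tri Q T 0 ?e c c k n + tri Q T 0 c' ?e c k n + tri Q T 0 c' c' ?e k n) t"
    unfolding cseries_scale[symmetric] by (rule arg_cong[where f = "\<lambda>x. cseries T x t"]) (rule ext, rule ek)
   also have "... = (-\<i>) * (cval T (tri Q T 0 ?e c c) n t + cval T (tri Q T 0 c' ?e c) n t + cval T (tri Q T 0 c' c' ?e) n t)"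
    unfolding add[OF nX_add(1)[OF trX(2)[OF e c(1) c(1)] trX(2)[OF c(2) e c(1)] W1_nonneg] trX(2)[OF c(2) c(2) e]]
     add[OF trX(2)[OF e c(1) c(1)] trX(2)[OF c(2) e c(1)]] ..
   finally show "cval T d n t = cseries T (\<lambda>k. (-\<i>) * u k n) t"
    unfolding ds[OF t] cseries_scale us by (simp only: mult.left_commute)
  qed
  then show "d k n = (-\<i>) * u k n" by (rule fun_cong)
 qed
 then have "nX ?W d <= cmod (-\<i>) * nX ?W u" using nX_scale_le(2)[OF u(1), of "-\<i>"] by simp
 then have le: "nX ?W d <= 3 * (Ctri * kap T M * r\<^sup>2) * nX ?W d" using u(2) by simp
 have "nX ?W d = 0"
 proof (rule ccontr)
  assume "nX ?W d \<noteq> 0"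
  then have "nX ?W d > 0" using nX_nonneg[OF d] by simp
  then have "3 * (Ctri * kap T M * r\<^sup>2) * nX ?W d < 1 * nX ?W d" by (intro mult_strict_right_mono M)
  with le show False by simp
 qed
 then have d0: "d = (\<lambda>_ _. 0)" by (rule nX_eq_0[OF d W1_pos])
 show ?thesis
 proof (rule ext, rule ext)
  fix k n
  have "(\<lambda>k. c k n) = (\<lambda>k. c' k n)"
  proof (rule cseries_inject[OF T(1) X1_summable[OF c(1)] X1_summable[OF c(2)]])
   fix t assume t: "t \<in> {0..T}"
   have "cval T ?e n t = 0" using ds[OF t, of n] unfolding d0 by (simp add: cseries_def)
   then show "cval T c n t = cval T c' n t"
    unfolding cseries_diff[OF X1_summable[OF c(1)] X1_summable[OF c(2)]] by simp
  qed
  then show "c k n = c' k n" by (rule fun_cong)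
 qed
qed

lemma fixp_iff:
 assumes T: "0 < T" "T <= 1" and c: "X1 c" and a: "X1 (iota a)"
 shows "fixp T a c \<longleftrightarrow> (\<forall>t\<in>{0..T}. \<forall>n. cval T c n t = a n - \<i> * integral {0..t} (nonlin Q T c c c n))"
proof -
 have T0: "0 <= (0::real)" by simp
 note trX = tri_inX[OF T T0 good_weight_1 c c c]
 have itX: "X1 (\<lambda>k n. \<i> * tri Q T 0 c c c k n)" by (rule nX_scale_le(1)[OF trX])
 have rX: "X1 (\<lambda>k n. iota a k n - \<i> * tri Q T 0 c c c k n)" by (rule nX_diff(1)[OF a itX W1_nonneg])
 have rs: "cseries T (\<lambda>k. iota a k n - \<i> * tri Q T 0 c c c k n) t = a n - \<i> * integral {0..t} (nonlin Q T c c c n)"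
  if "t \<in> {0..T}" for t n
  unfolding cseries_diff[OF X1_summable[OF a] X1_summable[OF itX]] cseries_scale cseries_iota cseries_tri[OF T T0 c c c that] by simp
 show ?thesis
 proof
  assume "fixp T a c"
  then have "c k n = iota a k n - \<i> * tri Q T 0 c c c k n" for k n unfolding fixp_def by (rule fun_cong[OF fun_cong])
  then have e: "(\<lambda>k. c k n) = (\<lambda>k. iota a k n - \<i> * tri Q T 0 c c c k n)" for n by (rule ext)
  show "\<forall>t\<in>{0..T}. \<forall>n. cval T c n t = a n - \<i> * integral {0..t} (nonlin Q T c c c n)"
  proof (intro ballI allI)
   fix t n assume t: "t \<in> {0..T}"
   have "cval T c n t = cseries T (\<lambda>k. iota a k n - \<i> * tri Q T 0 c c c k n) t" by (rule arg_cong[where f = "\<lambda>x. cseries T x t"]) (rule e)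
   then show "cval T c n t = a n - \<i> * integral {0..t} (nonlin Q T c c c n)" unfolding rs[OF t] .
  qed
 next
  assume eq: "\<forall>t\<in>{0..T}. \<forall>n. cval T c n t = a n - \<i> * integral {0..t} (nonlin Q T c c c n)"
  have "(\<lambda>k. c k n) = (\<lambda>k. iota a k n - \<i> * tri Q T 0 c c c k n)" for n
   by (rule cseries_inject[OF T(1) X1_summable[OF c] X1_summable[OF rX]]) (simp only: rs eq)
  then show "fixp T a c" unfolding fixp_def by (intro ext) (rule fun_cong)
 qed
qed

end

section \<open>Fourier series on the torus\<close>

lemma integral_lborel_prod_component:
 fixes g :: "'d::finite => real => complex"
 assumes g: "\<And>j. integrable lborel (g j)"
 shows "integral\<^sup>L lborel (\<lambda>x::real^'d. \<Prod>j\<in>UNIV. g j (x $ j)) = (\<Prod>j\<in>UNIV. integral\<^sup>L lborel (g j))"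
proof -
 interpret product_sigma_finite "\<lambda>_::real^'d. lborel :: real measure" by standard
 have [measurable]: "g j \<in> borel_measurable borel" for j using borel_measurable_integrable[OF g[of j]] by simp
 define ax where "ax j = axis j (1::real)" for j :: 'd
 define idx where "idx = inv ax"
 have inj: "inj ax" by (auto simp: inj_on_def ax_def axis_eq_axis)
 have idx: "idx (ax j) = j" for j unfolding idx_def by (rule inv_f_f[OF inj])
 have B: "Basis = ax ` UNIV" by (auto simp: ax_def Basis_vec_def)
 have comp: "(\<Sum>b\<in>Basis. f b *\<^sub>R b) $ j = f (ax j)" for f :: "real^'d => real" and j
  unfolding cart_eq_inner_axis ax_def by (rule inner_sum_left_Basis) simp
 have "integral\<^sup>L lborel (\<lambda>x::real^'d. \<Prod>j\<in>UNIV. g j (x $ j)) =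
  integral\<^sup>L (\<Pi>\<^sub>M b\<in>Basis. lborel) (\<lambda>f. \<Prod>j\<in>UNIV. g j ((\<Sum>b\<in>Basis. f b *\<^sub>R b) $ j))"
  by (subst lborel_eq, rule integral_distr) measurable
 also have "... = integral\<^sup>L (\<Pi>\<^sub>M b\<in>Basis. lborel) (\<lambda>f. \<Prod>b\<in>Basis. g (idx b) (f b))"
 proof -
  have "(\<Prod>b\<in>Basis. g (idx b) (f b)) = (\<Prod>j\<in>UNIV. g j (f (ax j)))" for f
   unfolding B by (simp add: prod.reindex[OF inj] idx)
  then show ?thesis unfolding comp by simp
 qed
 also have "... = (\<Prod>b\<in>Basis. integral\<^sup>L lborel (g (idx b)))"
  by (rule product_integral_prod) (auto intro: g)
 also have "... = (\<Prod>j\<in>UNIV. integral\<^sup>L lborel (g j))"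
  unfolding B by (simp add: prod.reindex[OF inj] idx)
 finally show ?thesis .
qed

definition char :: "real^'d::finite => int^'d => real^'d => complex" where
 "char \<alpha> n x = cis (freq \<alpha> n \<bullet> x)"

lemma freq_0: "freq \<alpha> 0 = 0" by (vector freq_def)

lemma char_mult: "char \<alpha> n x * char \<alpha> m x = char \<alpha> (n + m) x"
 by (simp add: char_def cis_mult freq_add inner_add_left)

lemma freq_minus: "freq \<alpha> (- n) = - freq \<alpha> n"
 by (vector freq_def)

lemma cnj_char: "cnj (char \<alpha> n x) = char \<alpha> (- n) x"
 by (simp add: char_def cis_cnj freq_minus)

lemma norm_char [simp]: "cmod (char \<alpha> n x) = 1" by (simp add: char_def)

lemma continuous_char [continuous_intros]: "continuous_on S (char \<alpha> n)"
 unfolding char_def cis_conv_exp by (intro continuous_intros)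

lemma measurable_char [measurable]: "char \<alpha> n \<in> borel_measurable borel"
 by (intro borel_measurable_continuous_onI continuous_char)

lemma integral_char_1d:
 assumes a: "a > 0"
 shows "set_integrable lborel {0..a} (\<lambda>t. cis (2 * pi * of_int m / a * t))"
  "(LINT t:{0..a}|lborel. cis (2 * pi * of_int m / a * t)) = (if m = 0 then of_real a else 0)"
proof -
 have c: "continuous_on {0..a} (\<lambda>t. cis (2 * pi * of_int m / a * t))" unfolding cis_conv_exp by (intro continuous_intros)
 show i: "set_integrable lborel {0..a} (\<lambda>t. cis (2 * pi * of_int m / a * t))"
  by (rule borel_integrable_atLeastAtMost'[OF c])
 have "(LINT t:{0..a}|lborel. cis (2 * pi * of_int m / a * t)) = duh 0 (2 * pi * of_int m / a) a"
  unfolding set_borel_integral_eq_integral(2)[OF i] by (rule integral_unique[OF cis_has_integral]) (use a in simp)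
 also have "... = (if m = 0 then of_real a else 0)"
 proof (cases "m = 0")
  case False
  have "exp (\<i> * of_real (2 * pi * of_int m / a) * of_real a) = cis (2 * pi * of_int m)"
   using a by (simp add: cis_conv_exp)
  also have "... = 1" by (rule cis_multiple_2pi) simp
  finally show ?thesis using False a by (simp add: duh_def)
 qed (simp add: duh_def)
 finally show "(LINT t:{0..a}|lborel. cis (2 * pi * of_int m / a * t)) = (if m = 0 then of_real a else 0)" .
qed

lemma cis_sum: "finite A ==> cis (sum f A) = (\<Prod>j\<in>A. cis (f j))"
 by (induction A rule: finite_induct) (simp_all add: cis_mult[symmetric])

definition period_box :: "real^'d::finite => (real^'d) measure" where
 "period_box \<alpha> = restrict_space lborel (cbox 0 \<alpha>)"

lemma integrable_period_box:
 fixes f :: "real^'d::finite => 'b::{banach, second_countable_topology}"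
 shows "integrable (period_box \<alpha>) f \<longleftrightarrow> set_integrable lborel (cbox 0 \<alpha>) f"
  "integral\<^sup>L (period_box \<alpha>) f = (LINT x:cbox 0 \<alpha>|lborel. f x)"
 unfolding period_box_def set_integrable_def set_lebesgue_integral_def
 by (rule integrable_restrict_space integral_restrict_space; simp)+

lemma measurable_period_box: "f \<in> borel_measurable borel ==> f \<in> borel_measurable (period_box \<alpha>)"
 unfolding period_box_def by (rule measurable_restrict_space1) simp

definition vol :: "real^'d::finite => real" where "vol \<alpha> = (\<Prod>j\<in>UNIV. \<alpha> $ j)"

locale flat_torus =
 fixes \<alpha> :: "real^'d::finite"
 assumes pos: "\<And>j. \<alpha> $ j > 0"
begin

abbreviation M where "M \<equiv> period_box \<alpha>"

lemma vol_pos: "vol \<alpha> > 0" unfolding vol_def by (intro prod_pos) (use pos in auto)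

lemma finite_measure_M: "finite_measure M"
proof (rule finite_measureI)
 have "emeasure M (space M) = emeasure lborel (cbox 0 \<alpha>)"
  unfolding period_box_def by (simp add: space_restrict_space emeasure_restrict_space)
 then show "emeasure M (space M) \<noteq> \<infinity>" using emeasure_lborel_cbox_finite[of 0 \<alpha>] by (simp add: less_top[symmetric])
qed

lemma integrable_bounded:
 fixes f :: "real^'d => 'b::{banach, second_countable_topology}"
 assumes "f \<in> borel_measurable borel" "\<And>x. norm (f x) <= B"
 shows "integrable M f"
 by (rule finite_measure.integrable_const_bound[OF finite_measure_M _ measurable_period_box[OF assms(1)]]) (use assms(2) in auto)

lemma integral_char: "integral\<^sup>L M (char \<alpha> n) = (if n = 0 then of_real (vol \<alpha>) else 0)"
proof -
 define g where "g j t = indicator {0..\<alpha> $ j} t *\<^sub>R cis (2 * pi * of_int (n $ j) / \<alpha> $ j * t)" for j t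
 have gi: "integrable lborel (g j)" and gI: "integral\<^sup>L lborel (g j) = (if n $ j = 0 then of_real (\<alpha> $ j) else 0)" for j
  using integral_char_1d[OF pos[of j], of "n $ j"] unfolding g_def set_integrable_def set_lebesgue_integral_def by auto
 have "integral\<^sup>L M (char \<alpha> n) = integral\<^sup>L lborel (\<lambda>x. indicator (cbox 0 \<alpha>) x *\<^sub>R char \<alpha> n x)"
  unfolding integrable_period_box(2) set_lebesgue_integral_def ..
 also have "... = integral\<^sup>L lborel (\<lambda>x. \<Prod>j\<in>UNIV. g j (x $ j))"
 proof (rule Bochner_Integration.integral_cong[OF refl])
  fix x :: "real^'d"
  have "freq \<alpha> n \<bullet> x = (\<Sum>j\<in>UNIV. 2 * pi * of_int (n $ j) / \<alpha> $ j * x $ j)"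
   by (simp add: freq_def inner_vec_def)
  then have c: "char \<alpha> n x = (\<Prod>j\<in>UNIV. cis (2 * pi * of_int (n $ j) / \<alpha> $ j * x $ j))"
   unfolding char_def by (simp only: cis_sum[OF finite_class.finite_UNIV])
  show "indicator (cbox 0 \<alpha>) x *\<^sub>R char \<alpha> n x = (\<Prod>j\<in>UNIV. g j (x $ j))"
  proof (cases "x \<in> cbox 0 \<alpha>")
   case True
   then have "g j (x $ j) = cis (2 * pi * of_int (n $ j) / \<alpha> $ j * x $ j)" for j by (simp add: g_def mem_box_cart)
   then show ?thesis using True c by simp
  next
   case False
   then obtain j where "\<not> (0 <= x $ j \<and> x $ j <= \<alpha> $ j)" by (auto simp: mem_box_cart)
   then have "g j (x $ j) = 0" by (simp add: g_def)
   then have "(\<Prod>j\<in>UNIV. g j (x $ j)) = 0" by (intro prod_zero) auto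
   then show ?thesis using False by simp
  qed
 qed
 also have "... = (\<Prod>j\<in>UNIV. if n $ j = 0 then of_real (\<alpha> $ j) else 0)"
  unfolding integral_lborel_prod_component[OF gi] gI ..
 also have "... = (if n = 0 then of_real (vol \<alpha>) else 0)"
 proof (cases "n = 0")
  case False
  then obtain j where "n $ j \<noteq> 0" by (auto simp: vec_eq_iff)
  then have "(\<Prod>j\<in>UNIV. if n $ j = 0 then complex_of_real (\<alpha> $ j) else 0) = 0" by (intro prod_zero) auto
  then show ?thesis using False by simp
 qed (simp add: vol_def)
 finally show ?thesis .
qed

lemma integral_char_sum:
 assumes "finite \<Theta>"
 shows "integral\<^sup>L M (\<lambda>x. \<Sum>\<theta>\<in>\<Theta>. w \<theta> * char \<alpha> (\<phi> \<theta>) x) = of_real (vol \<alpha>) * (\<Sum>\<theta>\<in>\<Theta>. if \<phi> \<theta> = 0 then w \<theta> else 0)"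
proof -
 have "integral\<^sup>L M (\<lambda>x. \<Sum>\<theta>\<in>\<Theta>. w \<theta> * char \<alpha> (\<phi> \<theta>) x) = (\<Sum>\<theta>\<in>\<Theta>. w \<theta> * integral\<^sup>L M (char \<alpha> (\<phi> \<theta>)))"
  by (subst Bochner_Integration.integral_sum) (auto intro!: integrable_mult_right integrable_bounded[where B = 1])
 then show ?thesis unfolding integral_char by (simp add: sum_distrib_left if_distrib mult.commute cong: if_cong)
qed

definition trig :: "(int^'d) set => (int^'d => complex) => real^'d => complex" where
 "trig A z x = (\<Sum>n\<in>A. z n * char \<alpha> n x)"

lemma measurable_trig [measurable]: "trig A z \<in> borel_measurable borel"
 unfolding trig_def by measurable

lemma norm_trig_le: "cmod (trig A z x) <= (\<Sum>n\<in>A. cmod (z n))"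
 unfolding trig_def by (rule sum_norm_le) (simp add: norm_mult)

lemma integral_trig:
 assumes "finite A"
 shows "integral\<^sup>L M (\<lambda>x. trig A z x * char \<alpha> (- m) x) = of_real (vol \<alpha>) * (if m \<in> A then z m else 0)"
proof -
 have "(\<lambda>x. trig A z x * char \<alpha> (- m) x) = (\<lambda>x. \<Sum>n\<in>A. z n * char \<alpha> (n - m) x)"
  unfolding trig_def sum_distrib_right mult.assoc char_mult by simp
 then show ?thesis by (simp add: integral_char_sum[OF assms] sum.delta[OF assms] cong: if_cong)
qed

lemma integral_trig_square:
 assumes "finite A"
 shows "integral\<^sup>L M (\<lambda>x. (cmod (trig A z x))\<^sup>2) = vol \<alpha> * (\<Sum>n\<in>A. (cmod (z n))\<^sup>2)"
proof -
 have "complex_of_real (integral\<^sup>L M (\<lambda>x. (cmod (trig A z x))\<^sup>2)) = integral\<^sup>L M (\<lambda>x. complex_of_real ((cmod (trig A z x))\<^sup>2))"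
  by (rule integral_complex_of_real[symmetric])
 also have "(\<lambda>x. complex_of_real ((cmod (trig A z x))\<^sup>2)) = (\<lambda>x. \<Sum>\<theta>\<in>A \<times> A. (z (fst \<theta>) * cnj (z (snd \<theta>))) * char \<alpha> (fst \<theta> - snd \<theta>) x)"
 proof
  fix x
  have "complex_of_real ((cmod (trig A z x))\<^sup>2) = trig A z x * cnj (trig A z x)" by (rule complex_norm_square)
  also have "... = (\<Sum>\<theta>\<in>A \<times> A. (z (fst \<theta>) * char \<alpha> (fst \<theta>) x) * (cnj (z (snd \<theta>)) * char \<alpha> (- snd \<theta>) x))"
   unfolding trig_def cnj_sum complex_cnj_mult cnj_char sum_product sum.cartesian_product by (simp add: split_beta)
  also have "... = (\<Sum>\<theta>\<in>A \<times> A. (z (fst \<theta>) * cnj (z (snd \<theta>))) * (char \<alpha> (fst \<theta>) x * char \<alpha> (- snd \<theta>) x))"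
   by (rule sum.cong[OF refl]) (simp only: mult_ac)
  finally show "complex_of_real ((cmod (trig A z x))\<^sup>2) = (\<Sum>\<theta>\<in>A \<times> A. (z (fst \<theta>) * cnj (z (snd \<theta>))) * char \<alpha> (fst \<theta> - snd \<theta>) x)"
   unfolding char_mult by simp
 qed
 also have "integral\<^sup>L M ... = of_real (vol \<alpha>) * (\<Sum>\<theta>\<in>A \<times> A. if fst \<theta> - snd \<theta> = 0 then z (fst \<theta>) * cnj (z (snd \<theta>)) else 0)"
  by (rule integral_char_sum) (use assms in simp)
 also have "(\<Sum>\<theta>\<in>A \<times> A. if fst \<theta> - snd \<theta> = 0 then z (fst \<theta>) * cnj (z (snd \<theta>)) else 0) = (\<Sum>n\<in>A. \<Sum>m\<in>A. if n = m then z n * cnj (z m) else 0)"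
  unfolding sum.cartesian_product by (simp add: split_beta)
 also have "... = complex_of_real (\<Sum>n\<in>A. (cmod (z n))\<^sup>2)"
  unfolding of_real_sum complex_norm_square by (rule sum.cong[OF refl]) (simp add: sum.delta'[OF assms] assms)
 finally have "complex_of_real (integral\<^sup>L M (\<lambda>x. (cmod (trig A z x))\<^sup>2)) = complex_of_real (vol \<alpha> * (\<Sum>n\<in>A. (cmod (z n))\<^sup>2))" by simp
 then show ?thesis by (simp only: of_real_eq_iff)
qed

definition conv3 :: "(int^'d) set => (int^'d => complex) => int^'d => complex" where
 "conv3 A z m = (\<Sum>\<theta>\<in>A\<times>A\<times>A. if out \<theta> = m then (case \<theta> of (n1, n2, n3) => z n1 * cnj (z n2) * z n3) else 0)"

lemma integral_trig_cubic:
 assumes "finite A"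
 shows "integral\<^sup>L M (\<lambda>x. of_real ((cmod (trig A z x))\<^sup>2) * trig A z x * char \<alpha> (- m) x) = of_real (vol \<alpha>) * conv3 A z m"
proof -
 let ?w = "\<lambda>(n1, n2, n3). z n1 * cnj (z n2) * z n3"
 have "(\<lambda>x. of_real ((cmod (trig A z x))\<^sup>2) * trig A z x * char \<alpha> (- m) x) = (\<lambda>x. \<Sum>\<theta>\<in>A\<times>A\<times>A. ?w \<theta> * char \<alpha> (out \<theta> - m) x)"
 proof
  fix x
  have "of_real ((cmod (trig A z x))\<^sup>2) * trig A z x * char \<alpha> (- m) x = trig A z x * (cnj (trig A z x) * (trig A z x * char \<alpha> (- m) x))"
   unfolding complex_norm_square by (simp only: mult_ac)
  also have "... = (\<Sum>n1\<in>A. \<Sum>n2\<in>A. \<Sum>n3\<in>A. (z n1 * char \<alpha> n1 x) * ((cnj (z n2) * char \<alpha> (- n2) x) * ((z n3 * char \<alpha> n3 x) * char \<alpha> (- m) x)))"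
   unfolding trig_def cnj_sum complex_cnj_mult cnj_char by (simp only: sum_distrib_left[symmetric] sum_distrib_right[symmetric])
  also have "... = (\<Sum>n1\<in>A. \<Sum>n2\<in>A. \<Sum>n3\<in>A. (z n1 * cnj (z n2) * z n3) * (char \<alpha> n1 x * (char \<alpha> (- n2) x * (char \<alpha> n3 x * char \<alpha> (- m) x))))"
   by (intro sum.cong refl) (simp only: mult_ac)
  also have "... = (\<Sum>\<theta>\<in>A\<times>A\<times>A. ?w \<theta> * char \<alpha> (out \<theta> - m) x)"
   unfolding char_mult sum.cartesian_product' prod.case out_def by (simp add: algebra_simps)
  finally show "of_real ((cmod (trig A z x))\<^sup>2) * trig A z x * char \<alpha> (- m) x = (\<Sum>\<theta>\<in>A\<times>A\<times>A. ?w \<theta> * char \<alpha> (out \<theta> - m) x)" .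
 qed
 then show ?thesis using assms by (simp add: integral_char_sum conv3_def cong: if_cong)
qed

end

section \<open>Periodicity and synthesis by dyadic partial sums\<close>

context flat_torus
begin

definition lattice :: "int^'d => real^'d" where "lattice m = (\<chi> j. \<alpha> $ j * of_int (m $ j))"

lemma char_shift: "char \<alpha> n (x + lattice m) = char \<alpha> n x"
proof -
 have "freq \<alpha> n \<bullet> lattice m = (\<Sum>j\<in>UNIV. 2 * pi * of_int (n $ j * m $ j))"
  unfolding freq_def lattice_def inner_vec_def using pos
  by (intro sum.cong refl) (simp add: order_less_imp_not_eq2)
 also have "... = 2 * pi * of_int (\<Sum>j\<in>UNIV. n $ j * m $ j)" unfolding of_int_sum sum_distrib_left ..
 finally have e: "freq \<alpha> n \<bullet> lattice m = 2 * pi * of_int (\<Sum>j\<in>UNIV. n $ j * m $ j)" .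
 have "cis (freq \<alpha> n \<bullet> lattice m) = 1" unfolding e by (rule cis_multiple_2pi) (rule Ints_of_int)
 then show ?thesis unfolding char_def inner_add_right cis_mult[symmetric] by simp
qed

lemma trig_shift: "trig A z (x + lattice m) = trig A z x"
 unfolding trig_def char_shift ..

lemma ex_lattice_in_box: "\<exists>m. x + lattice m \<in> cbox 0 \<alpha>"
proof
 define m :: "int^'d" where "m = (\<chi> j. - \<lfloor>x $ j / \<alpha> $ j\<rfloor>)"
 show "x + lattice m \<in> cbox 0 \<alpha>"
  unfolding mem_box_cart
 proof (intro allI)
  fix j
  have "of_int \<lfloor>x $ j / \<alpha> $ j\<rfloor> * \<alpha> $ j <= x $ j" "x $ j <= (of_int \<lfloor>x $ j / \<alpha> $ j\<rfloor> + 1) * \<alpha> $ j"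
   using pos[of j] by (simp_all add: pos_le_divide_eq[symmetric] pos_divide_le_eq[symmetric])
  then show "0 $ j <= (x + lattice m) $ j \<and> (x + lattice m) $ j <= \<alpha> $ j"
   by (simp add: lattice_def m_def algebra_simps)
 qed
qed

text \<open>Countably many lattice translates of the period box cover the space, so null exceptional
  sets add up to a null set.\<close>

lemma AE_periodic:
 assumes P: "\<And>x m. P (x + lattice m) ==> P x" and ae: "AE x in M. P x"
 shows "AE x in lborel. P x"
proof -
 have "AE x in lborel. x \<in> cbox 0 \<alpha> \<longrightarrow> P x"
  using ae unfolding period_box_def by (subst (asm) AE_restrict_space_iff) auto
 then have "\<forall>m. AE x in lborel. x + lattice m \<in> cbox 0 \<alpha> \<longrightarrow> P (x + lattice m)"
  by (intro allI AE_lborel_shift)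
 then have "AE x in lborel. \<forall>m. x + lattice m \<in> cbox 0 \<alpha> \<longrightarrow> P (x + lattice m)"
  by (subst AE_all_countable)
 then show ?thesis by eventually_elim (metis ex_lattice_in_box P)
qed

definition part :: "(int^'d => complex) => nat => real^'d => complex" where
 "part z J = trig {n. level n < J} z"

text \<open>\<open>lim\<close> has one fixed value on all divergent sequences. As every partial sum
  is periodic, the function is periodic at every point and not only where the limit exists.\<close>

definition synth_fun :: "(int^'d => complex) => real^'d => complex" where
 "synth_fun z x = lim (\<lambda>J. part z J x)"

lemma finite_level_less: "finite {n::int^'d. level n < J}"
 by (rule finite_subset[OF _ finite_level_le[of J]]) auto

lemma part_eq: "part z J x = (\<Sum>j<J. trig {n. level n = j} z x)"
proof -
 have "(\<Sum>j\<in>{..<J}. \<Sum>n\<in>{n \<in> {n. level n < J}. level n = j}. z n * char \<alpha> n x) = (\<Sum>n\<in>{n. level n < J}. z n * char \<alpha> n x)"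
  by (rule sum.group) (auto simp: finite_level_less)
 moreover have "{n \<in> {n. level n < J}. level n = j} = {n::int^'d. level n = j}" if "j \<in> {..<J}" for j using that by auto
 ultimately show ?thesis unfolding part_def trig_def by simp
qed

lemma measurable_part [measurable]: "part z J \<in> borel_measurable borel"
 unfolding part_def by (rule measurable_trig)

lemma measurable_synth_fun [measurable]: "synth_fun z \<in> borel_measurable borel"
 unfolding synth_fun_def[abs_def] by measurable

lemma synth_fun_shift: "synth_fun z (x + lattice m) = synth_fun z x"
 unfolding synth_fun_def part_def trig_shift ..

end

locale sobolev_torus = flat_torus \<alpha> for \<alpha> :: "real^'d::finite" +
 fixes s :: real
 assumes \<alpha>: "\<And>j. \<alpha> $ j \<in> {1/2..2}" and s: "real CARD('d) < 6 * s"
begin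

definition hs :: "(int^'d => complex) => bool" where
 "hs z \<longleftrightarrow> (\<exists>B. \<forall>S. finite S \<longrightarrow> L2_set (\<lambda>n. japanese \<alpha> n powr s * cmod (z n)) S <= B)"

text \<open>A sixth root of the L3 gain from one dyadic shell to the next. Three of the six powers
  are spent on pointwise geometric decay, the other three on the summability of the
  integrals.\<close>

definition ratio :: real where "ratio = 2 powr ((real CARD('d) / 2 - 3 * s) / 6)"

lemma ratio: "0 < ratio" "ratio < 1"
 using s unfolding ratio_def by (auto intro: powr_less_one)

text \<open>The cube is bounded by the supremum times the square. Cauchy-Schwarz over the shell
  gives the supremum an exponent d/2 - s, orthogonality gives the square -2s; the total d/2 - 3s is
  negative exactly when s > d/6.\<close>

lemma shell_integral:
 assumes "hs z"
 obtains K where "K >= 0" "\<And>j. integral\<^sup>L M (\<lambda>x. cmod (trig {n. level n = j} z x) ^ 3) <= K * ratio ^ (6 * j)"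
proof -
 obtain B where B: "\<And>S. finite S ==> L2_set (\<lambda>n. japanese \<alpha> n powr s * cmod (z n)) S <= B"
  using assms unfolding hs_def by blast
 have B0: "B >= 0" using B[of "{}"] by simp
 have s0: "s > 0" using s by (smt (verit) of_nat_0_le_iff)
 define A where "A j = {n::int^'d. level n = j}" for j
 have A: "finite (A j)" for j unfolding A_def by (rule finite_subset[OF _ finite_level_le[of j]]) auto
 have L2: "L2_set (\<lambda>n. cmod (z n)) (A j) <= B * 2 powr (- (s * j))" for j
 proof -
  have pt: "2 powr (s * j) * cmod (z n) <= japanese \<alpha> n powr s * cmod (z n)" if "n \<in> A j" for n
  proof (rule mult_right_mono)
   have "2 powr (s * j) = (2 powr real (level n)) powr s" using that by (simp add: A_def powr_powr mult.commute)
   also have "... <= japanese \<alpha> n powr s" using s0 by (intro powr_mono2 level_le_japanese \<alpha>) auto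
   finally show "2 powr (s * j) <= japanese \<alpha> n powr s" .
  qed simp
  have "2 powr (s * j) * L2_set (\<lambda>n. cmod (z n)) (A j) = L2_set (\<lambda>n. 2 powr (s * j) * cmod (z n)) (A j)"
   by (rule L2_set_mult_const[symmetric]) simp
  also have "... <= L2_set (\<lambda>n. japanese \<alpha> n powr s * cmod (z n)) (A j)"
   by (rule L2_set_mono) (use pt in auto)
  also have "... <= B" by (rule B[OF A])
  finally show ?thesis by (simp add: powr_minus field_simps)
 qed
 have L1: "(\<Sum>n\<in>A j. cmod (z n)) <= sqrt (3 ^ CARD('d)) * 2 powr (real CARD('d) / 2 * j) * (B * 2 powr (- (s * j)))" for j
 proof -
  have c: "real (card (A j)) <= 3 ^ CARD('d) * 2 powr (real CARD('d) * j)"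
  proof -
   have "card (A j) <= card {n::int^'d. level n <= j}"
    unfolding A_def by (rule card_mono[OF finite_level_le]) auto
   then show ?thesis using card_level_le_set[of j, where 'd = 'd] by linarith
  qed
  have "(\<Sum>n\<in>A j. cmod (z n)) = (\<Sum>n\<in>A j. \<bar>1\<bar> * \<bar>cmod (z n)\<bar>)" by simp
  also have "... <= L2_set (\<lambda>_. 1) (A j) * L2_set (\<lambda>n. cmod (z n)) (A j)" by (rule L2_set_mult_ineq)
  also have "... <= (sqrt (3 ^ CARD('d)) * 2 powr (real CARD('d) / 2 * j)) * (B * 2 powr (- (s * j)))"
  proof (rule mult_mono[OF _ L2])
   have "L2_set (\<lambda>_. 1) (A j) = sqrt (card (A j))" by (simp add: L2_set_def)
   also have "... <= sqrt (3 ^ CARD('d) * 2 powr (real CARD('d) * j))" by (rule real_sqrt_le_mono[OF c])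
   also have "... = sqrt (3 ^ CARD('d)) * 2 powr (real CARD('d) / 2 * j)"
    by (simp add: real_sqrt_mult powr_half_sqrt[symmetric] powr_powr)
   finally show "L2_set (\<lambda>_. 1) (A j) <= sqrt (3 ^ CARD('d)) * 2 powr (real CARD('d) / 2 * j)" .
  qed auto
  finally show ?thesis by (simp add: mult_ac)
 qed
 define K where "K = sqrt (3 ^ CARD('d)) * B * (vol \<alpha> * B\<^sup>2)"
 have "integral\<^sup>L M (\<lambda>x. cmod (trig (A j) z x) ^ 3) <= K * ratio ^ (6 * j)" for j
 proof -
  let ?m = "\<Sum>n\<in>A j. cmod (z n)"
  have bd: "cmod (trig (A j) z x) <= ?m" for x by (rule norm_trig_le)
  have m0: "?m >= 0" by (rule sum_nonneg) simp
  have "integral\<^sup>L M (\<lambda>x. cmod (trig (A j) z x) ^ 3) <= integral\<^sup>L M (\<lambda>x. ?m * (cmod (trig (A j) z x))\<^sup>2)"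
  proof (rule integral_mono)
   show "integrable M (\<lambda>x. cmod (trig (A j) z x) ^ 3)"
    by (rule integrable_bounded[where B = "?m ^ 3"]) (auto intro!: power_mono bd)
   show "integrable M (\<lambda>x. ?m * (cmod (trig (A j) z x))\<^sup>2)"
    by (rule integrable_mult_right, rule integrable_bounded[where B = "?m ^ 2"]) (auto intro!: power_mono bd)
   show "cmod (trig (A j) z x) ^ 3 <= ?m * (cmod (trig (A j) z x))\<^sup>2" for x
    unfolding power3_eq_cube power2_eq_square mult.assoc by (rule mult_right_mono[OF bd]) simp
  qed
  also have "... = ?m * (vol \<alpha> * (L2_set (\<lambda>n. cmod (z n)) (A j))\<^sup>2)"
   using integral_trig_square[OF A] by (simp add: L2_set_def sum_nonneg)
  also have "... <= (sqrt (3 ^ CARD('d)) * 2 powr (real CARD('d) / 2 * j) * (B * 2 powr (- (s * j)))) * (vol \<alpha> * (B * 2 powr (- (s * j)))\<^sup>2)"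
   using vol_pos B0 by (intro mult_mono L1 mult_left_mono power_mono L2) (auto intro!: mult_nonneg_nonneg)
  also have "... = K * (2 powr (real CARD('d) / 2 * j) * (2 powr (- (s * j)) * (2 powr (- (s * j)) * 2 powr (- (s * j)))))"
   unfolding K_def power2_eq_square by (simp only: mult_ac)
  also have "2 powr (real CARD('d) / 2 * j) * (2 powr (- (s * j)) * (2 powr (- (s * j)) * 2 powr (- (s * j)))) = ratio ^ (6 * j)"
  proof -
   have "ratio ^ (6 * j) = ratio powr real (6 * j)" using ratio(1) by (rule powr_realpow[symmetric])
   also have "... = 2 powr ((real CARD('d) / 2 - 3 * s) / 6 * real (6 * j))" unfolding ratio_def powr_powr ..
   also have "(real CARD('d) / 2 - 3 * s) / 6 * real (6 * j) = real CARD('d) / 2 * j + (- (s * j) + (- (s * j) + - (s * j)))"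
    by (simp add: field_simps)
   finally show ?thesis unfolding powr_add by simp
  qed
  finally show ?thesis .
 qed
 moreover have "K >= 0" unfolding K_def using B0 vol_pos by simp
 ultimately show ?thesis using that unfolding A_def by blast
qed

lemma cube_root_le:
 assumes "a >= 0" "q > 0" "a ^ 3 / q ^ 3 <= h"
 shows "a <= root 3 h * q"
proof -
 have "a / q = root 3 ((a / q) ^ 3)" using assms by (simp add: real_root_power_cancel)
 also have "... <= root 3 h" using assms by (simp add: power_divide)
 finally show ?thesis using assms(2) by (simp add: pos_divide_le_eq)
qed

text \<open>The sum \<open>H\<close> of the shell cubes, each divided by
  \<open>(ratio ^ j) ^ 3\<close>, is integrable. Where it is finite, shell \<open>j\<close> is at
  most a cube root of \<open>H\<close> times \<open>ratio ^ j\<close>, so one integrable function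
  yields both pointwise convergence and a majorant for the cubes of all partial sums.\<close>

lemma dominated:
 assumes z: "hs z"
 obtains h where "integrable M h" "AE x in lborel. (\<lambda>J. part z J x) \<longlonglongrightarrow> synth_fun z x"
  "AE x in M. (\<lambda>J. part z J x) \<longlonglongrightarrow> synth_fun z x" "AE x in M. \<forall>J. cmod (part z J x) ^ 3 <= h x"
proof -
 obtain K where K: "K >= 0" "\<And>j. integral\<^sup>L M (\<lambda>x. cmod (trig {n. level n = j} z x) ^ 3) <= K * ratio ^ (6 * j)"
  using shell_integral[OF z] by blast
 define t where "t j x = cmod (trig {n. level n = j} z x)" for j x
 define f where "f j x = t j x ^ 3 / (ratio ^ j) ^ 3" for j x
 have f0: "f j x >= 0" for j x using ratio by (simp add: f_def t_def)
 have fm: "f j \<in> borel_measurable borel" for j unfolding f_def t_def by measurable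
 have fi: "integrable M (f j)" for j
 proof (rule integrable_bounded[OF fm])
  show "norm (f j x) <= (\<Sum>n | level n = j. cmod (z n)) ^ 3 / (ratio ^ j) ^ 3" for x
   using f0[of j x] ratio unfolding f_def t_def by (simp add: divide_right_mono power_mono norm_trig_le)
 qed
 have fI: "integral\<^sup>L M (f j) <= K * (ratio ^ 3) ^ j" for j
 proof -
  have "integral\<^sup>L M (f j) = integral\<^sup>L M (\<lambda>x. t j x ^ 3) / (ratio ^ j) ^ 3" unfolding f_def by simp
  also have "... <= K * ratio ^ (6 * j) / (ratio ^ j) ^ 3" unfolding t_def using K(2)[of j] ratio by (intro divide_right_mono) auto
  also have "... = K * (ratio ^ 3) ^ j"
   using ratio by (simp add: power_mult[symmetric] mult.commute[of j] power_add[symmetric] divide_eq_eq mult.assoc)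
  finally show ?thesis .
 qed
 have r3: "norm (ratio ^ 3) < 1" using ratio by (simp add: power_less_one_iff)
 have sI: "summable (\<lambda>j. integral\<^sup>L M (f j))"
 proof (rule summable_comparison_test'[where N = 0])
  show "summable (\<lambda>j. K * (ratio ^ 3) ^ j)" by (intro summable_mult summable_geometric r3)
  show "norm (integral\<^sup>L M (f j)) <= K * (ratio ^ 3) ^ j" for j
   using fI[of j] f0 by (simp add: abs_of_nonneg integral_nonneg_AE)
 qed
 have good: "AE x in M. summable (\<lambda>j. f j x)"
 proof -
  have meas [measurable]: "(\<lambda>x. ennreal (f j x)) \<in> borel_measurable M" for j
   using measurable_period_box[OF fm[of j]] by measurable
  have "(\<integral>\<^sup>+x. (\<Sum>j. ennreal (f j x)) \<partial>M) = (\<Sum>j. \<integral>\<^sup>+x. ennreal (f j x) \<partial>M)"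
   by (rule nn_integral_suminf[OF meas])
  also have "... = (\<Sum>j. ennreal (integral\<^sup>L M (f j)))"
   by (subst nn_integral_eq_integral[OF fi]) (auto simp: f0)
  also have "... = ennreal (\<Sum>j. integral\<^sup>L M (f j))"
   by (rule suminf_ennreal2[OF _ sI]) (simp add: integral_nonneg_AE f0)
  finally have "(\<integral>\<^sup>+x. (\<Sum>j. ennreal (f j x)) \<partial>M) \<noteq> \<infinity>" by simp
  then have "AE x in M. (\<Sum>j. ennreal (f j x)) \<noteq> \<infinity>"
   by (intro nn_integral_PInf_AE) measurable
  then show ?thesis by eventually_elim (rule summable_suminf_not_top, auto simp: f0)
 qed
 define H where "H x = (\<Sum>j. f j x)" for x
 have Hi: "integrable M H" unfolding H_def
  by (rule integrable_suminf[OF fi]) (use good sI f0 in \<open>auto simp: abs_of_nonneg\<close>)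
 have key: "(\<lambda>J. part z J x) \<longlonglongrightarrow> synth_fun z x" "\<forall>J. cmod (part z J x) ^ 3 <= H x * (1 / (1 - ratio)) ^ 3"
  if g: "summable (\<lambda>j. f j x)" for x
 proof -
  have fH: "f j x <= H x" for j
   using sum_le_suminf[OF g, of "{j}"] f0 by (simp add: H_def)
  have H0: "H x >= 0" using fH[of 0] f0[of 0 x] by simp
  have tj: "t j x <= root 3 (H x) * ratio ^ j" for j
   by (rule cube_root_le) (use fH[of j] ratio in \<open>auto simp: f_def t_def\<close>)
  have sg: "summable (\<lambda>j. root 3 (H x) * ratio ^ j)"
   using ratio by (intro summable_mult summable_geometric) auto
  have "summable (\<lambda>j. trig {n. level n = j} z x)"
   by (rule summable_comparison_test'[OF sg, where N = 0]) (use tj in \<open>simp add: t_def\<close>)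
  then have "convergent (\<lambda>J. part z J x)" unfolding part_eq by (simp add: summable_iff_convergent)
  then show "(\<lambda>J. part z J x) \<longlonglongrightarrow> synth_fun z x" unfolding synth_fun_def by (simp add: convergent_LIMSEQ_iff)
  show "\<forall>J. cmod (part z J x) ^ 3 <= H x * (1 / (1 - ratio)) ^ 3"
  proof
   fix J
   have "cmod (part z J x) <= (\<Sum>j<J. root 3 (H x) * ratio ^ j)"
    unfolding part_eq by (rule sum_norm_le) (use tj in \<open>simp add: t_def\<close>)
   also have "... <= root 3 (H x) * (1 / (1 - ratio))"
   proof -
    have "(\<Sum>j<J. ratio ^ j) <= (\<Sum>j. ratio ^ j)" using ratio by (intro sum_le_suminf summable_geometric) auto
    also have "... = 1 / (1 - ratio)" using ratio by (intro suminf_geometric) auto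
    finally show ?thesis unfolding sum_distrib_left[symmetric] using H0 by (intro mult_left_mono) auto
   qed
   finally have "cmod (part z J x) ^ 3 <= (root 3 (H x) * (1 / (1 - ratio))) ^ 3" by (intro power_mono) auto
   also have "... = H x * (1 / (1 - ratio)) ^ 3" unfolding power_mult_distrib using H0 by simp
   finally show "cmod (part z J x) ^ 3 <= H x * (1 / (1 - ratio)) ^ 3" .
  qed
 qed
 have "AE x in lborel. summable (\<lambda>j. f j x)"
  by (rule AE_periodic[OF _ good]) (simp add: f_def t_def trig_shift)
 then have 1: "AE x in lborel. (\<lambda>J. part z J x) \<longlonglongrightarrow> synth_fun z x" by eventually_elim (rule key)
 have 2: "AE x in M. (\<lambda>J. part z J x) \<longlonglongrightarrow> synth_fun z x" using good by eventually_elim (rule key)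
 have 3: "AE x in M. \<forall>J. cmod (part z J x) ^ 3 <= H x * (1 / (1 - ratio)) ^ 3" using good by eventually_elim (rule key)
 show ?thesis by (rule that[OF _ 1 2 3]) (intro integrable_mult_left Hi)
qed

lemma le_1_plus_cube: "(t::real) >= 0 ==> k <= 3 ==> t ^ k <= 1 + t ^ 3"
proof (cases "t <= 1")
 case True
 assume "t >= 0"
 then have "t ^ k <= 1" "t ^ 3 >= 0" using True by (auto intro: power_le_one)
 then show ?thesis by linarith
next
 case False
 assume "k <= 3"
 then have "t ^ k <= t ^ 3" using False by (intro power_increasing) auto
 then show ?thesis by simp
qed

text \<open>Dominated convergence for every \<open>G\<close> of at most cubic growth: the identity
  gives the Fourier coefficients, the square L2, and the cubic map the nonlinearity.\<close>

lemma part_limit: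
 fixes G :: "complex => complex"
 assumes z: "hs z" and G: "continuous_on UNIV G" "\<And>u. cmod (G u) <= 1 + cmod u ^ 3"
 shows "integrable M (\<lambda>x. G (synth_fun z x) * char \<alpha> m x)"
  "(\<lambda>J. integral\<^sup>L M (\<lambda>x. G (part z J x) * char \<alpha> m x)) \<longlonglongrightarrow> integral\<^sup>L M (\<lambda>x. G (synth_fun z x) * char \<alpha> m x)"
proof -
 obtain h where h: "integrable M h" and lim: "AE x in M. (\<lambda>J. part z J x) \<longlonglongrightarrow> synth_fun z x"
  and bd: "AE x in M. \<forall>J. cmod (part z J x) ^ 3 <= h x" by (rule dominated[OF z]) blast
 have [measurable]: "G \<in> borel_measurable borel" by (rule borel_measurable_continuous_onI[OF G(1)])
 have m1: "(\<lambda>x. G (synth_fun z x) * char \<alpha> m x) \<in> borel_measurable M" by (rule measurable_period_box) measurable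
 have m2: "(\<lambda>x. G (part z J x) * char \<alpha> m x) \<in> borel_measurable M" for J by (rule measurable_period_box) measurable
 have i: "integrable M (\<lambda>x. 1 + h x)"
  using h by (intro Bochner_Integration.integrable_add finite_measure.integrable_const finite_measure_M) auto
 have l: "AE x in M. (\<lambda>J. G (part z J x) * char \<alpha> m x) \<longlonglongrightarrow> G (synth_fun z x) * char \<alpha> m x"
  using lim by eventually_elim
   (intro tendsto_mult_right continuous_on_tendsto_compose[OF G(1)]; simp)
 have b: "AE x in M. norm (G (part z J x) * char \<alpha> m x) <= 1 + h x" for J
  using bd
 proof eventually_elim
  case (elim x)
  have "norm (G (part z J x) * char \<alpha> m x) <= 1 + cmod (part z J x) ^ 3" using G(2) by (simp add: norm_mult)
  also have "... <= 1 + h x" using elim by simp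
  finally show ?case .
 qed
 show "integrable M (\<lambda>x. G (synth_fun z x) * char \<alpha> m x)"
  "(\<lambda>J. integral\<^sup>L M (\<lambda>x. G (part z J x) * char \<alpha> m x)) \<longlonglongrightarrow> integral\<^sup>L M (\<lambda>x. G (synth_fun z x) * char \<alpha> m x)"
  by (rule integrable_dominated_convergence[OF m1 m2 i l b] integral_dominated_convergence[OF m1 m2 i l b])+
qed

end

lemma abs_L0_eqI: "ae_eq f g ==> abs_L0 f = abs_L0 g"
 by (rule Quotient_rel_abs[OF Quotient_L0])

lemma ae_eq_refl: "f \<in> borel_measurable borel ==> ae_eq f f"
 by (simp add: ae_eq_def)

section \<open>Functions with prescribed coefficients and their cubic term\<close>

context sobolev_torus
begin

definition synth :: "(int^'d => complex) => 'd L0" where "synth z = abs_L0 (synth_fun z)"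

lemma ae_synth: "ae_eq (synth_fun z) (synth_fun z)"
 by (rule ae_eq_refl) (rule measurable_synth_fun)

lemma part_AE_limit: "hs z ==> AE x in lborel. (\<lambda>J. part z J x) \<longlonglongrightarrow> synth_fun z x"
 by (erule dominated)

lemma part_add: "part (\<lambda>n. z n + c * z' n) J x = part z J x + c * part z' J x"
 by (simp add: part_def trig_def distrib_right sum.distrib sum_distrib_left mult.assoc)

lemma hs_add_scale:
 assumes "hs z" "hs z'"
 shows "hs (\<lambda>n. z n + c * z' n)"
proof -
 obtain B where B: "\<And>S. finite S ==> L2_set (\<lambda>n. japanese \<alpha> n powr s * cmod (z n)) S <= B" using assms(1) unfolding hs_def by blast
 obtain B' where B': "\<And>S. finite S ==> L2_set (\<lambda>n. japanese \<alpha> n powr s * cmod (z' n)) S <= B'" using assms(2) unfolding hs_def by blast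
 have "L2_set (\<lambda>n. japanese \<alpha> n powr s * cmod (z n + c * z' n)) S <= B + cmod c * B'" if S: "finite S" for S
 proof -
  have "L2_set (\<lambda>n. japanese \<alpha> n powr s * cmod (z n + c * z' n)) S <=
   L2_set (\<lambda>n. japanese \<alpha> n powr s * cmod (z n) + cmod c * (japanese \<alpha> n powr s * cmod (z' n))) S"
  proof (rule L2_set_mono)
   fix n
   have "japanese \<alpha> n powr s * cmod (z n + c * z' n) <= japanese \<alpha> n powr s * (cmod (z n) + cmod c * cmod (z' n))"
    by (intro mult_left_mono) (auto simp: norm_mult[symmetric] norm_triangle_ineq)
   then show "japanese \<alpha> n powr s * cmod (z n + c * z' n) <= japanese \<alpha> n powr s * cmod (z n) + cmod c * (japanese \<alpha> n powr s * cmod (z' n))"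
    by (simp add: algebra_simps)
  qed simp
  also have "... <= L2_set (\<lambda>n. japanese \<alpha> n powr s * cmod (z n)) S + L2_set (\<lambda>n. cmod c * (japanese \<alpha> n powr s * cmod (z' n))) S"
   by (rule L2_set_triangle_ineq)
  also have "... <= B + cmod c * B'"
   unfolding L2_set_mult_const[OF norm_ge_zero] by (intro add_mono mult_left_mono B B' S norm_ge_zero)
  finally show ?thesis .
 qed
 then show ?thesis unfolding hs_def by blast
qed

lemma synth_add_scale:
 assumes "hs z" "hs z'"
 shows "synth (\<lambda>n. z n + c * z' n) = synth z + scaleC c (synth z')"
proof -
 have sc: "ae_eq (\<lambda>x. c * synth_fun z' x) (\<lambda>x. c * synth_fun z' x)" by (rule ae_eq_refl) measurable
 have "synth z + scaleC c (synth z') = abs_L0 (\<lambda>x. synth_fun z x + c * synth_fun z' x)"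
  unfolding synth_def scaleC.abs_eq[OF ae_synth] by (rule plus_L0.abs_eq[OF ae_synth sc])
 also have "... = synth (\<lambda>n. z n + c * z' n)"
  unfolding synth_def
 proof (rule abs_L0_eqI, unfold ae_eq_def, intro conjI)
  show "AE x in lborel. synth_fun z x + c * synth_fun z' x = synth_fun (\<lambda>n. z n + c * z' n) x"
   using part_AE_limit[OF assms(1)] part_AE_limit[OF assms(2)] part_AE_limit[OF hs_add_scale[OF assms, of c]]
  proof eventually_elim
   case (elim x)
   have "(\<lambda>J. part (\<lambda>n. z n + c * z' n) J x) \<longlonglongrightarrow> synth_fun z x + c * synth_fun z' x"
    unfolding part_add by (intro tendsto_intros elim)
   then show ?case using elim(3) by (rule LIMSEQ_unique)
  qed
 qed measurable
 finally show ?thesis by simp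
qed

lemma hs_zero: "hs (\<lambda>_. 0)"
 unfolding hs_def by (intro exI[of _ 0]) (simp add: L2_set_def)

lemma synth_zero: "synth (\<lambda>_. 0) = 0"
proof -
 have "synth_fun (\<lambda>_. 0) = (\<lambda>_. 0)" by (simp add: fun_eq_iff synth_fun_def part_def trig_def)
 then show ?thesis unfolding synth_def zero_L0_def by simp
qed

lemma periodic_synth: "periodic \<alpha> (synth z)"
proof -
 have "lattice (axis j 1) = axis j (\<alpha> $ j)" for j
  by (simp add: lattice_def vec_eq_iff axis_def)
 then have "synth_fun z (x + axis j (\<alpha> $ j)) = synth_fun z x" for x j
  using synth_fun_shift[of z x "axis j 1"] by simp
 then show ?thesis unfolding synth_def periodic.abs_eq[OF ae_synth] by simp
qed

lemma char_0: "char \<alpha> 0 x = 1" by (simp add: char_def freq_0)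

lemma L2_synth: assumes "hs z" shows "torus_L2 \<alpha> (synth z)"
proof -
 have "integrable M (\<lambda>x. complex_of_real ((cmod (synth_fun z x))\<^sup>2) * char \<alpha> 0 x)"
  by (rule part_limit(1)[OF assms, of "\<lambda>u. complex_of_real ((cmod u)\<^sup>2)"]) (auto intro!: continuous_intros simp: norm_power le_1_plus_cube)
 then have "integrable M (\<lambda>x. norm (complex_of_real ((cmod (synth_fun z x))\<^sup>2) * char \<alpha> 0 x))" by (rule integrable_norm)
 then have "integrable M (\<lambda>x. (cmod (synth_fun z x))\<^sup>2)" by (simp add: norm_mult norm_power)
 then show ?thesis unfolding synth_def torus_L2.abs_eq[OF ae_synth] integrable_period_box(1) .
qed

lemma cubic_synth: "cubic (synth z) = abs_L0 (\<lambda>x. of_real ((cmod (synth_fun z x))\<^sup>2) * synth_fun z x)"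
 unfolding synth_def by (rule cubic.abs_eq[OF ae_synth])

lemma ae_cubic: "ae_eq (\<lambda>x. of_real ((cmod (synth_fun z x))\<^sup>2) * synth_fun z x) (\<lambda>x. of_real ((cmod (synth_fun z x))\<^sup>2) * synth_fun z x)"
 by (rule ae_eq_refl) measurable

lemma fourier_abs_L0:
 assumes "ae_eq f f"
 shows "fourier \<alpha> (abs_L0 f) m = integral\<^sup>L M (\<lambda>x. f x * char \<alpha> (- m) x) / of_real (vol \<alpha>)"
 unfolding fourier.abs_eq[OF assms] integrable_period_box(2) vol_def char_def freq_minus by simp

lemma fourier_synth:
 assumes z: "hs z"
 shows "fourier \<alpha> (synth z) m = z m"
proof -
 have "(\<lambda>J. integral\<^sup>L M (\<lambda>x. part z J x * char \<alpha> (- m) x)) \<longlonglongrightarrow> integral\<^sup>L M (\<lambda>x. synth_fun z x * char \<alpha> (- m) x)"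
  by (rule part_limit(2)[OF z, of "\<lambda>u. u"]) (use le_1_plus_cube[of _ 1] in auto)
 moreover have "(\<lambda>J. integral\<^sup>L M (\<lambda>x. part z J x * char \<alpha> (- m) x)) \<longlonglongrightarrow> of_real (vol \<alpha>) * z m"
  unfolding part_def integral_trig[OF finite_level_less]
  by (rule tendsto_eventually, rule eventually_sequentiallyI[of "Suc (level m)"]) auto
 ultimately have "integral\<^sup>L M (\<lambda>x. synth_fun z x * char \<alpha> (- m) x) = of_real (vol \<alpha>) * z m" by (rule LIMSEQ_unique)
 then show ?thesis unfolding synth_def fourier_abs_L0[OF ae_synth] using vol_pos by simp
qed

lemma cubic_growth:
 "continuous_on UNIV (\<lambda>u. of_real ((cmod u)\<^sup>2) * u)" "cmod (of_real ((cmod u)\<^sup>2) * u) <= 1 + cmod u ^ 3"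
 by (auto intro!: continuous_intros simp: norm_mult norm_power power2_eq_square power3_eq_cube)

lemma L1_cubic_synth: assumes "hs z" shows "torus_L1 \<alpha> (cubic (synth z))"
proof -
 have "integrable M (\<lambda>x. of_real ((cmod (synth_fun z x))\<^sup>2) * synth_fun z x * char \<alpha> 0 x)"
  by (rule part_limit(1)[OF assms cubic_growth])
 then show ?thesis unfolding cubic_synth torus_L1.abs_eq[OF ae_cubic] integrable_period_box(1)[symmetric] by (simp add: char_0)
qed

lemma conv3_limit:
 assumes z: "hs z"
 shows "(\<lambda>J. conv3 {n. level n < J} z m) \<longlonglongrightarrow> fourier \<alpha> (cubic (synth z)) m"
proof -
 have "(\<lambda>J. integral\<^sup>L M (\<lambda>x. of_real ((cmod (part z J x))\<^sup>2) * part z J x * char \<alpha> (- m) x) / of_real (vol \<alpha>)) \<longlonglongrightarrow>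
  integral\<^sup>L M (\<lambda>x. of_real ((cmod (synth_fun z x))\<^sup>2) * synth_fun z x * char \<alpha> (- m) x) / of_real (vol \<alpha>)"
  using vol_pos by (intro tendsto_divide tendsto_const part_limit(2)[OF z cubic_growth]) auto
 then show ?thesis
  unfolding part_def integral_trig_cubic[OF finite_level_less] cubic_synth fourier_abs_L0[OF ae_cubic] using vol_pos by simp
qed

lemma exhaust_triples: "filterlim (\<lambda>J. {n::int^'d. level n < J} \<times> {n::int^'d. level n < J} \<times> {n::int^'d. level n < J}) (finite_subsets_at_top UNIV) sequentially"
 unfolding filterlim_finite_subsets_at_top
proof (intro allI impI)
 fix X :: "((int^'d) \<times> (int^'d) \<times> (int^'d)) set" assume "finite X \<and> X \<subseteq> UNIV"
 then have X: "finite X" by simp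
 define N where "N = Max (insert 0 ((\<lambda>(n1, n2, n3). max (level n1) (max (level n2) (level n3))) ` X))"
 have N: "level n1 <= N \<and> level n2 <= N \<and> level n3 <= N" if "(n1, n2, n3) \<in> X" for n1 n2 n3
 proof -
  have "max (level n1) (max (level n2) (level n3)) <= N"
   unfolding N_def using X that by (intro Max_ge) (auto intro!: rev_image_eqI[of "(n1, n2, n3)"])
  then show ?thesis by simp
 qed
 show "\<forall>\<^sub>F J in sequentially. finite ({n::int^'d. level n < J} \<times> {n::int^'d. level n < J} \<times> {n::int^'d. level n < J}) \<and>
  X \<subseteq> {n. level n < J} \<times> {n. level n < J} \<times> {n. level n < J} \<and> {n::int^'d. level n < J} \<times> {n::int^'d. level n < J} \<times> {n::int^'d. level n < J} \<subseteq> UNIV"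
 proof (rule eventually_sequentiallyI[of "Suc N"], intro conjI finite_cartesian_product finite_level_less subset_UNIV)
  fix J assume J: "Suc N <= J"
  show "X \<subseteq> {n. level n < J} \<times> {n. level n < J} \<times> {n. level n < J}"
  proof
   fix \<theta> assume "\<theta> \<in> X"
   moreover obtain n1 n2 n3 where "\<theta> = (n1, n2, n3)" by (metis surj_pair)
   ultimately show "\<theta> \<in> {n. level n < J} \<times> {n. level n < J} \<times> {n. level n < J}"
    using N[of n1 n2 n3] J by simp
  qed
 qed
qed

text \<open>For nonnegative \<open>V\<close> the truncated convolutions are Fourier coefficients of
  cubic terms of partial sums. They converge, so they are bounded, and bounded sums of nonnegative
  terms over exhausting boxes give absolute summability.\<close>

lemma conv_summable_torus:
 assumes V: "\<And>n. V n >= (0::real)" and hsV: "hs (\<lambda>n. of_real (V n))"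
 shows "(\<lambda>\<theta>. if out \<theta> = m then (case \<theta> of (n1, n2, n3) => V n1 * V n2 * V n3) else 0) summable_on (UNIV :: ((int^'d) \<times> (int^'d) \<times> (int^'d)) set)"
proof (rule nonneg_bdd_above_summable_on)
 let ?f = "\<lambda>\<theta>. if out \<theta> = m then (case \<theta> of (n1, n2, n3) => V n1 * V n2 * V n3) else 0"
 let ?A = "\<lambda>J. {n::int^'d. level n < J}"
 show f0: "?f \<theta> >= 0" for \<theta> using V by (auto simp: split_beta)
 have "Bseq (\<lambda>J. conv3 (?A J) (\<lambda>n. of_real (V n)) m)"
  by (rule convergent_imp_Bseq, rule convergentI, rule conv3_limit[OF hsV])
 then obtain K where K: "\<And>J. cmod (conv3 (?A J) (\<lambda>n. of_real (V n)) m) <= K" unfolding Bseq_def by blast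
 have c: "conv3 A (\<lambda>n. of_real (V n)) m = of_real (\<Sum>\<theta>\<in>A\<times>A\<times>A. ?f \<theta>)" for A
  unfolding conv3_def of_real_sum by (rule sum.cong) (auto simp: split_beta)
 show "bdd_above (sum ?f ` {F. F \<subseteq> UNIV \<and> finite F})"
 proof (rule bdd_aboveI2)
  fix F :: "((int^'d) \<times> (int^'d) \<times> (int^'d)) set" assume "F \<in> {F. F \<subseteq> UNIV \<and> finite F}"
  then have F: "finite F" by simp
  from exhaust_triples[unfolded filterlim_finite_subsets_at_top, rule_format, of F] F
  obtain J where J: "F \<subseteq> ?A J \<times> ?A J \<times> ?A J" by (auto simp: eventually_sequentially)
  have "sum ?f F <= sum ?f (?A J \<times> ?A J \<times> ?A J)"
   by (rule sum_mono2[OF _ J]) (use f0 in \<open>auto simp: finite_level_less\<close>)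
  also have "... <= cmod (conv3 (?A J) (\<lambda>n. of_real (V n)) m)" unfolding c norm_of_real by (rule abs_ge_self)
  also have "... <= K" by (rule K)
  finally show "sum ?f F <= K" .
 qed
qed

text \<open>The convolutions over dyadic boxes converge to the Fourier coefficient by
  \<open>conv3_limit\<close>, and to the unordered sum because it converges absolutely.\<close>

lemma fourier_cubic_synth:
 assumes z: "hs z"
 shows "fourier \<alpha> (cubic (synth z)) m = (\<Sum>\<^sub>\<infinity>\<theta>. if out \<theta> = m then (case \<theta> of (n1, n2, n3) => z n1 * cnj (z n2) * z n3) else 0)"
proof -
 let ?f = "\<lambda>\<theta>. if out \<theta> = m then (case \<theta> of (n1, n2, n3) => z n1 * cnj (z n2) * z n3) else 0"
 have "hs (\<lambda>n. of_real (cmod (z n)))" using z unfolding hs_def by simp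
 from conv_summable_torus[OF norm_ge_zero this]
 have "(\<lambda>\<theta>. cmod (?f \<theta>)) summable_on UNIV"
  by (rule summable_on_cong[THEN iffD1, rotated]) (auto simp: norm_mult split_beta)
 then have s: "?f summable_on UNIV" by (rule abs_summable_summable)
 have "(\<lambda>J. conv3 {n. level n < J} z m) \<longlonglongrightarrow> infsum ?f UNIV"
  unfolding conv3_def by (rule filterlim_compose[OF infsum_tendsto[OF s] exhaust_triples])
 then show ?thesis using conv3_limit[OF z] by (rule LIMSEQ_unique[symmetric])
qed

end

section \<open>Local well-posedness\<close>

lemma inX_mono:
 fixes W W' :: "'a => real"
 assumes "inX W c" "\<And>n. 0 <= W' n" "\<And>n. W' n <= K * W n" "K >= 0"
 shows "inX W' c"
proof (rule nX_leI(2))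
 fix I :: "nat set" and S :: "'a set" assume fin: "finite I" "finite S"
 have "snorm W' I S c <= K * snorm W I S c"
  unfolding snorm_def sum_distrib_left
 proof (rule sum_mono)
  fix k
  have "L2_set (\<lambda>n. W' n * cmod (c k n)) S <= L2_set (\<lambda>n. K * (W n * cmod (c k n))) S"
   by (rule L2_set_mono) (use assms(2,3) in \<open>auto simp: mult.assoc[symmetric] intro!: mult_right_mono\<close>)
  then show "L2_set (\<lambda>n. W' n * cmod (c k n)) S <= K * L2_set (\<lambda>n. W n * cmod (c k n)) S"
   unfolding L2_set_mult_const[OF assms(4)] .
 qed
 also have "... <= K * nX W c" by (intro mult_left_mono snorm_le_nX assms fin)
 finally show "snorm W' I S c <= K * nX W c" .
qed

lemma japanese_pos: "japanese \<alpha> n > 0"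
 using sqf_nonneg[of \<alpha> n] by (simp add: japanese_def)

lemma sobolev_weight: "(1 + (norm (freq \<alpha> n))\<^sup>2) powr r * (cmod z)\<^sup>2 = (japanese \<alpha> n powr r * cmod z)\<^sup>2"
proof -
 have "(1 + (norm (freq \<alpha> n))\<^sup>2) = (japanese \<alpha> n)\<^sup>2" using sqf_nonneg[of \<alpha> n] by (simp add: japanese_def sqf_def)
 then have "(1 + (norm (freq \<alpha> n))\<^sup>2) powr r = (japanese \<alpha> n powr r)\<^sup>2"
  using japanese_pos[of \<alpha> n] by (simp add: power2_eq_square powr_mult)
 then show ?thesis by (simp add: power_mult_distrib)
qed

lemma L2_set_bounded:
 fixes f :: "'a => real"
 assumes "\<And>S. finite S ==> L2_set f S <= B"
 shows "(\<lambda>n. (f n)\<^sup>2) summable_on UNIV" "sqrt (\<Sum>\<^sub>\<infinity>n. (f n)\<^sup>2) <= B"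
proof -
 have B: "B >= 0" using assms[of "{}"] by simp
 have le: "(\<Sum>n\<in>S. (f n)\<^sup>2) <= B\<^sup>2" if "finite S" for S
  using assms[OF that] unfolding L2_set_def by (intro sqrt_le_D)
 show s: "(\<lambda>n. (f n)\<^sup>2) summable_on UNIV"
  by (rule nonneg_bdd_above_summable_on) (auto intro!: bdd_aboveI2 le)
 have "(\<Sum>\<^sub>\<infinity>n. (f n)\<^sup>2) <= B\<^sup>2" by (rule infsum_le_finite_sums[OF s le])
 then show "sqrt (\<Sum>\<^sub>\<infinity>n. (f n)\<^sup>2) <= B" using B by (simp add: real_le_lsqrt infsum_nonneg)
qed

lemma L2_set_le_infsum:
 fixes f :: "'a => real"
 assumes "(\<lambda>n. (f n)\<^sup>2) summable_on UNIV" "finite S"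
 shows "L2_set f S <= sqrt (\<Sum>\<^sub>\<infinity>n. (f n)\<^sup>2)"
 unfolding L2_set_def by (intro real_sqrt_le_mono finite_sum_le_infsum assms) auto

lemma scaleC_zero: "scaleC z 0 = 0"
 by transfer (simp add: ae_eq_def)

locale torus_nls = dispersive "sqf \<alpha>" "japanese \<alpha>" level C "real CARD('d)" \<sigma> s + sobolev_torus \<alpha> s
 for \<alpha> :: "real^'d::finite" and C \<sigma> s
begin

sublocale nls "sqf \<alpha>" "japanese \<alpha>" level C "real CARD('d)" \<sigma> s
proof
 fix V :: "int^'d => real" and n
 assume V: "\<And>n. V n >= 0" and B: "\<exists>B. \<forall>S. finite S \<longrightarrow> L2_set (\<lambda>n. japanese \<alpha> n powr s * V n) S <= B"
 show "(\<lambda>\<theta>. if out \<theta> = n then (case \<theta> of (n1, n2, n3) => V n1 * V n2 * V n3) else 0) summable_on UNIV"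
  by (rule conv_summable_torus[OF V]) (use B V in \<open>simp add: hs_def\<close>)
qed

abbreviation W1 :: "int^'d => real" where "W1 \<equiv> Wt (\<lambda>_. 1)"

lemma W1_eq: "W1 = (\<lambda>n. japanese \<alpha> n powr s)" by (simp add: Wt_def fun_eq_iff)

lemma hs_of_X1:
 assumes "X1 c" "\<And>n. cmod (z n) <= K * absum c n" "K >= 0"
 shows "hs z"
 unfolding hs_def
proof (intro exI allI impI)
 fix S :: "(int^'d) set" assume S: "finite S"
 have "L2_set (\<lambda>n. japanese \<alpha> n powr s * cmod (z n)) S <= L2_set (\<lambda>n. K * (W1 n * absum c n)) S"
 proof (rule L2_set_mono)
  fix n
  have "japanese \<alpha> n powr s * cmod (z n) <= japanese \<alpha> n powr s * (K * absum c n)" by (intro mult_left_mono assms) simp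
  then show "japanese \<alpha> n powr s * cmod (z n) <= K * (W1 n * absum c n)" by (simp add: W1_eq mult_ac)
 qed simp
 also have "... <= K * nX W1 c"
  unfolding L2_set_mult_const[OF assms(3)] by (intro mult_left_mono L2_set_absum_le assms W1_pos S)
 finally show "L2_set (\<lambda>n. japanese \<alpha> n powr s * cmod (z n)) S <= K * nX W1 c" .
qed

text \<open>The profile \<open>cval T c n t\<close> belongs to the solution pulled back by the free
  group; the phase returns to the solution itself.\<close>

definition coef :: "real => (nat => int^'d => complex) => real => int^'d => complex" where
 "coef T c t n = cis (- t * sqf \<alpha> n) * cval T c n t"

definition mk :: "real => (nat => int^'d => complex) => real => 'd L0" where
 "mk T c t = (if t \<in> {0..T} then synth (coef T c t) else 0)"

lemma norm_coef_le: "X1 c ==> cmod (coef T c t n) <= absum c n"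
 unfolding coef_def norm_mult norm_cis mult_1 by (erule norm_cseries_le_absum) (rule W1_pos)

lemma hs_coef: "X1 c ==> hs (coef T c t)"
 by (rule hs_of_X1[where K = 1]) (auto simp: norm_coef_le)

lemma coef_add_scale:
 assumes "X1 c" "X1 c'"
 shows "coef T (\<lambda>k n. c k n + z * c' k n) t n = coef T c t n + z * coef T c' t n"
proof -
 have "cseries T (\<lambda>k. c k n - (-z) * c' k n) t = cval T c n t - cseries T (\<lambda>k. (-z) * c' k n) t"
  by (rule cseries_diff[OF X1_summable[OF assms(1)] X1_summable[OF nX_scale_le(1)[OF assms(2)]]])
 then have "cseries T (\<lambda>k. c k n + z * c' k n) t = cval T c n t + z * cval T c' n t"
  unfolding cseries_scale by simp
 then show ?thesis unfolding coef_def by (simp add: algebra_simps)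
qed

lemma mk_add_scale:
 assumes "X1 c" "X1 c'"
 shows "mk T (\<lambda>k n. c k n + z * c' k n) = mk T c + (\<lambda>t. scaleC z (mk T c' t))"
proof
 fix t
 have "coef T (\<lambda>k n. c k n + z * c' k n) t = (\<lambda>n. coef T c t n + z * coef T c' t n)"
  by (rule ext) (rule coef_add_scale[OF assms])
 then show "mk T (\<lambda>k n. c k n + z * c' k n) t = (mk T c + (\<lambda>t. scaleC z (mk T c' t))) t"
  by (simp add: mk_def plus_fun_def synth_add_scale[OF hs_coef[OF assms(1)] hs_coef[OF assms(2)]] scaleC_zero)
qed

lemma X1_zero: "X1 (\<lambda>_ _. 0)" by (rule nX_zero)

lemma mk_zero: "mk T (\<lambda>_ _. 0) = 0"
proof -
 have e: "coef T (\<lambda>_ _. 0) t = (\<lambda>_. 0)" for t by (simp add: coef_def cseries_def fun_eq_iff)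
 show ?thesis unfolding mk_def zero_fun_def e synth_zero by simp
qed

lemma mk_scale: "X1 c ==> mk T (\<lambda>k n. z * c k n) = (\<lambda>t. scaleC z (mk T c t))"
 using mk_add_scale[OF X1_zero, of c T z] by (simp add: mk_zero)

lemma mk_add: "X1 c ==> X1 c' ==> mk T (\<lambda>k n. c k n + c' k n) = mk T c + mk T c'"
proof -
 assume c: "X1 c" "X1 c'"
 have "(\<lambda>t. scaleC 1 (mk T c' t)) = mk T (\<lambda>k n. 1 * c' k n)" by (rule mk_scale[OF c(2), symmetric])
 then have e: "(\<lambda>t. scaleC 1 (mk T c' t)) = mk T c'" by (simp only: mult_1)
 show ?thesis using mk_add_scale[OF c, of T 1] unfolding e mult_1 .
qed

lemma mk_diff: "X1 c ==> X1 c' ==> mk T (cdiff c c') = mk T c - mk T c'"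
proof -
 assume c: "X1 c" "X1 c'"
 have "mk T (\<lambda>k n. (c k n - c' k n) + c' k n) = mk T (cdiff c c') + mk T c'"
  by (rule mk_add[OF nX_diff(1)[OF c W1_nonneg] c(2)])
 then show ?thesis by (simp add: eq_diff_eq)
qed

lemma fourier_mk: "X1 c ==> t \<in> {0..T} ==> fourier \<alpha> (mk T c t) n = coef T c t n"
 by (simp add: mk_def fourier_synth[OF hs_coef])

lemma mk_inject:
 assumes T: "T > 0" and c: "X1 c" "X1 c'" and eq: "mk T c = mk T c'"
 shows "c = c'"
proof (rule ext, rule ext)
 fix k n
 have "(\<lambda>k. c k n) = (\<lambda>k. c' k n)"
 proof (rule cseries_inject[OF T X1_summable[OF c(1)] X1_summable[OF c(2)]])
  fix t assume t: "t \<in> {0..T}"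
  have "coef T c t n = coef T c' t n" using fourier_mk[OF c(1) t, of n] fourier_mk[OF c(2) t, of n] eq by simp
  then show "cval T c n t = cval T c' n t" unfolding coef_def by simp
 qed
 then show "c k n = c' k n" by (rule fun_cong)
qed

definition XT :: "real => (real => 'd L0) set" where "XT T = mk T ` {c. X1 c}"

text \<open>The norm transported along \<open>mk T\<close>; \<open>mk_inject\<close> makes the
  choice of \<open>c\<close> unique for \<open>T > 0\<close>.\<close>

definition NT :: "real => (real => 'd L0) => real" where "NT T u = nX W1 (SOME c. X1 c \<and> mk T c = u)"

lemma NT_mk:
 assumes "T > 0" "X1 c"
 shows "NT T (mk T c) = nX W1 c"
proof -
 have "X1 (SOME c'. X1 c' \<and> mk T c' = mk T c) \<and> mk T (SOME c'. X1 c' \<and> mk T c' = mk T c) = mk T c"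
  by (rule someI[where x = c]) (use assms in simp)
 then have "(SOME c'. X1 c' \<and> mk T c' = mk T c) = c" using mk_inject[OF assms(1) _ assms(2)] by blast
 then show ?thesis by (simp add: NT_def)
qed

lemma banach_XT:
 assumes T: "T > 0"
 shows "complex_banach_on (\<lambda>c u t. scaleC c (u t)) (XT T) (NT T)"
proof -
 note N = NT_mk[OF T]
 note W0 = W1_nonneg
 have 1: "0 \<in> XT T" using mk_zero[of T] nX_zero(1)[of W1] unfolding XT_def by (metis imageI mem_Collect_eq)
 have 2: "u + v \<in> XT T" if "u \<in> XT T" "v \<in> XT T" for u v
  using that unfolding XT_def by (auto simp: mk_add[symmetric] intro!: imageI nX_add(1) W0)
 have 3: "(\<lambda>t. scaleC z (u t)) \<in> XT T" if "u \<in> XT T" for z u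
  using that unfolding XT_def by (auto simp: mk_scale[symmetric] intro!: imageI nX_scale_le(1))
 have 4: "0 <= NT T u" if "u \<in> XT T" for u using that N by (auto simp: XT_def nX_nonneg)
 have 5: "NT T u = 0 \<longleftrightarrow> u = 0" if u: "u \<in> XT T" for u
 proof -
  obtain c where c: "X1 c" "u = mk T c" using u by (auto simp: XT_def)
  show ?thesis
  proof
   assume "NT T u = 0"
   then have "nX W1 c = 0" using N[OF c(1)] c(2) by simp
   then have "c = (\<lambda>_ _. 0)" by (rule nX_eq_0[OF c(1) W1_pos])
   then show "u = 0" using c(2) mk_zero by simp
  next
   assume "u = 0"
   then show "NT T u = 0" using N[OF X1_zero] nX_zero(2)[of W1] mk_zero[of T] by simp
  qed
 qed
 have 6: "NT T (\<lambda>t. scaleC z (u t)) = cmod z * NT T u" if "u \<in> XT T" for z u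
  using that unfolding XT_def by (auto simp: mk_scale[symmetric] N nX_scale_le(1) nX_scale)
 have 7: "NT T (u + v) <= NT T u + NT T v" if "u \<in> XT T" "v \<in> XT T" for u v
  using that unfolding XT_def by (auto simp: mk_add[symmetric] N nX_add(1)[OF _ _ W0] nX_add(2)[OF _ _ W0])
 have 8: "\<exists>u\<in>XT T. (\<lambda>k. NT T (f k - u)) \<longlonglongrightarrow> 0"
  if f: "\<And>k. f k \<in> XT T" and cauchy: "\<And>e. e > 0 ==> \<exists>N. \<forall>k\<ge>N. \<forall>l\<ge>N. NT T (f k - f l) < e" for f :: "nat => real => 'd L0"
 proof -
  have "\<exists>c. X1 c \<and> f k = mk T c" for k using f[of k] by (auto simp: XT_def)
  then obtain g where g: "\<And>k. X1 (g k)" "\<And>k. f k = mk T (g k)" by metis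
  have d: "NT T (f k - mk T u) = nX W1 (\<lambda>i n. g k i n - u i n)" if "X1 u" for k u
   unfolding g(2) mk_diff[OF g(1) that, symmetric] by (rule N[OF nX_diff(1)[OF g(1) that W0]])
  have cc: "\<exists>N. \<forall>k\<ge>N. \<forall>l\<ge>N. nX W1 (\<lambda>i n. g k i n - g l i n) < e" if "e > 0" for e
   using cauchy[OF that] unfolding g(2)[of l for l] d[OF g(1), unfolded g(2)] .
  obtain u where u: "X1 u" "(\<lambda>k. nX W1 (\<lambda>i n. g k i n - u i n)) \<longlonglongrightarrow> 0"
   by (rule nX_complete[of W1 g, OF W1_pos g(1) cc]) (assumption, blast)
  show ?thesis by (rule bexI[of _ "mk T u"]) (use u d[OF u(1)] in \<open>auto simp: XT_def\<close>)
 qed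
 show ?thesis unfolding complex_banach_on_def
  by (intro conjI allI ballI impI 1 2 3 4 5 6 7 8) auto
qed

text \<open>Convergence of the synthesis uses the exponent \<open>s\<close>, while the norm may be
  measured in any exponent \<open>r\<close>; it is applied with \<open>r = s\<close> and with the
  higher regularity.\<close>

lemma sobolev_synth_bound:
 assumes c: "X1 c" and r: "inX (\<lambda>n. japanese \<alpha> n powr r) c"
  and z: "\<And>n. cmod (z n) <= K * absum c n" and K: "K >= 0"
 shows "synth z \<in> sobolev \<alpha> r" "sobolev_norm \<alpha> r (synth z) <= K * nX (\<lambda>n. japanese \<alpha> n powr r) c"
proof -
 let ?W = "\<lambda>n. japanese \<alpha> n powr r"
 have hz: "hs z" by (rule hs_of_X1[OF c z K])
 have W: "?W n > 0" for n using japanese_pos[of \<alpha> n] by simp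
 have b: "L2_set (\<lambda>n. ?W n * cmod (z n)) S <= K * nX ?W c" if S: "finite S" for S
 proof -
  have "L2_set (\<lambda>n. ?W n * cmod (z n)) S <= L2_set (\<lambda>n. K * (?W n * absum c n)) S"
  proof (rule L2_set_mono)
   fix n
   have "?W n * cmod (z n) <= ?W n * (K * absum c n)" by (intro mult_left_mono z) simp
   then show "?W n * cmod (z n) <= K * (?W n * absum c n)" by (simp add: mult_ac)
  qed simp
  also have "... <= K * nX ?W c"
   unfolding L2_set_mult_const[OF K] by (intro mult_left_mono L2_set_absum_le r W S K)
  finally show ?thesis .
 qed
 show "synth z \<in> sobolev \<alpha> r"
  unfolding sobolev_def mem_Collect_eq fourier_synth[OF hz] sobolev_weight
  by (intro conjI periodic_synth L2_synth[OF hz] L2_set_bounded(1)[OF b])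
 show "sobolev_norm \<alpha> r (synth z) <= K * nX ?W c"
  unfolding sobolev_norm_def fourier_synth[OF hz] sobolev_weight by (rule L2_set_bounded(2)[OF b])
qed

text \<open>Each coefficient is continuous in time and dominated by \<open>absum c\<close>,
  uniformly in time. The weighted squares of \<open>absum c\<close> are summable, so the squared
  norm of the difference is a uniform limit of continuous functions.\<close>

lemma mk_C0:
 assumes c: "X1 c" and r: "inX (\<lambda>n. japanese \<alpha> n powr r) c"
 shows "mk T c \<in> C0_sobolev \<alpha> r T"
 unfolding C0_sobolev_def mem_Collect_eq
proof (intro conjI ballI allI impI)
 let ?W = "\<lambda>n. japanese \<alpha> n powr r"
 have W: "?W n > 0" for n using japanese_pos[of \<alpha> n] by simp
 show "mk T c t \<in> sobolev \<alpha> r" if "t \<in> {0..T}" for t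
  using that sobolev_synth_bound(1)[OF c r, of "coef T c t" 1] norm_coef_le[OF c] by (simp add: mk_def)
 show "mk T c t = 0" if "t \<notin> {0..T}" for t unfolding mk_def if_not_P[OF that] ..
 fix t assume t: "t \<in> {0..T}"
 define F where "F q = (\<Sum>\<^sub>\<infinity>n. (?W n * cmod (coef T c q n + (-1) * coef T c t n))\<^sup>2)" for q
 have hd: "hs (\<lambda>n. coef T c q n + (-1) * coef T c t n)" for q by (rule hs_add_scale[OF hs_coef[OF c] hs_coef[OF c]])
 have norm_eq: "sobolev_norm \<alpha> r (mk T c q - mk T c t) = sqrt (F q)" if "q \<in> {0..T}" for q
 proof -
  have m1: "scaleC (-1) y = - y" for y :: "'d L0" by transfer (auto simp: ae_eq_def)
  have "mk T c q - mk T c t = synth (\<lambda>n. coef T c q n + (-1) * coef T c t n)"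
   using that t unfolding synth_add_scale[OF hs_coef[OF c] hs_coef[OF c]] m1 by (simp add: mk_def)
  then show ?thesis unfolding sobolev_norm_def F_def by (simp only: fourier_synth[OF hd] sobolev_weight)
 qed
 have "continuous_on {0..T} F"
 proof (rule uniform_limit_theorem)
  have bd: "L2_set (\<lambda>n. 2 * (?W n * absum c n)) S <= 2 * nX ?W c" if "finite S" for S
   using L2_set_absum_le[OF r W that] by (simp add: L2_set_mult_const)
  show "uniform_limit {0..T} (\<lambda>S q. \<Sum>n\<in>S. (?W n * cmod (coef T c q n + (-1) * coef T c t n))\<^sup>2) F (finite_subsets_at_top UNIV)"
   unfolding F_def
  proof (rule Weierstrass_m_test_general[OF _ L2_set_bounded(1)[OF bd]])
   fix n q
   have "cmod (coef T c q n + (-1) * coef T c t n) <= cmod (coef T c q n) + cmod ((-1) * coef T c t n)" by (rule norm_triangle_ineq)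
   also have "... <= 2 * absum c n" using norm_coef_le[OF c, of T q n] norm_coef_le[OF c, of T t n] by simp
   finally have "?W n * cmod (coef T c q n + (-1) * coef T c t n) <= ?W n * (2 * absum c n)" using W[of n] by (intro mult_left_mono) auto
   then have "(?W n * cmod (coef T c q n + (-1) * coef T c t n))\<^sup>2 <= (2 * (?W n * absum c n))\<^sup>2" by (intro power_mono) (simp_all add: mult_ac)
   then show "norm ((?W n * cmod (coef T c q n + (-1) * coef T c t n))\<^sup>2) <= (2 * (?W n * absum c n))\<^sup>2" by simp
  qed
  have "continuous_on {0..T} (\<lambda>q. coef T c q n)" for n
   unfolding coef_def cis_conv_exp by (intro continuous_intros continuous_cseries X1_summable c)
  then show "\<forall>\<^sub>F S in finite_subsets_at_top UNIV. continuous_on {0..T} (\<lambda>q. \<Sum>n\<in>S. (?W n * cmod (coef T c q n + (-1) * coef T c t n))\<^sup>2)"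
   by (intro always_eventually allI continuous_intros)
 qed simp
 then have "(F \<longlongrightarrow> F t) (at t within {0..T})" using t by (simp add: continuous_on)
 moreover have "F t = 0" unfolding F_def by simp
 ultimately have "((\<lambda>q. sqrt (F q)) \<longlongrightarrow> sqrt 0) (at t within {0..T})" by (intro tendsto_real_sqrt) simp
 then have lim: "((\<lambda>q. sqrt (F q)) \<longlongrightarrow> 0) (at t within {0..T})" by simp
 have "\<forall>\<^sub>F q in at t within {0..T}. sqrt (F q) = sobolev_norm \<alpha> r (mk T c q - mk T c t)"
  unfolding eventually_at_filter by (rule always_eventually) (simp add: norm_eq)
 from Lim_transform_eventually[OF lim this]
 show "((\<lambda>q. sobolev_norm \<alpha> r (mk T c q - mk T c t)) \<longlongrightarrow> 0) (at t within {0..T})" .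
qed

lemma mk_norm_le:
 assumes "X1 c" "t \<in> {0..T}"
 shows "sobolev_norm \<alpha> s (mk T c t) <= nX W1 c"
 using sobolev_synth_bound(2)[OF assms(1) assms(1)[unfolded W1_eq], of "coef T c t" 1] norm_coef_le[OF assms(1)] assms(2)
 by (simp add: mk_def W1_eq)

end

lemma schrodinger_group_sqf: "schrodinger_group \<alpha> t a n = cis (- t * sqf \<alpha> n) * a n"
 by (simp add: schrodinger_group_def sqf_def)

section \<open>Duhamel's formula and the choice of the existence time\<close>

context torus_nls
begin

text \<open>On triples with output \<open>n\<close> the three free phases combine to the free phase
  of \<open>n\<close> times the oscillation of the resonance.\<close>

lemma fourier_cubic_mk:
 assumes c: "X1 c" and t: "t \<in> {0..T}"
 shows "fourier \<alpha> (cubic (mk T c t)) n = cis (- t * sqf \<alpha> n) * nonlin (sqf \<alpha>) T c c c n t"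
proof -
 have "fourier \<alpha> (cubic (mk T c t)) n =
  (\<Sum>\<^sub>\<infinity>\<theta>. if out \<theta> = n then (case \<theta> of (n1, n2, n3) => coef T c t n1 * cnj (coef T c t n2) * coef T c t n3) else 0)"
  using t by (simp add: mk_def fourier_cubic_synth[OF hs_coef[OF c]])
 also have "... = (\<Sum>\<^sub>\<infinity>\<theta>. cis (- t * sqf \<alpha> n) * (if out \<theta> = n then cis (res (sqf \<alpha>) \<theta> * t) *
  (case \<theta> of (n1, n2, n3) => cval T c n1 t * cnj (cval T c n2 t) * cval T c n3 t) else 0))"
 proof (rule infsum_cong)
  fix \<theta> :: "(int^'d) \<times> (int^'d) \<times> (int^'d)"
  obtain n1 n2 n3 where th: "\<theta> = (n1, n2, n3)" by (metis surj_pair)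
  let ?A = "\<lambda>n. cval T c n t"
  show "(if out \<theta> = n then (case \<theta> of (n1, n2, n3) => coef T c t n1 * cnj (coef T c t n2) * coef T c t n3) else 0) =
   cis (- t * sqf \<alpha> n) * (if out \<theta> = n then cis (res (sqf \<alpha>) \<theta> * t) *
   (case \<theta> of (n1, n2, n3) => ?A n1 * cnj (?A n2) * ?A n3) else 0)"
  proof (cases "out \<theta> = n")
   case True
   have n: "n = n1 - n2 + n3" using True by (simp add: th out_def)
   have "coef T c t n1 * cnj (coef T c t n2) * coef T c t n3 =
    (cis (- t * sqf \<alpha> n1) * (cis (t * sqf \<alpha> n2) * cis (- t * sqf \<alpha> n3))) * (?A n1 * cnj (?A n2) * ?A n3)"
    unfolding coef_def complex_cnj_mult cis_cnj by (simp add: mult_ac)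
   also have "cis (- t * sqf \<alpha> n1) * (cis (t * sqf \<alpha> n2) * cis (- t * sqf \<alpha> n3)) = cis (- t * sqf \<alpha> n) * cis (res (sqf \<alpha>) \<theta> * t)"
    unfolding cis_mult n th res_def prod.case by (rule arg_cong[where f = cis]) (simp add: algebra_simps)
   finally show ?thesis unfolding if_P[OF True] by (simp only: th prod.case mult.assoc)
  qed simp
 qed
 also have "... = cis (- t * sqf \<alpha> n) * nonlin (sqf \<alpha>) T c c c n t"
  unfolding nonlin_eq[OF c c c] infsum_cmult_right' ..
 finally show ?thesis .
qed

text \<open>Up to the nonvanishing factor \<open>cis (- t * sqf \<alpha> n)\<close>, Duhamel's
  formula is the equation of \<open>fixp_iff\<close>; the integrability clauses follow from the
  continuity of \<open>nonlin\<close>.\<close>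

lemma duhamel_iff_fixp:
 assumes T: "0 < T" "T <= 1" and c: "X1 c" and a: "X1 (iota (fourier \<alpha> u0))"
 shows "duhamel_solution \<alpha> T u0 (mk T c) \<longleftrightarrow> fixp T (fourier \<alpha> u0) c"
proof -
 let ?a = "fourier \<alpha> u0"
 let ?N = "nonlin (sqf \<alpha>) T c c c"
 have L1: "torus_L1 \<alpha> (cubic (mk T c \<tau>))" if "\<tau> \<in> {0..T}" for \<tau>
  using that L1_cubic_synth[OF hs_coef[OF c]] by (simp add: mk_def)
 have E: "schrodinger_group \<alpha> (t - \<tau>) (fourier \<alpha> (cubic (mk T c \<tau>))) n = cis (- t * sqf \<alpha> n) * ?N n \<tau>"
  if "t \<in> {0..T}" "\<tau> \<in> {0..t}" for t \<tau> n
 proof -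
  have ph: "cis (- (t - \<tau>) * sqf \<alpha> n) * cis (- \<tau> * sqf \<alpha> n) = cis (- t * sqf \<alpha> n)"
   unfolding cis_mult by (rule arg_cong[where f = cis]) (simp add: algebra_simps)
  have "\<tau> \<in> {0..T}" using that by auto
  then show ?thesis unfolding schrodinger_group_sqf fourier_cubic_mk[OF c] mult.assoc[symmetric]
   by (simp only: fourier_cubic_mk[OF c] mult.assoc[symmetric] ph)
 qed
 have si: "set_integrable lborel {0..t} (\<lambda>\<tau>. schrodinger_group \<alpha> (t - \<tau>) (fourier \<alpha> (cubic (mk T c \<tau>))) n)"
  and I: "(LINT \<tau>:{0..t}|lborel. schrodinger_group \<alpha> (t - \<tau>) (fourier \<alpha> (cubic (mk T c \<tau>))) n) =
   cis (- t * sqf \<alpha> n) * integral {0..t} (?N n)" if t: "t \<in> {0..T}" for t n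
 proof -
  have "continuous_on {0..t} (\<lambda>\<tau>. cis (- t * sqf \<alpha> n) * ?N n \<tau>)" by (intro continuous_intros continuous_nonlin c)
  then have i: "set_integrable lborel {0..t} (\<lambda>\<tau>. cis (- t * sqf \<alpha> n) * ?N n \<tau>)" by (rule borel_integrable_atLeastAtMost')
  show "set_integrable lborel {0..t} (\<lambda>\<tau>. schrodinger_group \<alpha> (t - \<tau>) (fourier \<alpha> (cubic (mk T c \<tau>))) n)"
   by (rule set_integrable_cong[THEN iffD1, OF refl refl _ i]) (rule E[OF t, symmetric])
  have "(LINT \<tau>:{0..t}|lborel. schrodinger_group \<alpha> (t - \<tau>) (fourier \<alpha> (cubic (mk T c \<tau>))) n) =
   (LINT \<tau>:{0..t}|lborel. cis (- t * sqf \<alpha> n) * ?N n \<tau>)"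
   by (rule set_lebesgue_integral_cong) (auto simp: E[OF t])
  also have "... = integral {0..t} (\<lambda>\<tau>. cis (- t * sqf \<alpha> n) * ?N n \<tau>)" by (rule set_borel_integral_eq_integral(2)[OF i])
  finally show "(LINT \<tau>:{0..t}|lborel. schrodinger_group \<alpha> (t - \<tau>) (fourier \<alpha> (cubic (mk T c \<tau>))) n) =
   cis (- t * sqf \<alpha> n) * integral {0..t} (?N n)" by simp
 qed
 have eq: "fourier \<alpha> (mk T c t) n = schrodinger_group \<alpha> t ?a n - \<i> * (LINT \<tau>:{0..t}|lborel. schrodinger_group \<alpha> (t - \<tau>) (fourier \<alpha> (cubic (mk T c \<tau>))) n)
  \<longleftrightarrow> cval T c n t = ?a n - \<i> * integral {0..t} (?N n)" if t: "t \<in> {0..T}" for t n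
 proof -
  have "cis (- t * sqf \<alpha> n) * ?a n - \<i> * (cis (- t * sqf \<alpha> n) * integral {0..t} (?N n)) = cis (- t * sqf \<alpha> n) * (?a n - \<i> * integral {0..t} (?N n))"
   by (simp add: algebra_simps)
  then show ?thesis unfolding fourier_mk[OF c t] coef_def I[OF t] unfolding schrodinger_group_sqf by simp
 qed
 show ?thesis unfolding duhamel_solution_def fixp_iff[OF T c a] using L1 si eq by simp
qed

lemma iota_sobolev:
 assumes "(\<lambda>n. (japanese \<alpha> n powr s * cmod (a n))\<^sup>2) summable_on UNIV"
 shows "X1 (iota a)" "nX W1 (iota a) <= sqrt (\<Sum>\<^sub>\<infinity>n. (japanese \<alpha> n powr s * cmod (a n))\<^sup>2)"
proof -
 have "0 <= sqrt (\<Sum>\<^sub>\<infinity>n. (japanese \<alpha> n powr s * cmod (a n))\<^sup>2)" by (simp add: infsum_nonneg)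
 from iota_inX[OF this, of W1 a] L2_set_le_infsum[OF assms]
 show "X1 (iota a)" "nX W1 (iota a) <= sqrt (\<Sum>\<^sub>\<infinity>n. (japanese \<alpha> n powr s * cmod (a n))\<^sup>2)" unfolding W1_eq by blast+
qed

lemma sobolev_summable:
 assumes "u0 \<in> sobolev \<alpha> r"
 shows "(\<lambda>n. (japanese \<alpha> n powr r * cmod (fourier \<alpha> u0 n))\<^sup>2) summable_on UNIV"
 using assms unfolding sobolev_def sobolev_weight by blast

lemma sobolev_norm_eq: "sobolev_norm \<alpha> r u0 = sqrt (\<Sum>\<^sub>\<infinity>n. (japanese \<alpha> n powr r * cmod (fourier \<alpha> u0 n))\<^sup>2)"
 unfolding sobolev_norm_def sobolev_weight ..

lemma fourier_diff:
 assumes "torus_L2 \<alpha> f" "torus_L2 \<alpha> g"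
 shows "fourier \<alpha> (f - g) n = fourier \<alpha> f n - fourier \<alpha> g n"
proof -
 obtain F where F: "ae_eq F F" "f = abs_L0 F" by (rule L0.abs_induct[of "\<lambda>f. \<exists>F. ae_eq F F \<and> f = abs_L0 F" f, THEN exE]) auto
 obtain G where G: "ae_eq G G" "g = abs_L0 G" by (rule L0.abs_induct[of "\<lambda>f. \<exists>F. ae_eq F F \<and> f = abs_L0 F" g, THEN exE]) auto
 have int: "integrable M (\<lambda>x. H x * char \<alpha> m x)" if H: "ae_eq H H" and L2: "torus_L2 \<alpha> (abs_L0 H)" for H m
 proof -
  have m: "H \<in> borel_measurable borel" using H by (simp add: ae_eq_def)
  have i: "integrable M (\<lambda>x. 1 + (cmod (H x))\<^sup>2)"
   using L2 unfolding torus_L2.abs_eq[OF H] integrable_period_box(1)[symmetric]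
   by (intro Bochner_Integration.integrable_add finite_measure.integrable_const finite_measure_M)
  show ?thesis
  proof (rule Bochner_Integration.integrable_bound[OF i])
   show "(\<lambda>x. H x * char \<alpha> m x) \<in> borel_measurable M" by (rule measurable_period_box) (use m in measurable)
   have "t <= 1 + t\<^sup>2" for t :: real
    using zero_le_power2[of "t - 1/2"] by (simp add: power2_eq_square algebra_simps)
   then show "AE x in M. norm (H x * char \<alpha> m x) <= norm (1 + (cmod (H x))\<^sup>2)" by (simp add: norm_mult)
  qed
 qed
 have d: "ae_eq (\<lambda>x. F x - G x) (\<lambda>x. F x - G x)" using F(1) G(1) by (simp add: ae_eq_def)
 have fg: "f - g = abs_L0 (\<lambda>x. F x - G x)" unfolding F(2) G(2) by (rule minus_L0.abs_eq[OF F(1) G(1)])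
 show ?thesis
  unfolding fg unfolding F(2) G(2) fourier_abs_L0[OF F(1)] fourier_abs_L0[OF G(1)] fourier_abs_L0[OF d] left_diff_distrib
  by (subst Bochner_Integration.integral_diff) (use int F G assms in \<open>auto simp: diff_divide_distrib\<close>)
qed

text \<open>The factor \<open>1 + norm (freq \<alpha> n) * h\<close> has the advantage of being
  submultiplicative with constant 1: \<open>1 + (p + q + r)\<close> is part of the expanded
  product.\<close>

lemma good_weight_sobolev:
 assumes h: "h >= 0" and m: "m >= 0"
 shows "good_weight (\<lambda>n. (1 + norm (freq \<alpha> n) * h) powr m)"
 unfolding good_weight_def
proof (intro conjI allI)
 fix n1 n2 n3
 let ?x = "\<lambda>n. 1 + norm (freq \<alpha> n) * h"
 show "1 <= ?x n1 powr m" using h m by (intro ge_one_powr_ge_zero) auto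
 have "norm (freq \<alpha> (n1 - n2 + n3)) <= norm (freq \<alpha> n1) + norm (freq \<alpha> n2) + norm (freq \<alpha> n3)"
  unfolding freq_add freq_diff by (rule order_trans[OF norm_triangle_ineq add_right_mono[OF norm_triangle_ineq4]])
 from mult_right_mono[OF this h]
 have le: "?x (n1 - n2 + n3) <= 1 + (norm (freq \<alpha> n1) * h + norm (freq \<alpha> n2) * h + norm (freq \<alpha> n3) * h)"
  by (simp only: distrib_right add_left_mono)
 have prod: "1 + (p + q + r) <= (1 + p) * (1 + q) * (1 + r)" if "p >= 0" "q >= 0" "r >= 0" for p q r :: real
 proof -
  have "(1 + p) * (1 + q) * (1 + r) = 1 + (p + q + r) + (p * q + p * r + q * r + p * q * r)" by (simp add: algebra_simps)
  moreover have "p * q + p * r + q * r + p * q * r >= 0" using that by simp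
  ultimately show ?thesis by linarith
 qed
 have "?x (n1 - n2 + n3) <= ?x n1 * ?x n2 * ?x n3" by (rule order_trans[OF le prod]) (use h in auto)
 then have "?x (n1 - n2 + n3) powr m <= (?x n1 * ?x n2 * ?x n3) powr m" using h m by (intro powr_mono2) auto
 also have "... = ?x n1 powr m * ?x n2 powr m * ?x n3 powr m" using h by (simp add: powr_mult)
 finally show "?x (n1 - n2 + n3) powr m <= ?x n1 powr m * ?x n2 powr m * ?x n3 powr m" .
qed

text \<open>As \<open>h \<rightarrow> 0\<close> the norm with weight \<open>(1 + h |\<xi>|)\<^bsup>m\<^esup>\<close> tends to the \<open>H\<^sup>s\<close> norm, so the
 existence time for a small \<open>h\<close> depends on the \<open>H\<^sup>s\<close> norm only.\<close>

lemma small_weight: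
 assumes a: "(\<lambda>n. (japanese \<alpha> n powr s * cmod (a n))\<^sup>2) summable_on UNIV" "sqrt (\<Sum>\<^sub>\<infinity>n. (japanese \<alpha> n powr s * cmod (a n))\<^sup>2) <= R"
  and R: "R > 0" and m: "m >= 0" and a': "(\<lambda>n. (japanese \<alpha> n powr (s + m) * cmod (a n))\<^sup>2) summable_on UNIV"
 obtains h where "0 < h" "h <= 1"
  "\<And>S. finite S ==> L2_set (\<lambda>n. Wt (\<lambda>n. (1 + norm (freq \<alpha> n) * h) powr m) n * cmod (a n)) S <= 2 * R"
proof -
 define f where "f h n = (japanese \<alpha> n powr s * (1 + norm (freq \<alpha> n) * h) powr m * cmod (a n))\<^sup>2" for h n
 have one_le: "1 + norm (freq \<alpha> n) * h <= 2 * japanese \<alpha> n" if "0 <= h" "h <= 1" for h n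
 proof -
  have "norm (freq \<alpha> n) * h <= norm (freq \<alpha> n)" using that by (intro mult_left_le) auto
  then show ?thesis using norm_freq_le_japanese[of \<alpha> n] jb_ge_1[of n] by linarith
 qed
 have dom: "f h n <= (2 powr m)\<^sup>2 * (japanese \<alpha> n powr (s + m) * cmod (a n))\<^sup>2" if h: "0 <= h" "h <= 1" for h n
 proof -
  have "(1 + norm (freq \<alpha> n) * h) powr m <= (2 * japanese \<alpha> n) powr m" using h m by (intro powr_mono2 one_le) auto
  also have "... = 2 powr m * japanese \<alpha> n powr m" using japanese_pos[of \<alpha> n] by (simp add: powr_mult)
  finally have "japanese \<alpha> n powr s * (1 + norm (freq \<alpha> n) * h) powr m * cmod (a n) <= japanese \<alpha> n powr s * (2 powr m * japanese \<alpha> n powr m) * cmod (a n)"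
   by (intro mult_right_mono mult_left_mono) auto
  also have "... = 2 powr m * (japanese \<alpha> n powr (s + m) * cmod (a n))" by (simp add: powr_add)
  finally show ?thesis unfolding f_def power_mult_distrib[symmetric] by (intro power_mono) auto
 qed
 have sd: "(\<lambda>n. (2 powr m)\<^sup>2 * (japanese \<alpha> n powr (s + m) * cmod (a n))\<^sup>2) summable_on UNIV"
  by (rule summable_on_cmult_right[OF a'])
 have f0: "f h n >= 0" for h n by (simp add: f_def)
 \<comment> \<open>Continuity in \<open>h\<close> by the Weierstrass test, with the summable
   majorant supplied by the higher regularity of the data. At \<open>h = 0\<close> the weight
   \<open>w\<close> is 1.\<close>
 have "continuous_on {0..1} (\<lambda>h. \<Sum>\<^sub>\<infinity>n. f h n)"
 proof (rule uniform_limit_theorem)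
  show "uniform_limit {0..1} (\<lambda>S h. \<Sum>n\<in>S. f h n) (\<lambda>h. \<Sum>\<^sub>\<infinity>n. f h n) (finite_subsets_at_top UNIV)"
   by (rule Weierstrass_m_test_general[OF _ sd]) (use dom f0 in auto)
  have nz: "1 + norm (freq \<alpha> n) * h \<noteq> 0" if "h \<in> {0..1}" for h n
  proof -
   have "norm (freq \<alpha> n) * h >= 0" using that by simp
   then show ?thesis by linarith
  qed
  have "continuous_on {0..1} (\<lambda>h. f h n)" for n
   unfolding f_def by (intro continuous_intros ballI nz)
  then show "\<forall>\<^sub>F S in finite_subsets_at_top UNIV. continuous_on {0..1} (\<lambda>h. \<Sum>n\<in>S. f h n)"
   by (intro always_eventually allI continuous_on_sum)
 qed simp
 then have lim: "((\<lambda>h. \<Sum>\<^sub>\<infinity>n. f h n) \<longlongrightarrow> (\<Sum>\<^sub>\<infinity>n. f 0 n)) (at 0 within {0..1})" by (simp add: continuous_on)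
 have "(\<Sum>\<^sub>\<infinity>n. f 0 n) <= R\<^sup>2"
 proof -
  have "(\<Sum>\<^sub>\<infinity>n. f 0 n) = (\<Sum>\<^sub>\<infinity>n. (japanese \<alpha> n powr s * cmod (a n))\<^sup>2)" by (simp add: f_def)
  then show ?thesis using a(2) by (simp add: sqrt_le_D)
 qed
 also have "R\<^sup>2 < (2 * R)\<^sup>2" using R by (simp add: power_mult_distrib)
 finally have "(\<Sum>\<^sub>\<infinity>n. f 0 n) < (2 * R)\<^sup>2" .
 from order_tendstoD(2)[OF lim this]
 have ev: "\<forall>\<^sub>F h in at 0 within {0..1}. (\<Sum>\<^sub>\<infinity>n. f h n) < (2 * R)\<^sup>2" .
 have nb: "at (0::real) within {0..1} \<noteq> bot" by (simp add: at_within_Icc_at_right)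
 have "\<forall>\<^sub>F h in at (0::real) within {0..1}. h \<in> {0..1} \<and> h \<noteq> 0" by (simp add: eventually_at_filter)
 from eventually_happens'[OF nb eventually_conj[OF ev this]]
 obtain h where "(\<Sum>\<^sub>\<infinity>n. f h n) < (2 * R)\<^sup>2" "h \<in> {0..1}" "h \<noteq> 0" by blast
 then have h: "0 < h" "h <= 1" "(\<Sum>\<^sub>\<infinity>n. f h n) < (2 * R)\<^sup>2" by simp_all
 show ?thesis
 proof (rule that[OF h(1,2)])
  fix S :: "(int^'d) set" assume S: "finite S"
  have s: "(\<lambda>n. f h n) summable_on UNIV" by (rule summable_on_comparison_test[OF sd]) (use dom h f0 in auto)
  have "(L2_set (\<lambda>n. Wt (\<lambda>n. (1 + norm (freq \<alpha> n) * h) powr m) n * cmod (a n)) S) = sqrt (\<Sum>n\<in>S. f h n)"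
   unfolding L2_set_def f_def Wt_def ..
  also have "... <= sqrt (\<Sum>\<^sub>\<infinity>n. f h n)" by (intro real_sqrt_le_mono finite_sum_le_infsum s S) (auto simp: f0)
  also have "... <= 2 * R" using h(3) R by (intro real_le_lsqrt) (auto simp: infsum_nonneg f0)
  finally show "L2_set (\<lambda>n. Wt (\<lambda>n. (1 + norm (freq \<alpha> n) * h) powr m) n * cmod (a n)) S <= 2 * R" .
 qed
qed

theorem locally_well_posed_torus: "locally_well_posed \<alpha> s"
 unfolding locally_well_posed_def Let_def
proof (intro allI impI)
 fix R :: real assume R: "R > 0"
 \<comment> \<open>Makes \<open>3 * (Ctri * \<gamma> * (4 * R)^2)\<close> equal to 1/2. Data are
   allowed norm \<open>2 * R\<close>, since the weighted norm in \<open>small_weight\<close> is only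
   known to be that small, and the ball has twice this radius; one \<open>T\<close> then serves
   every \<open>s'\<close>.\<close>
 define \<gamma> where "\<gamma> = 1 / (6 * (Ctri * (4 * R)\<^sup>2))"
 have \<gamma>: "\<gamma> > 0" using Ctri(1) R by (simp add: \<gamma>_def)
 define T where "T = min 1 (\<gamma> powr (1 / (2 * \<delta>)))"
 have T: "0 < T" "T <= 1" using \<gamma> by (auto simp: T_def)
 have kap: "kap T 0 <= \<gamma>"
 proof -
  have "T powr (2 * \<delta>) <= (\<gamma> powr (1 / (2 * \<delta>))) powr (2 * \<delta>)" using T delta(1) by (intro powr_mono2) (auto simp: T_def)
  also have "... = \<gamma>" using \<gamma> delta(1) by (simp add: powr_powr)
  finally show ?thesis by (simp add: kap_def)
 qed
 have small: "3 * (Ctri * kap T 0 * (2 * (2 * R))\<^sup>2) <= 1/2"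
 proof -
  have "3 * (Ctri * kap T 0 * (2 * (2 * R))\<^sup>2) <= 3 * (Ctri * \<gamma> * (4 * R)\<^sup>2)"
   using Ctri(1) kap by (simp add: mult_left_mono mult_right_mono)
  also have "... = 1/2" unfolding \<gamma>_def using Ctri(1) R by (simp add: field_simps)
  finally show ?thesis .
 qed
 have R2: "2 * R >= 0" using R by simp
 have iota: "X1 (iota (fourier \<alpha> u0))" "nX W1 (iota (fourier \<alpha> u0)) <= 2 * R"
  if u0: "u0 \<in> sobolev \<alpha> s" "sobolev_norm \<alpha> s u0 <= R" for u0
  using iota_sobolev[OF sobolev_summable[OF u0(1)]] u0(2) R unfolding sobolev_norm_eq by auto
 have ex: "\<exists>c. X1 c \<and> nX W1 c <= 2 * (2 * R) \<and> fixp T (fourier \<alpha> u0) c"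
  if u0: "u0 \<in> sobolev \<alpha> s" "sobolev_norm \<alpha> s u0 <= R" for u0
  by (rule fixp_exists[OF T good_weight_1 R2 iota[OF u0] small]) blast
 \<comment> \<open>By uniqueness, an arbitrary solution in the space is the one constructed by
   iteration, so it lies in the ball where the Lipschitz estimate holds.\<close>
 have bound: "nX W1 c <= 2 * (2 * R)"
  if u0: "u0 \<in> sobolev \<alpha> s" "sobolev_norm \<alpha> s u0 <= R" and c: "X1 c" "fixp T (fourier \<alpha> u0) c" for u0 c
  using ex[OF u0] fixp_unique[OF T c(1) _ c(2)] by blast
 have duh: "duhamel_solution \<alpha> T u0 (mk T c) \<longleftrightarrow> fixp T (fourier \<alpha> u0) c"
  if "u0 \<in> sobolev \<alpha> s" "sobolev_norm \<alpha> s u0 <= R" "X1 c" for u0 c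
  by (rule duhamel_iff_fixp[OF T that(3) iota(1)[OF that(1,2)]])
 define B where "B = {u0 \<in> sobolev \<alpha> s. sobolev_norm \<alpha> s u0 <= R}"
 have 1: "complex_banach_on (\<lambda>c u t. scaleC c (u t)) (XT T) (NT T)" by (rule banach_XT[OF T(1)])
 have 2: "XT T \<subseteq> C0_sobolev \<alpha> s T"
  unfolding XT_def by (auto intro!: mk_C0 simp: W1_eq[symmetric])
 have 3: "\<exists>C. \<forall>u\<in>XT T. \<forall>t\<in>{0..T}. sobolev_norm \<alpha> s (u t) <= C * NT T u"
  by (rule exI[of _ 1]) (auto simp: XT_def NT_mk[OF T(1)] intro!: mk_norm_le)
 have 4: "\<exists>!u. u \<in> XT T \<and> duhamel_solution \<alpha> T u0 u" if "u0 \<in> B" for u0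
 proof -
  have u0: "u0 \<in> sobolev \<alpha> s" "sobolev_norm \<alpha> s u0 <= R" using that by (auto simp: B_def)
  obtain c where c: "X1 c" "fixp T (fourier \<alpha> u0) c" using ex[OF u0] by blast
  show ?thesis
  proof (rule ex1I[of _ "mk T c"])
   show "mk T c \<in> XT T \<and> duhamel_solution \<alpha> T u0 (mk T c)" using c duh[OF u0 c(1)] by (auto simp: XT_def)
   fix v assume v: "v \<in> XT T \<and> duhamel_solution \<alpha> T u0 v"
   then obtain c' where c': "X1 c'" "v = mk T c'" by (auto simp: XT_def)
   then have "fixp T (fourier \<alpha> u0) c'" using v duh[OF u0 c'(1)] by simp
   then show "v = mk T c" using fixp_unique[OF T c'(1) c(1) _ c(2)] c'(2) by simp
  qed
 qed
 have 5: "u \<in> C0_sobolev \<alpha> s' T"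
  if H: "u0 \<in> B" "s' > s" "u0 \<in> sobolev \<alpha> s'" "u \<in> XT T" "duhamel_solution \<alpha> T u0 u" for u0 s' u
 proof -
  have u0: "u0 \<in> sobolev \<alpha> s" "sobolev_norm \<alpha> s u0 <= R" using H(1) by (auto simp: B_def)
  obtain c where c: "X1 c" "u = mk T c" using H(4) by (auto simp: XT_def)
  have fc: "fixp T (fourier \<alpha> u0) c" using H(5) duh[OF u0 c(1)] c(2) by simp
  define m where "m = s' - s"
  have m: "m >= 0" "s + m = s'" using H(2) by (auto simp: m_def)
  obtain h where h: "0 < h" "h <= 1" and hL: "\<And>S. finite S ==> L2_set (\<lambda>n. Wt (\<lambda>n. (1 + norm (freq \<alpha> n) * h) powr m) n * cmod (fourier \<alpha> u0 n)) S <= 2 * R"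
   by (rule small_weight[OF sobolev_summable[OF u0(1)] u0(2)[unfolded sobolev_norm_eq] R m(1) sobolev_summable[OF H(3), folded m(2)]]) blast
  define w where "w n = (1 + norm (freq \<alpha> n) * h) powr m" for n
  have w: "good_weight w" unfolding w_def using h m by (intro good_weight_sobolev) auto
  note io = iota_inX[OF R2 hL, folded w_def]
  obtain c' where c': "inX (Wt w) c'" "fixp T (fourier \<alpha> u0) c'"
   by (rule fixp_exists[OF T w R2 io small]) blast
  have W1c': "X1 c'"
   by (rule inX_mono[where K = 1, OF c'(1) W1_nonneg]) (use Wt_1_le[OF w] in auto)
  \<comment> \<open>The solution built in the weighted space also lies in the unweighted one, where
    uniqueness identifies it with the given solution.\<close>
  have cc: "c = c'" by (rule fixp_unique[OF T c(1) W1c' fc c'(2)])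
  have "inX (\<lambda>n. japanese \<alpha> n powr s') c"
  \<comment> \<open>For fixed \<open>h > 0\<close> the weight is comparable with a full power of the
    bracket. The constant \<open>(2 / h) powr m\<close> depends on the data, which is harmless here
    as only membership is claimed.\<close>
  proof (rule inX_mono[OF c'(1)[folded cc], of _ "(2 / h) powr m"])
   fix n
   have "japanese \<alpha> n <= 1 + norm (freq \<alpha> n)"
    unfolding japanese_def sqf_def by (rule real_le_lsqrt) (auto simp: power2_sum)
   also have "... <= (2 / h) * (1 + norm (freq \<alpha> n) * h)"
   proof -
    have "(2 / h) * (1 + norm (freq \<alpha> n) * h) = 2 / h + 2 * norm (freq \<alpha> n)" using h by (simp add: field_simps)
    moreover have "2 <= 2 / h" using h by (simp add: le_divide_eq)
    ultimately show ?thesis using norm_ge_zero[of "freq \<alpha> n"] by linarith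
   qed
   finally have "japanese \<alpha> n powr m <= ((2 / h) * (1 + norm (freq \<alpha> n) * h)) powr m"
    using m japanese_pos[of \<alpha> n] by (intro powr_mono2) auto
   also have "... = (2 / h) powr m * w n" unfolding w_def by (rule powr_mult)
   finally have "japanese \<alpha> n powr s * japanese \<alpha> n powr m <= japanese \<alpha> n powr s * ((2 / h) powr m * w n)" by (rule mult_left_mono) simp
   then show "japanese \<alpha> n powr s' <= (2 / h) powr m * Wt w n"
    unfolding m(2)[symmetric] powr_add Wt_def by (simp add: mult_ac)
  qed auto
  then show ?thesis unfolding c(2) by (rule mk_C0[OF c(1)])
 qed
 have 6: "NT T (u - v) < e"
  if H: "u0 \<in> B" "v0 \<in> B" "u \<in> XT T" "v \<in> XT T" "duhamel_solution \<alpha> T u0 u" "duhamel_solution \<alpha> T v0 v"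
   and d: "sobolev_norm \<alpha> s (u0 - v0) < e / 2" for u0 v0 u v e
 proof -
  have u0: "u0 \<in> sobolev \<alpha> s" "sobolev_norm \<alpha> s u0 <= R" and v0: "v0 \<in> sobolev \<alpha> s" "sobolev_norm \<alpha> s v0 <= R"
   using H(1,2) by (auto simp: B_def)
  obtain c where c: "X1 c" "u = mk T c" using H(3) by (auto simp: XT_def)
  obtain c' where c': "X1 c'" "v = mk T c'" using H(4) by (auto simp: XT_def)
  have fc: "fixp T (fourier \<alpha> u0) c" using H(5) duh[OF u0 c(1)] c(2) by simp
  have fc': "fixp T (fourier \<alpha> v0) c'" using H(6) duh[OF v0 c'(1)] c'(2) by simp
  let ?a = "\<lambda>n. fourier \<alpha> u0 n - fourier \<alpha> v0 n"
  have L2: "torus_L2 \<alpha> u0" "torus_L2 \<alpha> v0" using u0(1) v0(1) by (auto simp: sobolev_def)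
  have iX: "X1 (iota ?a)"
  proof -
   have "iota ?a = (\<lambda>k n. iota (fourier \<alpha> u0) k n - iota (fourier \<alpha> v0) k n)" by (auto simp: iota_def fun_eq_iff)
   then show ?thesis using nX_diff(1)[OF iota(1)[OF u0] iota(1)[OF v0] W1_nonneg] by simp
  qed
  have sm: "(\<lambda>n. (japanese \<alpha> n powr s * cmod (?a n))\<^sup>2) summable_on UNIV"
  proof (rule L2_set_bounded(1))
   fix S :: "(int^'d) set" assume S: "finite S"
   have "L2_set (\<lambda>n. japanese \<alpha> n powr s * cmod (?a n)) S = snorm W1 {0} S (iota ?a)"
    by (simp add: snorm_iota W1_eq)
   also have "... <= nX W1 (iota ?a)" by (rule snorm_le_nX[OF iX _ S]) simp
   finally show "L2_set (\<lambda>n. japanese \<alpha> n powr s * cmod (?a n)) S <= nX W1 (iota ?a)" .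
  qed
  have "nX W1 (iota ?a) <= sobolev_norm \<alpha> s (u0 - v0)"
   unfolding sobolev_norm_eq fourier_diff[OF L2] by (rule iota_sobolev(2)[OF sm])
  moreover have "nX W1 (cdiff c c') <= 2 * nX W1 (iota ?a)"
   by (rule fixp_lipschitz[OF T good_weight_1 c(1) c'(1) bound[OF u0 c(1) fc] bound[OF v0 c'(1) fc'] small fc fc' iX])
  moreover have "NT T (u - v) = nX W1 (cdiff c c')"
   unfolding c(2) c'(2) mk_diff[OF c(1) c'(1), symmetric] by (rule NT_mk[OF T(1) nX_diff(1)[OF c(1) c'(1) W1_nonneg]])
  ultimately show ?thesis using d by linarith
 qed
 have 7: "\<exists>\<delta>>0. \<forall>u0\<in>B. \<forall>v0\<in>B. \<forall>u\<in>XT T. \<forall>v\<in>XT T. duhamel_solution \<alpha> T u0 u \<longrightarrow> duhamel_solution \<alpha> T v0 v \<longrightarrow>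
  sobolev_norm \<alpha> s (u0 - v0) < \<delta> \<longrightarrow> NT T (u - v) < e" if "e > 0" for e
  \<comment> \<open>The solution map is Lipschitz with constant 2 on the ball of data.\<close>
  by (rule exI[of _ "e / 2"]) (use that 6 in auto)
 show "\<exists>T>0. \<exists>X N. complex_banach_on (\<lambda>c u t. scaleC c (u t)) X N \<and> X \<subseteq> C0_sobolev \<alpha> s T \<and>
  (\<exists>C. \<forall>u\<in>X. \<forall>t\<in>{0..T}. sobolev_norm \<alpha> s (u t) <= C * N u) \<and>
  (\<forall>u0\<in>{u0 \<in> sobolev \<alpha> s. sobolev_norm \<alpha> s u0 <= R}. \<exists>!u. u \<in> X \<and> duhamel_solution \<alpha> T u0 u) \<and>
  (\<forall>u0\<in>{u0 \<in> sobolev \<alpha> s. sobolev_norm \<alpha> s u0 <= R}. \<forall>s'>s. u0 \<in> sobolev \<alpha> s' \<longrightarrow>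
   (\<forall>u\<in>X. duhamel_solution \<alpha> T u0 u \<longrightarrow> u \<in> C0_sobolev \<alpha> s' T)) \<and>
  (\<forall>e>0. \<exists>\<delta>>0. \<forall>u0\<in>{u0 \<in> sobolev \<alpha> s. sobolev_norm \<alpha> s u0 <= R}. \<forall>v0\<in>{u0 \<in> sobolev \<alpha> s. sobolev_norm \<alpha> s u0 <= R}.
   \<forall>u\<in>X. \<forall>v\<in>X. duhamel_solution \<alpha> T u0 u \<longrightarrow> duhamel_solution \<alpha> T v0 v \<longrightarrow>
   sobolev_norm \<alpha> s (u0 - v0) < \<delta> \<longrightarrow> N (u - v) < e)"
  unfolding B_def[symmetric]
  by (rule exI[of _ T], rule conjI[OF T(1)], rule exI[of _ "XT T"], rule exI[of _ "NT T"], intro conjI ballI allI impI 1 2 3 4 7)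
   (assumption | (rule 5; assumption))+
qed

end

theorem theorem1:
  fixes \<alpha> :: "real^'d::finite" and s :: real
  assumes "CARD('d) \<ge> 2"
    and "\<And>j. \<alpha> $ j \<in> {1/2..2}"
    and "CARD('d) = 2 \<Longrightarrow> s > 1/3"
    and "CARD('d) \<ge> 3 \<Longrightarrow> odd CARD('d) \<Longrightarrow> s > real CARD('d) / 2 - real CARD('d) / (real CARD('d) + 1)"
    and "CARD('d) \<ge> 4 \<Longrightarrow> even CARD('d) \<Longrightarrow> s > real CARD('d) / 2 - 1"
  shows "locally_well_posed \<alpha> s"
proof -
 let ?d = "real CARD('d)"
 have frac: "?d / (?d + 1) < 1" by simp
 \<comment> \<open>The threshold 3/2 - 3/4 of dimension 3 is the exponent 3/4 of
   \<open>count_shell\<close>.\<close>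
 have s3: "s > 3/4" if "CARD('d) = 3" using assms(4) that by simp
 have s4: "s > ?d / 2 - 1" if "CARD('d) >= 4"
 proof (cases "even CARD('d)")
  case True
  then show ?thesis using assms(5) that by blast
 next
  case False
  have "CARD('d) >= 3" using that by simp
  \<comment> \<open>In odd dimension at least 5 the threshold exceeds d/2 - 1, because d/(d+1) < 1,
    so the count with four coordinates suffices.\<close>
  from assms(4)[OF this False] frac show ?thesis by linarith
 qed
 obtain C \<sigma> where disp: "dispersive (sqf \<alpha>) (japanese \<alpha>) level C ?d \<sigma> s"
  using dispersive_torus[OF assms(1,2,3) s3 s4] by blast
 \<comment> \<open>The L3 condition s > d/6 follows from the counting thresholds: it is the same
   condition for d = 2, and 3/4 > 1/2 and d/2 - 1 > d/6 in the remaining cases.\<close>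
 have "?d < 6 * s"
 proof -
  consider "CARD('d) = 2" | "CARD('d) = 3" | "CARD('d) >= 4" using assms(1) by linarith
  then show ?thesis
  proof cases
   case 1
   then show ?thesis using assms(3) by simp
  next
   case 2
   then show ?thesis using s3 by simp
  next
   case 3
   then show ?thesis using s4 by simp
  qed
 qed
 moreover have "\<alpha> $ j > 0" for j using assms(2)[of j] by simp
 ultimately have "sobolev_torus \<alpha> s" using assms(2) by unfold_locales auto
 then interpret torus_nls \<alpha> C \<sigma> s by (intro torus_nls.intro disp)
 show ?thesis by (rule locally_well_posed_torus)
qed

end
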